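(* Let $\Delta=\mathrm{conv}(v_0,\dots,v_n)$ be a reduced and reflexive simplex in $\mathbb{R}^n$ with weight $(q_0,\dots,q_n)$, arranged by increasing order, where $q_n\ge2$, and put $\mu:=q_0+\cdots+q_n$. Let $f_1<f_2<\cdots<f_k$ be the elements, arranged by increasing order, of the set $$F=\left\{\frac{\ell}{q_i}\ :\ 0\le\ell\le q_i-1,\ 0\le i\le n\right\},$$ and let $d_i:=\mathrm{Card}\{j\in\{0,\dots,n\}: q_jf_i\in\mathbb{Z}\}$. Then the Laurent polynomial $f_\Delta(u)=\sum_{i=0}^nu^{v_i}$ on $(\mathbb{C}^* )^n$ satisfies the KKP conjecture if and only if $$\sum_{\ell=1}^{i-1}d_\ell-\mu f_i=\frac{d_1-d_i}{2}\qquad\text{for } i=2,\dots,k.$$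
   Context: Simplices. A simplex is a polytope $\Delta=\mathrm{conv}(v_0,\dots,v_n)\subset\mathbb{R}^n$ with vertices $v_i\in\mathbb{Z}^n$ and containing the origin as an interior point. Its weight is the tuple $(q_0,\dots,q_n)$ with $q_i=|\det(v_0,\dots,\widehat{v_i},\dots,v_n)|$, the vertices being numbered so that the tuple is arranged by increasing order. $\Delta$ is reduced if $\gcd(q_0,\dots,q_n)=1$. A lattice polytope $P$ containing the origin in its interior is reflexive if its polar polytope $\{y:\langle y,x\rangle\le1\ \forall x\in P\}$ is a lattice polytope; a reduced simplex is reflexive if and only if $q_i$ divides $\mu=q_0+\cdots+q_n$ for $i=0,\dots,n$. The mixed Hodge structure of $f$. Let $f$ be a Laurent polynomial on $U=(\mathbb{C}^* )^n$ which is convenient (the origin is an interior point of its Newton polytope $P$) and nondegenerate in the sense of Kouchnirenko ($f_\Delta$ is such, with Newton polytope $\Delta$). It defines a mixed Hodge structure $MHS_f=(H,F^\bullet H,W_\bullet H)$, produced by the Laplace transform of its Gauss–Manin system, as follows. Let $$G=\Omega^n(U)[\tau,\tau^{-1}]\big/(d-\tau\,df\wedge)\,\Omega^{n-1}(U)[\tau,\tau^{-1}],$$ with the action $\partial_\tau[\omega\tau^j]=[j\omega\tau^{j-1}-f\omega\tau^j]$; it is a free $\mathbb{C}[\tau,\tau^{-1}]$-module of finite rank with a connection having a regular singularity at $\tau=0$. Let $G_0$ (the Brieskorn lattice) be the image of $\Omega^n(U)[\tau^{-1}]$ in $G$. Let $V_\bullet G$ be the increasing Kashiwara–Malgrange filtration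 at $\tau=0$, indexed by $\mathbb{Q}$: the $V_\alpha G$ are free $\mathbb{C}[\tau]$-modules generating $G$ over $\mathbb{C}[\tau,\tau^{-1}]$, stable by $\tau\partial_\tau$, with $\tau V_\alpha G=V_{\alpha-1}G$ and $\tau\partial_\tau+\alpha$ nilpotent on $\mathrm{gr}^V_\alpha G$. Set $H=\bigoplus_{\alpha\in[0,1[}\mathrm{gr}^V_\alpha G$, with $$F^{n-p}\,\mathrm{gr}^V_\alpha G=(\tau^pG_0\cap V_\alpha G)/(\tau^pG_0\cap V_{<\alpha}G)\quad\text{for }\alpha=0$$ (and, up to the usual convention $F^{n-1-p}$ for $\alpha\in\,]0,1[$, similarly for the other $\alpha$). $W_\bullet H$ is the monodromy weight filtration of the nilpotent endomorphism $\mathrm{N}$ induced by $-(\tau\partial_\tau+\alpha)$ on $\mathrm{gr}^V_\alpha G$, centered at $n$ on $\mathrm{gr}^V_0G$ and at $n-1$ on $\mathrm{gr}^V_\alpha G$, $\alpha\in\,]0,1[$. If $P$ is reflexive, then $\mathrm{gr}^V_\alpha G=0$ for $\alpha\in\,]0,1[$, so $H=\mathrm{gr}^V_0G$. KKP conjecture. When the Newton polytope $P$ is reflexive, $f$ is said to satisfy the KKP (Katzarkov–Kontsevich–Pantev) conjecture if $\dim\mathrm{gr}^p_FH=\dim\mathrm{gr}^W_{2p}H$ for all $p\in\mathbb{Z}$. *)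

theory Defs
  imports
    "HOL-Analysis.Analysis"
    "HOL-Library.Poly_Mapping"
    "HOL-Algebra.AbelCoset"
    "Jordan_Normal_Form.Missing_VectorSpace"
begin

hide_const (open) Modules.module Module.submodule

section \<open>Lattice polytopes and simplices\<close>

definition real_vec :: "int^'n \<Rightarrow> real^'n" where
  "real_vec v = (\<chi> j. real_of_int (v $ j))"

definition lattice_polytope :: "(real^'n) set \<Rightarrow> bool" where
  "lattice_polytope P \<longleftrightarrow> (\<exists>S :: (int^'n) set. finite S \<and> P = convex hull (real_vec ` S))"

definition polar_set :: "(real^'n) set \<Rightarrow> (real^'n) set" where
  "polar_set P = {y. \<forall>x\<in>P. y \<bullet> x \<le> 1}"

definition reflexive_polytope :: "(real^'n) set \<Rightarrow> bool" where
  "reflexive_polytope P \<longleftrightarrow>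
     lattice_polytope P \<and> 0 \<in> interior P \<and> lattice_polytope (polar_set P)"

text \<open>The vertices are \<open>v 0, \<dots>, v n\<close> with \<open>n = CARD('n)\<close>; the values of \<open>v\<close> beyond
  \<open>n\<close> are irrelevant.\<close>

definition simplex_hull :: "(nat \<Rightarrow> int^'n) \<Rightarrow> (real^'n) set" where
  "simplex_hull v = convex hull ((\<lambda>i. real_vec (v i)) ` {0..CARD('n)})"

definition lattice_simplex :: "(nat \<Rightarrow> int^'n) \<Rightarrow> bool" where
  "lattice_simplex v \<longleftrightarrow>
     inj_on v {0..CARD('n)} \<and>
     \<not> affine_dependent ((\<lambda>i. real_vec (v i)) ` {0..CARD('n)}) \<and>
     0 \<in> interior (simplex_hull v)"

text \<open>\<open>|det (v\<^sub>0, \<dots>, v\<^sub>i omitted, \<dots>, v\<^sub>n)|\<close>. The type \<open>'n\<close> carries no order, so the columns are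
  enumerated by an arbitrary bijection; the absolute value does not depend on it.\<close>

definition simplex_weight :: "(nat \<Rightarrow> int^'n) \<Rightarrow> nat \<Rightarrow> nat" where
  "simplex_weight v i =
     (let e = (SOME e :: 'n \<Rightarrow> nat. bij_betw e UNIV ({0..CARD('n)} - {i}))
      in nat \<bar>det (\<chi> r c. v (e c) $ r)\<bar>)"


section \<open>Modules: quotients, direct sums, filtrations\<close>

text \<open>Sub-objects of a module \<open>M\<close> are the subsets \<open>N\<close> with \<open>submodule R N M\<close>; the sub-object itself
  is \<open>M\<lparr>carrier := N\<rparr>\<close>. Elements of a quotient are cosets.\<close>

definition quotient_module :: "('s, 'a) module \<Rightarrow> 'a set \<Rightarrow> ('s, 'a set) module" where
  "quotient_module M N =
     \<lparr>carrier = a_rcosets\<^bsub>M\<^esub> N, mult = undefined, one = undefined,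
      zero = N, add = (\<lambda>X Y. X <+>\<^bsub>M\<^esub> Y),
      smult = (\<lambda>a X. \<Union>x\<in>X. N +>\<^bsub>M\<^esub> (a \<odot>\<^bsub>M\<^esub> x))\<rparr>"

text \<open>The map into \<open>M/N\<close> induced on cosets by a map \<open>\<phi>\<close> with values in \<open>M\<close>.\<close>

definition induced_map :: "('s, 'a) module \<Rightarrow> 'a set \<Rightarrow> ('b \<Rightarrow> 'a) \<Rightarrow> 'b set \<Rightarrow> 'a set" where
  "induced_map M N \<phi> X = (\<Union>x\<in>X. N +>\<^bsub>M\<^esub> \<phi> x)"

definition direct_sum_module :: "'i set \<Rightarrow> ('i \<Rightarrow> ('s, 'a) module) \<Rightarrow> ('s, 'i \<Rightarrow> 'a) module" where
  "direct_sum_module I M =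
     \<lparr>carrier = {h \<in> (\<Pi>\<^sub>E i\<in>I. carrier (M i)). finite {i\<in>I. h i \<noteq> \<zero>\<^bsub>M i\<^esub>}},
      mult = undefined, one = undefined,
      zero = (\<lambda>i\<in>I. \<zero>\<^bsub>M i\<^esub>), add = (\<lambda>g h. \<lambda>i\<in>I. g i \<oplus>\<^bsub>M i\<^esub> h i),
      smult = (\<lambda>a h. \<lambda>i\<in>I. a \<odot>\<^bsub>M i\<^esub> h i)\<rparr>"

definition free_finite_rank :: "'s ring \<Rightarrow> ('s, 'a) module \<Rightarrow> bool" where
  "free_finite_rank R M \<longleftrightarrow>
     (\<exists>S. finite S \<and> S \<subseteq> carrier M \<and> \<not> module.lin_dep R M S \<and> module.span R M S = carrier M)"

definition nilpotent_on :: "('s, 'a) module \<Rightarrow> ('a \<Rightarrow> 'a) \<Rightarrow> bool" where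
  "nilpotent_on M \<phi> \<longleftrightarrow> (\<exists>m. \<forall>x\<in>carrier M. (\<phi> ^^ m) x = \<zero>\<^bsub>M\<^esub>)"

definition is_weight_filtration ::
  "'s ring \<Rightarrow> ('s, 'a) module \<Rightarrow> ('a \<Rightarrow> 'a) \<Rightarrow> int \<Rightarrow> (int \<Rightarrow> 'a set) \<Rightarrow> bool" where
  "is_weight_filtration K M N c W \<longleftrightarrow>
     (\<forall>k. submodule K (W k) M) \<and>
     (\<forall>k. W k \<subseteq> W (k + 1)) \<and>
     (\<exists>k. W k = {\<zero>\<^bsub>M\<^esub>}) \<and> (\<exists>k. W k = carrier M) \<and>
     (\<forall>k. N ` W k \<subseteq> W (k - 2)) \<and>
     (\<forall>j::nat. bij_betw (induced_map M (W (c - int j - 1)) (N ^^ j))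
        (carrier (quotient_module (M\<lparr>carrier := W (c + int j)\<rparr>) (W (c + int j - 1))))
        (carrier (quotient_module (M\<lparr>carrier := W (c - int j)\<rparr>) (W (c - int j - 1)))))"

text \<open>The monodromy weight filtration of the nilpotent endomorphism \<open>N\<close> of \<open>M\<close>, centered
  at \<open>c\<close>.\<close>

definition weight_filtration ::
  "'s ring \<Rightarrow> ('s, 'a) module \<Rightarrow> ('a \<Rightarrow> 'a) \<Rightarrow> int \<Rightarrow> int \<Rightarrow> 'a set" where
  "weight_filtration K M N c = (THE W. is_weight_filtration K M N c W)"


section \<open>Laurent polynomials and algebraic differential forms on the torus\<close>

text \<open>A Laurent polynomial \<open>\<Sum> c\<^sub>m u\<^sup>m\<close> on \<open>U = (\<complex>\<^sup>*)\<^sup>n\<close> is the finitely supported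
  function \<open>m \<mapsto> c\<^sub>m\<close>. Elements of \<open>\<complex>[\<tau>,\<tau>\<inverse>]\<close> are of type \<open>int \<Rightarrow>\<^sub>0 complex\<close>,
  and those of \<open>\<complex>[u,u\<inverse>][\<tau>,\<tau>\<inverse>]\<close> are Laurent polynomials in \<open>u\<close> over this ring.\<close>

type_synonym 'n laurent = "(int^'n) \<Rightarrow>\<^sub>0 complex"
type_synonym laurent_tau = "int \<Rightarrow>\<^sub>0 complex"
type_synonym 'n laurent_utau = "(int^'n) \<Rightarrow>\<^sub>0 (int \<Rightarrow>\<^sub>0 complex)"

definition embed_tau :: "('n::finite) laurent \<Rightarrow> 'n laurent_utau" where
  "embed_tau f = Poly_Mapping.map (Poly_Mapping.single 0) f"

text \<open>The Laurent polynomials in \<open>\<tau>\<close> with exponents in \<open>S\<close>; this gives the rings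
  \<open>\<complex>[\<tau>,\<tau>\<inverse>]\<close>, \<open>\<complex>[\<tau>]\<close> and the field of constants \<open>\<complex>\<close>.\<close>

definition tau_ring :: "int set \<Rightarrow> laurent_tau ring" where
  "tau_ring S = \<lparr>carrier = {a. Poly_Mapping.keys a \<subseteq> S},
     mult = (*), one = 1, zero = 0, add = (+)\<rparr>"

abbreviation ring_tau_inv :: "laurent_tau ring" where "ring_tau_inv \<equiv> tau_ring UNIV"
abbreviation ring_tau :: "laurent_tau ring" where "ring_tau \<equiv> tau_ring {0..}"
abbreviation field_const :: "laurent_tau ring" where "field_const \<equiv> tau_ring {0}"

definition tau_pow :: "int \<Rightarrow> laurent_tau" where
  "tau_pow p = Poly_Mapping.single p 1"

definition tau_const :: "complex \<Rightarrow> laurent_tau" where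
  "tau_const c = Poly_Mapping.single 0 c"

text \<open>The derivation \<open>\<theta>\<^sub>i = u\<^sub>i \<partial>/\<partial>u\<^sub>i\<close>.\<close>

definition theta :: "'n::finite \<Rightarrow> 'n laurent_utau \<Rightarrow> 'n laurent_utau" where
  "theta i g = (\<Sum>m\<in>Poly_Mapping.keys g.
     Poly_Mapping.single m (of_int (m $ i) * Poly_Mapping.lookup g m))"

definition deriv_tau :: "laurent_tau \<Rightarrow> laurent_tau" where
  "deriv_tau a = (\<Sum>j\<in>Poly_Mapping.keys a.
     Poly_Mapping.single (j - 1) (of_int j * Poly_Mapping.lookup a j))"

text \<open>The vector fields \<open>\<theta>\<^sub>i\<close> form a commuting basis of the derivations of \<open>\<complex>[u,u\<inverse>]\<close>. A
  \<open>p\<close>-form is alternating and multilinear in derivations, hence given by its values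
  \<open>\<omega> [i\<^sub>1, \<dots>, i\<^sub>p]\<close> on \<open>(\<theta>\<^sub>i\<^sub>1, \<dots>, \<theta>\<^sub>i\<^sub>p)\<close>, an alternating function of the indices; equivalently
  these are its coefficients with respect to the \<open>du\<^sub>i/u\<^sub>i\<close>. It is extended
  by 0 to lists of other lengths.\<close>

type_synonym 'n form = "'n list \<Rightarrow> 'n laurent_utau"

definition forms :: "nat \<Rightarrow> ('n::finite) form set" where  \<comment> \<open>\<open>\<Omega>\<^sup>p(U)[\<tau>,\<tau>\<inverse>]\<close>\<close>
  "forms p = {\<omega>.
     (\<forall>l. length l \<noteq> p \<longrightarrow> \<omega> l = 0) \<and>
     (\<forall>l i j. i < length l \<and> j < length l \<and> i \<noteq> j \<longrightarrow> \<omega> (l[i := l ! j, j := l ! i]) = - \<omega> l)}"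

definition drop_nth :: "nat \<Rightarrow> 'a list \<Rightarrow> 'a list" where
  "drop_nth k l = take k l @ drop (Suc k) l"

text \<open>Exterior derivative with respect to \<open>u\<close>. As the \<open>\<theta>\<^sub>i\<close> commute, the
  bracket terms of the invariant formula for \<open>d\<close> vanish.\<close>

definition ext_d :: "('n::finite) form \<Rightarrow> 'n form" where
  "ext_d \<omega> = (\<lambda>l. \<Sum>k<length l. (-1) ^ k * theta (l ! k) (\<omega> (drop_nth k l)))"

definition wedge1 :: "('n::finite) form \<Rightarrow> 'n form \<Rightarrow> 'n form" where  \<comment> \<open>\<open>\<eta> \<and> \<omega>\<close> for a 1-form \<open>\<eta>\<close>\<close>
  "wedge1 \<eta> \<omega> = (\<lambda>l. \<Sum>k<length l. (-1) ^ k * \<eta> [l ! k] * \<omega> (drop_nth k l))"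

definition form0 :: "('n::finite) laurent \<Rightarrow> 'n form" where
  "form0 f = (\<lambda>l. if l = [] then embed_tau f else 0)"

definition smult_form :: "laurent_tau \<Rightarrow> ('n::finite) form \<Rightarrow> 'n form" where
  "smult_form a \<omega> = (\<lambda>l. Poly_Mapping.single 0 a * \<omega> l)"

definition top_forms :: "(laurent_tau, ('n::finite) form) module" where
  "top_forms =
     \<lparr>carrier = forms CARD('n), mult = undefined, one = undefined,
      zero = (\<lambda>l. 0), add = (\<lambda>\<omega> \<eta> l. \<omega> l + \<eta> l), smult = smult_form\<rparr>"


section \<open>The Laplace transform of the Gauss-Manin system and its Brieskorn lattice\<close>

definition twisted_boundaries :: "('n::finite) laurent \<Rightarrow> 'n form set" where
  "twisted_boundaries f =
     (\<lambda>\<omega>. \<lambda>l. ext_d \<omega> l - smult_form (tau_pow 1) (wedge1 (ext_d (form0 f)) \<omega>) l)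
       ` forms (CARD('n) - 1)"

definition GM :: "('n::finite) laurent \<Rightarrow> (laurent_tau, 'n form set) module" where
  "GM f = quotient_module top_forms (twisted_boundaries f)"

definition GM_deriv :: "('n::finite) laurent \<Rightarrow> 'n form set \<Rightarrow> 'n form set" where
  "GM_deriv f = induced_map top_forms (twisted_boundaries f)
     (\<lambda>\<omega> l. Poly_Mapping.map deriv_tau (\<omega> l) - embed_tau f * \<omega> l)"

definition GM_euler :: "('n::finite) laurent \<Rightarrow> 'n form set \<Rightarrow> 'n form set" where  \<comment> \<open>\<open>\<tau>\<partial>\<^sub>\<tau>\<close>\<close>
  "GM_euler f x = tau_pow 1 \<odot>\<^bsub>GM f\<^esub> GM_deriv f x"

definition brieskorn :: "('n::finite) laurent \<Rightarrow> 'n form set set" where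
  "brieskorn f = {twisted_boundaries f +>\<^bsub>top_forms\<^esub> \<omega> |\<omega>.
     \<omega> \<in> forms CARD('n) \<and>
     (\<forall>l m. Poly_Mapping.keys (Poly_Mapping.lookup (\<omega> l) m) \<subseteq> {..0})}"

definition tau_brieskorn :: "('n::finite) laurent \<Rightarrow> int \<Rightarrow> 'n form set set" where  \<comment> \<open>\<open>\<tau>\<^sup>p G\<^sub>0\<close>\<close>
  "tau_brieskorn f p = (\<lambda>x. tau_pow p \<odot>\<^bsub>GM f\<^esub> x) ` brieskorn f"


section \<open>The Kashiwara-Malgrange filtration at \<open>\<tau> = 0\<close>\<close>

definition below :: "(rat \<Rightarrow> 'a set) \<Rightarrow> rat \<Rightarrow> 'a set" where  \<comment> \<open>\<open>V\<^sub><\<^sub>\<alpha>\<close>\<close>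
  "below V \<alpha> = (\<Union>\<beta>\<in>{..<\<alpha>}. V \<beta>)"

definition gr_of ::
  "('n::finite) laurent \<Rightarrow> (rat \<Rightarrow> 'n form set set) \<Rightarrow> rat \<Rightarrow> (laurent_tau, 'n form set set) module" where
  "gr_of f V \<alpha> = quotient_module ((GM f)\<lparr>carrier := V \<alpha>\<rparr>) (below V \<alpha>)"

definition N_of ::  \<comment> \<open>induced by \<open>-(\<tau>\<partial>\<^sub>\<tau> + \<alpha>)\<close>\<close>
  "('n::finite) laurent \<Rightarrow> (rat \<Rightarrow> 'n form set set) \<Rightarrow> rat \<Rightarrow> 'n form set set \<Rightarrow> 'n form set set" where
  "N_of f V \<alpha> = induced_map (GM f) (below V \<alpha>)
     (\<lambda>x. \<ominus>\<^bsub>GM f\<^esub> (GM_euler f x \<oplus>\<^bsub>GM f\<^esub> tau_const (of_rat \<alpha>) \<odot>\<^bsub>GM f\<^esub> x))"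

text \<open>The second line makes explicit that an increasing filtration indexed by the rationals
  jumps only on a discrete set of rationals (here \<open>(1/r)\<int>\<close> for some \<open>r\<close>) and contains the jump
  at the index where it occurs. Without it the remaining conditions also admit filtrations
  jumping at irrational numbers, or immediately after a rational one, for which every
  \<open>gr\<^sub>\<alpha>\<close> is zero.\<close>

definition is_KM_filtration :: "('n::finite) laurent \<Rightarrow> (rat \<Rightarrow> 'n form set set) \<Rightarrow> bool" where
  "is_KM_filtration f V \<longleftrightarrow>
     (\<forall>\<alpha> \<beta>. \<alpha> \<le> \<beta> \<longrightarrow> V \<alpha> \<subseteq> V \<beta>) \<and>
     (\<exists>r::nat. 0 < r \<and> (\<forall>\<alpha>. V \<alpha> = V (of_int \<lfloor>of_nat r * \<alpha>\<rfloor> / of_nat r))) \<and>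
     (\<forall>\<alpha>. submodule ring_tau (V \<alpha>) (GM f)) \<and>
     (\<forall>\<alpha>. free_finite_rank ring_tau ((GM f)\<lparr>carrier := V \<alpha>\<rparr>)) \<and>
     (\<forall>\<alpha>. module.span ring_tau_inv (GM f) (V \<alpha>) = carrier (GM f)) \<and>
     (\<forall>\<alpha>. GM_euler f ` V \<alpha> \<subseteq> V \<alpha>) \<and>
     (\<forall>\<alpha>. (\<lambda>x. tau_pow 1 \<odot>\<^bsub>GM f\<^esub> x) ` V \<alpha> = V (\<alpha> - 1)) \<and>
     (\<forall>\<alpha>. nilpotent_on (gr_of f V \<alpha>) (N_of f V \<alpha>))"

definition KM_filtration :: "('n::finite) laurent \<Rightarrow> rat \<Rightarrow> 'n form set set" where
  "KM_filtration f = (THE V. is_KM_filtration f V)"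

definition gr_V :: "('n::finite) laurent \<Rightarrow> rat \<Rightarrow> (laurent_tau, 'n form set set) module" where
  "gr_V f \<alpha> = gr_of f (KM_filtration f) \<alpha>"

definition N_V :: "('n::finite) laurent \<Rightarrow> rat \<Rightarrow> 'n form set set \<Rightarrow> 'n form set set" where
  "N_V f \<alpha> = N_of f (KM_filtration f) \<alpha>"


section \<open>The mixed Hodge structure of \<open>f\<close> and the KKP condition\<close>

text \<open>\<open>n\<close> on \<open>gr\<^sub>0\<close> and \<open>n - 1\<close> on \<open>gr\<^sub>\<alpha>\<close> for \<open>0 < \<alpha> < 1\<close>: this is both the center of the weight
  filtration and the shift in the Hodge filtration.\<close>

definition mhs_center :: "'n::finite itself \<Rightarrow> rat \<Rightarrow> int" where
  "mhs_center _ \<alpha> = (if \<alpha> = 0 then int CARD('n) else int CARD('n) - 1)"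

text \<open>With \<open>c\<close> the above number, \<open>F\<^sup>c\<^sup>-\<^sup>p gr\<^sub>\<alpha>\<close> is the image of \<open>\<tau>\<^sup>p G\<^sub>0 \<inter> V\<^sub>\<alpha>\<close> in \<open>gr\<^sub>\<alpha>\<close>.\<close>

definition hodge_gr :: "('n::finite) laurent \<Rightarrow> rat \<Rightarrow> int \<Rightarrow> 'n form set set set" where
  "hodge_gr f \<alpha> r =
     (\<lambda>x. below (KM_filtration f) \<alpha> +>\<^bsub>GM f\<^esub> x) `
       (tau_brieskorn f (mhs_center TYPE('n) \<alpha> - r) \<inter> KM_filtration f \<alpha>)"

definition weight_gr :: "('n::finite) laurent \<Rightarrow> rat \<Rightarrow> int \<Rightarrow> 'n form set set set" where
  "weight_gr f \<alpha> = weight_filtration field_const (gr_V f \<alpha>) (N_V f \<alpha>) (mhs_center TYPE('n) \<alpha>)"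

definition mhs_H :: "('n::finite) laurent \<Rightarrow> (laurent_tau, rat \<Rightarrow> 'n form set set) module" where
  "mhs_H f = direct_sum_module {0..<1} (gr_V f)"

definition mhs_F :: "('n::finite) laurent \<Rightarrow> int \<Rightarrow> (rat \<Rightarrow> 'n form set set) set" where
  "mhs_F f p = {h \<in> carrier (mhs_H f). \<forall>\<alpha>\<in>{0..<1}. h \<alpha> \<in> hodge_gr f \<alpha> p}"

definition mhs_W :: "('n::finite) laurent \<Rightarrow> int \<Rightarrow> (rat \<Rightarrow> 'n form set set) set" where
  "mhs_W f k = {h \<in> carrier (mhs_H f). \<forall>\<alpha>\<in>{0..<1}. h \<alpha> \<in> weight_gr f \<alpha> k}"

definition dim_gr_F :: "('n::finite) laurent \<Rightarrow> int \<Rightarrow> nat" where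
  "dim_gr_F f p = vectorspace.dim field_const
     (quotient_module ((mhs_H f)\<lparr>carrier := mhs_F f p\<rparr>) (mhs_F f (p + 1)))"

definition dim_gr_W :: "('n::finite) laurent \<Rightarrow> int \<Rightarrow> nat" where
  "dim_gr_W f k = vectorspace.dim field_const
     (quotient_module ((mhs_H f)\<lparr>carrier := mhs_W f k\<rparr>) (mhs_W f (k - 1)))"

text \<open>To be used for a convenient, nondegenerate \<open>f\<close> with reflexive Newton polytope.\<close>

definition satisfies_KKP :: "('n::finite) laurent \<Rightarrow> bool" where
  "satisfies_KKP f \<longleftrightarrow> (\<forall>p. dim_gr_F f p = dim_gr_W f (2 * p))"

definition f_Delta :: "(nat \<Rightarrow> int^'n) \<Rightarrow> 'n laurent" where
  "f_Delta v = (\<Sum>i=0..CARD('n). Poly_Mapping.single (v i) 1)"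

end

theory Submission
  imports Defs "HOL-Library.Function_Algebras"
begin

text \<open>Start at \<open>0\<close> and always add a vertex \<open>v\<^sub>j\<close> with minimal \<open>c\<^sub>j / q\<^sub>j\<close>, where \<open>c\<^sub>j\<close> counts its previous
  uses; after \<open>\<mu>\<close> steps this closes up at \<open>\<Sum> q\<^sub>j v\<^sub>j = 0\<close>. The monomials \<open>u\<^bsup>m\<^esup>\<close> on this path form a
  basis of the Gauss-Manin system, in which \<open>\<tau>\<partial>\<^sub>\<tau>\<close> is a diagonal plus a cyclic shift. Rescaling the \<open>k\<close>-th
  one by \<open>\<tau>\<^bsup>k - lev k\<^esup>\<close>, where \<open>lev k\<close> is \<open>\<mu>\<close> times the \<open>k\<close>-th element of \<open>F\<close> counted with multiplicity
  (an integer by reflexivity), gives a basis of \<open>V\<^sub>0\<close>, and on \<open>gr\<^sub>0\<close> the endomorphism \<open>N\<close> has one Jordan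
  chain of length \<open>d\<^sub>i\<close> for each \<open>f\<^sub>i \<in> F\<close>. As \<open>G\<^sub>0\<close> is spanned by the unscaled monomials, the \<open>k\<close>-th basis
  vector has Hodge degree \<open>n - k + lev k\<close>. Weights are centered at \<open>n\<close> on each chain, so the KKP
  condition, by comparison of second moments, says that twice the Hodge degrees are too; this is
  the displayed equation for \<open>d\<^sub>i\<close> and \<open>f\<^sub>i\<close>.\<close>

section \<open>Coordinates on modules\<close>

text \<open>For m = \<Sum> c_i v_i the relations of the Gauss-Manin system say that \<Sum> (c_i u^m
  - tau u^(v_i + m)) v_i vanishes. All linear relations among the vertices are multiples of the one
  with coefficients q_i, so the i-th coefficient here is q_i times an element independent of i.
  Summing over i identifies that element as 1 / mu times (tau d/dtau + |c|) u^m. Hence one more use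
  of v_i multiplies tau^|c| u^m by c_i - (1 / p_i) tau d/dtau, where p_i = mu / q_i. These operators
  commute, and \<Sum> q_i v_i = 0 turns their product along a closed path into a hypergeometric
  equation. Its roots are the numbers l p_i with l < q_i, and the path takes them in increasing
  order. This derivation does not show that the system is as large as the equation predicts. So the
  model with its operator is built first, forms are mapped to it, and a separate spanning argument
  bounds the kernel. The other obstacle is that both filtrations are definite descriptions on cosets
  of cosets of forms: each needs a uniqueness proof, done in coordinates for an arbitrary
  candidate.\<close>

text \<open>All computations in quotient modules go through an additive injection into a function space. The
  underlying structure need not be known to be a module, which is deduced from the chart.\<close>

definition chart :: "'s set \<Rightarrow> ('s, 'a) module \<Rightarrow> ('s \<Rightarrow> 'b \<Rightarrow> 'b) \<Rightarrow> ('a \<Rightarrow> 'b::ab_group_add) \<Rightarrow> bool" where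
  "chart S M sc h \<longleftrightarrow> inj_on h (carrier M) \<and> \<zero>\<^bsub>M\<^esub> \<in> carrier M \<and> h \<zero>\<^bsub>M\<^esub> = 0 \<and>
     (\<forall>x\<in>carrier M. \<forall>y\<in>carrier M. x \<oplus>\<^bsub>M\<^esub> y \<in> carrier M \<and> h (x \<oplus>\<^bsub>M\<^esub> y) = h x + h y) \<and>
     (\<forall>x\<in>carrier M. \<exists>y\<in>carrier M. h y = - h x) \<and>
     (\<forall>a\<in>S. \<forall>x\<in>carrier M. a \<odot>\<^bsub>M\<^esub> x \<in> carrier M \<and> h (a \<odot>\<^bsub>M\<^esub> x) = sc a (h x))"

lemma chartD:
  assumes "chart S M sc h"
  shows "\<zero>\<^bsub>M\<^esub> \<in> carrier M" "h \<zero>\<^bsub>M\<^esub> = 0"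
    "\<And>x y. x \<in> carrier M \<Longrightarrow> y \<in> carrier M \<Longrightarrow> x \<oplus>\<^bsub>M\<^esub> y \<in> carrier M"
    "\<And>x y. x \<in> carrier M \<Longrightarrow> y \<in> carrier M \<Longrightarrow> h (x \<oplus>\<^bsub>M\<^esub> y) = h x + h y"
    "\<And>a x. a \<in> S \<Longrightarrow> x \<in> carrier M \<Longrightarrow> a \<odot>\<^bsub>M\<^esub> x \<in> carrier M"
    "\<And>a x. a \<in> S \<Longrightarrow> x \<in> carrier M \<Longrightarrow> h (a \<odot>\<^bsub>M\<^esub> x) = sc a (h x)"
    "\<And>x y. x \<in> carrier M \<Longrightarrow> y \<in> carrier M \<Longrightarrow> h x = h y \<Longrightarrow> x = y"
    "\<And>x. x \<in> carrier M \<Longrightarrow> \<exists>y\<in>carrier M. h y = - h x"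
  using assms unfolding chart_def inj_on_def by auto

lemma chart_abelian_group:
  assumes "chart S M sc h"
  shows "abelian_group M"
proof (rule abelian_groupI)
  note c = chartD[OF assms]
  fix x assume x: "x \<in> carrier M"
  obtain y where y: "y \<in> carrier M" "h y = - h x" using c(8)[OF x] by blast
  then have "y \<oplus>\<^bsub>M\<^esub> x = \<zero>\<^bsub>M\<^esub>" using x c(1-4) by (intro c(7)) auto
  with y show "\<exists>y\<in>carrier M. y \<oplus>\<^bsub>M\<^esub> x = \<zero>\<^bsub>M\<^esub>" by blast
next
  note c = chartD[OF assms]
  fix x y z assume "x \<in> carrier M" "y \<in> carrier M" "z \<in> carrier M"
  then show "x \<oplus>\<^bsub>M\<^esub> y \<oplus>\<^bsub>M\<^esub> z = x \<oplus>\<^bsub>M\<^esub> (y \<oplus>\<^bsub>M\<^esub> z)"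
    using c(3,4) by (intro c(7)) (auto simp: add.assoc)
next
  note c = chartD[OF assms]
  fix x y assume "x \<in> carrier M" "y \<in> carrier M"
  then show "x \<oplus>\<^bsub>M\<^esub> y = y \<oplus>\<^bsub>M\<^esub> x"
    using c(3,4) by (intro c(7)) (auto simp: add.commute)
next
  note c = chartD[OF assms]
  fix x assume "x \<in> carrier M"
  then show "\<zero>\<^bsub>M\<^esub> \<oplus>\<^bsub>M\<^esub> x = x" using c(1-4) by (intro c(7)) auto
qed (use chartD[OF assms] in auto)

lemma chart_minus:
  assumes "chart S M sc h" "x \<in> carrier M"
  shows "\<ominus>\<^bsub>M\<^esub> x \<in> carrier M" "h (\<ominus>\<^bsub>M\<^esub> x) = - h x"
proof -
  interpret abelian_group M using chart_abelian_group[OF assms(1)] .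
  note c = chartD[OF assms(1)]
  show m: "\<ominus>\<^bsub>M\<^esub> x \<in> carrier M" using assms(2) by simp
  have "h (\<ominus>\<^bsub>M\<^esub> x \<oplus>\<^bsub>M\<^esub> x) = 0" using assms(2) c(2) by (simp add: l_neg)
  then have "h (\<ominus>\<^bsub>M\<^esub> x) + h x = 0" using c(4)[OF m assms(2)] by simp
  then show "h (\<ominus>\<^bsub>M\<^esub> x) = - h x" by (simp add: eq_neg_iff_add_eq_0)
qed

lemma chart_restrict:
  assumes "chart S M sc h" "V = {x \<in> carrier M. h x \<in> \<Gamma>}" "S' \<subseteq> S" "0 \<in> \<Gamma>"
    "\<And>x y. x \<in> \<Gamma> \<Longrightarrow> y \<in> \<Gamma> \<Longrightarrow> x + y \<in> \<Gamma>" "\<And>x. x \<in> \<Gamma> \<Longrightarrow> - x \<in> \<Gamma>"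
    "\<And>a x. a \<in> S' \<Longrightarrow> x \<in> \<Gamma> \<Longrightarrow> sc a x \<in> \<Gamma>"
  shows "chart S' (M\<lparr>carrier := V\<rparr>) sc h"
  using chartD[OF assms(1)] assms(2-) unfolding chart_def inj_on_def
  by (auto simp: subset_iff) (metis (no_types))

text \<open>Subobjects of known shape are presented as kernels of an additive map
  \<open>\<pi>\<close> on coordinates, so that their cosets become the fibres of
  \<open>\<pi>\<close>.\<close>

lemma chart_coset:
  fixes \<pi> :: "'b::ab_group_add \<Rightarrow> 'c::ab_group_add"
  assumes "chart S M sc h" "\<And>a b. \<pi> (a + b) = \<pi> a + \<pi> b"
    "N = {x \<in> carrier M. \<pi> (h x) = 0}" "x \<in> carrier M"
  shows "N +>\<^bsub>M\<^esub> x = {y \<in> carrier M. \<pi> (h y) = \<pi> (h x)}"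
proof -
  interpret abelian_group M using chart_abelian_group[OF assms(1)] .
  note c = chartD[OF assms(1)]
  have "\<pi> 0 + \<pi> 0 = \<pi> 0 + 0" using assms(2)[of 0 0] by simp
  then have p0: "\<pi> 0 = 0" by (simp only: add_left_cancel)
  have pm: "\<pi> (- a) = - \<pi> a" for a
    using assms(2)[of "-a" a] p0 by (simp add: eq_neg_iff_add_eq_0)
  show ?thesis
  proof (intro equalityI subsetI)
    fix y assume "y \<in> N +>\<^bsub>M\<^esub> x"
    then show "y \<in> {y \<in> carrier M. \<pi> (h y) = \<pi> (h x)}"
      using assms c(3,4) by (auto simp: a_r_coset_def')
  next
    fix y assume y: "y \<in> {y \<in> carrier M. \<pi> (h y) = \<pi> (h x)}"
    have "h (y \<oplus>\<^bsub>M\<^esub> \<ominus>\<^bsub>M\<^esub> x) = h y + - h x" using y assms(4) c(4) chart_minus[OF assms(1,4)] by auto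
    then have "y \<oplus>\<^bsub>M\<^esub> \<ominus>\<^bsub>M\<^esub> x \<in> N"
      using y assms(3,4) pm assms(2)[of "h y" "- h x"] by auto
    moreover have "y = y \<oplus>\<^bsub>M\<^esub> \<ominus>\<^bsub>M\<^esub> x \<oplus>\<^bsub>M\<^esub> x" using y assms(4) by (simp add: a_assoc l_neg)
    ultimately show "y \<in> N +>\<^bsub>M\<^esub> x" unfolding a_r_coset_def' by blast
  qed
qed

text \<open>The choice of a representative is harmless: in all uses \<open>\<pi> \<circ> h\<close>
  is constant on the cosets.\<close>

definition quot_coord :: "('b \<Rightarrow> 'c) \<Rightarrow> ('a \<Rightarrow> 'b) \<Rightarrow> 'a set \<Rightarrow> 'c" where
  "quot_coord \<pi> h X = \<pi> (h (SOME x. x \<in> X))"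

text \<open>The quotient gets coordinates in the same sense, so the construction can be iterated:
  \<open>gr_V\<close> is a quotient of a submodule of a quotient. Compatibility with scalars is
  asked for \<open>a \<in> S\<close> only, because passing to constant terms commutes with constants
  but not with \<open>tau_pow 1\<close>.\<close>

lemma chart_quotient:
  fixes \<pi> :: "'b::ab_group_add \<Rightarrow> 'c::ab_group_add"
  assumes ch: "chart S M sc h" and add: "\<And>a b. \<pi> (a + b) = \<pi> a + \<pi> b"
    and sc: "\<And>a x. a \<in> S \<Longrightarrow> x \<in> carrier M \<Longrightarrow> \<pi> (sc a (h x)) = sc' a (\<pi> (h x))"
    and N: "N = {x \<in> carrier M. \<pi> (h x) = 0}"
  shows "chart S (quotient_module M N) sc' (quot_coord \<pi> h)"
    and "\<And>x. x \<in> carrier M \<Longrightarrow> N +>\<^bsub>M\<^esub> x \<in> carrier (quotient_module M N)"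
    and "\<And>x. x \<in> carrier M \<Longrightarrow> quot_coord \<pi> h (N +>\<^bsub>M\<^esub> x) = \<pi> (h x)"
    and "\<And>X. X \<in> carrier (quotient_module M N) \<Longrightarrow> \<exists>x\<in>carrier M. X = N +>\<^bsub>M\<^esub> x"
    and "\<And>x y. x \<in> carrier M \<Longrightarrow> y \<in> carrier M \<Longrightarrow>
      (N +>\<^bsub>M\<^esub> x) \<oplus>\<^bsub>quotient_module M N\<^esub> (N +>\<^bsub>M\<^esub> y) = N +>\<^bsub>M\<^esub> (x \<oplus>\<^bsub>M\<^esub> y)"
    and "\<And>a x. a \<in> S \<Longrightarrow> x \<in> carrier M \<Longrightarrow>
      a \<odot>\<^bsub>quotient_module M N\<^esub> (N +>\<^bsub>M\<^esub> x) = N +>\<^bsub>M\<^esub> (a \<odot>\<^bsub>M\<^esub> x)"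
proof -
  interpret abelian_group M using chart_abelian_group[OF ch] .
  note c = chartD[OF ch]
  note co = chart_coset[OF ch add N]
  let ?Q = "quotient_module M N"
  have p0: "\<pi> 0 = 0" using add[of 0 0] by simp
  have pm: "\<pi> (- a) = - \<pi> a" for a
    using add[of "-a" a] p0 by (simp add: eq_neg_iff_add_eq_0)
  have car: "carrier ?Q = {N +>\<^bsub>M\<^esub> x | x. x \<in> carrier M}"
    unfolding quotient_module_def A_RCOSETS_def' by auto
  show in1: "\<And>x. x \<in> carrier M \<Longrightarrow> N +>\<^bsub>M\<^esub> x \<in> carrier ?Q" unfolding car by auto
  show ex: "\<And>X. X \<in> carrier ?Q \<Longrightarrow> \<exists>x\<in>carrier M. X = N +>\<^bsub>M\<^esub> x" unfolding car by auto
  show val: "quot_coord \<pi> h (N +>\<^bsub>M\<^esub> x) = \<pi> (h x)" if "x \<in> carrier M" for x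
  proof -
    have "x \<in> N +>\<^bsub>M\<^esub> x" using that by (simp add: co)
    then have "(SOME y. y \<in> N +>\<^bsub>M\<^esub> x) \<in> N +>\<^bsub>M\<^esub> x" by (rule someI)
    then show ?thesis unfolding quot_coord_def using that by (simp add: co)
  qed
  show addQ: "(N +>\<^bsub>M\<^esub> x) \<oplus>\<^bsub>?Q\<^esub> (N +>\<^bsub>M\<^esub> y) = N +>\<^bsub>M\<^esub> (x \<oplus>\<^bsub>M\<^esub> y)"
    if xy: "x \<in> carrier M" "y \<in> carrier M" for x y
  proof -
    have "(N +>\<^bsub>M\<^esub> x) <+>\<^bsub>M\<^esub> (N +>\<^bsub>M\<^esub> y) = N +>\<^bsub>M\<^esub> (x \<oplus>\<^bsub>M\<^esub> y)"
    proof (intro equalityI subsetI)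
      fix z assume "z \<in> (N +>\<^bsub>M\<^esub> x) <+>\<^bsub>M\<^esub> (N +>\<^bsub>M\<^esub> y)"
      then show "z \<in> N +>\<^bsub>M\<^esub> (x \<oplus>\<^bsub>M\<^esub> y)"
        using xy c(3,4) add by (auto simp: set_add_def set_mult_def co)
    next
      fix z assume z: "z \<in> N +>\<^bsub>M\<^esub> (x \<oplus>\<^bsub>M\<^esub> y)"
      then have zc: "z \<in> carrier M" "\<pi> (h z) = \<pi> (h x) + \<pi> (h y)" using xy c(3,4) add by (auto simp: co)
      have "h (z \<oplus>\<^bsub>M\<^esub> \<ominus>\<^bsub>M\<^esub> y) = h z + - h y" using zc xy c(4) chart_minus[OF ch] by auto
      then have "z \<oplus>\<^bsub>M\<^esub> \<ominus>\<^bsub>M\<^esub> y \<in> N +>\<^bsub>M\<^esub> x"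
        using zc xy add[of "h z" "- h y"] pm by (auto simp: co)
      moreover have "y \<in> N +>\<^bsub>M\<^esub> y" using xy by (simp add: co)
      moreover have "z = z \<oplus>\<^bsub>M\<^esub> \<ominus>\<^bsub>M\<^esub> y \<oplus>\<^bsub>M\<^esub> y" using zc xy by (simp add: a_assoc l_neg)
      ultimately show "z \<in> (N +>\<^bsub>M\<^esub> x) <+>\<^bsub>M\<^esub> (N +>\<^bsub>M\<^esub> y)"
        unfolding set_add_def set_mult_def by auto
    qed
    then show ?thesis by (simp add: quotient_module_def)
  qed
  show scQ: "a \<odot>\<^bsub>?Q\<^esub> (N +>\<^bsub>M\<^esub> x) = N +>\<^bsub>M\<^esub> (a \<odot>\<^bsub>M\<^esub> x)" if ax: "a \<in> S" "x \<in> carrier M" for a x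
  proof -
    have "N +>\<^bsub>M\<^esub> (a \<odot>\<^bsub>M\<^esub> y) = N +>\<^bsub>M\<^esub> (a \<odot>\<^bsub>M\<^esub> x)" if "y \<in> N +>\<^bsub>M\<^esub> x" for y
      using that ax c(5,6) sc by (auto simp: co)
    moreover have "x \<in> N +>\<^bsub>M\<^esub> x" using ax by (simp add: co)
    ultimately have "(\<Union>y\<in>N +>\<^bsub>M\<^esub> x. N +>\<^bsub>M\<^esub> (a \<odot>\<^bsub>M\<^esub> y)) = N +>\<^bsub>M\<^esub> (a \<odot>\<^bsub>M\<^esub> x)" by blast
    then show ?thesis by (simp add: quotient_module_def)
  qed
  have zQ: "\<zero>\<^bsub>?Q\<^esub> = N +>\<^bsub>M\<^esub> \<zero>\<^bsub>M\<^esub>"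
    using c(1,2) by (simp add: quotient_module_def co p0) (simp add: N)
  have neg: "\<exists>Y\<in>carrier ?Q. quot_coord \<pi> h Y = - quot_coord \<pi> h X" if "X \<in> carrier ?Q" for X
  proof -
    obtain x where x: "x \<in> carrier M" "X = N +>\<^bsub>M\<^esub> x" using ex \<open>X \<in> _\<close> by blast
    then show ?thesis using chart_minus[OF ch x(1)] by (intro bexI[of _ "N +>\<^bsub>M\<^esub> (\<ominus>\<^bsub>M\<^esub> x)"]) (auto simp: val pm in1)
  qed
  show "chart S ?Q sc' (quot_coord \<pi> h)"
    unfolding chart_def
  proof (intro conjI ballI)
    show "inj_on (quot_coord \<pi> h) (carrier ?Q)"
    proof (rule inj_onI)
      fix X Y assume "X \<in> carrier ?Q" "Y \<in> carrier ?Q" and eq: "quot_coord \<pi> h X = quot_coord \<pi> h Y"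
      then obtain x y where xy: "x \<in> carrier M" "X = N +>\<^bsub>M\<^esub> x" "y \<in> carrier M" "Y = N +>\<^bsub>M\<^esub> y" using ex by meson
      then have "\<pi> (h x) = \<pi> (h y)" using eq by (simp add: val)
      then show "X = Y" using xy by (simp add: co)
    qed
    show "\<zero>\<^bsub>?Q\<^esub> \<in> carrier ?Q" unfolding zQ using c(1) by (rule in1)
    show "quot_coord \<pi> h \<zero>\<^bsub>?Q\<^esub> = 0" unfolding zQ using c(1,2) by (simp add: val p0)
  next
    fix X assume "X \<in> carrier ?Q"
    then show "\<exists>Y\<in>carrier ?Q. quot_coord \<pi> h Y = - quot_coord \<pi> h X" by (rule neg)
  next
    fix X Y assume "X \<in> carrier ?Q" "Y \<in> carrier ?Q"
    then obtain x y where xy: "x \<in> carrier M" "X = N +>\<^bsub>M\<^esub> x" "y \<in> carrier M" "Y = N +>\<^bsub>M\<^esub> y" using ex by meson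
    show "X \<oplus>\<^bsub>?Q\<^esub> Y \<in> carrier ?Q" using xy c(3) by (auto simp: addQ intro!: in1)
    show "quot_coord \<pi> h (X \<oplus>\<^bsub>?Q\<^esub> Y) = quot_coord \<pi> h X + quot_coord \<pi> h Y"
      using xy c(3,4) add by (auto simp: addQ val)
  next
    fix a X assume a: "a \<in> S" and "X \<in> carrier ?Q"
    then obtain x where x: "x \<in> carrier M" "X = N +>\<^bsub>M\<^esub> x" using ex by meson
    show "a \<odot>\<^bsub>?Q\<^esub> X \<in> carrier ?Q" using x a c(5) by (auto simp: scQ intro!: in1)
    show "quot_coord \<pi> h (a \<odot>\<^bsub>?Q\<^esub> X) = sc' a (quot_coord \<pi> h X)"
      using x a c(5,6) sc by (auto simp: scQ val)
  qed
qed

lemma induced_map_coset: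
  fixes \<pi> :: "'b::ab_group_add \<Rightarrow> 'c::ab_group_add"
  assumes "chart S M sc h" "\<And>a b. \<pi> (a + b) = \<pi> a + \<pi> b"
    "N = {x \<in> carrier M. \<pi> (h x) = 0}" "z \<in> X"
    "\<And>x. x \<in> X \<Longrightarrow> \<phi> x \<in> carrier M \<and> \<pi> (h (\<phi> x)) = \<pi> (h (\<phi> z))"
  shows "induced_map M N \<phi> X = N +>\<^bsub>M\<^esub> \<phi> z"
proof -
  have "N +>\<^bsub>M\<^esub> \<phi> x = N +>\<^bsub>M\<^esub> \<phi> z" if "x \<in> X" for x
    using assms(5)[OF that] assms(5)[OF assms(4)] by (simp add: chart_coset[OF assms(1-3)])
  then show ?thesis unfolding induced_map_def using assms(4) by blast
qed

subsection \<open>Laurent polynomials in \<open>\<tau>\<close> as scalars\<close>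

abbreviation lk :: "('a \<Rightarrow>\<^sub>0 'b::zero) \<Rightarrow> 'a \<Rightarrow> 'b" where "lk \<equiv> Poly_Mapping.lookup"

lemma cring_tau_ring:
  assumes "0 \<in> E" "\<And>a b. a \<in> E \<Longrightarrow> b \<in> E \<Longrightarrow> a + b \<in> E"
  shows "cring (tau_ring E)"
proof (rule cringI)
  show "abelian_group (tau_ring E)"
  proof (rule abelian_groupI)
    fix x assume "x \<in> carrier (tau_ring E)"
    then show "\<exists>y\<in>carrier (tau_ring E). y \<oplus>\<^bsub>tau_ring E\<^esub> x = \<zero>\<^bsub>tau_ring E\<^esub>"
      by (intro bexI[of _ "- x"]) (auto simp: tau_ring_def keys_minus)
  next
    fix x y assume "x \<in> carrier (tau_ring E)" "y \<in> carrier (tau_ring E)"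
    then show "x \<oplus>\<^bsub>tau_ring E\<^esub> y \<in> carrier (tau_ring E)"
      using Poly_Mapping.keys_add[of x y] by (auto simp: tau_ring_def)
  qed (auto simp: tau_ring_def add.assoc add.commute)
  show "Group.comm_monoid (tau_ring E)"
  proof (rule comm_monoidI)
    fix x y assume "x \<in> carrier (tau_ring E)" "y \<in> carrier (tau_ring E)"
    then show "x \<otimes>\<^bsub>tau_ring E\<^esub> y \<in> carrier (tau_ring E)"
      using Poly_Mapping.keys_mult[of x y] assms(2) by (fastforce simp: tau_ring_def)
  qed (use assms in \<open>auto simp: tau_ring_def mult.assoc mult.commute\<close>)
qed (auto simp: tau_ring_def distrib_right)

lemma tau_const_carrier: "a \<in> carrier field_const \<longleftrightarrow> a = tau_const (lk a 0)"
proof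
  assume "a \<in> carrier field_const"
  then show "a = tau_const (lk a 0)"
    by (intro poly_mapping_eqI)
       (auto simp: tau_ring_def tau_const_def lookup_single when_def in_keys_iff subset_iff)
next
  assume "a = tau_const (lk a 0)"
  then show "a \<in> carrier field_const"
    by (metis (no_types, lifting) keys_single mem_Collect_eq partial_object.select_convs(1) subset_refl
        tau_const_def tau_ring_def empty_subsetI)
qed

lemma tau_const_simps [simp]:
  "tau_const 0 = 0" "tau_const 1 = 1" "tau_const (a + b) = tau_const a + tau_const b"
  "tau_const (a * b) = tau_const a * tau_const b" "tau_const (- a) = - tau_const a"
  "tau_const (a - b) = tau_const a - tau_const b" "lk (tau_const a) 0 = a"
  "tau_const (of_nat n) = of_nat n" "tau_const (of_int i) = of_int i"
  by (simp_all add: tau_const_def single_add mult_single single_uminus single_diff)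

lemma tau_const_in [simp]: "tau_const c \<in> carrier field_const"
  by (simp add: tau_const_carrier)

lemma field_field_const: "field field_const"
proof -
  interpret cring field_const by (rule cring_tau_ring) auto
  have one: "\<one>\<^bsub>field_const\<^esub> = 1" and zero: "\<zero>\<^bsub>field_const\<^esub> = 0"
    and mult: "\<And>x y. x \<otimes>\<^bsub>field_const\<^esub> y = x * y" by (auto simp: tau_ring_def)
  show ?thesis
  proof (rule cring_fieldI2)
    show "\<zero>\<^bsub>field_const\<^esub> \<noteq> \<one>\<^bsub>field_const\<^esub>" by (simp add: one zero)
    fix a assume "a \<in> carrier field_const" "a \<noteq> \<zero>\<^bsub>field_const\<^esub>"
    then have a: "a = tau_const (lk a 0)" and "lk a 0 \<noteq> 0" using tau_const_carrier zero by force+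
    then have "a * tau_const (inverse (lk a 0)) = 1"
      by (metis right_inverse tau_const_simps(2,4))
    then show "\<exists>b\<in>carrier field_const. a \<otimes>\<^bsub>field_const\<^esub> b = \<one>\<^bsub>field_const\<^esub>"
      by (intro bexI[of _ "tau_const (inverse (lk a 0))"]) (auto simp: one mult)
  qed
qed

lemma tau_pow_mult: "tau_pow a * tau_pow b = tau_pow (a + b)"
  by (simp add: tau_pow_def mult_single)

lemma tau_pow_0 [simp]: "tau_pow 0 = 1"
  by (simp add: tau_pow_def)

lemma tau_pow_inv [simp]: "tau_pow a * (tau_pow (- a) * x) = x" "tau_pow (- a) * (tau_pow a * x) = x"
  by (simp_all add: tau_pow_mult flip: mult.assoc)

lemma lookup_single_mult:
  fixes g :: "'a::ab_group_add \<Rightarrow>\<^sub>0 'b::semiring_0"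
  shows "lk (Poly_Mapping.single p a * g) m = a * lk g (m - p)"
proof -
  have "lk (Poly_Mapping.single p a * g) m =
    Sum_any (\<lambda>l. lk (Poly_Mapping.single p a) l * Sum_any (\<lambda>q. lk g q when m = l + q))"
    by (simp add: lookup_mult)
  also have "\<dots> = Sum_any (\<lambda>l. (a * Sum_any (\<lambda>q. lk g q when m = l + q)) when l = p)"
    by (rule arg_cong[where f = Sum_any]) (auto simp: lookup_single when_def)
  also have "\<dots> = a * Sum_any (\<lambda>q. lk g q when m = p + q)" by simp
  also have "Sum_any (\<lambda>q. lk g q when m = p + q) = Sum_any (\<lambda>q. lk g q when q = m - p)"
    by (rule arg_cong[where f = Sum_any]) (auto simp: when_def)
  finally show ?thesis by simp
qed

lemma lookup_tau_mult [simp]: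
  "lk (tau_pow p * x) i = lk x (i - p)" "lk (tau_const c * x) i = c * lk x i"
  by (simp_all add: tau_pow_def tau_const_def lookup_single_mult)

text \<open>Coordinates take values in \<open>nat \<Rightarrow> laurent_tau\<close>, also for complex vector spaces, whose
  coordinates are constant.\<close>

definition fsc :: "laurent_tau \<Rightarrow> (nat \<Rightarrow> laurent_tau) \<Rightarrow> nat \<Rightarrow> laurent_tau" where
  "fsc a x = (\<lambda>k. a * x k)"

lemma fsc_simps [simp]:
  "fsc a (x + y) = fsc a x + fsc a y" "fsc (a + b) x = fsc a x + fsc b x" "fsc a (- x) = - fsc a x"
  "fsc a (fsc b x) = fsc (a * b) x" "fsc 1 x = x" "fsc a 0 = 0" "fsc 0 x = 0"
  "fsc a (x - y) = fsc a x - fsc a y" "fsc (a - b) x = fsc a x - fsc b x" "fsc (- a) x = - fsc a x"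
  by (auto simp: fsc_def fun_eq_iff algebra_simps)

lemma chart_module:
  assumes ch: "chart (carrier (tau_ring E)) M fsc h"
    and E: "0 \<in> E" "\<And>a b. a \<in> E \<Longrightarrow> b \<in> E \<Longrightarrow> a + b \<in> E"
  shows "Module.module (tau_ring E) M"
proof -
  note c = chartD[OF ch]
  interpret cring "tau_ring E" by (rule cring_tau_ring) (use E in auto)
  have ops: "\<And>x y. x \<otimes>\<^bsub>tau_ring E\<^esub> y = x * y" "\<And>x y. x \<oplus>\<^bsub>tau_ring E\<^esub> y = x + y" "\<one>\<^bsub>tau_ring E\<^esub> = 1"
    by (auto simp: tau_ring_def)
  show ?thesis
  proof (rule moduleI)
    show "cring (tau_ring E)" by unfold_locales
    show "abelian_group M" by (rule chart_abelian_group[OF ch])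
  qed (use c(3-6) a_closed m_closed one_closed in \<open>auto simp: ops intro!: c(7)\<close>)
qed

lemma chart_lincomb:
  assumes ch: "chart (carrier (tau_ring E)) M fsc h"
    and E: "0 \<in> E" "\<And>a b. a \<in> E \<Longrightarrow> b \<in> E \<Longrightarrow> a + b \<in> E"
    and "finite A" "A \<subseteq> carrier M" "a \<in> A \<rightarrow> carrier (tau_ring E)"
  shows "h (module.lincomb M a A) = (\<Sum>v\<in>A. fsc (a v) (h v))"
proof -
  interpret Module.module "tau_ring E" M by (rule chart_module[OF ch]) (use E in auto)
  note c = chartD[OF ch]
  show ?thesis using assms(4-)
  proof (induction A)
    case empty
    then show ?case using c(2) by (simp add: lincomb_def)
  next
    case (insert v A)
    have "lincomb a (A \<union> {v}) = a v \<odot>\<^bsub>M\<^esub> v \<oplus>\<^bsub>M\<^esub> lincomb a A"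
      using insert by (intro lincomb_insert) auto
    moreover have "lincomb a A \<in> carrier M" using insert by (intro lincomb_closed) auto
    ultimately show ?case using insert c(4-6) by (auto simp: Pi_def)
  qed
qed

lemma sum_fun_apply: "sum f A k = (\<Sum>i\<in>A. f i k)"
  by (induction A rule: infinite_finite_induct) auto

text \<open>The basis consists of the preimages of tau^s times the unit vectors. With s = 0 over the
  constants this gives dimensions; with s = - \<lfloor>\<alpha>\<rfloor> over the polynomials in tau
  it gives the freeness of a step of the Kashiwara-Malgrange filtration.\<close>

lemma chart_basis:
  assumes ch: "chart (carrier (tau_ring E)) M fsc h"
    and E: "0 \<in> E" "\<And>a b. a \<in> E \<Longrightarrow> b \<in> E \<Longrightarrow> a + b \<in> E"
    and I: "finite I"
    and im: "h ` carrier M = {x. (\<forall>k. k \<notin> I \<longrightarrow> x k = 0) \<and> (\<forall>k\<in>I. \<exists>a\<in>carrier (tau_ring E). x k = a * tau_pow s)}"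
  obtains B where "finite B" "B \<subseteq> carrier M" "card B = card I" "\<not> module.lin_dep (tau_ring E) M B"
    "module.span (tau_ring E) M B = carrier M"
proof -
  interpret Module.module "tau_ring E" M by (rule chart_module[OF ch]) (use E in auto)
  note c = chartD[OF ch]
  have R: "\<one>\<^bsub>tau_ring E\<^esub> = 1" "\<zero>\<^bsub>tau_ring E\<^esub> = 0" by (auto simp: tau_ring_def)
  define d where "d = (\<lambda>k j :: nat. if j = k then tau_pow s else (0::laurent_tau))"
  have "\<exists>b\<in>carrier M. h b = d k" if "k \<in> I" for k
  proof -
    have "d k \<in> h ` carrier M" unfolding im d_def
      using that R one_closed zero_closed by (auto intro: bexI[of _ 1] bexI[of _ 0])
    then show ?thesis by (metis imageE)
  qed
  then obtain b where b: "\<And>k. k \<in> I \<Longrightarrow> b k \<in> carrier M" "\<And>k. k \<in> I \<Longrightarrow> h (b k) = d k" by metis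
  have ts: "tau_pow s \<noteq> 0" using tau_pow_mult[of s "-s"] by auto
  have inj: "inj_on b I"
  proof (rule inj_onI)
    fix j k assume "j \<in> I" "k \<in> I" "b j = b k"
    then have "d j j = d k j" using b by metis
    then show "j = k" using ts by (auto simp: d_def split: if_splits)
  qed
  have lc: "h (lincomb a (b ` I)) k = (if k \<in> I then a (b k) * tau_pow s else 0)"
    if "a \<in> b ` I \<rightarrow> carrier (tau_ring E)" for a k
  proof -
    have "h (lincomb a (b ` I)) = (\<Sum>v\<in>b ` I. fsc (a v) (h v))"
      by (rule chart_lincomb[OF ch]) (use E I b that in auto)
    also have "\<dots> = (\<Sum>j\<in>I. fsc (a (b j)) (d j))" using inj b(2) by (simp add: sum.reindex)
    finally have "h (lincomb a (b ` I)) k = (\<Sum>j\<in>I. a (b j) * d j k)"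
      by (simp add: fsc_def sum_fun_apply)
    also have "\<dots> = (\<Sum>j\<in>I. if k = j then a (b j) * tau_pow s else 0)" by (intro sum.cong) (auto simp: d_def)
    finally show ?thesis using I by simp
  qed
  show ?thesis
  proof (rule that[of "b ` I"])
    show "finite (b ` I)" "b ` I \<subseteq> carrier M" "card (b ` I) = card I" using I b(1) inj by (auto simp: card_image)
    show "\<not> lin_dep (b ` I)"
    proof (rule finite_lin_indpt2)
      fix a assume a: "a \<in> b ` I \<rightarrow> carrier (tau_ring E)" "lincomb a (b ` I) = \<zero>\<^bsub>M\<^esub>"
      have "a (b k) = 0" if "k \<in> I" for k using lc[OF a(1), of k] a(2) that ts c(2) by simp
      then show "\<forall>v\<in>b ` I. a v = \<zero>\<^bsub>tau_ring E\<^esub>" by (auto simp: R)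
    qed (use I b in auto)
    show "span (b ` I) = carrier M"
    proof
      show "span (b ` I) \<subseteq> carrier M" using b(1) by (intro span_is_subset2) auto
      show "carrier M \<subseteq> span (b ` I)"
      proof
        fix x assume x: "x \<in> carrier M"
        then have hx: "h x \<in> h ` carrier M" by simp
        then have "\<forall>k\<in>I. \<exists>a\<in>carrier (tau_ring E). h x k = a * tau_pow s" unfolding im by blast
        then obtain a where a: "\<And>k. k \<in> I \<Longrightarrow> a k \<in> carrier (tau_ring E) \<and> h x k = a k * tau_pow s" by metis
        define a' where "a' = (\<lambda>v. a (the_inv_into I b v))"
        have a'b: "a' (b k) = a k" if "k \<in> I" for k using inj that by (simp add: a'_def the_inv_into_f_f)
        have a'c: "a' \<in> b ` I \<rightarrow> carrier (tau_ring E)" using a a'b by auto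
        have "h (lincomb a' (b ` I)) = h x"
        proof
          fix k show "h (lincomb a' (b ` I)) k = h x k"
            using hx a a'b unfolding lc[OF a'c] im by auto
        qed
        moreover have "lincomb a' (b ` I) \<in> carrier M" using a'c b by (intro lincomb_closed) auto
        ultimately have "x = lincomb a' (b ` I)" using x c(7) by metis
        then show "x \<in> span (b ` I)" unfolding span_def using I a'c by blast
      qed
    qed
  qed
qed

lemma chart_dim:
  assumes ch: "chart (carrier field_const) M fsc h" and I: "finite I"
    and im: "h ` carrier M = {x. (\<forall>k. k \<notin> I \<longrightarrow> x k = 0) \<and> (\<forall>k. x k \<in> carrier field_const)}"
  shows "vectorspace.dim field_const M = card I"
proof -
  interpret vectorspace field_const M
    using chart_module[OF ch] field_field_const unfolding vectorspace_def by auto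
  have "0 \<in> carrier field_const" by (metis tau_const_in tau_const_simps(1))
  then have im': "h ` carrier M =
    {x. (\<forall>k. k \<notin> I \<longrightarrow> x k = 0) \<and> (\<forall>k\<in>I. \<exists>a\<in>carrier field_const. x k = a * tau_pow 0)}"
    unfolding im by (intro Collect_cong) (metis mult.right_neutral tau_pow_0)
  show ?thesis
    by (rule chart_basis[OF ch _ _ I im']) (auto dest: dim_basis simp: basis_def)
qed

section \<open>Uniqueness of the Kashiwara-Malgrange filtration\<close>

definition shift_op :: "((nat \<Rightarrow> laurent_tau) \<Rightarrow> nat \<Rightarrow> laurent_tau) \<Rightarrow> rat \<Rightarrow> (nat \<Rightarrow> laurent_tau) \<Rightarrow> nat \<Rightarrow> laurent_tau" where
  "shift_op D \<gamma> x = D x + fsc (tau_const (of_rat \<gamma>)) x"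

text \<open>What \<open>is_KM_filtration\<close> says about the images of the steps under a chart.
  Freeness enters as finite generation over \<open>ring_tau\<close>; together with the generation of
  \<open>\<Gamma>\<close> over all Laurent polynomials it makes any two such filtrations
  commensurable.\<close>

definition KM_coord ::
  "((nat \<Rightarrow> laurent_tau) \<Rightarrow> nat \<Rightarrow> laurent_tau) \<Rightarrow> (nat \<Rightarrow> laurent_tau) set \<Rightarrow> (rat \<Rightarrow> (nat \<Rightarrow> laurent_tau) set) \<Rightarrow> bool" where
  "KM_coord D \<Gamma> V \<longleftrightarrow>
     (\<forall>\<alpha> \<beta>. \<alpha> \<le> \<beta> \<longrightarrow> V \<alpha> \<subseteq> V \<beta>) \<and>
     (\<exists>r::nat. 0 < r \<and> (\<forall>\<alpha>. V \<alpha> = V (of_int \<lfloor>of_nat r * \<alpha>\<rfloor> / of_nat r))) \<and>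
     (\<forall>\<alpha>. V \<alpha> \<subseteq> \<Gamma> \<and> 0 \<in> V \<alpha> \<and> (\<forall>x\<in>V \<alpha>. \<forall>y\<in>V \<alpha>. x + y \<in> V \<alpha>) \<and>
        (\<forall>a\<in>carrier ring_tau. \<forall>x\<in>V \<alpha>. fsc a x \<in> V \<alpha>)) \<and>
     (\<forall>\<alpha>. \<exists>S. finite S \<and> S \<subseteq> V \<alpha> \<and>
        (\<forall>x\<in>V \<alpha>. \<exists>a. (\<forall>s\<in>S. a s \<in> carrier ring_tau) \<and> x = (\<Sum>s\<in>S. fsc (a s) s))) \<and>
     (\<forall>\<alpha>. \<forall>x\<in>\<Gamma>. \<exists>A a. finite A \<and> A \<subseteq> V \<alpha> \<and> x = (\<Sum>s\<in>A. fsc (a s) s)) \<and>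
     (\<forall>\<alpha>. D ` V \<alpha> \<subseteq> V \<alpha>) \<and>
     (\<forall>\<alpha>. fsc (tau_pow 1) ` V \<alpha> = V (\<alpha> - 1)) \<and>
     (\<forall>\<alpha>. \<exists>m. \<forall>x\<in>V \<alpha>. (shift_op D \<alpha> ^^ m) x \<in> below V \<alpha>)"

lemma KM_coordD:
  assumes "KM_coord D \<Gamma> V"
  shows "\<And>\<alpha> \<beta>. \<alpha> \<le> \<beta> \<Longrightarrow> V \<alpha> \<subseteq> V \<beta>"
    "\<exists>r::nat. 0 < r \<and> (\<forall>\<alpha>. V \<alpha> = V (of_int \<lfloor>of_nat r * \<alpha>\<rfloor> / of_nat r))"
    "\<And>\<alpha>. V \<alpha> \<subseteq> \<Gamma>" "\<And>\<alpha>. 0 \<in> V \<alpha>" "\<And>\<alpha> x y. x \<in> V \<alpha> \<Longrightarrow> y \<in> V \<alpha> \<Longrightarrow> x + y \<in> V \<alpha>"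
    "\<And>\<alpha> a x. a \<in> carrier ring_tau \<Longrightarrow> x \<in> V \<alpha> \<Longrightarrow> fsc a x \<in> V \<alpha>"
    "\<And>\<alpha>. \<exists>S. finite S \<and> S \<subseteq> V \<alpha> \<and>
        (\<forall>x\<in>V \<alpha>. \<exists>a. (\<forall>s\<in>S. a s \<in> carrier ring_tau) \<and> x = (\<Sum>s\<in>S. fsc (a s) s))"
    "\<And>\<alpha> x. x \<in> \<Gamma> \<Longrightarrow> \<exists>A a. finite A \<and> A \<subseteq> V \<alpha> \<and> x = (\<Sum>s\<in>A. fsc (a s) s)"
    "\<And>\<alpha> x. x \<in> V \<alpha> \<Longrightarrow> D x \<in> V \<alpha>"
    "\<And>\<alpha>. fsc (tau_pow 1) ` V \<alpha> = V (\<alpha> - 1)"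
    "\<And>\<alpha>. \<exists>m. \<forall>x\<in>V \<alpha>. (shift_op D \<alpha> ^^ m) x \<in> below V \<alpha>"
  using assms unfolding KM_coord_def by (auto simp: image_subset_iff)

text \<open>Steps change only at multiples of 1/r, so the union of all earlier steps is the step
  just before.\<close>

lemma KM_coord_below:
  fixes r :: nat
  assumes "KM_coord D \<Gamma> V" "0 < r" "\<And>\<alpha>. V \<alpha> = V (of_int \<lfloor>of_nat r * \<alpha>\<rfloor> / of_nat r)"
  shows "below V (of_int i / of_nat r) = V (of_int (i - 1) / of_nat r)"
proof
  show "below V (of_int i / of_nat r) \<subseteq> V (of_int (i - 1) / of_nat r)"
  proof
    fix x assume "x \<in> below V (of_int i / of_nat r)"
    then obtain \<beta> where \<beta>: "\<beta> < of_int i / of_nat r" "x \<in> V \<beta>" unfolding below_def by auto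
    then have "of_nat r * \<beta> < of_int i" using assms(2) by (simp add: field_simps)
    then have "\<lfloor>of_nat r * \<beta>\<rfloor> \<le> i - 1" by linarith
    then have "(of_int \<lfloor>of_nat r * \<beta>\<rfloor> :: rat) / of_nat r \<le> of_int (i - 1) / of_nat r"
      by (intro divide_right_mono) (auto simp del: of_int_diff)
    then show "x \<in> V (of_int (i - 1) / of_nat r)"
      using KM_coordD(1)[OF assms(1)] \<beta>(2) assms(3) by blast
  qed
  have "of_int (i - 1) / of_nat r < (of_int i / of_nat r :: rat)"
    using assms(2) by (intro divide_strict_right_mono) auto
  then show "V (of_int (i - 1) / of_nat r) \<subseteq> below V (of_int i / of_nat r)" unfolding below_def by blast
qed

text \<open>Lets \<open>below V \<alpha>\<close> be handled as a single step, hence as a submodule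
  stable under \<open>D\<close>. The index is the largest multiple of 1/r strictly below
  \<open>\<alpha>\<close>.\<close>

lemma KM_coord_below_eq:
  assumes "KM_coord D \<Gamma> V"
  shows "\<exists>\<alpha>'<\<alpha>. below V \<alpha> = V \<alpha>'"
proof -
  obtain r :: nat where r: "0 < r" "\<And>\<alpha>. V \<alpha> = V (of_int \<lfloor>of_nat r * \<alpha>\<rfloor> / of_nat r)"
    using KM_coordD(2)[OF assms] by blast
  define i where "i = \<lceil>of_nat r * \<alpha>\<rceil>"
  have "of_int (i - 1) < of_nat r * \<alpha>" unfolding i_def by linarith
  then have lt: "of_int (i - 1) / of_nat r < \<alpha>" using r(1) by (simp add: field_simps)
  have "of_nat r * \<alpha> \<le> of_int i" unfolding i_def by linarith
  then have "\<alpha> \<le> of_int i / of_nat r" using r(1) by (simp add: field_simps)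
  then have "below V \<alpha> \<subseteq> below V (of_int i / of_nat r)" unfolding below_def by fastforce
  also have "\<dots> = V (of_int (i - 1) / of_nat r)" by (rule KM_coord_below[OF assms r])
  finally have "below V \<alpha> = V (of_int (i - 1) / of_nat r)" using lt unfolding below_def by blast
  then show ?thesis using lt by blast
qed

lemma KM_coord_shift:
  assumes "KM_coord D \<Gamma> V"
  shows "fsc (tau_pow (int k)) ` V \<alpha> = V (\<alpha> - of_nat k)"
proof (induction k)
  case (Suc k)
  have "fsc (tau_pow (int (Suc k))) ` V \<alpha> = fsc (tau_pow 1) ` fsc (tau_pow (int k)) ` V \<alpha>"
    by (simp add: image_image tau_pow_mult)
  then show ?case using Suc KM_coordD(10)[OF assms, of "\<alpha> - of_nat k"] by (simp add: algebra_simps)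
qed (simp add: image_def)

lemma tau_pow_mult_ring_tau: "\<exists>k. \<forall>k'\<ge>k. tau_pow (int k') * a \<in> carrier ring_tau"
proof -
  define b where "b = (\<Sum>i\<in>Poly_Mapping.keys a. nat (- i))"
  have b: "- i \<le> int b" if "i \<in> Poly_Mapping.keys a" for i
  proof -
    have "nat (- i) \<le> b" unfolding b_def using that by (intro member_le_sum) auto
    then show ?thesis by linarith
  qed
  have "tau_pow (int k') * a \<in> carrier ring_tau" if "b \<le> k'" for k'
  proof -
    have "0 \<le> i" if "lk (tau_pow (int k') * a) i \<noteq> 0" for i
      using that b[of "i - int k'"] \<open>b \<le> k'\<close> by (simp add: in_keys_iff)
    then show ?thesis by (auto simp: tau_ring_def in_keys_iff)
  qed
  then show ?thesis by blast
qed

lemma KM_coord_sum: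
  assumes "KM_coord D \<Gamma> V" "\<And>s. s \<in> S \<Longrightarrow> f s \<in> V \<alpha>"
  shows "(\<Sum>s\<in>S. f s) \<in> V \<alpha>"
  using assms(2) by (induction S rule: infinite_finite_induct) (auto intro: KM_coordD[OF assms(1)])

text \<open>Write \<open>x\<close> as a combination of elements of \<open>V 0\<close> with Laurent
  coefficients: a power tau^K clears their negative exponents, and tau^K maps the step with index K
  onto \<open>V 0\<close>.\<close>

lemma KM_coord_exhaust:
  assumes V: "KM_coord D \<Gamma> V" and x: "x \<in> \<Gamma>"
  shows "\<exists>k::nat. x \<in> V (of_nat k)"
proof -
  obtain A a where A: "finite A" "A \<subseteq> V 0" "x = (\<Sum>s\<in>A. fsc (a s) s)" using KM_coordD(8)[OF V x] by blast
  have "\<forall>s. \<exists>k. \<forall>k'\<ge>k. tau_pow (int k') * a s \<in> carrier ring_tau"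
    using tau_pow_mult_ring_tau by blast
  from choice[OF this] obtain k where k: "\<forall>s. \<forall>k'\<ge>k s. tau_pow (int k') * a s \<in> carrier ring_tau" by blast
  define K where "K = (\<Sum>s\<in>A. k s)"
  have "tau_pow (int K) * a s \<in> carrier ring_tau" if "s \<in> A" for s
  proof -
    have "k s \<le> K" unfolding K_def using that A(1) by (intro member_le_sum) auto
    then show ?thesis using k by blast
  qed
  moreover have "fsc (tau_pow (int K)) x = (\<Sum>s\<in>A. fsc (tau_pow (int K) * a s) s)"
    unfolding A(3) by (auto simp: fsc_def fun_eq_iff sum_fun_apply sum_distrib_left mult.assoc)
  ultimately have "fsc (tau_pow (int K)) x \<in> V 0"
    using A(2) KM_coordD(6)[OF V] by (auto intro!: KM_coord_sum[OF V])
  also have "V 0 = fsc (tau_pow (int K)) ` V (of_nat K)" using KM_coord_shift[OF V, of K "of_nat K"] by simp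
  finally obtain y where y: "y \<in> V (of_nat K)" "fsc (tau_pow (int K)) x = fsc (tau_pow (int K)) y" by blast
  then have "fsc (tau_pow (- int K)) (fsc (tau_pow (int K)) x) = fsc (tau_pow (- int K)) (fsc (tau_pow (int K)) y)" by simp
  then have "x = y" by (simp add: tau_pow_mult)
  then show ?thesis using y by blast
qed

text \<open>\<open>\<tau>\<partial>\<^sub>\<tau> + \<beta>\<close> is nilpotent on \<open>gr\<^sub>\<beta>\<close>, hence \<open>\<tau>\<partial>\<^sub>\<tau> + \<gamma>\<close> is injective there for \<open>\<gamma> \<noteq> \<beta>\<close>.\<close>

lemma KM_coord_inj:
  assumes V: "KM_coord D \<Gamma> V"
    and D: "\<And>x y. D (x + y) = D x + D y" "\<And>c x. D (fsc (tau_const c) x) = fsc (tau_const c) (D x)"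
    and x: "x \<in> V \<beta>" "shift_op D \<gamma> x \<in> below V \<beta>" "\<gamma> \<noteq> \<beta>"
  shows "x \<in> below V \<beta>"
proof -
  obtain \<beta>' where U: "below V \<beta> = V \<beta>'" using KM_coord_below_eq[OF V] by blast
  note v = KM_coordD[OF V]
  have const: "tau_const c \<in> carrier ring_tau" for c by (auto simp: tau_ring_def tau_const_def)
  have Uc: "fsc (tau_const c) y \<in> V \<beta>'" if "y \<in> V \<beta>'" for c y using v(6) const that by blast
  define e where "e = tau_const (of_rat (\<beta> - \<gamma>))"
  have e: "tau_const (of_rat \<beta>) = tau_const (of_rat \<gamma>) + e" by (simp add: e_def of_rat_diff)
  \<comment> \<open>Modulo \<open>V \<beta>'\<close> the operator for \<open>\<gamma>\<close> kills
    \<open>x\<close>, so the operator for \<open>\<beta>\<close> multiplies \<open>x\<close> by the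
    constant \<open>e\<close>, which is \<open>\<beta> - \<gamma>\<close>. Its nilpotency then puts
    a nonzero multiple of \<open>x\<close> into \<open>V \<beta>'\<close>.\<close>
  have key: "\<exists>u\<in>V \<beta>'. (shift_op D \<beta> ^^ m) x = fsc (e ^ m) x + u" for m
  proof (induction m)
    case 0 then show ?case using v(4) by (intro bexI[of _ 0]) auto
  next
    case (Suc m)
    then obtain u where u: "u \<in> V \<beta>'" "(shift_op D \<beta> ^^ m) x = fsc (e ^ m) x + u" by blast
    have em: "e ^ m = tau_const (of_rat (\<beta> - \<gamma>) ^ m)" unfolding e_def by (induction m) auto
    have Dem: "D (fsc (e ^ m) x) = fsc (e ^ m) (D x)" by (simp only: em D)
    have "(shift_op D \<beta> ^^ Suc m) x = fsc (e ^ Suc m) x + (fsc (e ^ m) (shift_op D \<gamma> x) + (D u + fsc (tau_const (of_rat \<beta>)) u))"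
      unfolding funpow.simps o_apply u(2) shift_op_def D(1) Dem
      by (auto simp: e fsc_def fun_eq_iff algebra_simps)
    moreover have "fsc (e ^ m) (shift_op D \<gamma> x) + (D u + fsc (tau_const (of_rat \<beta>)) u) \<in> V \<beta>'"
      using x(2) u(1) unfolding em U by (intro v(5) Uc v(9))
    ultimately show ?case by blast
  qed
  obtain m where m: "\<forall>x\<in>V \<beta>. (shift_op D \<beta> ^^ m) x \<in> below V \<beta>" using v(11) by blast
  obtain u where u: "u \<in> V \<beta>'" "(shift_op D \<beta> ^^ m) x = fsc (e ^ m) x + u" using key by blast
  then have u: "u \<in> V \<beta>'" "fsc (e ^ m) x + u \<in> V \<beta>'" using m x(1) U by auto
  have em: "e ^ m = tau_const (of_rat (\<beta> - \<gamma>) ^ m)" unfolding e_def by (induction m) auto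
  have "fsc (tau_const (inverse (of_rat (\<beta> - \<gamma>) ^ m))) ((fsc (e ^ m) x + u) + fsc (tau_const (-1)) u) \<in> V \<beta>'"
    using u Uc v(5) by blast
  moreover have "(fsc (e ^ m) x + u) + fsc (tau_const (-1)) u = fsc (e ^ m) x"
    by (simp add: fun_eq_iff fsc_def del: tau_const_simps(5)) (simp add: tau_const_simps(5))
  moreover have "fsc (tau_const (inverse (of_rat (\<beta> - \<gamma>) ^ m))) (fsc (e ^ m) x) = x"
    using x(3) unfolding em fsc_simps tau_const_simps(4)[symmetric] by simp
  ultimately show ?thesis unfolding U by simp
qed

lemma KM_coord_inj_list:
  assumes V: "KM_coord D \<Gamma> V"
    and D: "\<And>x y. D (x + y) = D x + D y" "\<And>c x. D (fsc (tau_const c) x) = fsc (tau_const c) (D x)"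
    and x: "x \<in> V \<beta>" "fold (shift_op D) \<gamma>s x \<in> below V \<beta>" "\<beta> \<notin> set \<gamma>s"
  shows "x \<in> below V \<beta>"
  using x
proof (induction \<gamma>s arbitrary: x)
  case (Cons \<gamma> \<gamma>s)
  note v = KM_coordD[OF V]
  have const: "tau_const c \<in> carrier ring_tau" for c by (auto simp: tau_ring_def tau_const_def)
  have "shift_op D \<gamma> x \<in> V \<beta>" unfolding shift_op_def using Cons.prems(1) const v(5,6,9) by blast
  then have "shift_op D \<gamma> x \<in> below V \<beta>" using Cons by auto
  then show ?case using KM_coord_inj[OF V D] Cons.prems by auto
qed auto

text \<open>A power of the operator that is nilpotent on the current graded piece crosses one gap of
  width 1/r; after r * M gaps the index has dropped by M.\<close>

lemma KM_coord_descend: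
  assumes V: "KM_coord D \<Gamma> V" and x: "x \<in> V \<alpha>"
  shows "\<exists>\<gamma>s. set \<gamma>s \<subseteq> {..\<alpha>} \<and> fold (shift_op D) \<gamma>s x \<in> V (\<alpha> - of_nat M)"
proof -
  note v = KM_coordD[OF V]
  obtain r :: nat where r: "0 < r" "\<And>\<alpha>. V \<alpha> = V (of_int \<lfloor>of_nat r * \<alpha>\<rfloor> / of_nat r)" using v(2) by blast
  define i where "i = \<lfloor>of_nat r * \<alpha>\<rfloor>"
  have "of_int i \<le> of_nat r * \<alpha>" unfolding i_def by linarith
  then have i: "of_int i / of_nat r \<le> \<alpha>" using r(1) by (simp add: field_simps)
  have "\<exists>\<gamma>s. set \<gamma>s \<subseteq> {..of_int i / of_nat r} \<and>
    fold (shift_op D) \<gamma>s x \<in> V (of_int (i - int j) / of_nat r)" for j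
  proof (induction j)
    case 0
    have "x \<in> V (of_int i / of_nat r)" using x r(2) unfolding i_def by blast
    then show ?case by (intro exI[of _ "[]"]) auto
  next
    case (Suc j)
    then obtain \<gamma>s where g: "set \<gamma>s \<subseteq> {..of_int i / of_nat r}"
      "fold (shift_op D) \<gamma>s x \<in> V (of_int (i - int j) / of_nat r)" by blast
    define \<delta> :: rat where "\<delta> = of_int (i - int j) / of_nat r"
    obtain m where "(shift_op D \<delta> ^^ m) (fold (shift_op D) \<gamma>s x) \<in> below V \<delta>" using v(11) g(2) \<delta>_def by blast
    also have "below V \<delta> = V (of_int (i - int (Suc j)) / of_nat r)"
      using KM_coord_below[OF V r, of "i - int j"] unfolding \<delta>_def by (simp add: algebra_simps)
    finally have "fold (shift_op D) (\<gamma>s @ replicate m \<delta>) x \<in> V (of_int (i - int (Suc j)) / of_nat r)"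
      by (simp add: fold_replicate)
    moreover have "\<delta> \<le> of_int i / of_nat r" unfolding \<delta>_def by (intro divide_right_mono) auto
    ultimately show ?case using g(1) by (intro exI[of _ "\<gamma>s @ replicate m \<delta>"]) auto
  qed
  from this[of "r * M"] obtain \<gamma>s where g: "set \<gamma>s \<subseteq> {..of_int i / of_nat r}"
    "fold (shift_op D) \<gamma>s x \<in> V (of_int (i - int (r * M)) / of_nat r)" by blast
  have "of_int (i - int (r * M)) / of_nat r \<le> \<alpha> - of_nat M" using i r(1) by (simp add: field_simps)
  then show ?thesis using g i v(1) by (intro exI[of _ \<gamma>s]) (auto simp: subset_iff intro: order.trans)
qed

text \<open>Since \<open>V1\<close> and \<open>V2\<close> are commensurable, operators \<open>\<tau>\<partial>\<^sub>\<tau> + \<gamma>\<close> with \<open>\<gamma> \<le> \<alpha>\<close> push \<open>V1 \<alpha>\<close> into any given step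
  of \<open>V2\<close>, but they are injective on the graded pieces of \<open>V2\<close> above \<open>\<alpha>\<close>.\<close>

lemma KM_coord_mono:
  assumes V1: "KM_coord D \<Gamma> V1" and V2: "KM_coord D \<Gamma> V2"
    and D: "\<And>x y. D (x + y) = D x + D y" "\<And>c x. D (fsc (tau_const c) x) = fsc (tau_const c) (D x)"
  shows "V1 \<alpha> \<subseteq> V2 \<alpha>"
proof -
  note v1 = KM_coordD[OF V1] and v2 = KM_coordD[OF V2]
  obtain r :: nat where r: "0 < r" "\<And>\<alpha>. V2 \<alpha> = V2 (of_int \<lfloor>of_nat r * \<alpha>\<rfloor> / of_nat r)" using v2(2) by blast
  obtain S where S: "finite S" "S \<subseteq> V1 \<alpha>"
    "\<forall>x\<in>V1 \<alpha>. \<exists>a. (\<forall>s\<in>S. a s \<in> carrier ring_tau) \<and> x = (\<Sum>s\<in>S. fsc (a s) s)" using v1(7)[of \<alpha>] by (elim exE conjE)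
  have "\<forall>s\<in>S. \<exists>k::nat. s \<in> V2 (of_nat k)" using KM_coord_exhaust[OF V2] S(2) v1(3) by blast
  then obtain k :: "_ \<Rightarrow> nat" where k: "\<And>s. s \<in> S \<Longrightarrow> s \<in> V2 (of_nat (k s))" by metis
  define K where "K = (\<Sum>s\<in>S. k s)"
  have kK: "of_nat (k s) \<le> (of_nat K :: rat)" if "s \<in> S" for s
    using that S(1) by (simp add: K_def member_le_sum del: of_nat_sum)
  have SK: "s \<in> V2 (of_nat K)" if "s \<in> S" for s using that k[OF that] v2(1)[OF kK[OF that]] by blast
  have sub: "V1 \<alpha> \<subseteq> V2 (of_nat K)"
  proof
    fix x assume "x \<in> V1 \<alpha>"
    then obtain a where a: "\<forall>s\<in>S. a s \<in> carrier ring_tau" "x = (\<Sum>s\<in>S. fsc (a s) s)" using S(3) by blast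
    show "x \<in> V2 (of_nat K)" unfolding a(2) using a(1) SK by (intro KM_coord_sum[OF V2] v2(6)) auto
  qed
  \<comment> \<open>The index of \<open>V2\<close> can be lowered as long as it exceeds
    \<open>\<alpha>\<close>: then it differs from every member of \<open>\<gamma>s\<close>, so the
    operators that carry \<open>x\<close> far down are injective on this graded piece of
    \<open>V2\<close>.\<close>
  have down: "V1 \<alpha> \<subseteq> V2 (of_int (i - 1) / of_nat r)"
    if i: "\<alpha> < of_int i / of_nat r" and P: "V1 \<alpha> \<subseteq> V2 (of_int i / of_nat r)" for i
  proof
    fix x assume x: "x \<in> V1 \<alpha>"
    \<comment> \<open>\<open>M\<close> is so large that lowering the crude bound \<open>K\<close> by
      \<open>M\<close> already falls below the step at i/r.\<close>
    obtain M :: nat where M: "of_nat K - of_int (i - 1) / of_nat r \<le> (of_nat M :: rat)" by (meson real_arch_simple)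
    have "V1 (\<alpha> - of_nat M) \<subseteq> V2 (of_nat K - of_nat M)"
      using sub unfolding KM_coord_shift[OF V1, symmetric] KM_coord_shift[OF V2, symmetric] by blast
    also have "\<dots> \<subseteq> V2 (of_int (i - 1) / of_nat r)" using M by (intro v2(1)) (simp add: algebra_simps)
    finally have "V1 (\<alpha> - of_nat M) \<subseteq> below V2 (of_int i / of_nat r)" using KM_coord_below[OF V2 r] by simp
    moreover obtain \<gamma>s where "set \<gamma>s \<subseteq> {..\<alpha>}" "fold (shift_op D) \<gamma>s x \<in> V1 (\<alpha> - of_nat M)"
      using KM_coord_descend[OF V1 x, of M] by (elim exE conjE)
    ultimately have f: "fold (shift_op D) \<gamma>s x \<in> below V2 (of_int i / of_nat r)" "of_int i / of_nat r \<notin> set \<gamma>s"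
      using i by auto
    have "x \<in> below V2 (of_int i / of_nat r)"
      by (rule KM_coord_inj_list[OF V2 D _ f]) (use P x in blast)+
    then show "x \<in> V2 (of_int (i - 1) / of_nat r)" using KM_coord_below[OF V2 r] by simp
  qed
  define f where "f = \<lfloor>of_nat r * \<alpha>\<rfloor>"
  have V2f: "V2 \<alpha> = V2 (of_int f / of_nat r)" using r(2) unfolding f_def by blast
  show ?thesis
  proof (cases "of_nat K \<le> \<alpha>")
    case True then show ?thesis using sub v2(1) by blast
  next
    case False
    have top: "V1 \<alpha> \<subseteq> V2 (of_int (int (K * r)) / of_nat r)" using sub r(1) by simp
    have fK: "f \<le> int (K * r)"
    proof -
      have "of_nat r * \<alpha> \<le> of_int (int (K * r))" using False r(1) by simp
      then show ?thesis unfolding f_def by linarith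
    qed
    \<comment> \<open>Descending induction from the crude bound K = K r / r down to
      \<open>f\<close>, the last index for which i/r is not above \<open>\<alpha>\<close>.\<close>
    have "f \<le> i \<Longrightarrow> V1 \<alpha> \<subseteq> V2 (of_int i / of_nat r)" if "i \<le> int (K * r)" for i
      using that
    proof (induction i rule: int_le_induct)
      case (step i)
      have "\<not> of_nat r * \<alpha> \<ge> of_int i" using step unfolding f_def by linarith
      then have "\<alpha> < of_int i / of_nat r" using r(1) by (simp add: field_simps)
      then show ?case using step down by simp
    qed (use top in simp)
    then have "V1 \<alpha> \<subseteq> V2 (of_int f / of_nat r)" using fK by blast
    then show ?thesis using V2f by simp
  qed
qed

lemma KM_coord_unique:
  assumes V1: "KM_coord D \<Gamma> V1" and V2: "KM_coord D \<Gamma> V2"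
    and D: "\<And>x y. D (x + y) = D x + D y" "\<And>c x. D (fsc (tau_const c) x) = fsc (tau_const c) (D x)"
  shows "V1 = V2"
proof
  fix \<alpha> show "V1 \<alpha> = V2 \<alpha>" using KM_coord_mono[OF V1 V2 D] KM_coord_mono[OF V2 V1 D] by blast
qed

section \<open>The weight filtration in a Jordan basis\<close>

text \<open>The counterpart of \<open>is_weight_filtration\<close> without cosets: the bijection
  that the j-th power of \<open>N\<close> induces between the graded pieces at c + j and c - j is
  split into its injective and its surjective half.\<close>

definition WF_coord ::
  "((nat \<Rightarrow> laurent_tau) \<Rightarrow> nat \<Rightarrow> laurent_tau) \<Rightarrow> (nat \<Rightarrow> laurent_tau) set \<Rightarrow> int \<Rightarrow> (int \<Rightarrow> (nat \<Rightarrow> laurent_tau) set) \<Rightarrow> bool" where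
  "WF_coord N \<Gamma> c W \<longleftrightarrow>
     (\<forall>k. W k \<subseteq> \<Gamma> \<and> 0 \<in> W k \<and> (\<forall>x\<in>W k. \<forall>y\<in>W k. x + y \<in> W k) \<and>
        (\<forall>a\<in>carrier field_const. \<forall>x\<in>W k. fsc a x \<in> W k)) \<and>
     (\<forall>k. W k \<subseteq> W (k + 1)) \<and> (\<exists>k. W k = {0}) \<and> (\<exists>k. W k = \<Gamma>) \<and>
     (\<forall>k. N ` W k \<subseteq> W (k - 2)) \<and>
     (\<forall>j::nat. (\<forall>x\<in>W (c + int j). (N ^^ j) x \<in> W (c - int j - 1) \<longrightarrow> x \<in> W (c + int j - 1)) \<and>
        (\<forall>y\<in>W (c - int j). \<exists>x\<in>W (c + int j). y - (N ^^ j) x \<in> W (c - int j - 1)))"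

lemma WF_coordD:
  assumes "WF_coord N \<Gamma> c W"
  shows "\<And>k. W k \<subseteq> \<Gamma>" "\<And>k. 0 \<in> W k" "\<And>k x y. x \<in> W k \<Longrightarrow> y \<in> W k \<Longrightarrow> x + y \<in> W k"
    "\<And>k a x. a \<in> carrier field_const \<Longrightarrow> x \<in> W k \<Longrightarrow> fsc a x \<in> W k"
    "\<And>k. W k \<subseteq> W (k + 1)" "\<exists>k. W k = {0}" "\<exists>k. W k = \<Gamma>"
    "\<And>k x. x \<in> W k \<Longrightarrow> N x \<in> W (k - 2)"
    "\<And>j x. x \<in> W (c + int j) \<Longrightarrow> (N ^^ j) x \<in> W (c - int j - 1) \<Longrightarrow> x \<in> W (c + int j - 1)"
    "\<And>j y. y \<in> W (c - int j) \<Longrightarrow> \<exists>x\<in>W (c + int j). y - (N ^^ j) x \<in> W (c - int j - 1)"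
  using assms unfolding WF_coord_def by (auto simp: image_subset_iff)

lemma WF_coord_mono:
  assumes "WF_coord N \<Gamma> c W" "k \<le> l"
  shows "W k \<subseteq> W l"
  using assms(2)
proof (induction l rule: int_ge_induct)
  case (step l) then show ?case using WF_coordD(5)[OF assms(1), of l] by blast
qed simp

lemma WF_coord_pow:
  assumes "WF_coord N \<Gamma> c W" "x \<in> W k"
  shows "(N ^^ j) x \<in> W (k - 2 * int j)"
proof (induction j)
  case (Suc j)
  then show ?case using WF_coordD(8)[OF assms(1) Suc] by (simp add: algebra_simps)
qed (use assms in simp)

text \<open>Successive approximation: for each s, surjectivity of the (l + s)-th power of
  \<open>N\<close> onto the graded piece at c - l - s corrects the preimage and lowers the error by
  one step, until the filtration is zero.\<close>

lemma WF_coord_image: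
  assumes W: "WF_coord N \<Gamma> c W" and N: "\<And>x y. N (x + y) = N x + N y"
    and \<Gamma>: "\<And>x y. x \<in> \<Gamma> \<Longrightarrow> y \<in> \<Gamma> \<Longrightarrow> x + y \<in> \<Gamma>" "\<And>x. x \<in> \<Gamma> \<Longrightarrow> N x \<in> \<Gamma>"
    and y: "y \<in> W (c - int l)"
  shows "y \<in> (N ^^ l) ` \<Gamma>"
proof -
  note w = WF_coordD[OF W]
  have Npow: "(N ^^ j) (x + y) = (N ^^ j) x + (N ^^ j) y" for j x y
    by (induction j) (simp_all only: funpow.simps o_apply id_apply N)
  have pow\<Gamma>: "(N ^^ j) x \<in> \<Gamma>" if "x \<in> \<Gamma>" for j x using that by (induction j) (auto intro: \<Gamma>)
  obtain k0 where k0: "W k0 = {0}" using w(6) by blast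
  have "\<exists>x\<in>\<Gamma>. y - (N ^^ l) x \<in> W (c - int l - int s)" for s
  proof (induction s)
    case 0
    have "N 0 = 0" using N[of 0 0] by simp
    then have "(N ^^ l) 0 = 0" by (induction l) (simp_all only: funpow.simps o_apply id_apply)
    moreover have "0 \<in> \<Gamma>" using w(1,2) by blast
    moreover have "y - (N ^^ l) 0 = y" using calculation(1) by (simp only: diff_zero)
    moreover have "c - int l - int 0 = c - int l" by simp
    ultimately show ?case using y by metis
  next
    case (Suc s)
    moreover have "c - int l - int s = c - int (l + s)" by simp
    ultimately obtain x where x: "x \<in> \<Gamma>" "y - (N ^^ l) x \<in> W (c - int (l + s))" by metis
    obtain x' where x': "x' \<in> W (c + int (l + s))"
      "y - (N ^^ l) x - (N ^^ (l + s)) x' \<in> W (c - int (l + s) - 1)" using w(10)[OF x(2)] by blast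
    have "y - (N ^^ l) (x + (N ^^ s) x') = y - (N ^^ l) x - (N ^^ (l + s)) x'"
      by (simp only: Npow funpow_add o_apply diff_diff_eq)
    moreover have "x + (N ^^ s) x' \<in> \<Gamma>" using x x' w(1) by (intro \<Gamma>(1) pow\<Gamma>) auto
    moreover have "c - int (l + s) - 1 = c - int l - int (Suc s)" by simp
    ultimately show ?case using x'(2) by metis
  qed
  from this[of "nat (c - int l - k0)"] obtain x where x: "x \<in> \<Gamma>"
    "y - (N ^^ l) x \<in> W (c - int l - int (nat (c - int l - k0)))" by blast
  have "y - (N ^^ l) x \<in> W k0"
    by (rule subsetD[OF WF_coord_mono[OF W] x(2)]) linarith
  then have "y = (N ^^ l) x" using k0 by simp
  then show ?thesis using x(1) by blast
qed

text \<open>Dual to \<open>WF_coord_image\<close>: start at the top step. All powers beyond the l-th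
  kill \<open>y\<close>, so injectivity on the graded pieces lowers its step one at a time down to c
  + l.\<close>

lemma WF_coord_kernel:
  assumes W: "WF_coord N \<Gamma> c W" and N0: "N 0 = 0" and y: "y \<in> \<Gamma>" "(N ^^ Suc l) y = 0"
  shows "y \<in> W (c + int l)"
proof -
  note w = WF_coordD[OF W]
  obtain k1 where k1: "W k1 = \<Gamma>" using w(7) by blast
  have pow0: "(N ^^ j) 0 = 0" for j by (induction j) (simp_all only: funpow.simps o_apply id_apply N0)
  have "y \<in> W (c + int l + int s) \<Longrightarrow> y \<in> W (c + int l)" for s
  proof (induction s)
    case (Suc s)
    have "l + Suc s = s + Suc l" by simp
    then have "(N ^^ (l + Suc s)) y = (N ^^ s) ((N ^^ Suc l) y)" by (simp only: funpow_add o_apply)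
    then have "(N ^^ (l + Suc s)) y = 0" using y(2) pow0 by simp
    then have "y \<in> W (c + int (l + Suc s) - 1)" using Suc.prems w(2) by (intro w(9)) (auto simp: algebra_simps)
    then show ?case using Suc.IH by (simp add: algebra_simps)
  qed simp
  moreover have "y \<in> W (c + int l + int (nat (k1 - c - int l)))"
    using y(1) k1 WF_coord_mono[OF W, of k1 "c + int l + int (nat (k1 - c - int l))"] by fastforce
  ultimately show ?thesis by blast
qed

lemma down_closed_card:
  assumes "\<And>i j. i \<le> j \<Longrightarrow> j < (n::nat) \<Longrightarrow> P j \<Longrightarrow> P i"
  shows "{i. i < n \<and> P i} = {..<card {i. i < n \<and> P i}}"
  using assms
proof (induction n)
  case (Suc n)
  show ?case
  proof (cases "P n")
    case True
    then have "{i. i < Suc n \<and> P i} = {..<Suc n}" using Suc.prems by (auto simp: less_Suc_eq_le)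
    then show ?thesis by simp
  next
    case False
    then have "{i. i < Suc n \<and> P i} = {i. i < n \<and> P i}" by (auto simp: less_Suc_eq)
    then show ?thesis using Suc by auto
  qed
qed auto

section \<open>Jordan blocks and the weights on them\<close>

definition jspace :: "nat \<Rightarrow> (nat \<Rightarrow> laurent_tau) set" where
  "jspace n = {x. (\<forall>k. k \<notin> {..<n} \<longrightarrow> x k = 0) \<and> (\<forall>k. x k \<in> carrier field_const)}"

text \<open>On basis vectors this moves \<open>k\<close> to \<open>k + 1\<close> inside a block of
  equal \<open>\<alpha>\<close> and kills the last vector of the block; on coordinates it therefore
  reads position \<open>k - 1\<close>. The guard \<open>1 \<le> k\<close> excludes the truncated
  case.\<close>

definition jop :: "nat \<Rightarrow> (nat \<Rightarrow> int) \<Rightarrow> (nat \<Rightarrow> laurent_tau) \<Rightarrow> nat \<Rightarrow> laurent_tau" where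
  "jop n \<alpha> x = (\<lambda>k. if 1 \<le> k \<and> k < n \<and> \<alpha> (k - 1) = \<alpha> k then x (k - 1) else 0)"

definition jfirst :: "nat \<Rightarrow> (nat \<Rightarrow> int) \<Rightarrow> nat \<Rightarrow> nat" where
  "jfirst n \<alpha> k = card {i. i < n \<and> \<alpha> i < \<alpha> k}"

definition jlast :: "nat \<Rightarrow> (nat \<Rightarrow> int) \<Rightarrow> nat \<Rightarrow> nat" where
  "jlast n \<alpha> k = card {i. i < n \<and> \<alpha> i \<le> \<alpha> k}"

text \<open>The basis vectors with equal \<open>\<alpha>\<close> form one Jordan chain, occupying the positions
  \<open>jfirst \<le> k < jlast\<close>, and the weights on a chain of length \<open>d\<close> are \<open>c + d - 1, c + d - 3, \<dots>, c - d + 1\<close>.\<close>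

definition jweight :: "nat \<Rightarrow> (nat \<Rightarrow> int) \<Rightarrow> int \<Rightarrow> nat \<Rightarrow> int" where
  "jweight n \<alpha> c k = c + int (jlast n \<alpha> k) + int (jfirst n \<alpha> k) - 1 - 2 * int k"

definition jfil :: "nat \<Rightarrow> (nat \<Rightarrow> int) \<Rightarrow> int \<Rightarrow> int \<Rightarrow> (nat \<Rightarrow> laurent_tau) set" where
  "jfil n \<alpha> c m = {x \<in> jspace n. \<forall>k. x k \<noteq> 0 \<longrightarrow> jweight n \<alpha> c k \<le> m}"

lemma jspace_closed:
  "0 \<in> jspace n" "x \<in> jspace n \<Longrightarrow> y \<in> jspace n \<Longrightarrow> x + y \<in> jspace n"
  "x \<in> jspace n \<Longrightarrow> - x \<in> jspace n"
  "x \<in> jspace n \<Longrightarrow> y \<in> jspace n \<Longrightarrow> x - y \<in> jspace n"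
  "a \<in> carrier field_const \<Longrightarrow> x \<in> jspace n \<Longrightarrow> fsc a x \<in> jspace n"
  "x \<in> jspace n \<Longrightarrow> jop n \<alpha> x \<in> jspace n"
proof -
  interpret field field_const by (rule field_field_const)
  have o: "(0::laurent_tau) \<in> carrier field_const" "\<And>a b. a \<in> carrier field_const \<Longrightarrow> b \<in> carrier field_const \<Longrightarrow> a + b \<in> carrier field_const"
    "\<And>a b. a \<in> carrier field_const \<Longrightarrow> b \<in> carrier field_const \<Longrightarrow> a * b \<in> carrier field_const"
    using zero_closed a_closed m_closed by (auto simp: tau_ring_def)
  have m: "\<And>a. a \<in> carrier field_const \<Longrightarrow> - a \<in> carrier field_const" by (auto simp: tau_ring_def keys_minus)
  show "0 \<in> jspace n" "x \<in> jspace n \<Longrightarrow> y \<in> jspace n \<Longrightarrow> x + y \<in> jspace n"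
    "x \<in> jspace n \<Longrightarrow> - x \<in> jspace n"
    "a \<in> carrier field_const \<Longrightarrow> x \<in> jspace n \<Longrightarrow> fsc a x \<in> jspace n"
    "x \<in> jspace n \<Longrightarrow> jop n \<alpha> x \<in> jspace n"
    by (auto simp: jspace_def o m fsc_def jop_def)
  show "x \<in> jspace n \<Longrightarrow> y \<in> jspace n \<Longrightarrow> x - y \<in> jspace n"
    using o(2) m by (auto simp: jspace_def) (metis add_uminus_conv_diff)
qed

lemma jop_linear: "jop n \<alpha> (x + y) = jop n \<alpha> x + jop n \<alpha> y" "jop n \<alpha> (fsc a x) = fsc a (jop n \<alpha> x)" "jop n \<alpha> 0 = 0"
  by (auto simp: jop_def fun_eq_iff fsc_def)

context
  fixes n :: nat and \<alpha> :: "nat \<Rightarrow> int" and c :: int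
  assumes mono: "\<And>i j. i \<le> j \<Longrightarrow> j < n \<Longrightarrow> \<alpha> i \<le> \<alpha> j"
begin

lemma less_jfirst: "i < n \<Longrightarrow> i < jfirst n \<alpha> k \<longleftrightarrow> \<alpha> i < \<alpha> k"
  and jfirst_le_n: "jfirst n \<alpha> k \<le> n"
proof -
  have "{i. i < n \<and> \<alpha> i < \<alpha> k} = {..<jfirst n \<alpha> k}"
    unfolding jfirst_def using mono by (intro down_closed_card) (metis order.strict_trans1)
  then show "i < n \<Longrightarrow> i < jfirst n \<alpha> k \<longleftrightarrow> \<alpha> i < \<alpha> k" by blast
  have "card {i. i < n \<and> \<alpha> i < \<alpha> k} \<le> card {..<n}" by (rule card_mono) auto
  then show "jfirst n \<alpha> k \<le> n" unfolding jfirst_def by simp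
qed

lemma less_jlast: "i < n \<Longrightarrow> i < jlast n \<alpha> k \<longleftrightarrow> \<alpha> i \<le> \<alpha> k"
  and jlast_le_n: "jlast n \<alpha> k \<le> n"
proof -
  have "{i. i < n \<and> \<alpha> i \<le> \<alpha> k} = {..<jlast n \<alpha> k}"
    unfolding jlast_def using mono by (intro down_closed_card) (metis order.trans)
  then show "i < n \<Longrightarrow> i < jlast n \<alpha> k \<longleftrightarrow> \<alpha> i \<le> \<alpha> k" by blast
  have "card {i. i < n \<and> \<alpha> i \<le> \<alpha> k} \<le> card {..<n}" by (rule card_mono) auto
  then show "jlast n \<alpha> k \<le> n" unfolding jlast_def by simp
qed

lemma jchain_iff:
  assumes "k < n"
  shows "i < n \<and> \<alpha> i = \<alpha> k \<longleftrightarrow> jfirst n \<alpha> k \<le> i \<and> i < jlast n \<alpha> k"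
  using less_jfirst[of i k] less_jlast[of i k] jlast_le_n[of k] by (cases "i < n") auto

lemma jchain_self: "k < n \<Longrightarrow> jfirst n \<alpha> k \<le> k \<and> k < jlast n \<alpha> k"
  using jchain_iff[of k k] by simp

lemma jweight_chain:
  assumes "\<alpha> i = \<alpha> k"
  shows "jweight n \<alpha> c i = jweight n \<alpha> c k + 2 * int k - 2 * int i"
  using assms by (simp add: jweight_def jfirst_def jlast_def)

text \<open>For nondecreasing \<open>\<alpha>\<close>, equality at the two ends of a stretch forces
  equality throughout, so one condition describes all j steps.\<close>

lemma jop_pow:
  assumes "x \<in> jspace n"
  shows "(jop n \<alpha> ^^ j) x k = (if j \<le> k \<and> k < n \<and> \<alpha> (k - j) = \<alpha> k then x (k - j) else 0)"
proof (induction j arbitrary: k)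
  case 0 then show ?case using assms by (auto simp: jspace_def)
next
  case (Suc j)
  have "\<alpha> (k - 1) = \<alpha> k" if "Suc j \<le> k" "k < n" "\<alpha> (k - Suc j) = \<alpha> k"
    using mono[of "k - Suc j" "k - 1"] mono[of "k - 1" k] that by simp
  moreover have "(jop n \<alpha> ^^ Suc j) x k =
    (if 1 \<le> k \<and> k < n \<and> \<alpha> (k - 1) = \<alpha> k then (jop n \<alpha> ^^ j) x (k - 1) else 0)"
    by (simp only: funpow.simps o_apply) (simp only: jop_def)
  ultimately show ?case by (auto simp: Suc)
qed

text \<open>Images of powers of the operator bound every step from above
  (\<open>WF_coord_image\<close>), kernels bound it from below (\<open>WF_coord_kernel\<close>), and
  in a Jordan basis the two bounds meet.\<close>

lemma jfil_unique:
  assumes W: "WF_coord (jop n \<alpha>) (jspace n) c W"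
  shows "W m = jfil n \<alpha> c m"
proof
  note w = WF_coordD[OF W]
  show "W m \<subseteq> jfil n \<alpha> c m"
  proof
    fix x assume x: "x \<in> W m"
    have xj: "x \<in> jspace n" using x w(1) by blast
    have "jweight n \<alpha> c k \<le> m" if k: "x k \<noteq> 0" for k
    proof (rule ccontr)
      assume neg: "\<not> jweight n \<alpha> c k \<le> m"
      have kn: "k < n" using k xj by (auto simp: jspace_def)
      define f l where "f = jfirst n \<alpha> k" and "l = jlast n \<alpha> k"
      have fl: "f \<le> k" "k < l" "l \<le> n" using jchain_self[OF kn] jlast_le_n by (auto simp: f_def l_def)
      define j where "j = l - 1 - k"
      \<comment> \<open>Pushing position \<open>k\<close> to the end of its block takes
        \<open>j\<close> steps and lands in \<open>W (c - L)\<close>. That the weight of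
        \<open>k\<close> exceeds \<open>m\<close> means exactly that \<open>L\<close> is at least
        the block length, and then the L-th power reaches no entry at the end of the block.\<close>
      define L where "L = nat (c + 2 * int j - m)"
      have L: "int L = c + 2 * int j - m" "int l - int f \<le> int L"
        using neg fl unfolding L_def j_def jweight_def f_def[symmetric] l_def[symmetric] by auto
      have "(jop n \<alpha> ^^ j) x \<in> W (m - 2 * int j)" by (rule WF_coord_pow[OF W x])
      also have "m - 2 * int j = c - int L" using L by simp
      finally have "(jop n \<alpha> ^^ j) x \<in> (jop n \<alpha> ^^ L) ` jspace n"
        by (intro WF_coord_image[OF W]) (auto intro: jspace_closed jop_linear)
      then obtain y where y: "y \<in> jspace n" "(jop n \<alpha> ^^ j) x = (jop n \<alpha> ^^ L) y" by blast
      have al: "\<alpha> (l - 1) = \<alpha> k" using jchain_iff[OF kn, of "l - 1"] fl by (auto simp: f_def l_def)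
      have "(jop n \<alpha> ^^ j) x (l - 1) = x k"
        using fl al unfolding jop_pow[OF xj] j_def by (auto simp: Suc_diff_Suc)
      moreover have "(jop n \<alpha> ^^ L) y (l - 1) = 0"
      proof -
        have "\<alpha> (l - 1 - L) \<noteq> \<alpha> k" if "L \<le> l - 1"
          using jchain_iff[OF kn, of "l - 1 - L"] L(2) fl that by (auto simp: f_def l_def)
        then have "\<not> (L \<le> l - 1 \<and> l - 1 < n \<and> \<alpha> (l - 1 - L) = \<alpha> (l - 1))" using al by auto
        then show ?thesis unfolding jop_pow[OF y(1)] by (rule if_not_P)
      qed
      ultimately show False using y(2) k by simp
    qed
    then show "x \<in> jfil n \<alpha> c m" using xj by (simp add: jfil_def)
  qed
  show "jfil n \<alpha> c m \<subseteq> W m"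
  proof
    fix x assume x: "x \<in> jfil n \<alpha> c m"
    then have xj: "x \<in> jspace n" by (simp add: jfil_def)
    define u where "u = (\<lambda>k i. if i = k then x k else 0)"
    have uW: "u k \<in> W m" if kn: "k < n" for k
    proof (cases "x k = 0")
      case True
      then have "u k = 0" by (auto simp: u_def fun_eq_iff)
      then show ?thesis using w(2) by simp
    next
      case False
      define f l where "f = jfirst n \<alpha> k" and "l = jlast n \<alpha> k"
      have fl: "f \<le> k" "k < l" "l \<le> n" using jchain_self[OF kn] jlast_le_n by (auto simp: f_def l_def)
      \<comment> \<open>The first vector of the block, with the coefficient found at
        \<open>k\<close>. It is killed by the power given by the block length, and its image after
        \<open>k - f\<close> steps is the component of \<open>x\<close> at \<open>k\<close>.\<close>
      define b where "b = (\<lambda>i. if i = f then x k else 0)"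
      have b: "b \<in> jspace n" using xj fl jspace_closed(1)[of n] by (auto simp: b_def jspace_def)
      have af: "\<alpha> f = \<alpha> k" using jchain_iff[OF kn, of f] fl by (simp add: f_def l_def)
      have "(jop n \<alpha> ^^ Suc (l - 1 - f)) b = 0"
      proof
        fix i
        have "i - (l - f) \<noteq> f" if "l - f \<le> i" "i < n" "\<alpha> (i - (l - f)) = \<alpha> i"
          using jchain_iff[OF kn, of i] af that fl by (auto simp: f_def l_def)
        moreover have "Suc (l - 1 - f) = l - f" using fl by simp
        ultimately show "(jop n \<alpha> ^^ Suc (l - 1 - f)) b i = 0 i"
          unfolding jop_pow[OF b] by (auto simp: b_def)
      qed
      then have "b \<in> W (c + int (l - 1 - f))" by (intro WF_coord_kernel[OF W jop_linear(3) b])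
      then have "(jop n \<alpha> ^^ (k - f)) b \<in> W (c + int (l - 1 - f) - 2 * int (k - f))" by (rule WF_coord_pow[OF W])
      moreover have "(jop n \<alpha> ^^ (k - f)) b = u k"
      proof
        fix i
        show "(jop n \<alpha> ^^ (k - f)) b i = u k i"
          unfolding jop_pow[OF b] using fl kn af by (auto simp: u_def b_def)
      qed
      moreover have "c + int (l - 1 - f) - 2 * int (k - f) = jweight n \<alpha> c k"
        using fl unfolding jweight_def f_def[symmetric] l_def[symmetric] by simp
      moreover have "W (jweight n \<alpha> c k) \<subseteq> W m" using x False by (intro WF_coord_mono[OF W]) (auto simp: jfil_def)
      ultimately show ?thesis by auto
    qed
    have "(\<Sum>k<m'. u k) \<in> W m" if "m' \<le> n" for m'
      using that
    proof (induction m')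
      case (Suc m')
      then show ?case unfolding sum.lessThan_Suc by (intro w(3) uW) simp_all
    qed (use w(2)[of m] in simp)
    moreover have "(\<Sum>k<n. u k) = x"
      using xj by (auto simp: fun_eq_iff sum_fun_apply u_def jspace_def)
    ultimately show "x \<in> W m" by auto
  qed
qed

text \<open>The weights on a block are symmetric about \<open>c\<close>: if \<open>k\<close> has
  weight c + j, its mirror image in the block is k + j, of weight c - j. So the j-th power matches
  the basis vectors of these two weights.\<close>

lemma jfil_WF: "WF_coord (jop n \<alpha>) (jspace n) c (jfil n \<alpha> c)"
proof -
  have wb: "\<bar>jweight n \<alpha> c k - c\<bar> \<le> 2 * int n + 1" if "k < n" for k
    using that jfirst_le_n[of k] jlast_le_n[of k] unfolding jweight_def by simp
  have js: "x k = 0" if "x \<in> jspace n" "\<not> k < n" for x k using that by (simp add: jspace_def)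
  have 1: "jfil n \<alpha> c m \<subseteq> jspace n \<and> 0 \<in> jfil n \<alpha> c m \<and>
    (\<forall>x\<in>jfil n \<alpha> c m. \<forall>y\<in>jfil n \<alpha> c m. x + y \<in> jfil n \<alpha> c m) \<and>
    (\<forall>a\<in>carrier field_const. \<forall>x\<in>jfil n \<alpha> c m. fsc a x \<in> jfil n \<alpha> c m)" for m
  proof (intro conjI ballI)
    fix x y assume x: "x \<in> jfil n \<alpha> c m" and y: "y \<in> jfil n \<alpha> c m"
    have "x k \<noteq> 0 \<or> y k \<noteq> 0" if "x k + y k \<noteq> 0" for k using that by auto
    then show "x + y \<in> jfil n \<alpha> c m" using x y by (auto simp: jfil_def jspace_closed)
  qed (auto simp: jfil_def jspace_closed fsc_def[symmetric], auto simp: jspace_closed fsc_def)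
  have bot: "jfil n \<alpha> c (c - 2 * int n - 2) = {0}"
  proof -
    have "x = 0" if x: "x \<in> jfil n \<alpha> c (c - 2 * int n - 2)" for x
    proof (rule ccontr)
      assume "x \<noteq> 0"
      then obtain k where k: "x k \<noteq> 0" by (auto simp: fun_eq_iff)
      then have "k < n" using js x by (auto simp: jfil_def)
      then show False using wb[of k] k x by (auto simp: jfil_def)
    qed
    then show ?thesis using 1 by blast
  qed
  have top: "jfil n \<alpha> c (c + 2 * int n + 2) = jspace n"
  proof -
    have "x \<in> jfil n \<alpha> c (c + 2 * int n + 2)" if x: "x \<in> jspace n" for x
    proof -
      have "jweight n \<alpha> c k \<le> c + 2 * int n + 2" if "x k \<noteq> 0" for k
        using wb[of k] js[OF x, of k] that by fastforce
      then show ?thesis using x by (simp add: jfil_def)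
    qed
    then show ?thesis by (auto simp: jfil_def)
  qed
  have low: "jop n \<alpha> x \<in> jfil n \<alpha> c (m - 2)" if x: "x \<in> jfil n \<alpha> c m" for x m
  proof -
    have "jweight n \<alpha> c k \<le> m - 2" if "jop n \<alpha> x k \<noteq> 0" for k
    proof -
      have k: "1 \<le> k" "\<alpha> (k - 1) = \<alpha> k" "x (k - 1) \<noteq> 0" using that by (auto simp: jop_def split: if_splits)
      then show ?thesis using jweight_chain[of "k - 1" k] x by (fastforce simp: jfil_def of_nat_diff)
    qed
    then show ?thesis using x by (simp add: jfil_def jspace_closed)
  qed
  have inj: "x \<in> jfil n \<alpha> c (c + int j - 1)"
    if x: "x \<in> jfil n \<alpha> c (c + int j)" and Nx: "(jop n \<alpha> ^^ j) x \<in> jfil n \<alpha> c (c - int j - 1)" for x j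
  proof -
    have xj: "x \<in> jspace n" using x by (simp add: jfil_def)
    have "jweight n \<alpha> c k \<noteq> c + int j" if k: "x k \<noteq> 0" for k
    proof
      assume wt: "jweight n \<alpha> c k = c + int j"
      have kn: "k < n" using js[OF xj] k by blast
      have "k + j < n \<and> \<alpha> (k + j) = \<alpha> k"
        unfolding jchain_iff[OF kn] using wt jchain_self[OF kn] by (auto simp: jweight_def)
      then have "(jop n \<alpha> ^^ j) x (k + j) \<noteq> 0" "jweight n \<alpha> c (k + j) = c - int j"
        using k wt jweight_chain[of "k + j" k] by (auto simp: jop_pow[OF xj])
      then show False using Nx by (auto simp: jfil_def)
    qed
    then show ?thesis using x by (fastforce simp: jfil_def)
  qed
  have surj: "\<exists>x\<in>jfil n \<alpha> c (c + int j). y - (jop n \<alpha> ^^ j) x \<in> jfil n \<alpha> c (c - int j - 1)"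
    if y: "y \<in> jfil n \<alpha> c (c - int j)" for y j
  proof -
    have yj: "y \<in> jspace n" using y by (simp add: jfil_def)
    \<comment> \<open>The preimage reads the entries of \<open>y\<close> of weight exactly c - j at
      their mirror positions; the other entries of \<open>y\<close> already lie one step
      lower.\<close>
    define x where "x = (\<lambda>k. if k < n \<and> jweight n \<alpha> c k = c + int j then y (k + j) else 0)"
    have xj: "x \<in> jspace n" using yj jspace_closed(1)[of n] by (auto simp: x_def jspace_def)
    have pow: "(jop n \<alpha> ^^ j) x p = (if jweight n \<alpha> c p = c - int j then y p else 0)" for p
    proof (cases "j \<le> p \<and> p < n \<and> \<alpha> (p - j) = \<alpha> p")
      case True
      then have "jweight n \<alpha> c (p - j) = jweight n \<alpha> c p + 2 * int j"
        using jweight_chain[of "p - j" p] by (simp add: of_nat_diff)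
      moreover have "(jop n \<alpha> ^^ j) x p = x (p - j)" using True by (simp add: jop_pow[OF xj])
      ultimately show ?thesis using True by (auto simp: x_def)
    next
      case False
      have "y p = 0" if wt: "jweight n \<alpha> c p = c - int j"
      proof (rule ccontr)
        assume "y p \<noteq> 0"
        then have pn: "p < n" using js[OF yj] by blast
        have "j \<le> p \<and> p - j < n \<and> \<alpha> (p - j) = \<alpha> p"
          unfolding jchain_iff[OF pn] using wt jchain_self[OF pn] by (auto simp: jweight_def)
        then show False using False pn by blast
      qed
      then show ?thesis using False by (auto simp: jop_pow[OF xj])
    qed
    have "y - (jop n \<alpha> ^^ j) x \<in> jspace n"
    proof -
      have "(jop n \<alpha> ^^ i) x \<in> jspace n" for i by (induction i) (auto simp: xj jspace_closed)
      then show ?thesis using yj by (simp add: jspace_closed)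
    qed
    moreover have "jweight n \<alpha> c k \<le> c - int j - 1" if "(y - (jop n \<alpha> ^^ j) x) k \<noteq> 0" for k
    proof -
      have "jweight n \<alpha> c k \<noteq> c - int j" "y k \<noteq> 0" using that by (auto simp: pow split: if_splits)
      then show ?thesis using y by (fastforce simp: jfil_def)
    qed
    ultimately have "y - (jop n \<alpha> ^^ j) x \<in> jfil n \<alpha> c (c - int j - 1)" by (simp add: jfil_def)
    moreover have "x \<in> jfil n \<alpha> c (c + int j)" using xj by (auto simp: jfil_def x_def)
    ultimately show ?thesis by blast
  qed
  show ?thesis
    unfolding WF_coord_def
  proof (intro conjI allI)
    show "jfil n \<alpha> c k \<subseteq> jfil n \<alpha> c (k + 1)" for k by (auto simp: jfil_def)
    show "\<exists>k. jfil n \<alpha> c k = {0}" using bot by blast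
    show "\<exists>k. jfil n \<alpha> c k = jspace n" using top by blast
  qed (use 1 low inj surj in blast)+
qed

end

section \<open>Subgroups, cosets and induced maps in coordinates\<close>

definition subgrp :: "'b::ab_group_add set \<Rightarrow> bool" where
  "subgrp U \<longleftrightarrow> 0 \<in> U \<and> (\<forall>x\<in>U. \<forall>y\<in>U. x - y \<in> U)"

lemma subgrpD:
  assumes "subgrp U"
  shows "0 \<in> U" "x \<in> U \<Longrightarrow> y \<in> U \<Longrightarrow> x - y \<in> U" "x \<in> U \<Longrightarrow> - x \<in> U" "x \<in> U \<Longrightarrow> y \<in> U \<Longrightarrow> x + y \<in> U"
proof -
  show a: "0 \<in> U" and b: "x \<in> U \<Longrightarrow> y \<in> U \<Longrightarrow> x - y \<in> U" for x y using assms by (auto simp: subgrp_def)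
  show c: "x \<in> U \<Longrightarrow> - x \<in> U" for x using b[OF a, of x] by simp
  show "x \<in> U \<Longrightarrow> y \<in> U \<Longrightarrow> x + y \<in> U" using b[of x "-y"] c[of y] by simp
qed

text \<open>Counterpart of \<open>chart_coset\<close> for subobjects that are not given as kernels:
  the steps of an arbitrary candidate for a filtration are known only to be subgroups.\<close>

lemma coset_sub:
  assumes ch: "chart S M sc h" and U: "U \<subseteq> carrier M" "subgrp (h ` U)" and x: "x \<in> carrier M"
  shows "U +>\<^bsub>M\<^esub> x = {y \<in> carrier M. h y - h x \<in> h ` U}"
proof -
  note c = chartD[OF ch]
  show ?thesis
  proof (intro equalityI subsetI)
    fix y assume "y \<in> U +>\<^bsub>M\<^esub> x"
    then obtain u where "u \<in> U" "y = u \<oplus>\<^bsub>M\<^esub> x" by (auto simp: a_r_coset_def')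
    then show "y \<in> {y \<in> carrier M. h y - h x \<in> h ` U}" using U(1) x c(3)[of u x] c(4)[of u x] by auto
  next
    fix y assume "y \<in> {y \<in> carrier M. h y - h x \<in> h ` U}"
    then obtain u where u: "y \<in> carrier M" "u \<in> U" "h y - h x = h u" by auto
    then have uM: "u \<in> carrier M" using U(1) by blast
    have "y = u \<oplus>\<^bsub>M\<^esub> x" using u uM x c(3)[of u x] c(4)[of u x]
      by (intro c(7)) (auto simp: diff_eq_eq)
    then show "y \<in> U +>\<^bsub>M\<^esub> x" using u(2) by (auto simp: a_r_coset_def')
  qed
qed

lemma coset_sub_eq:
  assumes ch: "chart S M sc h" and U: "U \<subseteq> carrier M" "subgrp (h ` U)"
    and x: "x \<in> carrier M" and y: "y \<in> carrier M"
  shows "U +>\<^bsub>M\<^esub> x = U +>\<^bsub>M\<^esub> y \<longleftrightarrow> h x - h y \<in> h ` U"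
proof
  note s = subgrpD[OF U(2)]
  assume "U +>\<^bsub>M\<^esub> x = U +>\<^bsub>M\<^esub> y"
  moreover have "x \<in> U +>\<^bsub>M\<^esub> x" using x s(1) by (simp add: coset_sub[OF ch U x])
  ultimately show "h x - h y \<in> h ` U" by (simp add: coset_sub[OF ch U y])
next
  note s = subgrpD[OF U(2)]
  assume a: "h x - h y \<in> h ` U"
  have "h z - h x \<in> h ` U \<longleftrightarrow> h z - h y \<in> h ` U" for z
    using s(4)[OF _ a, of "h z - h x"] s(2)[OF _ a, of "h z - h y"] by auto
  then show "U +>\<^bsub>M\<^esub> x = U +>\<^bsub>M\<^esub> y" by (simp add: coset_sub[OF ch U x] coset_sub[OF ch U y])
qed

lemma coset_sub_self:
  assumes ch: "chart S M sc h" and U: "U \<subseteq> carrier M" "subgrp (h ` U)" and x: "x \<in> carrier M"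
  shows "U +>\<^bsub>M\<^esub> x = U \<longleftrightarrow> h x \<in> h ` U"
proof -
  note c = chartD[OF ch]
  have "U +>\<^bsub>M\<^esub> \<zero>\<^bsub>M\<^esub> = {y \<in> carrier M. h y \<in> h ` U}"
    using c(1,2) by (simp add: coset_sub[OF ch U])
  also have "\<dots> = U" using U(1) c(7) by (auto simp: subset_iff)
  finally show ?thesis using coset_sub_eq[OF ch U x c(1)] c(2) by simp
qed

lemma chart_mem:
  assumes "chart S M sc h" "V \<subseteq> carrier M" "x \<in> carrier M"
  shows "h x \<in> h ` V \<longleftrightarrow> x \<in> V"
proof
  assume "h x \<in> h ` V"
  then obtain v where v: "v \<in> V" "h x = h v" by blast
  then have "x = v" using assms by (intro chartD(7)[OF assms(1)]) auto
  then show "x \<in> V" using v by simp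
qed simp

lemma carrier_quotient_restrict:
  "carrier (quotient_module (M\<lparr>carrier := V\<rparr>) U) = (\<lambda>x. U +>\<^bsub>M\<^esub> x) ` V"
  by (auto simp: quotient_module_def A_RCOSETS_def' a_r_coset_def')

lemma induced_map_sub:
  assumes ch: "chart S M sc h" and U1: "U1 \<subseteq> carrier M" "subgrp (h ` U1)"
    and U2: "U2 \<subseteq> carrier M" "subgrp (h ` U2)"
    and \<phi>: "\<And>x. x \<in> carrier M \<Longrightarrow> \<phi> x \<in> carrier M" "\<And>x. x \<in> carrier M \<Longrightarrow> h (\<phi> x) = \<phi>' (h x)"
    and \<phi>': "\<And>x y. \<phi>' (x - y) = \<phi>' x - \<phi>' y" "\<And>x. x \<in> h ` U1 \<Longrightarrow> \<phi>' x \<in> h ` U2"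
    and z: "z \<in> carrier M"
  shows "induced_map M U2 \<phi> (U1 +>\<^bsub>M\<^esub> z) = U2 +>\<^bsub>M\<^esub> \<phi> z"
proof -
  have "U2 +>\<^bsub>M\<^esub> \<phi> x = U2 +>\<^bsub>M\<^esub> \<phi> z" if "x \<in> U1 +>\<^bsub>M\<^esub> z" for x
  proof -
    have x: "x \<in> carrier M" "h x - h z \<in> h ` U1" using that by (auto simp: coset_sub[OF ch U1 z])
    have "h (\<phi> x) - h (\<phi> z) \<in> h ` U2" using \<phi>'(2)[OF x(2)] by (simp add: \<phi>'(1) \<phi>(2) x(1) z)
    then show ?thesis using coset_sub_eq[OF ch U2 \<phi>(1)[OF x(1)] \<phi>(1)[OF z]] by simp
  qed
  moreover have "z \<in> U1 +>\<^bsub>M\<^esub> z" using z subgrpD(1)[OF U1(2)] by (simp add: coset_sub[OF ch U1 z])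
  ultimately show ?thesis unfolding induced_map_def by blast
qed

text \<open>Additivity of \<open>\<phi>'\<close> turns equality of image cosets into membership of a
  difference. Applied to powers of \<open>N\<close>, this gives the two halves in
  \<open>WF_coord\<close>.\<close>

lemma bij_betw_induced_map:
  assumes ch: "chart S M sc h" and U1: "U1 \<subseteq> carrier M" "subgrp (h ` U1)"
    and U2: "U2 \<subseteq> carrier M" "subgrp (h ` U2)"
    and V1: "V1 \<subseteq> carrier M" "subgrp (h ` V1)" and V2: "V2 \<subseteq> carrier M"
    and \<phi>: "\<And>x. x \<in> carrier M \<Longrightarrow> \<phi> x \<in> carrier M" "\<And>x. x \<in> carrier M \<Longrightarrow> h (\<phi> x) = \<phi>' (h x)"
    and \<phi>': "\<And>x y. \<phi>' (x - y) = \<phi>' x - \<phi>' y" "\<And>x. x \<in> h ` U1 \<Longrightarrow> \<phi>' x \<in> h ` U2"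
    and \<phi>V: "\<And>x. x \<in> h ` V1 \<Longrightarrow> \<phi>' x \<in> h ` V2"
  shows "bij_betw (induced_map M U2 \<phi>) (carrier (quotient_module (M\<lparr>carrier := V1\<rparr>) U1))
      (carrier (quotient_module (M\<lparr>carrier := V2\<rparr>) U2)) \<longleftrightarrow>
    (\<forall>x\<in>h ` V1. \<phi>' x \<in> h ` U2 \<longrightarrow> x \<in> h ` U1) \<and> (\<forall>y\<in>h ` V2. \<exists>x\<in>h ` V1. y - \<phi>' x \<in> h ` U2)"
    (is "?B \<longleftrightarrow> ?I \<and> ?S")
proof -
  note c = chartD[OF ch]
  note ind = induced_map_sub[OF ch U1 U2 \<phi> \<phi>']
  let ?f = "induced_map M U2 \<phi>"
  have fV: "?f (U1 +>\<^bsub>M\<^esub> x) = U2 +>\<^bsub>M\<^esub> \<phi> x" if "x \<in> V1" for x using ind that V1(1) by blast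
  have \<phi>in: "\<phi> x \<in> V2" if "x \<in> V1" for x
  proof -
    have x: "x \<in> carrier M" using that V1(1) by blast
    have "\<phi>' (h x) \<in> h ` V2" using that by (intro \<phi>V) simp
    then show ?thesis using chart_mem[OF ch V2 \<phi>(1)[OF x]] \<phi>(2)[OF x] by simp
  qed
  have inj: "inj_on ?f ((\<lambda>x. U1 +>\<^bsub>M\<^esub> x) ` V1) \<longleftrightarrow> ?I"
  proof
    assume L: "inj_on ?f ((\<lambda>x. U1 +>\<^bsub>M\<^esub> x) ` V1)"
    show ?I
    proof (intro ballI impI)
      fix x' assume "x' \<in> h ` V1" and im: "\<phi>' x' \<in> h ` U2"
      then obtain x where x: "x \<in> V1" "x' = h x" by blast
      have "0 \<in> h ` V1" by (rule subgrpD(1)[OF V1(2)])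
      then obtain z where z: "z \<in> V1" "h z = 0" by (elim imageE) simp
      have p0: "\<phi>' 0 = 0" using \<phi>'(1)[of 0 0] by simp
      have xM: "x \<in> carrier M" "z \<in> carrier M" using x z V1(1) by auto
      have "h (\<phi> x) - h (\<phi> z) \<in> h ` U2" using im x z by (simp add: \<phi>(2) xM p0)
      then have "?f (U1 +>\<^bsub>M\<^esub> x) = ?f (U1 +>\<^bsub>M\<^esub> z)"
        unfolding fV[OF x(1)] fV[OF z(1)] by (rule coset_sub_eq[OF ch U2 \<phi>(1)[OF xM(1)] \<phi>(1)[OF xM(2)], THEN iffD2])
      then have "U1 +>\<^bsub>M\<^esub> x = U1 +>\<^bsub>M\<^esub> z" using L x z unfolding inj_on_def by blast
      then show "x' \<in> h ` U1" using coset_sub_eq[OF ch U1 xM] x z by simp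
    qed
  next
    assume R: ?I
    show "inj_on ?f ((\<lambda>x. U1 +>\<^bsub>M\<^esub> x) ` V1)"
    proof (rule inj_onI)
      fix X Y assume "X \<in> (\<lambda>x. U1 +>\<^bsub>M\<^esub> x) ` V1" "Y \<in> (\<lambda>x. U1 +>\<^bsub>M\<^esub> x) ` V1" and eq: "?f X = ?f Y"
      then obtain x y where xy: "x \<in> V1" "X = U1 +>\<^bsub>M\<^esub> x" "y \<in> V1" "Y = U1 +>\<^bsub>M\<^esub> y" by blast
      have xyM: "x \<in> carrier M" "y \<in> carrier M" using xy V1(1) by auto
      have "U2 +>\<^bsub>M\<^esub> \<phi> x = U2 +>\<^bsub>M\<^esub> \<phi> y" using eq xy fV by simp
      then have "h (\<phi> x) - h (\<phi> y) \<in> h ` U2" using coset_sub_eq[OF ch U2 \<phi>(1)[OF xyM(1)] \<phi>(1)[OF xyM(2)]] by simp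
      then have "\<phi>' (h x - h y) \<in> h ` U2" by (simp add: \<phi>'(1) \<phi>(2) xyM)
      then have "h x - h y \<in> h ` U1" using R subgrpD(2)[OF V1(2)] xy by blast
      then show "X = Y" unfolding xy using coset_sub_eq[OF ch U1 xyM] by blast
    qed
  qed
  have surj: "?f ` (\<lambda>x. U1 +>\<^bsub>M\<^esub> x) ` V1 = (\<lambda>x. U2 +>\<^bsub>M\<^esub> x) ` V2 \<longleftrightarrow> ?S"
  proof
    assume L: "?f ` (\<lambda>x. U1 +>\<^bsub>M\<^esub> x) ` V1 = (\<lambda>x. U2 +>\<^bsub>M\<^esub> x) ` V2"
    show ?S
    proof
      fix y' assume "y' \<in> h ` V2"
      then obtain y where y: "y \<in> V2" "y' = h y" by blast
      have "U2 +>\<^bsub>M\<^esub> y \<in> ?f ` (\<lambda>x. U1 +>\<^bsub>M\<^esub> x) ` V1" unfolding L using y by blast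
      then obtain x where x: "x \<in> V1" "U2 +>\<^bsub>M\<^esub> y = ?f (U1 +>\<^bsub>M\<^esub> x)" by blast
      then have "U2 +>\<^bsub>M\<^esub> y = U2 +>\<^bsub>M\<^esub> \<phi> x" using fV by simp
      moreover have yM: "y \<in> carrier M" and xM: "x \<in> carrier M" using x(1) V1(1) y V2 by auto
      ultimately have "h y - h (\<phi> x) \<in> h ` U2" using coset_sub_eq[OF ch U2 yM \<phi>(1)[OF xM]] by simp
      moreover have "h (\<phi> x) = \<phi>' (h x)" using x(1) V1(1) by (intro \<phi>(2)) blast
      ultimately show "\<exists>x\<in>h ` V1. y' - \<phi>' x \<in> h ` U2" using x(1) y(2) by auto
    qed
  next
    assume R: ?S
    have "U2 +>\<^bsub>M\<^esub> y \<in> ?f ` (\<lambda>x. U1 +>\<^bsub>M\<^esub> x) ` V1" if y: "y \<in> V2" for y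
    proof -
      obtain x where x: "x \<in> V1" "h y - \<phi>' (h x) \<in> h ` U2" using R y by blast
      have M: "x \<in> carrier M" "y \<in> carrier M" using x y V1(1) V2 by auto
      have "h y - h (\<phi> x) \<in> h ` U2" using x(2) by (simp add: \<phi>(2) M)
      then have "U2 +>\<^bsub>M\<^esub> y = ?f (U1 +>\<^bsub>M\<^esub> x)"
        unfolding fV[OF x(1)] using coset_sub_eq[OF ch U2 M(2) \<phi>(1)[OF M(1)]] by simp
      then show ?thesis using x(1) by blast
    qed
    moreover have "?f (U1 +>\<^bsub>M\<^esub> x) \<in> (\<lambda>x. U2 +>\<^bsub>M\<^esub> x) ` V2" if "x \<in> V1" for x
      unfolding fV[OF that] using \<phi>in[OF that] by blast
    ultimately show "?f ` (\<lambda>x. U1 +>\<^bsub>M\<^esub> x) ` V1 = (\<lambda>x. U2 +>\<^bsub>M\<^esub> x) ` V2" by blast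
  qed
  show ?thesis unfolding bij_betw_def carrier_quotient_restrict inj surj ..
qed

lemma fsc_minus_one: "fsc (tau_const (-1)) x = - x"
  by (simp add: fun_eq_iff fsc_def tau_const_simps(5))

lemma weight_filtration_chart:
  assumes ch: "chart (carrier field_const) M fsc h"
    and N: "\<And>x. x \<in> carrier M \<Longrightarrow> N x \<in> carrier M" "\<And>x. x \<in> carrier M \<Longrightarrow> h (N x) = N' (h x)"
    and N': "\<And>x y. N' (x - y) = N' x - N' y"
    and WM: "\<And>k. W k \<subseteq> carrier M"
  shows "is_weight_filtration field_const M N c W \<longleftrightarrow> WF_coord N' (h ` carrier M) c (\<lambda>k. h ` W k)"
proof -
  note c = chartD[OF ch]
  interpret Module.module field_const M by (rule chart_module[OF ch]) auto
  have powM: "(N ^^ j) x \<in> carrier M" "h ((N ^^ j) x) = (N' ^^ j) (h x)" if "x \<in> carrier M" for j x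
  proof -
    have "(N ^^ j) x \<in> carrier M \<and> h ((N ^^ j) x) = (N' ^^ j) (h x)" using that N by (induction j) auto
    then show "(N ^^ j) x \<in> carrier M" "h ((N ^^ j) x) = (N' ^^ j) (h x)" by auto
  qed
  have pow': "(N' ^^ j) (x - y) = (N' ^^ j) x - (N' ^^ j) y" for j x y
    by (induction j) (simp_all only: funpow.simps o_apply id_apply N')
  have mem: "h x \<in> h ` W k \<longleftrightarrow> x \<in> W k" if "x \<in> carrier M" for x k by (rule chart_mem[OF ch WM that])
  let ?Sub = "\<lambda>k. h ` W k \<subseteq> h ` carrier M \<and> 0 \<in> h ` W k \<and> (\<forall>x\<in>h ` W k. \<forall>y\<in>h ` W k. x + y \<in> h ` W k) \<and>
        (\<forall>a\<in>carrier field_const. \<forall>x\<in>h ` W k. fsc a x \<in> h ` W k)"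
  have sub: "submodule field_const (W k) M \<longleftrightarrow> ?Sub k" for k
  proof
    assume "submodule field_const (W k) M"
    then interpret s: submodule field_const "W k" M .
    have z: "\<zero>\<^bsub>M\<^esub> \<in> W k" "\<And>x y. x \<in> W k \<Longrightarrow> y \<in> W k \<Longrightarrow> x \<oplus>\<^bsub>M\<^esub> y \<in> W k"
      "\<And>a x. a \<in> carrier field_const \<Longrightarrow> x \<in> W k \<Longrightarrow> a \<odot>\<^bsub>M\<^esub> x \<in> W k" by auto
    show "?Sub k"
    proof (intro conjI ballI)
      show "h ` W k \<subseteq> h ` carrier M" using WM by blast
      show "0 \<in> h ` W k" using imageI[OF z(1), of h] c(2) by simp
      fix x y assume "x \<in> h ` W k" "y \<in> h ` W k"
      then obtain x' y' where xy: "x' \<in> W k" "y' \<in> W k" "x = h x'" "y = h y'" by blast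
      have "x' \<in> carrier M" "y' \<in> carrier M" using xy WM[of k] by auto
      then have "x + y = h (x' \<oplus>\<^bsub>M\<^esub> y')" unfolding xy by (rule c(4)[symmetric])
      then show "x + y \<in> h ` W k" using z(2)[OF xy(1,2)] by (rule image_eqI)
    next
      fix a x assume a: "a \<in> carrier field_const" "x \<in> h ` W k"
      then obtain x' where x: "x' \<in> W k" "x = h x'" by blast
      then have "fsc a x = h (a \<odot>\<^bsub>M\<^esub> x')" using c(6)[OF a(1), of x'] WM[of k] by auto
      then show "fsc a x \<in> h ` W k" using z(3)[OF a(1) x(1)] by blast
    qed
  next
    assume S: "?Sub k"
    show "submodule field_const (W k) M"
    proof (rule LinearCombinations.submodule.intro)
      show "Module.module field_const M" by unfold_locales
      show "W k \<subseteq> carrier M" by (rule WM)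
      show "\<zero>\<^bsub>M\<^esub> \<in> W k" using S mem[OF c(1)] c(2) by simp
      fix x y assume xy: "x \<in> W k" "y \<in> W k"
      then have M: "x \<in> carrier M" "y \<in> carrier M" using WM[of k] by auto
      have "h x + h y \<in> h ` W k" using S xy by blast
      then show "x \<oplus>\<^bsub>M\<^esub> y \<in> W k" using mem[OF c(3)[OF M]] c(4)[OF M] by simp
    next
      fix a x assume ax: "a \<in> carrier field_const" "x \<in> W k"
      then have M: "x \<in> carrier M" using WM[of k] by auto
      have "fsc a (h x) \<in> h ` W k" using S ax by blast
      then show "a \<odot>\<^bsub>M\<^esub> x \<in> W k" using mem[OF c(5)[OF ax(1) M]] c(6)[OF ax(1) M] by simp
    qed
  qed
  have sg: "subgrp (h ` W k)" if "?Sub k" for k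
    unfolding subgrp_def
  proof (intro conjI ballI)
    show "0 \<in> h ` W k" using that by blast
    fix x y assume xy: "x \<in> h ` W k" "y \<in> h ` W k"
    then have "fsc (tau_const (-1)) y \<in> h ` W k" using that tau_const_in by blast
    then have "x + fsc (tau_const (-1)) y \<in> h ` W k" using that xy(1) by blast
    then show "x - y \<in> h ` W k" by (simp only: fsc_minus_one add_uminus_conv_diff)
  qed
  have hsub: "h ` A \<subseteq> h ` B \<longleftrightarrow> A \<subseteq> B" if "A \<subseteq> carrier M" "B \<subseteq> carrier M" for A B
    using inj_on_image_subset_iff[of h "carrier M"] ch that by (simp add: chart_def)
  have inc: "W k \<subseteq> W (k + 1) \<longleftrightarrow> h ` W k \<subseteq> h ` W (k + 1)" for k by (simp add: hsub WM)
  have zero: "W k = {\<zero>\<^bsub>M\<^esub>} \<longleftrightarrow> h ` W k = {0}" for k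
  proof
    assume "W k = {\<zero>\<^bsub>M\<^esub>}" then show "h ` W k = {0}" using c(2) by simp
  next
    assume e: "h ` W k = {0}"
    have "x = \<zero>\<^bsub>M\<^esub>" if "x \<in> W k" for x
      using imageI[OF that, of h] e c(1,2) WM[of k] that by (intro c(7)) auto
    moreover have "W k \<noteq> {}" using e by auto
    ultimately show "W k = {\<zero>\<^bsub>M\<^esub>}" by blast
  qed
  have full: "W k = carrier M \<longleftrightarrow> h ` W k = h ` carrier M" for k
    unfolding set_eq_subset by (simp add: hsub WM)
  have low: "N ` W k \<subseteq> W (k - 2) \<longleftrightarrow> N' ` h ` W k \<subseteq> h ` W (k - 2)" for k
  proof -
    have "N x \<in> W (k - 2) \<longleftrightarrow> N' (h x) \<in> h ` W (k - 2)" if "x \<in> W k" for x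
    proof -
      have xM: "x \<in> carrier M" using that WM[of k] by blast
      show ?thesis using mem[OF N(1)[OF xM], of "k - 2"] N(2)[OF xM] by simp
    qed
    then show ?thesis by (auto simp: image_subset_iff)
  qed
  have bij: "bij_betw (induced_map M (W (c - int j - 1)) (N ^^ j))
        (carrier (quotient_module (M\<lparr>carrier := W (c + int j)\<rparr>) (W (c + int j - 1))))
        (carrier (quotient_module (M\<lparr>carrier := W (c - int j)\<rparr>) (W (c - int j - 1)))) \<longleftrightarrow>
     (\<forall>x\<in>h ` W (c + int j). (N' ^^ j) x \<in> h ` W (c - int j - 1) \<longrightarrow> x \<in> h ` W (c + int j - 1)) \<and>
        (\<forall>y\<in>h ` W (c - int j). \<exists>x\<in>h ` W (c + int j). y - (N' ^^ j) x \<in> h ` W (c - int j - 1))"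
    if S: "\<And>k. ?Sub k" and L: "\<And>k. N' ` h ` W k \<subseteq> h ` W (k - 2)" for j
  proof -
    have Lj: "(N' ^^ i) x \<in> h ` W (k - 2 * int i)" if "x \<in> h ` W k" for i k x
    proof (induction i)
      case (Suc i)
      then have "N' ((N' ^^ i) x) \<in> h ` W (k - 2 * int i - 2)" using L by blast
      then show ?case by (simp add: algebra_simps)
    qed (use that in simp)
    show ?thesis
    proof (rule bij_betw_induced_map[where \<phi>' = "N' ^^ j", OF ch WM sg[OF S] WM sg[OF S] WM sg[OF S] WM])
      show "(N' ^^ j) x \<in> h ` W (c - int j - 1)" if "x \<in> h ` W (c + int j - 1)" for x
        using Lj[OF that, of j] by (simp add: algebra_simps)
      show "(N' ^^ j) x \<in> h ` W (c - int j)" if "x \<in> h ` W (c + int j)" for x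
        using Lj[OF that, of j] by (simp add: algebra_simps)
    qed (simp_all add: powM pow')
  qed
  \<comment> \<open>The bijectivity clauses correspond to each other only in the presence of the
    submodule and lowering clauses, hence the congruence rule for conjunctions.\<close>
  show ?thesis
    unfolding is_weight_filtration_def WF_coord_def sub inc zero full low using bij
    by (intro conj_cong refl) auto
qed

text \<open>\<open>jfil_WF\<close> supplies existence and \<open>jfil_unique\<close> uniqueness, so
  the definite description is resolved; injectivity of \<open>h\<close> carries equality back from
  coordinates.\<close>

lemma weight_filtration_jordan:
  assumes ch: "chart (carrier field_const) M fsc h"
    and N: "\<And>x. x \<in> carrier M \<Longrightarrow> N x \<in> carrier M" "\<And>x. x \<in> carrier M \<Longrightarrow> h (N x) = jop n \<alpha> (h x)"
    and im: "h ` carrier M = jspace n" and mono: "\<And>i j. i \<le> j \<Longrightarrow> j < n \<Longrightarrow> \<alpha> i \<le> \<alpha> j"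
  shows "weight_filtration field_const M N c k = {x \<in> carrier M. h x \<in> jfil n \<alpha> c k}"
proof -
  note ch' = chartD[OF ch]
  have j: "jop n \<alpha> (x - y) = jop n \<alpha> x - jop n \<alpha> y" for x y by (auto simp: jop_def fun_eq_iff)
  have tr: "is_weight_filtration field_const M N c W \<longleftrightarrow> WF_coord (jop n \<alpha>) (h ` carrier M) c (\<lambda>k. h ` W k)"
    if "\<And>k. W k \<subseteq> carrier M" for W
    by (rule weight_filtration_chart[OF ch]) (fact N j that)+
  define W where "W = (\<lambda>k. {x \<in> carrier M. h x \<in> jfil n \<alpha> c k})"
  have hW: "h ` W k = jfil n \<alpha> c k" for k
  proof -
    have "jfil n \<alpha> c k \<subseteq> h ` carrier M" unfolding im jfil_def by blast
    then show ?thesis unfolding W_def by blast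
  qed
  have "is_weight_filtration field_const M N c W"
  proof -
    have WM: "W k \<subseteq> carrier M" for k unfolding W_def by blast
    have "(\<lambda>k. h ` W k) = jfil n \<alpha> c" by (rule ext) (rule hW)
    then have "WF_coord (jop n \<alpha>) (h ` carrier M) c (\<lambda>k. h ` W k)"
      using jfil_WF[of n \<alpha> c, OF mono] im by simp
    then show ?thesis unfolding tr[OF WM] .
  qed
  moreover have "W' = W" if W': "is_weight_filtration field_const M N c W'" for W'
  proof
    fix k
    have M: "W' k \<subseteq> carrier M" for k
      using W'[unfolded is_weight_filtration_def, THEN conjunct1, rule_format, of k]
      by (rule LinearCombinations.submodule.subset)
    have "WF_coord (jop n \<alpha>) (jspace n) c (\<lambda>k. h ` W' k)"
      using W' unfolding tr[OF M] im .
    from jfil_unique[OF mono this] have "h ` W' k = h ` W k" unfolding hW .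
    moreover have "W k \<subseteq> carrier M" unfolding W_def by blast
    moreover have "inj_on h (carrier M)" using ch by (simp add: chart_def)
    ultimately show "W' k = W k" using M[of k] by (simp add: inj_on_image_eq_iff)
  qed
  ultimately have "weight_filtration field_const M N c = W"
    unfolding weight_filtration_def by (rule the_equality)
  then show ?thesis by (simp add: W_def)
qed

section \<open>The Kashiwara-Malgrange filtration in coordinates\<close>

text \<open>Isolates what identifying the Kashiwara-Malgrange filtration takes: coordinates in which
  tau d/dtau becomes an additive operator that commutes with constants. The concrete model is
  plugged in later.\<close>

locale GM_chart =
  fixes f :: "('n::finite) laurent" and h :: "'n form set \<Rightarrow> nat \<Rightarrow> laurent_tau"
    and D :: "(nat \<Rightarrow> laurent_tau) \<Rightarrow> nat \<Rightarrow> laurent_tau"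
  assumes ch: "chart UNIV (GM f) fsc h"
    and euler: "\<And>x. x \<in> carrier (GM f) \<Longrightarrow> GM_euler f x \<in> carrier (GM f)"
      "\<And>x. x \<in> carrier (GM f) \<Longrightarrow> h (GM_euler f x) = D (h x)"
    and D_add: "\<And>x y. D (x + y) = D x + D y"
    and D_const: "\<And>c x. D (fsc (tau_const c) x) = fsc (tau_const c) (D x)"
begin

lemma D_diff: "D (x - y) = D x - D y"
  using D_add[of "x - y" y] by (simp add: eq_diff_eq)

lemma chart_S: "chart S (GM f) fsc h"
  using ch unfolding chart_def by blast

lemma shift_op_diff: "shift_op D \<alpha> (x - y) = shift_op D \<alpha> x - shift_op D \<alpha> y"
  by (simp only: shift_op_def D_diff fsc_simps) (simp only: add_diff_eq diff_add_eq diff_diff_eq2 diff_diff_eq add.commute)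

lemma nilpotent_coord:
  assumes V: "\<And>\<alpha>. V \<alpha> \<subseteq> carrier (GM f)" and mono: "\<And>\<alpha> \<beta>. \<alpha> \<le> \<beta> \<Longrightarrow> V \<alpha> \<subseteq> V \<beta>"
    and sg: "\<And>\<alpha>. subgrp (h ` V \<alpha>)" and const: "\<And>\<alpha> c x. x \<in> h ` V \<alpha> \<Longrightarrow> fsc (tau_const c) x \<in> h ` V \<alpha>"
    and E: "\<And>\<alpha> x. x \<in> h ` V \<alpha> \<Longrightarrow> D x \<in> h ` V \<alpha>"
  shows "nilpotent_on (gr_of f V \<alpha>) (N_of f V \<alpha>) \<longleftrightarrow>
    (\<exists>m. \<forall>x\<in>h ` V \<alpha>. (shift_op D \<alpha> ^^ m) x \<in> below (\<lambda>\<alpha>. h ` V \<alpha>) \<alpha>)"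
proof -
  note c = chartD[OF ch]
  define U where "U = below V \<alpha>"
  have hU: "h ` U = below (\<lambda>\<alpha>. h ` V \<alpha>) \<alpha>" unfolding U_def below_def by blast
  have UM: "U \<subseteq> carrier (GM f)" unfolding U_def below_def using V by blast
  have sgU: "subgrp (h ` U)"
    unfolding subgrp_def
  proof (intro conjI ballI)
    have "0 \<in> h ` V (\<alpha> - 1)" using sg subgrpD(1) by blast
    then show "0 \<in> h ` U" unfolding hU below_def by (intro UN_I[of "\<alpha> - 1"]) auto
    fix x y assume "x \<in> h ` U" "y \<in> h ` U"
    then obtain \<beta> \<beta>' where b: "\<beta> < \<alpha>" "x \<in> h ` V \<beta>" "\<beta>' < \<alpha>" "y \<in> h ` V \<beta>'" unfolding hU below_def by blast
    then have "x \<in> h ` V (max \<beta> \<beta>')" "y \<in> h ` V (max \<beta> \<beta>')" using mono[of \<beta> "max \<beta> \<beta>'"] mono[of \<beta>' "max \<beta> \<beta>'"] by auto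
    then have "x - y \<in> h ` V (max \<beta> \<beta>')" using subgrpD(2)[OF sg] by blast
    then show "x - y \<in> h ` U" unfolding hU below_def using b by (intro UN_I[of "max \<beta> \<beta>'"]) auto
  qed
  define \<phi> where "\<phi> = (\<lambda>x. \<ominus>\<^bsub>GM f\<^esub> (GM_euler f x \<oplus>\<^bsub>GM f\<^esub> tau_const (of_rat \<alpha>) \<odot>\<^bsub>GM f\<^esub> x))"
  define \<phi>' where "\<phi>' = (\<lambda>x. - shift_op D \<alpha> x)"
  have \<phi>: "\<phi> x \<in> carrier (GM f)" "h (\<phi> x) = \<phi>' (h x)" if "x \<in> carrier (GM f)" for x
  proof -
    have 1: "GM_euler f x \<oplus>\<^bsub>GM f\<^esub> tau_const (of_rat \<alpha>) \<odot>\<^bsub>GM f\<^esub> x \<in> carrier (GM f)"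
      "h (GM_euler f x \<oplus>\<^bsub>GM f\<^esub> tau_const (of_rat \<alpha>) \<odot>\<^bsub>GM f\<^esub> x) = shift_op D \<alpha> (h x)"
      using that c(3,4,5,6) euler by (auto simp: shift_op_def)
    show "\<phi> x \<in> carrier (GM f)" "h (\<phi> x) = \<phi>' (h x)"
      unfolding \<phi>_def \<phi>'_def using chart_minus[OF ch 1(1)] 1(2) by auto
  qed
  have \<phi>'d: "\<phi>' (x - y) = \<phi>' x - \<phi>' y" for x y
    unfolding \<phi>'_def shift_op_diff by simp
  have stab: "\<phi>' x \<in> h ` V \<beta>" if "x \<in> h ` V \<beta>" for x \<beta>
    unfolding \<phi>'_def shift_op_def
    by (rule subgrpD(3)[OF sg]) (rule subgrpD(4)[OF sg E[OF that] const[OF that]])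
  then have stabU: "\<phi>' x \<in> h ` U" if "x \<in> h ` U" for x using that unfolding hU below_def by blast
  have N: "N_of f V \<alpha> (U +>\<^bsub>GM f\<^esub> x) = U +>\<^bsub>GM f\<^esub> \<phi> x" if "x \<in> carrier (GM f)" for x
    unfolding N_of_def U_def[symmetric] \<phi>_def[symmetric]
    by (rule induced_map_sub[OF ch UM sgU UM sgU \<phi> \<phi>'d stabU that])
  have pow: "(\<phi> ^^ m) x \<in> carrier (GM f) \<and> h ((\<phi> ^^ m) x) = (\<phi>' ^^ m) (h x) \<and>
    (N_of f V \<alpha> ^^ m) (U +>\<^bsub>GM f\<^esub> x) = U +>\<^bsub>GM f\<^esub> (\<phi> ^^ m) x" if "x \<in> carrier (GM f)" for m x
    using that by (induction m) (auto simp: \<phi> N)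
  \<comment> \<open>\<open>N_of\<close> carries a minus sign that \<open>shift_op\<close> lacks.
    Powers agree up to sign, and membership in a subgroup does not see it.\<close>
  have sign: "(\<phi>' ^^ m) x = (shift_op D \<alpha> ^^ m) x \<or> (\<phi>' ^^ m) x = - (shift_op D \<alpha> ^^ m) x" for m x
  proof (induction m)
    case (Suc m)
    have neg: "shift_op D \<alpha> (- y) = - shift_op D \<alpha> y" for y
      using shift_op_diff[of \<alpha> 0 y] shift_op_diff[of \<alpha> 0 0] by simp
    have "\<phi>' y = - shift_op D \<alpha> y" for y by (simp only: \<phi>'_def)
    from this[of "(\<phi>' ^^ m) x"] have st: "(\<phi>' ^^ Suc m) x = - shift_op D \<alpha> ((\<phi>' ^^ m) x)"
      by (simp only: funpow.simps o_apply)
    from Suc show ?case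
    proof
      assume A: "(\<phi>' ^^ m) x = (shift_op D \<alpha> ^^ m) x"
      show ?thesis by (intro disjI2) (simp only: st A, simp only: funpow.simps o_apply)
    next
      assume A: "(\<phi>' ^^ m) x = - (shift_op D \<alpha> ^^ m) x"
      show ?thesis by (intro disjI1) (simp only: st A, simp only: funpow.simps o_apply neg minus_minus)
    qed
  qed simp
  have mem: "(\<phi>' ^^ m) x \<in> h ` U \<longleftrightarrow> (shift_op D \<alpha> ^^ m) x \<in> h ` U" for m x
  proof -
    have "- y \<in> h ` U \<longleftrightarrow> y \<in> h ` U" for y
      using subgrpD(3)[OF sgU, of y] subgrpD(3)[OF sgU, of "- y"] unfolding minus_minus by blast
    then show ?thesis using sign[of m x] by metis
  qed
  have car: "carrier (gr_of f V \<alpha>) = (\<lambda>x. U +>\<^bsub>GM f\<^esub> x) ` V \<alpha>"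
    unfolding gr_of_def U_def by (rule carrier_quotient_restrict)
  have zero: "\<zero>\<^bsub>gr_of f V \<alpha>\<^esub> = U" by (simp add: gr_of_def U_def quotient_module_def)
  have "(N_of f V \<alpha> ^^ m) (U +>\<^bsub>GM f\<^esub> x) = U \<longleftrightarrow> (shift_op D \<alpha> ^^ m) (h x) \<in> h ` U" if "x \<in> V \<alpha>" for m x
  proof -
    have xM: "x \<in> carrier (GM f)" using that V by blast
    have "(N_of f V \<alpha> ^^ m) (U +>\<^bsub>GM f\<^esub> x) = U +>\<^bsub>GM f\<^esub> (\<phi> ^^ m) x" "(\<phi> ^^ m) x \<in> carrier (GM f)"
      "h ((\<phi> ^^ m) x) = (\<phi>' ^^ m) (h x)" using pow[OF xM, of m] by auto
    then show ?thesis using coset_sub_self[OF ch UM sgU, of "(\<phi> ^^ m) x"] mem by simp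
  qed
  then show ?thesis unfolding nilpotent_on_def car zero hU[symmetric] by auto
qed

text \<open>Applied to an arbitrary candidate, this feeds \<open>KM_coord_unique\<close>; existence
  is shown directly for one explicit filtration.\<close>

lemma is_KM_coord:
  assumes "is_KM_filtration f V"
  shows "KM_coord D (h ` carrier (GM f)) (\<lambda>\<alpha>. h ` V \<alpha>)" "V \<alpha> \<subseteq> carrier (GM f)"
proof -
  note c = chartD[OF ch]
  note K = assms[unfolded is_KM_filtration_def]
  note mono = K[THEN conjunct1, rule_format]
    and disc = K[THEN conjunct2, THEN conjunct1]
    and sub = K[THEN conjunct2, THEN conjunct2, THEN conjunct1, rule_format]
    and free = K[THEN conjunct2, THEN conjunct2, THEN conjunct2, THEN conjunct1, rule_format]
    and span = K[THEN conjunct2, THEN conjunct2, THEN conjunct2, THEN conjunct2, THEN conjunct1, rule_format]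
    and eul = K[THEN conjunct2, THEN conjunct2, THEN conjunct2, THEN conjunct2, THEN conjunct2, THEN conjunct1, rule_format]
    and shift = K[THEN conjunct2, THEN conjunct2, THEN conjunct2, THEN conjunct2, THEN conjunct2, THEN conjunct2, THEN conjunct1, rule_format]
    and nil = K[THEN conjunct2, THEN conjunct2, THEN conjunct2, THEN conjunct2, THEN conjunct2, THEN conjunct2, THEN conjunct2, rule_format]
  have VM: "V \<alpha> \<subseteq> carrier (GM f)" for \<alpha> using sub[of \<alpha>] unfolding submodule_def by blast
  then show "V \<alpha> \<subseteq> carrier (GM f)" .
  have inj_h: "inj_on h (carrier (GM f))" using ch by (simp add: chart_def)
  have cl: "\<zero>\<^bsub>GM f\<^esub> \<in> V \<alpha>" "\<And>x y. x \<in> V \<alpha> \<Longrightarrow> y \<in> V \<alpha> \<Longrightarrow> x \<oplus>\<^bsub>GM f\<^esub> y \<in> V \<alpha>"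
    "\<And>a x. a \<in> carrier ring_tau \<Longrightarrow> x \<in> V \<alpha> \<Longrightarrow> a \<odot>\<^bsub>GM f\<^esub> x \<in> V \<alpha>" for \<alpha>
    using sub[of \<alpha>] unfolding submodule_def by blast+
  have 0: "0 \<in> h ` V \<alpha>" for \<alpha> using imageI[OF cl(1), of h] c(2) by simp
  have plus: "x + y \<in> h ` V \<alpha>" if xy: "x \<in> h ` V \<alpha>" "y \<in> h ` V \<alpha>" for x y \<alpha>
  proof -
    obtain x' y' where xy: "x' \<in> V \<alpha>" "y' \<in> V \<alpha>" "x = h x'" "y = h y'" using xy by blast
    have "x' \<in> carrier (GM f)" "y' \<in> carrier (GM f)" using xy VM[of \<alpha>] by auto
    then have "x + y = h (x' \<oplus>\<^bsub>GM f\<^esub> y')" unfolding xy by (rule c(4)[symmetric])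
    then show ?thesis using cl(2)[OF xy(1,2)] by (rule image_eqI)
  qed
  have sm: "fsc a x \<in> h ` V \<alpha>" if a: "a \<in> carrier ring_tau" "x \<in> h ` V \<alpha>" for a x \<alpha>
  proof -
    obtain x' where x: "x' \<in> V \<alpha>" "x = h x'" using a by blast
    then have "fsc a x = h (a \<odot>\<^bsub>GM f\<^esub> x')" using c(6)[of a x'] VM[of \<alpha>] by auto
    then show ?thesis using cl(3)[OF a(1) x(1)] by blast
  qed
  have const: "tau_const z \<in> carrier ring_tau" for z by (auto simp: tau_ring_def tau_const_def)
  have sg: "subgrp (h ` V \<alpha>)" for \<alpha>
    unfolding subgrp_def
  proof (intro conjI ballI 0)
    fix x y assume xy: "x \<in> h ` V \<alpha>" "y \<in> h ` V \<alpha>"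
    have "x + fsc (tau_const (-1)) y \<in> h ` V \<alpha>" by (intro plus sm const xy)
    then show "x - y \<in> h ` V \<alpha>" by (simp only: fsc_minus_one add_uminus_conv_diff)
  qed
  have DV: "D x \<in> h ` V \<alpha>" if a: "x \<in> h ` V \<alpha>" for x \<alpha>
  proof -
    obtain x' where x: "x' \<in> V \<alpha>" "x = h x'" using a by blast
    then have "D x = h (GM_euler f x')" using euler(2)[of x'] VM[of \<alpha>] by auto
    then show ?thesis using eul[of \<alpha>] x(1) by blast
  qed
  show "KM_coord D (h ` carrier (GM f)) (\<lambda>\<alpha>. h ` V \<alpha>)"
    unfolding KM_coord_def
  proof (intro conjI allI impI ballI)
    show "h ` V \<alpha> \<subseteq> h ` V \<beta>" if "\<alpha> \<le> \<beta>" for \<alpha> \<beta> using mono[OF that] by blast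
    obtain r :: nat where r: "0 < r" "\<forall>\<alpha>. V \<alpha> = V (of_int \<lfloor>of_nat r * \<alpha>\<rfloor> / of_nat r)" using disc by blast
    show "\<exists>r::nat. 0 < r \<and> (\<forall>\<alpha>. h ` V \<alpha> = h ` V (of_int \<lfloor>of_nat r * \<alpha>\<rfloor> / of_nat r))"
      using r(1) r(2)[rule_format] by (intro exI[of _ r] conjI allI arg_cong[of _ _ "\<lambda>V. h ` V"])
    show "h ` V \<alpha> \<subseteq> h ` carrier (GM f)" for \<alpha> using VM by blast
    show "\<exists>S. finite S \<and> S \<subseteq> h ` V \<alpha> \<and>
        (\<forall>x\<in>h ` V \<alpha>. \<exists>a. (\<forall>s\<in>S. a s \<in> carrier ring_tau) \<and> x = (\<Sum>s\<in>S. fsc (a s) s))" for \<alpha>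
    proof -
      have chV: "chart (carrier ring_tau) ((GM f)\<lparr>carrier := V \<alpha>\<rparr>) fsc h"
      proof (rule chart_restrict[where \<Gamma> = "h ` V \<alpha>", OF chart_S[of "carrier ring_tau"]])
        show "V \<alpha> = {x \<in> carrier (GM f). h x \<in> h ` V \<alpha>}" using chart_mem[OF ch VM] VM[of \<alpha>] by blast
      qed (auto intro: plus sm 0 subgrpD(3)[OF sg])
      interpret m: Module.module ring_tau "(GM f)\<lparr>carrier := V \<alpha>\<rparr>" by (rule chart_module[OF chV]) auto
      obtain S where S: "finite S" "S \<subseteq> V \<alpha>" "m.span S = V \<alpha>"
        using free[of \<alpha>] unfolding free_finite_rank_def by auto
      have injS: "inj_on h S"
        by (rule inj_on_subset[OF inj_h order.trans[OF S(2) VM]])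
      have "\<exists>a. (\<forall>s\<in>h ` S. a s \<in> carrier ring_tau) \<and> h x = (\<Sum>s\<in>h ` S. fsc (a s) s)" if "x \<in> V \<alpha>" for x
      proof -
        have "x \<in> m.span S" using that S(3) by simp
        then obtain a where a: "a \<in> S \<rightarrow> carrier ring_tau" "m.lincomb a S = x"
          using m.finite_in_span[of S x] S by auto
        have "h x = (\<Sum>s\<in>S. fsc (a s) (h s))"
          unfolding a(2)[symmetric] by (rule chart_lincomb[OF chV]) (use S a in auto)
        also have "\<dots> = (\<Sum>s\<in>h ` S. fsc (a (the_inv_into S h s)) s)"
          using injS by (simp add: sum.reindex the_inv_into_f_f)
        finally show ?thesis using a(1) injS
          by (intro exI[of _ "\<lambda>s. a (the_inv_into S h s)"]) (auto simp: the_inv_into_f_f)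
      qed
      then show ?thesis using S by (intro exI[of _ "h ` S"]) auto
    qed
    show "\<exists>A a. finite A \<and> A \<subseteq> h ` V \<alpha> \<and> x = (\<Sum>s\<in>A. fsc (a s) s)" if x: "x \<in> h ` carrier (GM f)" for x \<alpha>
    proof -
      interpret m: Module.module ring_tau_inv "GM f" by (rule chart_module[OF chart_S]) auto
      obtain x' where x': "x' \<in> carrier (GM f)" "x = h x'" using x by blast
      have "x' \<in> m.span (V \<alpha>)" using span x' by simp
      then obtain a A where a: "finite A" "A \<subseteq> V \<alpha>" "a \<in> A \<rightarrow> carrier ring_tau_inv" "m.lincomb a A = x'"
        unfolding m.span_def by blast
      have injA: "inj_on h A"
        by (rule inj_on_subset[OF inj_h order.trans[OF a(2) VM]])
      have "x = (\<Sum>s\<in>A. fsc (a s) (h s))"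
        unfolding x' a(4)[symmetric] by (rule chart_lincomb[OF chart_S]) (use a VM in auto)
      also have "\<dots> = (\<Sum>s\<in>h ` A. fsc (a (the_inv_into A h s)) s)"
        using injA by (simp add: sum.reindex the_inv_into_f_f)
      finally show ?thesis using a(1,2)
        by (intro exI[of _ "h ` A"] exI[of _ "\<lambda>s. a (the_inv_into A h s)"]) auto
    qed
    show "D ` h ` V \<alpha> \<subseteq> h ` V \<alpha>" for \<alpha> using DV by blast
    show "fsc (tau_pow 1) ` h ` V \<alpha> = h ` V (\<alpha> - 1)" for \<alpha>
    proof -
      have "h ` (\<lambda>x. tau_pow 1 \<odot>\<^bsub>GM f\<^esub> x) ` V \<alpha> = (\<lambda>x. fsc (tau_pow 1) (h x)) ` V \<alpha>"
        unfolding image_image using VM[of \<alpha>] c(6) by (intro image_cong) auto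
      then show ?thesis unfolding shift by (simp add: image_image)
    qed
    show "\<exists>m. \<forall>x\<in>h ` V \<alpha>. (shift_op D \<alpha> ^^ m) x \<in> below (\<lambda>\<alpha>. h ` V \<alpha>) \<alpha>" for \<alpha>
      using nil[of \<alpha>] by (subst (asm) nilpotent_coord[OF VM mono sg sm[OF const] DV])
  qed (use 0 plus sm in auto)
qed

lemma KM_filtration_eqI:
  assumes V: "is_KM_filtration f V"
  shows "KM_filtration f = V"
  unfolding KM_filtration_def
proof (rule the_equality)
  fix V' assume V': "is_KM_filtration f V'"
  have "(\<lambda>\<alpha>. h ` V' \<alpha>) = (\<lambda>\<alpha>. h ` V \<alpha>)"
    by (rule KM_coord_unique[OF is_KM_coord(1)[OF V'] is_KM_coord(1)[OF V] D_add D_const])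
  then have "h ` V' \<alpha> = h ` V \<alpha>" for \<alpha> by (rule fun_cong)
  moreover have "inj_on h (carrier (GM f))" using ch by (simp add: chart_def)
  ultimately show "V' = V" using is_KM_coord(2)[OF V'] is_KM_coord(2)[OF V]
    by (intro ext) (simp add: inj_on_image_eq_iff)
qed (rule V)

end

section \<open>Weights of a reduced reflexive simplex\<close>

lemma real_vec_simps: "real_vec v $ j = real_of_int (v $ j)" "real_vec v = real_vec w \<longleftrightarrow> v = w"
  by (auto simp: real_vec_def vec_eq_iff)

lemma bezout_Gcd:
  fixes q :: "nat \<Rightarrow> nat"
  shows "\<exists>y::nat \<Rightarrow> int. (\<Sum>i=0..n. y i * int (q i)) = int (Gcd (q ` {0..n}))"
proof (induction n)
  case 0 then show ?case by (intro exI[of _ "\<lambda>_. 1"]) simp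
next
  case (Suc n)
  then obtain y :: "nat \<Rightarrow> int" where y: "(\<Sum>i=0..n. y i * int (q i)) = int (Gcd (q ` {0..n}))" by blast
  define g where "g = Gcd (q ` {0..n})"
  obtain u w where uw: "u * int (q (Suc n)) + w * int g = gcd (int (q (Suc n))) (int g)" using bezout_int by blast
  have "Gcd (q ` {0..Suc n}) = gcd (q (Suc n)) g"
    unfolding g_def atLeast0_atMost_Suc by simp
  then have "int (Gcd (q ` {0..Suc n})) = u * int (q (Suc n)) + w * int g" using uw by simp
  moreover have "(\<Sum>i=0..n. (w * y i) * int (q i)) = w * int g"
    unfolding g_def y[symmetric] by (simp add: sum_distrib_left mult.assoc)
  ultimately show ?case
    by (intro exI[of _ "\<lambda>i. if i = Suc n then u else w * y i"]) (simp add: sum.atLeast0_atMost_Suc)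
qed

context
  fixes v :: "nat \<Rightarrow> int^'n::finite"
  assumes simplex: "lattice_simplex v"
begin

private abbreviation "X \<equiv> \<lambda>i. real_vec (v i)"

private lemma inj_X: "inj_on X {0..CARD('n)}"
  using simplex unfolding lattice_simplex_def inj_on_def by (auto simp: real_vec_simps)

text \<open>An interior point of a simplex has strictly positive barycentric coordinates
  \<open>b\<close>. From any relation \<open>a\<close> among the vertices subtract the multiple of
  \<open>b\<close> with the same coefficient sum: what is left is an affine relation, which vanishes
  by affine independence.\<close>

lemma barycentric_zero:
  "\<exists>b. (\<forall>i\<in>{0..CARD('n)}. 0 < b i) \<and> (\<Sum>i\<in>{0..CARD('n)}. b i *\<^sub>R X i) = 0 \<and>
    (\<forall>a. (\<Sum>i\<in>{0..CARD('n)}. a i *\<^sub>R X i) = 0 \<longrightarrow> (\<exists>s. \<forall>i\<in>{0..CARD('n)}. a i = s * b i))"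
proof -
  have ind: "\<not> affine_dependent (X ` {0..CARD('n)})" and zero: "0 \<in> interior (convex hull (X ` {0..CARD('n)}))"
    using simplex unfolding lattice_simplex_def simplex_hull_def by auto
  obtain u where u: "\<forall>x\<in>X ` {0..CARD('n)}. 0 < u x" "sum u (X ` {0..CARD('n)}) = 1" "(\<Sum>x\<in>X ` {0..CARD('n)}. u x *\<^sub>R x) = 0"
    using zero unfolding interior_convex_hull_explicit_minimal[OF ind] by (auto split: if_splits)
  define b where "b = (\<lambda>i. u (X i))"
  have b: "\<And>i. i \<in> {0..CARD('n)} \<Longrightarrow> 0 < b i" "(\<Sum>i\<in>{0..CARD('n)}. b i) = 1" "(\<Sum>i\<in>{0..CARD('n)}. b i *\<^sub>R X i) = 0"
    using u by (auto simp: b_def sum.reindex[OF inj_X])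
  have "\<exists>s. \<forall>i\<in>{0..CARD('n)}. a i = s * b i" if a: "(\<Sum>i\<in>{0..CARD('n)}. a i *\<^sub>R X i) = 0" for a
  proof -
    define s where "s = (\<Sum>i\<in>{0..CARD('n)}. a i)"
    define U where "U = (\<lambda>x. a (the_inv_into {0..CARD('n)} X x) - s * b (the_inv_into {0..CARD('n)} X x))"
    have UX: "U (X i) = a i - s * b i" if "i \<in> {0..CARD('n)}" for i
      using that by (simp add: U_def the_inv_into_f_f[OF inj_X])
    have "sum U (X ` {0..CARD('n)}) = (\<Sum>i\<in>{0..CARD('n)}. a i - s * b i)" by (simp add: sum.reindex[OF inj_X] UX)
    also have "\<dots> = 0" using b(2) by (simp add: sum_subtractf s_def flip: sum_distrib_left)
    finally have 1: "sum U (X ` {0..CARD('n)}) = 0" .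
    have "(\<Sum>x\<in>X ` {0..CARD('n)}. U x *\<^sub>R x) = (\<Sum>i\<in>{0..CARD('n)}. (a i - s * b i) *\<^sub>R X i)"
      by (simp add: sum.reindex[OF inj_X] UX)
    also have "\<dots> = (\<Sum>i\<in>{0..CARD('n)}. a i *\<^sub>R X i) - s *\<^sub>R (\<Sum>i\<in>{0..CARD('n)}. b i *\<^sub>R X i)"
      by (simp add: scaleR_left_diff_distrib sum_subtractf scaleR_sum_right)
    finally have 2: "(\<Sum>x\<in>X ` {0..CARD('n)}. U x *\<^sub>R x) = 0" using a b(3) by simp
    have "U (X i) = 0" if "i \<in> {0..CARD('n)}" for i
      using ind 1 2 that unfolding affine_dependent_explicit_finite[OF finite_imageI[OF finite_atLeastAtMost]] by blast
    then show ?thesis using UX by auto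
  qed
  then show ?thesis using b(1,3) by (intro exI[of _ b]) blast
qed

definition face_mat :: "('n \<Rightarrow> nat) \<Rightarrow> real^'n^'n" where
  "face_mat e = (\<chi> r c. X (e c) $ r)"

private lemma det_face_mat: "det (face_mat e) = real_of_int (det (\<chi> r c. v (e c) $ r))"
  by (simp add: det_def face_mat_def real_vec_simps)

private lemma face_mat_mult: "face_mat e *v x = (\<Sum>c\<in>UNIV. x $ c *\<^sub>R X (e c))"
  by (simp add: matrix_vector_mult_def face_mat_def vec_eq_iff mult.commute)

private lemma face_sum:
  assumes "bij_betw e UNIV ({0..CARD('n)} - {i})"
  shows "(\<Sum>c\<in>UNIV. g (e c)) = (\<Sum>l\<in>{0..CARD('n)} - {i}. g l)"
  using sum.reindex_bij_betw[OF assms] by blast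

text \<open>A kernel vector, extended by 0 at the omitted vertex, is a relation among all vertices.
  It is a multiple of the positive vector \<open>b\<close>, and the entry 0 makes the multiple
  zero.\<close>

lemma det_face_nz:
  assumes e: "bij_betw e UNIV ({0..CARD('n)} - {i})" and i: "i \<in> {0..CARD('n)}"
  shows "det (face_mat e) \<noteq> 0"
proof -
  from barycentric_zero obtain b where b': "\<forall>i\<in>{0..CARD('n)}. 0 < b i" "(\<Sum>i\<in>{0..CARD('n)}. b i *\<^sub>R X i) = 0"
    "\<forall>a. (\<Sum>i\<in>{0..CARD('n)}. a i *\<^sub>R X i) = 0 \<longrightarrow> (\<exists>s. \<forall>i\<in>{0..CARD('n)}. a i = s * b i)" by (elim exE conjE)
  note b = b'(1)[rule_format] b'(2) b'(3)[rule_format]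
  have "x = 0" if x: "face_mat e *v x = 0" for x
  proof -
    define a where "a = (\<lambda>l. if l = i then 0 else x $ the_inv_into UNIV e l)"
    have inj: "inj e" using e by (simp add: bij_betw_def)
    have ae: "a (e c) = x $ c" for c
      using e bij_betwE[OF e] by (auto simp: a_def the_inv_into_f_f[OF inj])
    have "0 = (\<Sum>c\<in>UNIV. a (e c) *\<^sub>R X (e c))" using x by (simp add: face_mat_mult ae)
    also have "\<dots> = (\<Sum>l\<in>{0..CARD('n)} - {i}. a l *\<^sub>R X l)" by (rule face_sum[OF e])
    also have "\<dots> = (\<Sum>l\<in>{0..CARD('n)}. a l *\<^sub>R X l)" using i by (subst sum.remove[of "{0..CARD('n)}" i]) (auto simp: a_def)
    finally obtain s where s: "\<forall>l\<in>{0..CARD('n)}. a l = s * b l" using b(3)[of a] by auto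
    then have "a i = s * b i" using i by blast
    then have "s * b i = 0" by (simp add: a_def)
    then have "s = 0" using b(1)[OF i] by auto
    then have "x $ c = 0" for c using s bij_betwE[OF e] ae[of c] by auto
    then show ?thesis by (simp add: vec_eq_iff)
  qed
  then have K: "x = 0" if "face_mat e *v x = 0" for x using that by blast
  have "inj ((*v) (face_mat e))"
  proof (rule injI)
    fix x y assume "face_mat e *v x = face_mat e *v y"
    then have "face_mat e *v (x - y) = 0" by (simp add: matrix_vector_mult_diff_distrib)
    then show "x = y" using K[of "x - y"] by simp
  qed
  then have "invertible (face_mat e)"
    by (simp add: invertible_left_inverse matrix_left_invertible_injective)
  then show ?thesis by (simp add: invertible_det_nz)
qed

text \<open>Two enumerations of a face differ by a permutation of the columns, so the choice made in
  \<open>simplex_weight\<close> does not affect the weight.\<close>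

lemma abs_det_face:
  assumes e: "bij_betw e UNIV ({0..CARD('n)} - {i})" and e': "bij_betw e' UNIV ({0..CARD('n)} - {i})"
  shows "\<bar>det (face_mat e)\<bar> = \<bar>det (face_mat e')\<bar>"
proof -
  define p where "p = the_inv_into UNIV e' \<circ> e"
  have "bij_betw (the_inv_into UNIV e') ({0..CARD('n)} - {i}) UNIV" by (rule bij_betw_the_inv_into[OF e'])
  then have "bij_betw p UNIV UNIV" unfolding p_def by (rule bij_betw_trans[OF e])
  then have p: "p permutes UNIV" by (rule bij_imp_permutes) simp
  have "e' (p c) = e c" for c
    using e e' bij_betwE[OF e] by (auto simp: p_def bij_betw_def intro: f_the_inv_into_f)
  then have "face_mat e = (\<chi> r c. face_mat e' $ r $ p c)" by (simp add: face_mat_def)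
  then have "det (face_mat e) = of_int (sign p) * det (face_mat e')" by (simp add: det_permute_columns[OF p])
  then show ?thesis by (simp add: abs_mult sign_def)
qed

lemma simplex_weight_face:
  assumes e: "bij_betw e UNIV ({0..CARD('n)} - {i})" and i: "i \<in> {0..CARD('n)}"
  shows "real (simplex_weight v i) = \<bar>det (face_mat e)\<bar>"
proof -
  define e0 where "e0 = (SOME e :: 'n \<Rightarrow> nat. bij_betw e UNIV ({0..CARD('n)} - {i}))"
  have e0: "bij_betw e0 UNIV ({0..CARD('n)} - {i})" unfolding e0_def by (rule someI[of _ e]) (rule e)
  have "real (simplex_weight v i) = \<bar>det (face_mat e0)\<bar>"
    by (simp add: simplex_weight_def Let_def e0_def[symmetric] det_face_mat)
  also have "\<dots> = \<bar>det (face_mat e)\<bar>" by (rule abs_det_face[OF e0 e])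
  finally show ?thesis .
qed

lemma ex_face_enum:
  assumes "i \<in> {0..CARD('n)}"
  obtains e :: "'n \<Rightarrow> nat" where "bij_betw e UNIV ({0..CARD('n)} - {i})"
proof -
  have "card (UNIV :: 'n set) = card ({0..CARD('n)} - {i})" using assms by simp
  then show ?thesis using finite_same_card_bij[of "UNIV :: 'n set" "{0..CARD('n)} - {i}"] that by auto
qed

lemma simplex_weight_pos:
  assumes "i \<in> {0..CARD('n)}" shows "0 < simplex_weight v i"
proof -
  obtain e :: "'n \<Rightarrow> nat" where e: "bij_betw e UNIV ({0..CARD('n)} - {i})" using ex_face_enum[OF assms] .
  show ?thesis using simplex_weight_face[OF e assms] det_face_nz[OF e assms] by linarith
qed

text \<open>Cramer's rule for expressing the vertex \<open>i\<close> by the others: the coefficient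
  of the vertex \<open>k\<close> is - b_k / b_i. It is also a quotient of face determinants, because
  putting the vertex \<open>i\<close> in place of \<open>k\<close> enumerates the face omitting
  \<open>k\<close>.\<close>

lemma weights_barycentric:
  assumes b: "\<And>i. i \<in> {0..CARD('n)} \<Longrightarrow> 0 < b i" "(\<Sum>i\<in>{0..CARD('n)}. b i *\<^sub>R X i) = 0" and ik: "i \<in> {0..CARD('n)}" "k \<in> {0..CARD('n)}"
  shows "b k * real (simplex_weight v i) = b i * real (simplex_weight v k)"
proof (cases "i = k")
  case False
  obtain e :: "'n \<Rightarrow> nat" where e: "bij_betw e UNIV ({0..CARD('n)} - {i})" using ex_face_enum[OF ik(1)] .
  have im: "range e = {0..CARD('n)} - {i}" using e by (simp add: bij_betw_def)
  then have "k \<in> range e" using ik(2) False by blast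
  then obtain c0 where c0: "e c0 = k" by (elim rangeE) simp
  have inj: "inj e" using e by (simp add: bij_betw_def)
  define x :: "real^'n" where "x = (\<chi> c. - b (e c) / b i)"
  have "face_mat e *v x = (\<Sum>l\<in>{0..CARD('n)} - {i}. (- b l / b i) *\<^sub>R X l)"
    unfolding face_mat_mult x_def using face_sum[OF e, of "\<lambda>l. (- b l / b i) *\<^sub>R X l"] by simp
  also have "\<dots> = (- 1 / b i) *\<^sub>R (\<Sum>l\<in>{0..CARD('n)} - {i}. b l *\<^sub>R X l)" by (simp add: scaleR_sum_right)
  also have "(\<Sum>l\<in>{0..CARD('n)} - {i}. b l *\<^sub>R X l) = - b i *\<^sub>R X i"
  proof -
    have "b i *\<^sub>R X i + (\<Sum>l\<in>{0..CARD('n)} - {i}. b l *\<^sub>R X l) = 0"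
      using b(2) sum.remove[of "{0..CARD('n)}" i "\<lambda>l. b l *\<^sub>R X l"] ik(1) by simp
    then show ?thesis by (simp add: add_eq_0_iff)
  qed
  also have "(- 1 / b i) *\<^sub>R (- b i *\<^sub>R X i) = X i" using b(1)[OF ik(1)] by simp
  finally have "x = (\<chi> c. det (\<chi> r j. if j = c then X i $ r else face_mat e $ r $ j) / det (face_mat e))"
    using cramer[OF det_face_nz[OF e ik(1)]] by simp
  then have "x $ c0 = det (\<chi> r j. if j = c0 then X i $ r else face_mat e $ r $ j) / det (face_mat e)" by simp
  also have "(\<chi> r j. if j = c0 then X i $ r else face_mat e $ r $ j) = face_mat (e(c0 := i))"
    by (auto simp: face_mat_def vec_eq_iff)
  finally have xc: "- b k / b i = det (face_mat (e(c0 := i))) / det (face_mat e)" using c0 by (simp add: x_def)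
  have e': "bij_betw (e(c0 := i)) UNIV ({0..CARD('n)} - {k})"
  proof (rule bij_betw_imageI)
    show "inj_on (e(c0 := i)) UNIV"
    proof (rule inj_onI)
      fix x y assume eq: "(e(c0 := i)) x = (e(c0 := i)) y"
      have ni: "e z \<noteq> i" for z using im by blast
      show "x = y" using eq ni[of x] ni[of y] inj by (auto simp: inj_eq split: if_splits)
    qed
    have "(e(c0 := i)) ` UNIV = insert i (e ` (UNIV - {c0}))" by auto
    also have "e ` (UNIV - {c0}) = range e - {k}" unfolding c0[symmetric] using inj by (simp add: image_set_diff)
    also have "insert i (range e - {k}) = {0..CARD('n)} - {k}"
    proof -
      have "insert i (A - {i} - {k}) = A - {k}" if "i \<in> A" "i \<noteq> k" for A :: "nat set" using that by blast
      from this[OF ik(1) False] show ?thesis unfolding im .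
    qed
    finally show "(e(c0 := i)) ` UNIV = {0..CARD('n)} - {k}" .
  qed
  have "\<bar>- b k / b i\<bar> = b k / b i" using b(1)[OF ik(1)] b(1)[OF ik(2)] by simp
  then have "b k / b i = real (simplex_weight v k) / real (simplex_weight v i)"
    unfolding xc simplex_weight_face[OF e ik(1)] simplex_weight_face[OF e' ik(2)] by (simp add: abs_divide)
  then show ?thesis using b(1)[OF ik(1)] simplex_weight_pos[OF ik(1)] by (simp add: field_simps)
qed simp

context
  fixes q :: "nat \<Rightarrow> nat"
  assumes q: "\<And>i. i \<in> {0..CARD('n)} \<Longrightarrow> q i = simplex_weight v i"
begin

lemma weight_kernel_real:
  "(\<Sum>i\<in>{0..CARD('n)}. real (q i) *\<^sub>R X i) = 0"
  "(\<Sum>i\<in>{0..CARD('n)}. a i *\<^sub>R X i) = 0 \<Longrightarrow> \<exists>s. \<forall>i\<in>{0..CARD('n)}. a i = s * real (q i)"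
proof -
  from barycentric_zero obtain b where b': "\<forall>i\<in>{0..CARD('n)}. 0 < b i" "(\<Sum>i\<in>{0..CARD('n)}. b i *\<^sub>R X i) = 0"
    "\<forall>a. (\<Sum>i\<in>{0..CARD('n)}. a i *\<^sub>R X i) = 0 \<longrightarrow> (\<exists>s. \<forall>i\<in>{0..CARD('n)}. a i = s * b i)" by (elim exE conjE)
  note b = b'(1)[rule_format] b'(2) b'(3)[rule_format]
  define t where "t = real (q 0) / b 0"
  have 0: "0 \<in> {0..CARD('n)}" by simp
  have t: "real (q i) = t * b i" if "i \<in> {0..CARD('n)}" for i
    using weights_barycentric[OF b(1,2) that 0] b(1)[OF 0] q[OF that] q[OF 0] by (simp add: t_def field_simps)
  have tp: "t > 0" unfolding t_def using b(1)[OF 0] q[OF 0] simplex_weight_pos[OF 0] by simp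
  have "(\<Sum>i\<in>{0..CARD('n)}. real (q i) *\<^sub>R X i) = t *\<^sub>R (\<Sum>i\<in>{0..CARD('n)}. b i *\<^sub>R X i)"
    by (simp add: scaleR_sum_right t)
  then show "(\<Sum>i\<in>{0..CARD('n)}. real (q i) *\<^sub>R X i) = 0" using b(2) by simp
  assume "(\<Sum>i\<in>{0..CARD('n)}. a i *\<^sub>R X i) = 0"
  then obtain s where "\<forall>i\<in>{0..CARD('n)}. a i = s * b i" using b(3) by blast
  then show "\<exists>s. \<forall>i\<in>{0..CARD('n)}. a i = s * real (q i)" using t tp by (intro exI[of _ "s / t"]) auto
qed

lemma weight_relation: "(\<Sum>i\<in>{0..CARD('n)}. int (q i) * v i $ j) = 0"
proof -
  have "real_of_int (\<Sum>i\<in>{0..CARD('n)}. int (q i) * v i $ j) = (\<Sum>i\<in>{0..CARD('n)}. real (q i) *\<^sub>R X i) $ j"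
    by (simp add: real_vec_simps)
  then have "real_of_int (\<Sum>i\<in>{0..CARD('n)}. int (q i) * v i $ j) = 0" unfolding weight_kernel_real(1) by simp
  then show ?thesis by (simp only: of_int_eq_0_iff)
qed

text \<open>Over the reals an integer relation is s times \<open>q\<close>. Pairing it with a Bezout
  combination of the reduced weights exhibits s as an integer.\<close>

lemma weight_kernel:
  assumes gcd: "Gcd (q ` {0..CARD('n)}) = 1" and c: "\<And>j. (\<Sum>i\<in>{0..CARD('n)}. c i * v i $ j) = 0"
  shows "\<exists>r. \<forall>i\<in>{0..CARD('n)}. c i = r * int (q i)"
proof -
  have "(\<Sum>i\<in>{0..CARD('n)}. real_of_int (c i) *\<^sub>R X i) = 0"
  proof (subst vec_eq_iff, rule allI)
    fix j
    have "(\<Sum>i\<in>{0..CARD('n)}. real_of_int (c i) *\<^sub>R X i) $ j = real_of_int (\<Sum>i\<in>{0..CARD('n)}. c i * v i $ j)"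
      by (simp add: real_vec_simps)
    then show "(\<Sum>i\<in>{0..CARD('n)}. real_of_int (c i) *\<^sub>R X i) $ j = 0 $ j" by (simp add: c)
  qed
  from weight_kernel_real(2)[OF this] obtain s where s: "\<forall>i\<in>{0..CARD('n)}. real_of_int (c i) = s * real (q i)" by blast
  obtain y :: "nat \<Rightarrow> int" where y: "(\<Sum>i\<in>{0..CARD('n)}. y i * int (q i)) = 1" using bezout_Gcd[of q "CARD('n)"] unfolding gcd by auto
  have "s = s * real_of_int (\<Sum>i\<in>{0..CARD('n)}. y i * int (q i))" unfolding y by simp
  also have "\<dots> = (\<Sum>i\<in>{0..CARD('n)}. real_of_int (y i) * (s * real (q i)))" by (simp add: sum_distrib_left mult_ac)
  also have "\<dots> = real_of_int (\<Sum>i\<in>{0..CARD('n)}. y i * c i)" using s by simp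
  finally have "real_of_int (c i) = real_of_int ((\<Sum>i\<in>{0..CARD('n)}. y i * c i) * int (q i))" if "i \<in> {0..CARD('n)}" for i
    using s that by simp
  then show ?thesis by (intro exI[of _ "\<Sum>i\<in>{0..CARD('n)}. y i * c i"]) (auto simp del: of_int_mult)
qed

text \<open>By Cramer's rule the face omitting the vertex \<open>i\<close> generates a lattice that
  contains q_i m for every integral m. As the weights have gcd 1, a Bezout combination over all
  faces gives m itself.\<close>

lemma simplex_generates:
  assumes gcd: "Gcd (q ` {0..CARD('n)}) = 1"
  shows "\<exists>c. \<forall>j. m $ j = (\<Sum>i\<in>{0..CARD('n)}. c i * v i $ j)"
proof -
  have "\<exists>c. \<forall>j. int (q i) * m $ j = (\<Sum>l\<in>{0..CARD('n)}. c l * v l $ j)" if i: "i \<in> {0..CARD('n)}" for i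
  proof -
    obtain e :: "'n \<Rightarrow> nat" where e: "bij_betw e UNIV ({0..CARD('n)} - {i})" using ex_face_enum[OF i] .
    have inj: "inj e" using e by (simp add: bij_betw_def)
    define z where "z = (\<lambda>c. det (\<chi> r j. if j = c then m $ r else v (e j) $ r))"
    define dt where "dt = det (\<chi> r c. v (e c) $ r)"
    have dt: "det (face_mat e) = real_of_int dt" unfolding dt_def by (rule det_face_mat)
    have z: "det (\<chi> r j. if j = c then real_vec m $ r else face_mat e $ r $ j) = real_of_int (z c)" for c
      unfolding z_def det_def by (simp add: face_mat_def real_vec_simps if_distrib[of real_of_int] cong: if_cong)
    have nz: "det (face_mat e) \<noteq> 0" by (rule det_face_nz[OF e i])
    define x :: "real^'n" where "x = (\<chi> c. real_of_int (z c) / det (face_mat e))"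
    have "face_mat e *v x = real_vec m" using cramer[OF nz, of x "real_vec m"] by (simp add: x_def z)
    then have eq: "(\<Sum>c\<in>UNIV. x $ c * X (e c) $ j) = real_vec m $ j" for j
      unfolding face_mat_mult by (drule_tac arg_cong[where f = "\<lambda>u. u $ j"]) simp
    have "real_of_int (dt * m $ j) = real_of_int (\<Sum>c\<in>UNIV. z c * v (e c) $ j)" for j
    proof -
      have "real_of_int (dt * m $ j) = det (face_mat e) * (\<Sum>c\<in>UNIV. x $ c * X (e c) $ j)"
        unfolding eq by (simp add: dt real_vec_simps)
      also have "\<dots> = (\<Sum>c\<in>UNIV. real_of_int (z c) * real_of_int (v (e c) $ j))"
        using nz by (simp add: sum_distrib_left x_def real_vec_simps)
      finally show ?thesis by simp
    qed
    then have dm: "dt * m $ j = (\<Sum>c\<in>UNIV. z c * v (e c) $ j)" for j by (simp only: of_int_eq_iff)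
    \<comment> \<open>The sign turns the determinant into its absolute value, which is the
      weight.\<close>
    define a where "a = (\<lambda>l. if l = i then 0 else sgn dt * z (the_inv_into UNIV e l))"
    have ae: "a (e c) = sgn dt * z c" for c
      using bij_betwE[OF e] by (auto simp: a_def the_inv_into_f_f[OF inj])
    have "real (q i) = \<bar>real_of_int dt\<bar>" using simplex_weight_face[OF e i] q[OF i] dt by simp
    then have "real_of_int (int (q i)) = real_of_int \<bar>dt\<bar>" by simp
    then have "int (q i) = sgn dt * dt" by (simp only: of_int_eq_iff abs_sgn mult.commute)
    then have "int (q i) * m $ j = (\<Sum>l\<in>{0..CARD('n)}. a l * v l $ j)" for j
    proof -
      assume *: "int (q i) = sgn dt * dt"
      have "int (q i) * m $ j = sgn dt * (\<Sum>c\<in>UNIV. z c * v (e c) $ j)" by (simp add: * mult.assoc dm)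
      also have "\<dots> = (\<Sum>c\<in>UNIV. a (e c) * v (e c) $ j)" by (simp add: sum_distrib_left ae mult.assoc)
      also have "\<dots> = (\<Sum>l\<in>{0..CARD('n)} - {i}. a l * v l $ j)" by (rule face_sum[OF e])
      also have "\<dots> = (\<Sum>l\<in>{0..CARD('n)}. a l * v l $ j)" using i by (subst sum.remove[of "{0..CARD('n)}" i]) (auto simp: a_def)
      finally show ?thesis .
    qed
    then show ?thesis by blast
  qed
  then have "\<forall>i\<in>{0..CARD('n)}. \<exists>c. \<forall>j. int (q i) * m $ j = (\<Sum>l\<in>{0..CARD('n)}. c l * v l $ j)" by blast
  from bchoice[OF this] obtain c where
    c: "\<forall>i\<in>{0..CARD('n)}. \<forall>j. int (q i) * m $ j = (\<Sum>l\<in>{0..CARD('n)}. c i l * v l $ j)" by blast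
  obtain y :: "nat \<Rightarrow> int" where y: "(\<Sum>i\<in>{0..CARD('n)}. y i * int (q i)) = 1" using bezout_Gcd[of q "CARD('n)"] unfolding gcd by auto
  have "m $ j = (\<Sum>l\<in>{0..CARD('n)}. (\<Sum>i\<in>{0..CARD('n)}. y i * c i l) * v l $ j)" for j
  proof -
    have "m $ j = (\<Sum>i\<in>{0..CARD('n)}. y i * int (q i)) * m $ j" unfolding y by simp
    also have "\<dots> = (\<Sum>i\<in>{0..CARD('n)}. y i * (int (q i) * m $ j))" by (simp add: sum_distrib_right mult.assoc)
    also have "\<dots> = (\<Sum>i\<in>{0..CARD('n)}. \<Sum>l\<in>{0..CARD('n)}. y i * c i l * v l $ j)" by (simp add: c sum_distrib_left mult.assoc)
    also have "\<dots> = (\<Sum>l\<in>{0..CARD('n)}. \<Sum>i\<in>{0..CARD('n)}. y i * c i l * v l $ j)" by (rule sum.swap)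
    finally show ?thesis by (simp add: sum_distrib_right)
  qed
  then show ?thesis by (intro exI[of _ "\<lambda>l. \<Sum>i\<in>{0..CARD('n)}. y i * c i l"]) blast
qed

text \<open>The values on the vertices of a face can be prescribed because the face matrix is
  invertible; the relation with coefficients \<open>q\<close> then determines the value at the
  omitted vertex.\<close>

lemma ex_functional:
  assumes i: "i \<in> {0..CARD('n)}"
  obtains y :: "real^'n" where "\<And>l. l \<in> {0..CARD('n)} \<Longrightarrow> l \<noteq> i \<Longrightarrow> y \<bullet> X l = t l"
    "real (q i) * (y \<bullet> X i) = - (\<Sum>l\<in>{0..CARD('n)} - {i}. real (q l) * t l)"
proof -
  obtain e :: "'n \<Rightarrow> nat" where e: "bij_betw e UNIV ({0..CARD('n)} - {i})" using ex_face_enum[OF i] .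
  have "det (transpose (face_mat e)) \<noteq> 0" using det_face_nz[OF e i] by (simp add: det_transpose)
  then obtain y :: "real^'n" where y: "transpose (face_mat e) *v y = (\<chi> c. t (e c))"
    using cramer[of "transpose (face_mat e)" _ "\<chi> c. t (e c)"] by blast
  have ye: "y \<bullet> X (e c) = t (e c)" for c
  proof -
    have "y \<bullet> X (e c) = (transpose (face_mat e) *v y) $ c"
      by (simp add: matrix_vector_mult_def transpose_def face_mat_def inner_vec_def mult.commute)
    then show ?thesis unfolding y by simp
  qed
  have yl: "y \<bullet> X l = t l" if "l \<in> {0..CARD('n)}" "l \<noteq> i" for l
  proof -
    have "range e = {0..CARD('n)} - {i}" using e by (simp add: bij_betw_def)
    then have "l \<in> range e" using that by blast
    then show ?thesis using ye by (elim rangeE) simp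
  qed
  have "0 = y \<bullet> (\<Sum>l\<in>{0..CARD('n)}. real (q l) *\<^sub>R X l)" by (simp add: weight_kernel_real(1))
  also have "\<dots> = (\<Sum>l\<in>{0..CARD('n)}. real (q l) * (y \<bullet> X l))" by (simp add: inner_sum_right)
  also have "\<dots> = real (q i) * (y \<bullet> X i) + (\<Sum>l\<in>{0..CARD('n)} - {i}. real (q l) * t l)"
    using i yl by (simp add: sum.remove[of "{0..CARD('n)}" i])
  finally have "real (q i) * (y \<bullet> X i) = - (\<Sum>l\<in>{0..CARD('n)} - {i}. real (q l) * t l)" by simp
  from that[OF yl this] show ?thesis .
qed

text \<open>A linear form that sees two vertices only. Applied to the relations of the Gauss-Manin
  system, it leaves just two shifted monomials, which can then be exchanged for each other.\<close>

lemma pair_functional: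
  assumes jk: "j \<in> {0..CARD('n)}" "k \<in> {0..CARD('n)}" "j \<noteq> k"
  obtains y :: "'n \<Rightarrow> real" where "\<And>l. l \<in> {0..CARD('n)} \<Longrightarrow>
    (\<Sum>a\<in>UNIV. y a * real_of_int (v l $ a)) = (if l = j then real (q k) else if l = k then - real (q j) else 0)"
proof -
  obtain y :: "real^'n" where y: "\<And>l. l \<in> {0..CARD('n)} \<Longrightarrow> l \<noteq> k \<Longrightarrow> y \<bullet> X l = (if l = j then real (q k) else 0)"
    "real (q k) * (y \<bullet> X k) = - (\<Sum>l\<in>{0..CARD('n)} - {k}. real (q l) * (if l = j then real (q k) else 0))"
    using ex_functional[OF jk(2), of "\<lambda>l. if l = j then real (q k) else 0"] by blast
  have "(\<Sum>l\<in>{0..CARD('n)} - {k}. real (q l) * (if l = j then real (q k) else 0)) = real (q j) * real (q k)"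
    using jk by (subst sum.remove[of _ j]) auto
  then have "real (q k) * (y \<bullet> X k) = real (q k) * - real (q j)" unfolding y(2) by simp
  moreover have "real (q k) \<noteq> 0" using simplex_weight_pos[OF jk(2)] q[OF jk(2)] by simp
  ultimately have "y \<bullet> X k = - real (q j)" by (metis mult_left_cancel)
  then have "y \<bullet> X l = (if l = j then real (q k) else if l = k then - real (q j) else 0)" if "l \<in> {0..CARD('n)}" for l
    using y(1)[OF that] jk by auto
  then show ?thesis using that[of "\<lambda>a. y $ a"] by (simp add: inner_vec_def real_vec_simps)
qed

text \<open>The form \<open>y\<close> with value 1 on all vertices except \<open>i\<close> lies in
  the polar polytope. In a convex combination of lattice points giving \<open>y\<close>, any point
  \<open>s\<close> of positive coefficient must take the same maximal value 1 on those vertices.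
  Pairing \<open>s\<close> with the relation among the vertices yields mu = q_i (1 - t), where t is
  the integral value of \<open>s\<close> at the vertex \<open>i\<close>.\<close>

lemma reflexive_dvd:
  assumes refl: "reflexive_polytope (simplex_hull v)" and i: "i \<in> {0..CARD('n)}"
  shows "q i dvd (\<Sum>l\<in>{0..CARD('n)}. q l)"
proof -
  obtain S :: "(int^'n) set" where S: "finite S" "polar_set (simplex_hull v) = convex hull (real_vec ` S)"
    using refl unfolding reflexive_polytope_def lattice_polytope_def by blast
  obtain y :: "real^'n" where y: "\<And>l. l \<in> {0..CARD('n)} \<Longrightarrow> l \<noteq> i \<Longrightarrow> y \<bullet> X l = 1"
    "real (q i) * (y \<bullet> X i) = - (\<Sum>l\<in>{0..CARD('n)} - {i}. real (q l) * 1)"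
    using ex_functional[OF i, of "\<lambda>l. 1"] by blast
  have qi: "real (q i) > 0" using simplex_weight_pos[OF i] q[OF i] by simp
  \<comment> \<open>The remaining inequality for \<open>y\<close> to belong to the polar
    polytope.\<close>
  have "real (q i) * (y \<bullet> X i) \<le> 0" unfolding y(2) by (simp add: sum_nonneg)
  then have yi: "y \<bullet> X i \<le> 0" using qi by (simp add: mult_le_0_iff)
  have "simplex_hull v \<subseteq> {x. y \<bullet> x \<le> 1}"
    unfolding simplex_hull_def
  proof (rule hull_minimal)
    show "X ` {0..CARD('n)} \<subseteq> {x. y \<bullet> x \<le> 1}" using y(1) yi by force
    show "convex {x. y \<bullet> x \<le> 1}" by (rule convex_halfspace_le)
  qed
  then have "y \<in> convex hull (real_vec ` S)" unfolding S(2)[symmetric] polar_set_def by blast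
  then obtain u where u: "\<forall>x\<in>real_vec ` S. 0 \<le> u x" "sum u (real_vec ` S) = 1" "(\<Sum>x\<in>real_vec ` S. u x *\<^sub>R x) = y"
    unfolding convex_hull_finite[OF finite_imageI[OF S(1)]] by blast
  have "\<exists>s\<in>real_vec ` S. 0 < u s"
  proof (rule ccontr)
    assume "\<not> ?thesis"
    then have "u x = 0" if "x \<in> real_vec ` S" for x using u(1) that by force
    then have "sum u (real_vec ` S) = 0" by (rule sum.neutral[OF ballI])
    then show False using u(2) by simp
  qed
  then obtain s where s: "s \<in> S" "0 < u (real_vec s)" by blast
  have le: "x \<bullet> X l \<le> 1" if "x \<in> real_vec ` S" "l \<in> {0..CARD('n)}" for x l
  proof -
    have "x \<in> polar_set (simplex_hull v)" unfolding S(2) using that by (simp add: hull_inc)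
    moreover have "X l \<in> simplex_hull v" unfolding simplex_hull_def using that by (intro hull_inc) auto
    ultimately show ?thesis by (simp add: polar_set_def)
  qed
  have s1: "real_vec s \<bullet> X l = 1" if l: "l \<in> {0..CARD('n)}" "l \<noteq> i" for l
  proof -
    have "(\<Sum>x\<in>real_vec ` S. u x * (1 - x \<bullet> X l)) = sum u (real_vec ` S) - (\<Sum>x\<in>real_vec ` S. u x *\<^sub>R x) \<bullet> X l"
      by (simp add: inner_sum_left sum_subtractf right_diff_distrib)
    also have "\<dots> = 0" unfolding u(2,3) using y(1)[OF l] by simp
    finally have "\<forall>x\<in>real_vec ` S. u x * (1 - x \<bullet> X l) = 0"
      using u(1) le l(1) S(1) by (subst (asm) sum_nonneg_eq_0_iff) auto
    then show ?thesis using s by auto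
  qed
  define t where "t = (\<Sum>a\<in>UNIV. s $ a * v i $ a)"
  have t: "real_vec s \<bullet> X i = real_of_int t" by (simp add: t_def inner_vec_def real_vec_simps)
  have "0 = real_vec s \<bullet> (\<Sum>l\<in>{0..CARD('n)}. real (q l) *\<^sub>R X l)" by (simp add: weight_kernel_real(1))
  also have "\<dots> = (\<Sum>l\<in>{0..CARD('n)}. real (q l) * (real_vec s \<bullet> X l))" by (simp add: inner_sum_right)
  also have "\<dots> = real (q i) * real_of_int t + (\<Sum>l\<in>{0..CARD('n)} - {i}. real (q l))"
    using i s1 by (simp add: sum.remove[of "{0..CARD('n)}" i] t)
  also have "(\<Sum>l\<in>{0..CARD('n)} - {i}. real (q l)) = real (\<Sum>l\<in>{0..CARD('n)}. q l) - real (q i)" using i by (simp add: sum.remove[of "{0..CARD('n)}" i])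
  finally have "real_of_int (int (\<Sum>l\<in>{0..CARD('n)}. q l)) = real_of_int (int (q i) * (1 - t))" by (simp add: algebra_simps)
  then have "int (\<Sum>l\<in>{0..CARD('n)}. q l) = int (q i) * (1 - t)" by (simp only: of_int_eq_iff)
  then have "int (q i) dvd int (\<Sum>l\<in>{0..CARD('n)}. q l)" by simp
  then show ?thesis by (simp only: int_dvd_int_iff)
qed

end

end

section \<open>Top degree forms\<close>

definition swap_nth :: "nat \<Rightarrow> nat \<Rightarrow> 'a list \<Rightarrow> 'a list" where
  "swap_nth i j l = l[i := l ! j, j := l ! i]"

lemma length_swap_nth [simp]: "length (swap_nth i j l) = length l"
  by (simp add: swap_nth_def)

lemma nth_swap_nth:
  assumes "i < length l" "j < length l" "k < length l"
  shows "swap_nth i j l ! k = (if k = j then l ! i else if k = i then l ! j else l ! k)"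
  using assms by (auto simp: swap_nth_def nth_list_update)

lemma swap_nth_commute: "i < length l \<Longrightarrow> j < length l \<Longrightarrow> swap_nth i j l = swap_nth j i l"
  by (rule nth_equalityI) (auto simp: nth_swap_nth)

lemma swap_nth_self: "i < length l \<Longrightarrow> j < length l \<Longrightarrow> l ! i = l ! j \<Longrightarrow> swap_nth i j l = l"
  by (rule nth_equalityI) (auto simp: nth_swap_nth)

lemma distinct_swap_nth: "i < length l \<Longrightarrow> j < length l \<Longrightarrow> distinct (swap_nth i j l) = distinct l"
  by (simp add: swap_nth_def)

lemma length_drop_nth [simp]: "k < length l \<Longrightarrow> length (drop_nth k l) = length l - 1"
  by (simp add: drop_nth_def)

lemma nth_drop_nth:
  assumes "k < length l" "m < length l - 1"
  shows "drop_nth k l ! m = (if m < k then l ! m else l ! Suc m)"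
  using assms by (auto simp: drop_nth_def nth_append)

text \<open>A longer transposition is a shorter one conjugated by an adjacent transposition, and the
  conjugation contributes two cancelling signs.\<close>

lemma alternating_adjacent:
  fixes F :: "'a list \<Rightarrow> 'b::ab_group_add"
  assumes adj: "\<And>l p. Suc p < length l \<Longrightarrow> F (swap_nth p (Suc p) l) = - F l"
    and ij: "i < length l" "j < length l" "i \<noteq> j"
  shows "F (swap_nth i j l) = - F l"
proof -
  have *: "F (swap_nth i (Suc (i + d)) l) = - F l" if "Suc (i + d) < length l" for i d l
    using that
  proof (induction d arbitrary: l)
    case 0 then show ?case using adj[of i l] by simp
  next
    case (Suc d)
    let ?s = "swap_nth (Suc (i + d)) (Suc (Suc (i + d)))"
    have "swap_nth i (Suc (i + Suc d)) l = ?s (swap_nth i (Suc (i + d)) (?s l))"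
      by (rule nth_equalityI) (use Suc.prems in \<open>auto simp: nth_swap_nth\<close>)
    then show ?case using Suc adj[of "Suc (i + d)"] by simp
  qed
  consider "i < j" | "j < i" using ij(3) by linarith
  then show ?thesis
  proof cases
    case 1 then show ?thesis using *[of i "j - i - 1" l] ij by simp
  next
    case 2 then show ?thesis using *[of j "i - j - 1" l] ij by (simp add: swap_nth_commute)
  qed
qed

text \<open>The exterior derivative and the product with a 1-form both have the shape below.\<close>

lemma alternating_contraction_sum:
  fixes T :: "'a \<Rightarrow> 'b::comm_ring_1 \<Rightarrow> 'b"
  assumes T: "\<And>i g. T i (- g) = - T i g"
    and alt: "\<And>l i j. i < length l \<Longrightarrow> j < length l \<Longrightarrow> i \<noteq> j \<Longrightarrow> \<omega> (swap_nth i j l) = - \<omega> l"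
    and ij: "i < length l" "j < length l" "i \<noteq> j"
  shows "(\<Sum>k<length l. (-1) ^ k * T (swap_nth i j l ! k) (\<omega> (drop_nth k (swap_nth i j l)))) =
    - (\<Sum>k<length l. (-1) ^ k * T (l ! k) (\<omega> (drop_nth k l)))"
proof -
  define F where "F = (\<lambda>l. \<Sum>k<length l. (-1) ^ k * T (l ! k) (\<omega> (drop_nth k l)))"
  have "F (swap_nth p (Suc p) l) = - F l" if p: "Suc p < length l" for l p
  proof -
    let ?l = "swap_nth p (Suc p) l" and ?\<sigma> = "Transposition.transpose p (Suc p)"
    let ?t = "\<lambda>l k. (-1) ^ k * T (l ! k) (\<omega> (drop_nth k l))"
    \<comment> \<open>If the removed position lies outside the exchanged pair, the exchange survives
      in the shortened list and gives the sign. If it belongs to the pair, the two terms change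
      places and the sign comes from (-1)^k.\<close>
    have t: "?t ?l k = - ?t l (?\<sigma> k)" if k: "k < length l" for k
    proof -
      consider "k < p" | "k = p" | "k = Suc p" | "k > Suc p" by linarith
      then show ?thesis
      proof cases
        case 1
        have "drop_nth k ?l = swap_nth (p - 1) p (drop_nth k l)"
          by (rule nth_equalityI) (use 1 p k in \<open>auto simp: nth_swap_nth nth_drop_nth\<close>)
        moreover have "\<omega> (swap_nth (p - 1) p (drop_nth k l)) = - \<omega> (drop_nth k l)"
          using 1 p k by (intro alt) auto
        ultimately show ?thesis using 1 p k by (simp add: nth_swap_nth T Transposition.transpose_def)
      next
        case 2
        have "drop_nth k ?l = drop_nth (Suc p) l"
          by (rule nth_equalityI) (use 2 p k in \<open>auto simp: nth_swap_nth nth_drop_nth less_Suc_eq\<close>)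
        then show ?thesis using 2 p by (simp add: nth_swap_nth Transposition.transpose_def)
      next
        case 3
        have "drop_nth k ?l = drop_nth p l"
          by (rule nth_equalityI) (use 3 p k in \<open>auto simp: nth_swap_nth nth_drop_nth less_Suc_eq\<close>)
        then show ?thesis using 3 p by (simp add: nth_swap_nth Transposition.transpose_def)
      next
        case 4
        have "drop_nth k ?l = swap_nth p (Suc p) (drop_nth k l)"
          by (rule nth_equalityI) (use 4 p k in \<open>auto simp: nth_swap_nth nth_drop_nth\<close>)
        moreover have "\<omega> (swap_nth p (Suc p) (drop_nth k l)) = - \<omega> (drop_nth k l)"
          using 4 p k by (intro alt) auto
        ultimately show ?thesis using 4 p k by (simp add: nth_swap_nth T Transposition.transpose_def)
      qed
    qed
    have "F ?l = (\<Sum>k<length l. - ?t l (?\<sigma> k))" unfolding F_def by (intro sum.cong) (auto simp: t)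
    also have "\<dots> = (\<Sum>k<length l. - ?t l k)"
    proof (rule sum.reindex_bij_betw)
      show "bij_betw ?\<sigma> {..<length l} {..<length l}"
        using p by (intro permutes_imp_bij permutes_swap_id) auto
    qed
    also have "\<dots> = - F l" unfolding F_def by (rule sum_negf)
    finally show ?thesis .
  qed
  from alternating_adjacent[where F = F, OF this ij] show ?thesis unfolding F_def by simp
qed

lemma form_swap: "\<omega> \<in> forms p \<Longrightarrow> i < length l \<Longrightarrow> j < length l \<Longrightarrow> i \<noteq> j \<Longrightarrow> \<omega> (swap_nth i j l) = - \<omega> l"
  by (simp add: forms_def swap_nth_def)

lemma formsI:
  fixes \<omega> :: "('n::finite) form"
  assumes "\<And>l. length l \<noteq> p \<Longrightarrow> \<omega> l = 0"
    "\<And>l i j. length l = p \<Longrightarrow> i < p \<Longrightarrow> j < p \<Longrightarrow> i \<noteq> j \<Longrightarrow> \<omega> (swap_nth i j l) = - \<omega> l"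
  shows "\<omega> \<in> forms p"
  unfolding forms_def
proof (intro CollectI conjI allI impI)
  fix l :: "'n list" and i j assume ij: "i < length l \<and> j < length l \<and> i \<noteq> j"
  show "\<omega> (l[i := l ! j, j := l ! i]) = - \<omega> l"
  proof (cases "length l = p")
    case True
    then show ?thesis using assms(2)[OF True, of i j] ij unfolding swap_nth_def by blast
  next
    case False
    then have "\<omega> (l[i := l ! j, j := l ! i]) = 0" "\<omega> l = 0" by (auto intro: assms(1))
    then show ?thesis by (simp only: neg_0_equal_iff_equal neg_equal_0_iff_equal)
  qed
qed (rule assms(1))

section \<open>The volume form and the coefficient of a top form\<close>

definition enum_list :: "'n::finite list" where
  "enum_list = (SOME l. distinct l \<and> set l = (UNIV :: 'n set))"

lemma enum_list: "distinct (enum_list :: 'n::finite list)" "set (enum_list :: 'n list) = UNIV"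
  "length (enum_list :: 'n list) = CARD('n)"
proof -
  have "\<exists>l. set l = (UNIV :: 'n set) \<and> distinct l" by (rule finite_distinct_list) simp
  then have "\<exists>l. distinct l \<and> set l = (UNIV :: 'n set)" by (simp only: conj_commute)
  then have "distinct (enum_list :: 'n list) \<and> set (enum_list :: 'n list) = UNIV"
    unfolding enum_list_def by (rule someI_ex)
  then show a: "distinct (enum_list :: 'n list)" "set (enum_list :: 'n list) = UNIV" by auto
  show "length (enum_list :: 'n list) = CARD('n)" using distinct_card[OF a(1)] a(2) by simp
qed

text \<open>Selection sort from the end of the list: \<open>k\<close> bounds the positions where
  \<open>l\<close> may still differ from \<open>enum_list\<close>, and each exchange costs a
  sign.\<close>

lemma alternating_enum:
  fixes F :: "'n::finite list \<Rightarrow> 'b::ab_group_add"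
  assumes alt: "\<And>l i j. length l = CARD('n) \<Longrightarrow> i < length l \<Longrightarrow> j < length l \<Longrightarrow> i \<noteq> j \<Longrightarrow> F (swap_nth i j l) = - F l"
    and l: "distinct l" "length l = CARD('n)"
  shows "F l = F enum_list \<or> F l = - F enum_list"
proof -
  let ?e = "enum_list :: 'n list"
  have "\<forall>i<CARD('n). k \<le> i \<longrightarrow> l ! i = ?e ! i \<Longrightarrow> F l = F ?e \<or> F l = - F ?e" if "k \<le> CARD('n)" for k
    using that l
  proof (induction k arbitrary: l)
    case 0
    then have "l = ?e" by (intro nth_equalityI) (auto simp: enum_list)
    then show ?case by simp
  next
    case (Suc k)
    have "card (set l) = card (UNIV :: 'n set)" using Suc.prems(3,4) by (simp add: distinct_card)
    then have "set l = UNIV" by (intro card_subset_eq) auto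
    then have "?e ! k \<in> set l" by simp
    then obtain i where i: "i < length l" "l ! i = ?e ! k" unfolding in_set_conv_nth by blast
    have ik: "i \<le> k"
    proof (rule ccontr)
      assume "\<not> i \<le> k"
      then have "?e ! i = ?e ! k" using Suc.prems(1,4) i by auto
      then show False using enum_list[where 'n = 'n] i Suc.prems \<open>\<not> i \<le> k\<close> by (simp add: nth_eq_iff_index_eq)
    qed
    show ?case
    proof (cases "i = k")
      case True
      then have "\<forall>i<CARD('n). k \<le> i \<longrightarrow> l ! i = ?e ! i" using Suc.prems(1) i(2)
        by (auto simp: Suc_le_eq le_less)
      then show ?thesis using Suc by simp
    next
      case False
      let ?l = "swap_nth i k l"
      have k: "k < length l" using Suc.prems by simp
      have "\<forall>j<CARD('n). k \<le> j \<longrightarrow> ?l ! j = ?e ! j"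
        using Suc.prems i k ik False by (auto simp: nth_swap_nth)
      moreover have "distinct ?l" using Suc.prems(3) i k by (simp add: distinct_swap_nth)
      ultimately have "F ?l = F ?e \<or> F ?l = - F ?e" using Suc.prems Suc.IH[of ?l] by simp
      moreover have "F ?l = - F l" using alt[of l i k] Suc.prems(4) i k False by simp
      ultimately have "- F l = F ?e \<or> - F l = - F ?e" by simp
      then show ?thesis by (simp only: neg_equal_iff_equal minus_equation_iff[of "F l"]) auto
    qed
  qed
  from this[of "CARD('n)"] show ?thesis by simp
qed

lemma eq_neg_self_laurent:
  fixes x :: "'n::finite laurent_utau"
  assumes "x = - x" shows "x = 0"
proof (intro poly_mapping_eqI)
  fix m i
  have "lk (lk x m) i = - lk (lk x m) i" using assms by (metis lookup_uminus)
  then show "lk (lk x m) i = lk (lk 0 m) i" by simp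
qed

lemma top_form_eq_0:
  fixes \<omega> :: "'n::finite form"
  assumes "\<omega> \<in> forms CARD('n)" "\<omega> enum_list = 0"
  shows "\<omega> l = 0"
proof (cases "length l = CARD('n)")
  case True
  show ?thesis
  proof (cases "distinct l")
    case d: True
    show ?thesis using alternating_enum[where F = \<omega>, OF form_swap[OF assms(1)] d True] assms(2) by auto
  next
    case False
    then obtain i j where ij: "i < length l" "j < length l" "i \<noteq> j" "l ! i = l ! j" by (auto simp: distinct_conv_nth)
    then have "swap_nth i j l = l" by (intro swap_nth_self)
    then have "\<omega> l = - \<omega> l" using form_swap[OF assms(1) ij(1-3)] by simp
    then show ?thesis by (rule eq_neg_self_laurent)
  qed
qed (use assms in \<open>simp add: forms_def\<close>)

text \<open>The sign of \<open>l\<close> as a rearrangement of \<open>enum_list\<close>, and 0 on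
  lists with repetitions. As a determinant it inherits the alternating property from row
  permutations.\<close>

definition vol :: "'n::finite list \<Rightarrow> int" where
  "vol l = (if length l = CARD('n) then det (\<chi> r. axis (l ! (SOME k. k < CARD('n) \<and> enum_list ! k = r)) 1 :: int^'n^'n) else 0)"

lemma enum_idx:
  fixes r :: "'n::finite"
  defines "k \<equiv> SOME k. k < CARD('n) \<and> enum_list ! k = r"
  shows "k < CARD('n)" "enum_list ! k = r"
proof -
  have "\<exists>k. k < CARD('n) \<and> enum_list ! k = r"
    using enum_list(2)[where 'n = 'n] enum_list(3)[where 'n = 'n] by (metis UNIV_I in_set_conv_nth)
  from someI_ex[OF this] show "k < CARD('n)" "enum_list ! k = r" by (auto simp: k_def)
qed

lemma vol_enum: "vol (enum_list :: 'n::finite list) = 1"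
proof -
  have "(\<chi> r. axis (enum_list ! (SOME k. k < CARD('n) \<and> enum_list ! k = r)) 1 :: int^'n^'n) = mat 1"
    by (simp add: enum_idx(2) vec_eq_iff mat_def axis_def)
  then show ?thesis by (simp add: vol_def enum_list)
qed

lemma vol_swap:
  fixes l :: "'n::finite list"
  assumes ij: "i < length l" "j < length l" "i \<noteq> j"
  shows "vol (swap_nth i j l) = - vol l"
proof (cases "length l = CARD('n)")
  case True
  define idx where "idx = (\<lambda>r::'n. SOME k. k < CARD('n) \<and> enum_list ! k = r)"
  have idx: "idx r < CARD('n)" "enum_list ! idx r = r" for r unfolding idx_def by (rule enum_idx)+
  have idx_enum: "idx (enum_list ! k) = k" if "k < CARD('n)" for k
    using idx[of "enum_list ! k"] that enum_list[where 'n = 'n] by (simp add: nth_eq_iff_index_eq)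
  define a b :: 'n where "a = enum_list ! i" and "b = enum_list ! j"
  have ab: "idx a = i" "idx b = j" "a \<noteq> b" using ij True idx_enum by (auto simp: a_def b_def nth_eq_iff_index_eq enum_list)
  let ?p = "Transposition.transpose a b"
  let ?A = "\<chi> r. axis (l ! idx r) 1 :: int^'n^'n"
  have "swap_nth i j l ! idx r = l ! idx (?p r)" for r
  proof -
    have "r = a \<longleftrightarrow> idx r = i" "r = b \<longleftrightarrow> idx r = j" using ab idx(2) by metis+
    then show ?thesis using nth_swap_nth[of i l j "idx r"] ij True idx(1) ab
      by (auto simp: Transposition.transpose_def)
  qed
  then have "(\<chi> r. axis (swap_nth i j l ! idx r) 1 :: int^'n^'n) = (\<chi> r. ?A $ ?p r)" by simp
  then have "det (\<chi> r. axis (swap_nth i j l ! idx r) 1 :: int^'n^'n) = det (\<chi> r. ?A $ ?p r)" by (rule arg_cong)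
  also have "\<dots> = of_int (sign ?p) * det ?A" by (rule det_permute_rows) (simp add: permutes_swap_id)
  also have "\<dots> = - det ?A" using ab(3) by (simp add: sign_swap_id)
  finally have "det (\<chi> r. axis (swap_nth i j l ! idx r) 1 :: int^'n^'n) = - det ?A" .
  then show ?thesis unfolding vol_def length_swap_nth idx_def using True by (simp only: refl if_True)
qed (simp add: vol_def)

lemma vol_not_distinct:
  assumes "\<not> distinct l" shows "vol l = 0"
proof -
  obtain i j where ij: "i < length l" "j < length l" "i \<noteq> j" "l ! i = l ! j"
    using assms by (auto simp: distinct_conv_nth)
  then have "swap_nth i j l = l" by (intro swap_nth_self)
  then show ?thesis using vol_swap[OF ij(1-3)] by simp
qed

lemma vol_square:
  fixes l :: "'n::finite list"
  assumes "distinct l" "length l = CARD('n)"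
  shows "vol l * vol l = 1"
  using alternating_enum[where F = vol, OF vol_swap assms] by (auto simp: vol_enum)

subsection \<open>Twisted derivations\<close>

lemma lookup_theta [simp]: "lk (theta i g) m = of_int (m $ i) * lk g m"
proof -
  have "lk (theta i g) m = (\<Sum>m'\<in>Poly_Mapping.keys g. lk (Poly_Mapping.single m' (of_int (m' $ i) * lk g m')) m)"
    by (simp add: theta_def lookup_sum)
  also have "\<dots> = (\<Sum>m'\<in>Poly_Mapping.keys g. if m' = m then of_int (m $ i) * lk g m else 0)"
    by (intro sum.cong) (auto simp: lookup_single when_def)
  finally show ?thesis by (simp add: in_keys_iff)
qed

lemma theta_linear: "theta i (g + h) = theta i g + theta i h" "theta i (- g) = - theta i g"
  "theta i (- 1 * g) = - 1 * theta i g" "theta i 0 = 0"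
  by (rule poly_mapping_eqI, simp add: lookup_add distrib_left)+

lemma theta_sign: "theta i ((-1) ^ k * g) = (-1) ^ k * theta i g"
  by (cases "even k") (simp_all add: theta_linear(2))

text \<open>The component of the differential d - tau df along the vector field theta_i.\<close>

definition twisted :: "('n::finite) laurent \<Rightarrow> 'n \<Rightarrow> 'n laurent_utau \<Rightarrow> 'n laurent_utau" where
  "twisted f i g = theta i g - Poly_Mapping.single 0 (tau_pow 1) * (theta i (embed_tau f) * g)"

lemma twisted_linear: "twisted f i (g + h) = twisted f i g + twisted f i h" "twisted f i (- g) = - twisted f i g"
  "twisted f i ((-1) ^ k * g) = (-1) ^ k * twisted f i g" "twisted f i 0 = 0"
proof -
  show "twisted f i ((-1) ^ k * g) = (-1) ^ k * twisted f i g"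
    by (simp add: twisted_def theta_sign right_diff_distrib mult.left_commute)
qed (simp_all add: twisted_def theta_linear algebra_simps)

definition twisted_image :: "('n::finite) laurent \<Rightarrow> 'n laurent_utau set" where
  "twisted_image f = {(\<Sum>i\<in>UNIV. twisted f i (g i)) | g. True}"

definition boundary :: "('n::finite) laurent \<Rightarrow> 'n form \<Rightarrow> 'n form" where
  "boundary f \<omega> = (\<lambda>l. ext_d \<omega> l - smult_form (tau_pow 1) (wedge1 (ext_d (form0 f)) \<omega>) l)"

lemma boundary_eq:
  "boundary f \<omega> l = (\<Sum>k<length l. (-1) ^ k * twisted f (l ! k) (\<omega> (drop_nth k l)))"
proof -
  have d0: "ext_d (form0 f) [i] = theta i (embed_tau f)" for i
    by (simp add: ext_d_def form0_def drop_nth_def)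
  have "wedge1 (ext_d (form0 f)) \<omega> l =
    (\<Sum>k<length l. (-1) ^ k * (theta (l ! k) (embed_tau f) * \<omega> (drop_nth k l)))"
    by (simp add: wedge1_def d0 mult.assoc)
  then have "boundary f \<omega> l = (\<Sum>k<length l. (-1) ^ k * theta (l ! k) (\<omega> (drop_nth k l))) -
    (\<Sum>k<length l. (-1) ^ k * (Poly_Mapping.single 0 (tau_pow 1) * (theta (l ! k) (embed_tau f) * \<omega> (drop_nth k l))))"
    by (simp add: boundary_def ext_d_def smult_form_def sum_distrib_left mult.left_commute)
  then show ?thesis by (simp add: twisted_def right_diff_distrib sum_subtractf)
qed

lemma boundary_form:
  fixes \<omega> :: "'n::finite form"
  assumes \<omega>: "\<omega> \<in> forms (CARD('n) - 1)"
  shows "boundary f \<omega> \<in> forms CARD('n)"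
proof (rule formsI)
  have n: "CARD('n) > 0" by simp
  fix l :: "'n list" assume l: "length l \<noteq> CARD('n)"
  have "\<omega> (drop_nth k l) = 0" if "k < length l" for k
    using \<omega> l n that unfolding forms_def by (auto simp del: zero_less_card_finite)
  then show "boundary f \<omega> l = 0" by (simp add: boundary_eq twisted_linear)
next
  fix l :: "'n list" and i j assume "length l = CARD('n)" "i < CARD('n)" "j < CARD('n)" "i \<noteq> j"
  then show "boundary f \<omega> (swap_nth i j l) = - boundary f \<omega> l"
    unfolding boundary_eq length_swap_nth
    by (intro alternating_contraction_sum twisted_linear form_swap[OF \<omega>]) auto
qed

text \<open>A combination of the contractions of the volume form with the coordinate fields. The
  sign \<open>\<epsilon> k\<close> is the value of \<open>vol\<close> at the only list where the
  k-th contraction is nonzero here, so their product is 1.\<close>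

lemma ex_form_values:
  fixes g :: "nat \<Rightarrow> 'n::finite laurent_utau"
  shows "\<exists>\<omega>\<in>forms (CARD('n) - 1). \<forall>k<CARD('n). \<omega> (drop_nth k enum_list) = g k"
proof -
  let ?e = "enum_list :: 'n list"
  define \<epsilon> where "\<epsilon> = (\<lambda>k. vol (?e ! k # drop_nth k ?e))"
  define \<omega> where "\<omega> = (\<lambda>l. \<Sum>k<CARD('n). of_int (\<epsilon> k * vol (?e ! k # l)) * g k)"
  have set_drop: "set (drop_nth k ?e) = UNIV - {?e ! k}" if k: "k < CARD('n)" for k
  proof -
    have "?e = take k ?e @ ?e ! k # drop (Suc k) ?e" using k by (simp add: enum_list id_take_nth_drop)
    then have "distinct (take k ?e @ ?e ! k # drop (Suc k) ?e)" "set (take k ?e @ ?e ! k # drop (Suc k) ?e) = UNIV"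
      using enum_list[where 'n = 'n] by simp_all
    then show ?thesis unfolding drop_nth_def by auto
  qed
  have dist_drop: "distinct (drop_nth k ?e)" if "k < CARD('n)" for k
  proof (rule card_distinct)
    show "card (set (drop_nth k ?e)) = length (drop_nth k ?e)" unfolding set_drop[OF that] using that by (simp add: enum_list)
  qed
  have "\<omega> \<in> forms (CARD('n) - 1)"
  proof (rule formsI)
    fix l :: "'n list" assume "length l \<noteq> CARD('n) - 1"
    then have "length (x # l) \<noteq> CARD('n)" for x by simp
    then show "\<omega> l = 0" by (simp add: \<omega>_def vol_def)
  next
    fix l :: "'n list" and i j assume ij: "length l = CARD('n) - 1" "i < CARD('n) - 1" "j < CARD('n) - 1" "i \<noteq> j"
    have "x # swap_nth i j l = swap_nth (Suc i) (Suc j) (x # l)" for x by (simp add: swap_nth_def)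
    then have "vol (x # swap_nth i j l) = - vol (x # l)" for x using ij by (simp add: vol_swap)
    then show "\<omega> (swap_nth i j l) = - \<omega> l" by (simp add: \<omega>_def sum_negf)
  qed
  moreover have "\<omega> (drop_nth m ?e) = g m" if m: "m < CARD('n)" for m
  proof -
    have "of_int (\<epsilon> k * vol (?e ! k # drop_nth m ?e)) * g k = (if k = m then g m else 0)" if k: "k < CARD('n)" for k
    proof (cases "k = m")
      case True
      have d: "distinct (?e ! m # drop_nth m ?e)" "length (?e ! m # drop_nth m ?e) = CARD('n)"
        using m dist_drop set_drop by (auto simp: enum_list)
      then show ?thesis using True vol_square[OF d] by (simp only: \<epsilon>_def) simp
    next
      case False
      then have "?e ! k \<noteq> ?e ! m" using k m enum_list[where 'n = 'n] by (simp add: nth_eq_iff_index_eq)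
      then have "\<not> distinct (?e ! k # drop_nth m ?e)" using set_drop[OF m] by simp
      then show ?thesis using False by (simp add: vol_not_distinct del: distinct.simps)
    qed
    then show ?thesis using m by (simp add: \<omega>_def)
  qed
  ultimately show ?thesis by blast
qed

text \<open>At \<open>enum_list\<close> the alternating sum of \<open>boundary_eq\<close> runs over
  every coordinate once. The signs are absorbed into the values of the form, and these values are
  arbitrary by \<open>ex_form_values\<close>.\<close>

lemma boundary_values:
  fixes f :: "('n::finite) laurent"
  shows "(\<lambda>\<omega>. \<omega> enum_list) ` twisted_boundaries f = twisted_image f"
proof -
  let ?e = "enum_list :: 'n list"
  have tb: "twisted_boundaries f = boundary f ` forms (CARD('n) - 1)"
    by (simp add: twisted_boundaries_def boundary_def)
  have bij: "bij_betw ((!) ?e) {..<CARD('n)} UNIV"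
    using bij_betw_nth[of ?e "{..<CARD('n)}" UNIV] enum_list[where 'n = 'n] by simp
  have val: "boundary f \<omega> ?e = (\<Sum>k<CARD('n). twisted f (?e ! k) ((-1) ^ k * \<omega> (drop_nth k ?e)))" for \<omega>
    by (simp add: boundary_eq enum_list twisted_linear)
  show ?thesis
  proof (intro equalityI subsetI)
    fix x assume "x \<in> (\<lambda>\<omega>. \<omega> ?e) ` twisted_boundaries f"
    then obtain \<omega> where "x = boundary f \<omega> ?e" unfolding tb by blast
    also have "\<dots> = (\<Sum>k<CARD('n). (\<lambda>i. twisted f i ((-1) ^ (inv_into {..<CARD('n)} ((!) ?e) i) *
        \<omega> (drop_nth (inv_into {..<CARD('n)} ((!) ?e) i) ?e))) (?e ! k))"
      unfolding val using bij by (intro sum.cong) (auto simp: bij_betw_def inv_into_f_f)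
    also have "\<dots> = (\<Sum>i\<in>UNIV. twisted f i ((-1) ^ (inv_into {..<CARD('n)} ((!) ?e) i) *
        \<omega> (drop_nth (inv_into {..<CARD('n)} ((!) ?e) i) ?e)))"
      by (rule sum.reindex_bij_betw[OF bij])
    finally have eq: "x = (\<Sum>i\<in>UNIV. twisted f i ((-1) ^ (inv_into {..<CARD('n)} ((!) ?e) i) *
        \<omega> (drop_nth (inv_into {..<CARD('n)} ((!) ?e) i) ?e)))" .
    show "x \<in> twisted_image f" unfolding twisted_image_def by (intro CollectI exI conjI TrueI) (rule eq)
  next
    fix x assume "x \<in> twisted_image f"
    then obtain g where x: "x = (\<Sum>i\<in>UNIV. twisted f i (g i))" unfolding twisted_image_def by blast
    obtain \<omega> where \<omega>: "\<omega> \<in> forms (CARD('n) - 1)" "\<And>k. k < CARD('n) \<Longrightarrow> \<omega> (drop_nth k ?e) = (-1) ^ k * g (?e ! k)"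
      using ex_form_values[of "\<lambda>k. (-1) ^ k * g (?e ! k)"] by blast
    have "boundary f \<omega> ?e = (\<Sum>k<CARD('n). twisted f (?e ! k) (g (?e ! k)))"
      unfolding val by (intro sum.cong refl) (simp add: \<omega>(2) flip: mult.assoc power_mult_distrib)
    also have "\<dots> = x" unfolding x by (rule sum.reindex_bij_betw[OF bij])
    finally show "x \<in> (\<lambda>\<omega>. \<omega> ?e) ` twisted_boundaries f" unfolding tb using \<omega>(1) by blast
  qed
qed

text \<open>Injective since an alternating function of n indices is determined by one value, onto
  since \<open>vol\<close> times any Laurent polynomial is a form. From here on a top form is a
  single Laurent polynomial.\<close>

lemma top_forms_chart:
  "chart UNIV (top_forms :: (laurent_tau, ('n::finite) form) module)
    (\<lambda>a g. Poly_Mapping.single 0 a * g) (\<lambda>\<omega>. \<omega> enum_list)"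
  "(\<lambda>\<omega>. \<omega> enum_list) ` carrier (top_forms :: (laurent_tau, 'n form) module) = UNIV"
proof -
  let ?M = "top_forms :: (laurent_tau, 'n form) module" and ?e = "enum_list :: 'n list"
  have car: "carrier ?M = forms CARD('n)" by (simp add: top_forms_def)
  have neg: "(\<lambda>l. - \<omega> l) \<in> forms CARD('n)" if "\<omega> \<in> forms CARD('n)" for \<omega> :: "'n form"
    using that by (auto simp: forms_def)
  have add: "(\<lambda>l. \<omega> l + \<eta> l) \<in> forms CARD('n)" if "\<omega> \<in> forms CARD('n)" "\<eta> \<in> forms CARD('n)" for \<omega> \<eta> :: "'n form"
    using that by (auto simp: forms_def)
  have inj: "inj_on (\<lambda>\<omega>. \<omega> ?e) (forms CARD('n))"
  proof (rule inj_onI)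
    fix \<omega> \<eta> :: "'n form" assume a: "\<omega> \<in> forms CARD('n)" "\<eta> \<in> forms CARD('n)" "\<omega> ?e = \<eta> ?e"
    have "(\<lambda>l. \<omega> l + - \<eta> l) l = 0" for l by (rule top_form_eq_0[OF add[OF a(1) neg[OF a(2)]]]) (simp add: a(3))
    then show "\<omega> = \<eta>" by (auto simp: fun_eq_iff)
  qed
  show "chart UNIV ?M (\<lambda>a g. Poly_Mapping.single 0 a * g) (\<lambda>\<omega>. \<omega> ?e)"
    unfolding chart_def car using inj neg
    by (auto simp: top_forms_def add smult_form_def) (auto simp: forms_def intro!: bexI[OF _ neg])
  show "(\<lambda>\<omega>. \<omega> ?e) ` carrier ?M = UNIV"
  proof (intro equalityI subsetI)
    fix g :: "'n laurent_utau"
    have "(\<lambda>l. of_int (vol l) * g) \<in> forms CARD('n)"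
      by (rule formsI) (auto simp: vol_swap, simp add: vol_def)
    moreover have "g = (\<lambda>l. of_int (vol l) * g) ?e" by (simp add: vol_enum)
    ultimately show "g \<in> (\<lambda>\<omega>. \<omega> ?e) ` carrier ?M" 
      unfolding car by (intro image_eqI[where x = "\<lambda>l. of_int (vol l) * g"])
  qed simp
qed

lemma twisted_boundaries_eq:
  fixes f :: "('n::finite) laurent"
  shows "twisted_boundaries f = {\<omega> \<in> carrier top_forms. \<omega> enum_list \<in> twisted_image f}"
proof -
  have sub: "twisted_boundaries f \<subseteq> carrier top_forms"
    using boundary_form by (auto simp: twisted_boundaries_def boundary_def top_forms_def)
  show ?thesis
    using chart_mem[OF top_forms_chart(1) sub] sub unfolding boundary_values by blast
qed

section \<open>The model of the Brieskorn module\<close>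

lemma poly_mapping_sum_induct [case_names single add]:
  fixes g :: "'a \<Rightarrow>\<^sub>0 'b::comm_monoid_add"
  assumes "\<And>m a. P (Poly_Mapping.single m a)" "\<And>g h. P g \<Longrightarrow> P h \<Longrightarrow> P (g + h)"
  shows "P g"
proof -
  have P0: "P 0" using assms(1)[of undefined 0] by simp
  have "P (\<Sum>m\<in>K. Poly_Mapping.single m (lk g m))" if "finite K" for K
    using that by (induction K) (auto simp: P0 intro: assms)
  moreover have "(\<Sum>m\<in>Poly_Mapping.keys g. Poly_Mapping.single m (lk g m)) = g"
    by (intro poly_mapping_eqI) (simp add: lookup_sum lookup_single when_def in_keys_iff)
  ultimately show ?thesis using finite_keys[of g] by metis
qed

definition tau_del :: "laurent_tau \<Rightarrow> laurent_tau" where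
  "tau_del a = tau_pow 1 * deriv_tau a"

lemma lookup_deriv_tau: "lk (deriv_tau a) i = of_int (i + 1) * lk a (i + 1)"
proof -
  have "lk (deriv_tau a) i = (\<Sum>j\<in>Poly_Mapping.keys a. lk (Poly_Mapping.single (j - 1) (of_int j * lk a j)) i)"
    by (simp add: deriv_tau_def lookup_sum)
  also have "\<dots> = (\<Sum>j\<in>Poly_Mapping.keys a. if j = i + 1 then of_int (i + 1) * lk a (i + 1) else 0)"
    by (intro sum.cong) (auto simp: lookup_single when_def)
  finally show ?thesis by (simp add: in_keys_iff)
qed

lemma lookup_tau_del [simp]: "lk (tau_del a) i = of_int i * lk a i"
  by (simp add: tau_del_def lookup_deriv_tau)

lemma deriv_tau_simps [simp]: "deriv_tau 0 = 0" "deriv_tau (a + b) = deriv_tau a + deriv_tau b"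
  "deriv_tau (- a) = - deriv_tau a"
  by (rule poly_mapping_eqI, simp add: lookup_deriv_tau lookup_add algebra_simps)+

lemma tau_del_simps [simp]: "tau_del 0 = 0" "tau_del 1 = 0" "tau_del (a + b) = tau_del a + tau_del b"
  "tau_del (tau_const c) = 0" "tau_del (tau_pow s) = of_int s * tau_pow s"
  "tau_del (a - b) = tau_del a - tau_del b"
proof -
  show "tau_del (tau_pow s) = of_int s * tau_pow s"
  proof (rule poly_mapping_eqI)
    fix i
    have "of_int s * tau_pow s = tau_const (of_int s) * tau_pow s" by simp
    then show "lk (tau_del (tau_pow s)) i = lk (of_int s * tau_pow s) i"
      by (simp only: lookup_tau_del lookup_tau_mult) (simp add: tau_pow_def lookup_single when_def)
  qed
qed (rule poly_mapping_eqI; simp add: lookup_add lookup_minus lookup_one tau_const_def lookup_single when_def algebra_simps)+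

lemma tau_del_mult: "tau_del (a * b) = tau_del a * b + a * tau_del b"
proof (induction a rule: poly_mapping_sum_induct)
  case (single s c)
  have "tau_del (Poly_Mapping.single s c) = Poly_Mapping.single s (of_int s * c)"
    by (rule poly_mapping_eqI) (simp add: lookup_single when_def)
  then show ?case
    by (intro poly_mapping_eqI)
      (simp only: lookup_tau_del lookup_add lookup_single_mult, simp add: algebra_simps)
next
  case (add g h) then show ?case by (simp add: algebra_simps)
qed

text \<open>The arithmetic of the weights alone, without the lattice. Divisibility is the form in
  which reflexivity enters.\<close>

locale weights =
  fixes n :: nat and q :: "nat \<Rightarrow> nat" and \<mu> :: nat
  assumes q_pos: "\<And>i. i \<le> n \<Longrightarrow> 0 < q i" and mu: "\<mu> = (\<Sum>i=0..n. q i)"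
    and q_dvd: "\<And>i. i \<le> n \<Longrightarrow> q i dvd \<mu>"
begin

definition p :: "nat \<Rightarrow> nat" where "p i = \<mu> div q i"

lemma pq: "i \<le> n \<Longrightarrow> p i * q i = \<mu>"
  using q_dvd by (simp add: p_def)

lemma mu_pos: "0 < \<mu>"
  using q_pos[of 0] unfolding mu by (intro sum_pos2[of _ 0]) auto

lemma p_pos: "i \<le> n \<Longrightarrow> 0 < p i"
  using pq[of i] mu_pos by (cases "p i = 0") auto

lemma sum_inverse_p: "(\<Sum>i=0..n. 1 / of_nat (p i)) = (1 :: complex)"
proof -
  have "(\<Sum>i=0..n. 1 / of_nat (p i)) = (\<Sum>i=0..n. of_nat (q i) / (of_nat \<mu> :: complex))"
  proof (intro sum.cong refl)
    fix i assume "i \<in> {0..n}"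
    then have i: "i \<le> n" by simp
    have "of_nat \<mu> = (of_nat (p i) * of_nat (q i) :: complex)" using pq[OF i] by (simp flip: of_nat_mult)
    then show "1 / of_nat (p i) = of_nat (q i) / (of_nat \<mu> :: complex)" using q_pos[OF i] by simp
  qed
  also have "\<dots> = of_nat \<mu> / of_nat \<mu>" by (simp only: sum_divide_distrib[symmetric] mu of_nat_sum)
  finally show ?thesis using mu_pos by simp
qed

text \<open>The path from \<open>0\<close> to \<open>(q\<^sub>0, \<dots>, q\<^sub>n)\<close> that always increases a coordinate with minimal
  \<open>c\<^sub>j / q\<^sub>j\<close>. It enumerates the elements \<open>l / q\<^sub>j\<close> of \<open>F\<close>, with multiplicities, in increasing order;
  \<open>lev k\<close> is \<open>\<mu>\<close> times the \<open>k\<close>-th of them.\<close>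

definition least_dir :: "(nat \<Rightarrow> nat) \<Rightarrow> nat" where
  "least_dir c = (LEAST j. j \<le> n \<and> (\<forall>i\<le>n. c j * p j \<le> c i * p i))"

fun path :: "nat \<Rightarrow> nat \<Rightarrow> nat" where
  "path 0 = (\<lambda>_. 0)"
| "path (Suc k) = (path k)(least_dir (path k) := Suc (path k (least_dir (path k))))"

definition dir :: "nat \<Rightarrow> nat" where "dir k = least_dir (path k)"

definition lev :: "nat \<Rightarrow> nat" where "lev k = path k (dir k) * p (dir k)"

lemma dir: "dir k \<le> n" "i \<le> n \<Longrightarrow> lev k \<le> path k i * p i"
proof -
  have "\<exists>j. j \<le> n \<and> (\<forall>i\<le>n. path k j * p j \<le> path k i * p i)"
    using ex_min_if_finite[of "(\<lambda>i. path k i * p i) ` {..n}"] by (auto simp: not_less)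
  from LeastI_ex[OF this] show "dir k \<le> n" "i \<le> n \<Longrightarrow> lev k \<le> path k i * p i"
    unfolding dir_def lev_def least_dir_def by auto
qed

lemma path_Suc: "path (Suc k) = (path k)(dir k := Suc (path k (dir k)))"
  by (simp add: dir_def)

declare path.simps(2) [simp del]

lemma path_mono: "k \<le> k' \<Longrightarrow> path k i \<le> path k' i"
  by (induction k' rule: dec_induct) (auto simp: path_Suc)

text \<open>\<open>lev k'\<close> is attained at \<open>dir k'\<close>. There the earlier point of
  the path has at most the same coordinate, and \<open>lev k\<close> is a minimum.\<close>

lemma lev_mono: "k \<le> k' \<Longrightarrow> lev k \<le> lev k'"
  using dir(2)[OF dir(1), of k k'] path_mono[of k k' "dir k'"] unfolding lev_def
  by (meson mult_le_mono1 order.trans)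

lemma sum_path: "(\<Sum>i=0..n. path k i) = k"
proof (induction k)
  case (Suc k)
  have "(\<Sum>i=0..n. path (Suc k) i) = (\<Sum>i=0..n. path k i + (if i = dir k then 1 else 0))"
    by (intro sum.cong) (auto simp: path_Suc)
  then show ?case using Suc dir(1)[of k] by (simp add: sum.distrib)
qed simp

text \<open>Before step mu some coordinate is still short of its bound, so the minimum
  \<open>lev k\<close> lies below mu, and the coordinate chosen by \<open>dir\<close> is short of
  its bound as well.\<close>

lemma path_le: "k \<le> \<mu> \<Longrightarrow> i \<le> n \<Longrightarrow> path k i \<le> q i"
  and path_dir_less: "k < \<mu> \<Longrightarrow> path k (dir k) < q (dir k)"
proof -
  have less: "path k (dir k) < q (dir k)" if "k < \<mu>" for k
  proof -
    have "(\<Sum>i=0..n. path k i) < (\<Sum>i=0..n. q i)" using that mu sum_path by simp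
    then obtain i where i: "i \<le> n" "path k i < q i"
      by (metis atLeastAtMost_iff linorder_not_less sum_mono)
    have "lev k \<le> path k i * p i" using dir(2) i(1) by blast
    also have "\<dots> < q i * p i" using i p_pos by simp
    also have "\<dots> = q (dir k) * p (dir k)" using pq[OF i(1)] pq[OF dir(1)] by (simp add: mult.commute)
    finally show ?thesis unfolding lev_def by simp
  qed
  then show "k < \<mu> \<Longrightarrow> path k (dir k) < q (dir k)" .
  show "k \<le> \<mu> \<Longrightarrow> i \<le> n \<Longrightarrow> path k i \<le> q i"
  proof (induction k)
    case (Suc k)
    then show ?case using less[of k] by (auto simp: path_Suc)
  qed simp
qed

lemma lev_less: "k < \<mu> \<Longrightarrow> lev k < \<mu>"
  using path_dir_less[of k] p_pos[OF dir(1)[of k]] pq[OF dir(1)[of k]] unfolding lev_def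
  by (metis mult.commute mult_less_mono2)

lemma path_mu:
  assumes "i \<le> n" shows "path \<mu> i = q i"
proof (rule ccontr)
  assume "path \<mu> i \<noteq> q i"
  then have "path \<mu> i < q i" using path_le[of \<mu> i] assms by simp
  then have "(\<Sum>i=0..n. path \<mu> i) < (\<Sum>i=0..n. q i)"
    using path_le[of \<mu>] assms by (intro sum_strict_mono_ex1) auto
  then show False using sum_path mu by simp
qed

lemma lev_0: "lev 0 = 0"
  by (simp add: lev_def)

text \<open>No pair recurs, since the path increases the chosen coordinate; equal cardinalities give
  surjectivity. Thus the path meets every fraction l / q_j of \<open>F\<close>, with
  multiplicity.\<close>

lemma bij_path: "bij_betw (\<lambda>k. (dir k, path k (dir k))) {..<\<mu>} (SIGMA j:{0..n}. {..<q j})"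
proof (rule bij_betw_imageI)
  show inj: "inj_on (\<lambda>k. (dir k, path k (dir k))) {..<\<mu>}"
  proof (rule linorder_inj_onI)
    fix k k' :: nat assume k: "k < k'"
    have "path (Suc k) (dir k) \<le> path k' (dir k)" using k by (intro path_mono) simp
    then show "(dir k, path k (dir k)) \<noteq> (dir k', path k' (dir k'))" by (auto simp: path_Suc)
  qed auto
  have "(\<lambda>k. (dir k, path k (dir k))) ` {..<\<mu>} \<subseteq> (SIGMA j:{0..n}. {..<q j})"
    using dir(1) path_dir_less by auto
  moreover have "card ((\<lambda>k. (dir k, path k (dir k))) ` {..<\<mu>}) = card (SIGMA j:{0..n}. {..<q j})"
    using card_image[OF inj] by (simp add: mu)
  ultimately show "(\<lambda>k. (dir k, path k (dir k))) ` {..<\<mu>} = (SIGMA j:{0..n}. {..<q j})"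
    by (intro card_subset_eq) auto
qed

lemma card_lev: "card {k. k < \<mu> \<and> P (lev k)} = (\<Sum>j=0..n. card {l. l < q j \<and> P (l * p j)})"
proof -
  let ?f = "\<lambda>k. (dir k, path k (dir k))"
  have "card {k. k < \<mu> \<and> P (lev k)} = card (?f ` {k. k < \<mu> \<and> P (lev k)})"
  proof (rule card_image[symmetric])
    have "inj_on ?f {..<\<mu>}" using bij_path by (simp add: bij_betw_def)
    then show "inj_on ?f {k. k < \<mu> \<and> P (lev k)}" by (rule inj_on_subset) auto
  qed
  also have "?f ` {k. k < \<mu> \<and> P (lev k)} = (SIGMA j:{0..n}. {l. l < q j \<and> P (l * p j)})"
  proof (intro equalityI subsetI)
    fix x assume "x \<in> ?f ` {k. k < \<mu> \<and> P (lev k)}"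
    then show "x \<in> (SIGMA j:{0..n}. {l. l < q j \<and> P (l * p j)})"
      using dir(1) path_dir_less by (auto simp: lev_def)
  next
    fix x assume x: "x \<in> (SIGMA j:{0..n}. {l. l < q j \<and> P (l * p j)})"
    then have "x \<in> ?f ` {..<\<mu>}" using bij_path by (auto simp: bij_betw_def)
    then obtain k where "k < \<mu>" "x = ?f k" by auto
    then show "x \<in> ?f ` {k. k < \<mu> \<and> P (lev k)}" using x by (auto simp: lev_def)
  qed
  finally show ?thesis by simp
qed

section \<open>The model operator and its hypergeometric equation\<close>

definition ev :: "nat \<Rightarrow> nat \<Rightarrow> laurent_tau" where
  "ev k = (\<lambda>i. if i = k then 1 else 0)"

text \<open>The product of the p_i^(q_i), that is, of the denominators collected along the closed
  path; \<open>kap_K\<close> shows that it is the right constant.\<close>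

definition K :: complex where
  "K = (\<Prod>k<\<mu>. of_nat (p (dir k)))"

text \<open>A cyclic shift twisted by powers of tau. The exponents are the gaps between successive
  levels, all nonnegative, and the last gap from \<open>lev (\<mu> - 1)\<close> to mu is
  positive.\<close>

definition shift :: "(nat \<Rightarrow> laurent_tau) \<Rightarrow> nat \<Rightarrow> laurent_tau" where
  "shift x k = (if k = 0 then tau_const K * tau_pow (int \<mu> - int (lev (\<mu> - 1))) * x (\<mu> - 1)
     else if k < \<mu> then tau_pow (int (lev k) - int (lev (k - 1))) * x (k - 1) else 0)"

text \<open>The operator \<open>\<tau>\<partial>\<^sub>\<tau>\<close> of the Gauss-Manin system in the coordinates with respect to the basis
  \<open>\<tau>\<^bsup>k - lev k\<^esup> u\<^bsup>m\<^sub>k\<^esup>\<close>, suitably scaled, where \<open>m\<^sub>k = \<Sum> path k i v\<^sub>i\<close>.\<close>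

definition D :: "(nat \<Rightarrow> laurent_tau) \<Rightarrow> nat \<Rightarrow> laurent_tau" where
  "D x = (\<lambda>k. tau_del (x k) - shift x k)"

lemma shift_linear: "shift (x + y) k = shift x k + shift y k" "shift (fsc a x) k = a * shift x k"
  by (auto simp: shift_def fsc_def algebra_simps)

lemma D_add: "D (x + y) = D x + D y"
  by (auto simp: D_def shift_linear fun_eq_iff)

lemma D_fsc: "D (fsc a x) = fsc a (D x) + fsc (tau_del a) x"
  by (simp add: D_def shift_linear fun_eq_iff) (simp add: fsc_def tau_del_mult algebra_simps)

lemma D_const: "D (fsc (tau_const c) x) = fsc (tau_const c) (D x)"
  by (simp add: D_fsc)

lemma D_tau_pow: "D (fsc (tau_pow s) x) = fsc (tau_pow s) (D x + fsc (of_int s) x)"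
  by (simp add: D_fsc mult.commute)

lemma D_0: "D 0 = 0"
  using D_add[of 0 0] by simp

text \<open>Up to the constant \<open>kap k\<close> this is tau^k u^(m_k). The value at
  \<open>\<mu>\<close> encodes the closing of the path, where a multiple of \<open>ev 0\<close>
  returns.\<close>

definition EV :: "nat \<Rightarrow> nat \<Rightarrow> laurent_tau" where
  "EV k = (if k < \<mu> then fsc (tau_pow (int (lev k))) (ev k) else fsc (tau_const K * tau_pow (int \<mu>)) (ev 0))"

lemma D_EV:
  assumes k: "k < \<mu>"
  shows "D (EV k) = fsc (of_nat (lev k)) (EV k) - EV (Suc k)"
proof
  fix i
  have "EV k = (\<lambda>i. if i = k then tau_pow (int (lev k)) else 0)" using k by (auto simp: EV_def ev_def fsc_def)
  moreover have "EV (Suc k) i = (if Suc k < \<mu> then if i = Suc k then tau_pow (int (lev (Suc k))) else 0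
      else if i = 0 then tau_const K * tau_pow (int \<mu>) else 0)"
    by (auto simp: EV_def ev_def fsc_def)
  ultimately show "D (EV k) i = (fsc (of_nat (lev k)) (EV k) - EV (Suc k)) i"
    using k mu_pos by (auto simp: D_def shift_def fsc_def tau_pow_mult mult.assoc)
qed

text \<open>The coordinate space as a module over the polynomial ring, the variable acting as
  \<open>D\<close>. Commutativity of polynomials is what allows the steps along a path to be
  rearranged.\<close>

definition act :: "complex poly \<Rightarrow> (nat \<Rightarrow> laurent_tau) \<Rightarrow> nat \<Rightarrow> laurent_tau" where
  "act P x = (\<Sum>i\<le>degree P. fsc (tau_const (coeff P i)) ((D ^^ i) x))"

lemma act_upto:
  assumes "degree P \<le> N"
  shows "act P x = (\<Sum>i\<le>N. fsc (tau_const (coeff P i)) ((D ^^ i) x))"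
  unfolding act_def using assms
  by (intro sum.mono_neutral_left) (auto simp: coeff_eq_0)

lemma fsc_sum: "fsc a (\<Sum>i\<in>S. f i) = (\<Sum>i\<in>S. fsc a (f i))"
  by (induction S rule: infinite_finite_induct) (simp_all only: sum.infinite sum.empty sum.insert fsc_simps not_False_eq_True)

lemma D_sum: "D (\<Sum>i\<in>S. f i) = (\<Sum>i\<in>S. D (f i))"
  by (induction S rule: infinite_finite_induct) (simp_all only: sum.infinite sum.empty sum.insert D_add D_0 not_False_eq_True)

lemma act_pCons: "act (pCons a P) x = fsc (tau_const a) x + D (act P x)"
proof -
  have "act (pCons a P) x = (\<Sum>i\<le>Suc (degree P). fsc (tau_const (coeff (pCons a P) i)) ((D ^^ i) x))"
    by (rule act_upto) (rule degree_pCons_le)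
  also have "\<dots> = fsc (tau_const a) x + (\<Sum>i\<le>degree P. fsc (tau_const (coeff P i)) ((D ^^ Suc i) x))"
    by (subst sum.atMost_Suc_shift) simp
  also have "(\<Sum>i\<le>degree P. fsc (tau_const (coeff P i)) ((D ^^ Suc i) x)) = D (act P x)"
    by (simp add: act_def D_sum D_const)
  finally show ?thesis .
qed

lemma act_0: "act 0 x = 0"
  by (simp add: act_def)

lemma act_add: "act (P + Q) x = act P x + act Q x"
proof -
  let ?N = "max (degree P) (degree Q)"
  have "degree (P + Q) \<le> ?N" by (rule degree_add_le) auto
  then show ?thesis by (simp add: act_upto[of _ ?N] sum.distrib)
qed

lemma act_smult: "act (Polynomial.smult c P) x = fsc (tau_const c) (act P x)"
  using degree_smult_le[of c P] by (simp add: act_upto[of _ "degree P"] fsc_sum)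

lemma act_mult: "act (P * Q) x = act P (act Q x)"
proof (induction P)
  case (pCons a P)
  then show ?case by (simp add: act_add act_smult act_pCons) 
qed (simp add: act_0)

text \<open>The factor with index \<open>l\<close> is the operator for going from l to l + 1 uses of
  the vertex \<open>j\<close>. The product depends only on the multiplicities \<open>c\<close>, not
  on the order of the steps.\<close>

definition cpoly :: "(nat \<Rightarrow> nat) \<Rightarrow> complex poly" where
  "cpoly c = (\<Prod>j=0..n. \<Prod>l<c j. [:of_nat l, - 1 / of_nat (p j):])"

text \<open>\<open>W c\<close> represents \<open>\<tau>\<^bsup>|c|\<^esup> u\<^bsup>m\<^esup>\<close> for \<open>m = \<Sum> c\<^sub>j v\<^sub>j\<close>.\<close>

definition W :: "(nat \<Rightarrow> nat) \<Rightarrow> nat \<Rightarrow> laurent_tau" where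
  "W c = act (cpoly c) (ev 0)"

lemma W_cong: "(\<And>j. j \<le> n \<Longrightarrow> c j = c' j) \<Longrightarrow> W c = W c'"
  unfolding W_def cpoly_def by (intro arg_cong[where f = "\<lambda>P. act P (ev 0)"] prod.cong) auto

lemma W_zero: "(\<And>j. j \<le> n \<Longrightarrow> c j = 0) \<Longrightarrow> W c = ev 0"
proof -
  assume "\<And>j. j \<le> n \<Longrightarrow> c j = 0"
  then have "cpoly c = 1" by (simp add: cpoly_def)
  then show ?thesis by (simp add: W_def act_def)
qed

lemma W_step:
  assumes j: "j \<le> n"
  shows "W (c(j := Suc (c j))) = fsc (of_nat (c j)) (W c) - fsc (tau_const (1 / of_nat (p j))) (D (W c))"
proof -
  let ?f = "\<lambda>c j. \<Prod>l<c j. [:of_nat l, - 1 / of_nat (p j) :: complex:]"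
  have "cpoly (c(j := Suc (c j))) = ?f (c(j := Suc (c j))) j * (\<Prod>i\<in>{0..n} - {j}. ?f (c(j := Suc (c j))) i)"
    unfolding cpoly_def using j by (intro prod.remove) auto
  also have "(\<Prod>i\<in>{0..n} - {j}. ?f (c(j := Suc (c j))) i) = (\<Prod>i\<in>{0..n} - {j}. ?f c i)"
    by (intro prod.cong) auto
  also have "?f (c(j := Suc (c j))) j = [:of_nat (c j), - 1 / of_nat (p j):] * ?f c j"
    by (simp only: fun_upd_same prod.lessThan_Suc mult.commute)
  also have "[:of_nat (c j), - 1 / of_nat (p j):] * ?f c j * (\<Prod>i\<in>{0..n} - {j}. ?f c i)
      = [:of_nat (c j), - 1 / of_nat (p j):] * cpoly c"
    unfolding cpoly_def mult.assoc using j by (subst prod.remove[of "{0..n}" j]) auto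
  finally have "W (c(j := Suc (c j))) = act [:of_nat (c j), - 1 / of_nat (p j):] (W c)"
    by (simp only: W_def act_mult)
  moreover have "act [:of_nat (c j), - 1 / of_nat (p j):] x
      = fsc (of_nat (c j)) x - fsc (tau_const (1 / of_nat (p j))) (D x)" for x
  proof -
    have "act [:of_nat (c j), - 1 / of_nat (p j):] x
      = fsc (tau_const (of_nat (c j))) x + D (fsc (tau_const (- (1 / of_nat (p j)))) x)"
      by (simp only: act_pCons act_0 D_0 add_0_right minus_divide_left)
    then show ?thesis by (simp only: D_const) (simp only: tau_const_simps fsc_simps add_uminus_conv_diff)
  qed
  ultimately show ?thesis by simp
qed

definition kap :: "nat \<Rightarrow> complex" where
  "kap k = (\<Prod>i<k. 1 / of_nat (p (dir i)))"

lemma kap_nz: "kap k \<noteq> 0"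
  using p_pos[OF dir(1)] by (simp add: kap_def)

text \<open>A step in the direction \<open>dir k\<close> applies (lev k - D) / p, which by
  \<open>D_EV\<close> carries \<open>EV k\<close> to a multiple of \<open>EV (Suc k)\<close>;
  \<open>kap\<close> collects the denominators.\<close>

lemma W_path: "k \<le> \<mu> \<Longrightarrow> W (path k) = fsc (tau_const (kap k)) (EV k)"
proof (induction k)
  case 0
  have "EV 0 = ev 0" using mu_pos by (simp add: EV_def lev_0)
  then show ?case by (simp add: kap_def W_zero)
next
  case (Suc k)
  let ?p = "tau_const (1 / of_nat (p (dir k)))"
  have "of_nat (lev k) = tau_const (of_nat (lev k))" by simp
  have pl: "?p * of_nat (lev k) = of_nat (path k (dir k))"
  proof -
    have "?p * of_nat (lev k) = tau_const (1 / of_nat (p (dir k)) * of_nat (lev k))"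
      by (simp only: tau_const_simps)
    also have "1 / of_nat (p (dir k)) * of_nat (lev k) = (of_nat (path k (dir k)) :: complex)"
      using p_pos[OF dir(1)[of k]] by (simp add: lev_def)
    finally show ?thesis by simp
  qed
  have "W (path (Suc k)) = fsc (of_nat (path k (dir k))) (W (path k)) - fsc ?p (D (W (path k)))"
    unfolding path_Suc by (rule W_step[OF dir(1)])
  also have "W (path k) = fsc (tau_const (kap k)) (EV k)" using Suc by simp
  also have "D (fsc (tau_const (kap k)) (EV k)) = fsc (tau_const (kap k)) (fsc (of_nat (lev k)) (EV k) - EV (Suc k))"
    unfolding D_const using Suc by (simp add: D_EV)
  also have "fsc (of_nat (path k (dir k))) (fsc (tau_const (kap k)) (EV k)) -
      fsc ?p (fsc (tau_const (kap k)) (fsc (of_nat (lev k)) (EV k) - EV (Suc k))) =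
      fsc (tau_const (kap k) * ?p) (EV (Suc k))"
    unfolding pl[symmetric] by (simp add: fsc_def fun_eq_iff algebra_simps)
  also have "tau_const (kap k) * ?p = tau_const (kap (Suc k))" by (simp only: kap_def prod.lessThan_Suc tau_const_simps)
  finally show ?case .
qed

lemma kap_K: "kap \<mu> * K = 1"
  using p_pos[OF dir(1)] by (simp add: kap_def K_def prod_dividef)

text \<open>The hypergeometric equation: the product of all factors over the closed path acts on
  \<open>ev 0\<close> as tau^mu.\<close>

lemma W_q: "W q = fsc (tau_pow (int \<mu>)) (ev 0)"
proof -
  have "W q = W (path \<mu>)" by (intro W_cong) (simp add: path_mu)
  also have "\<dots> = fsc (tau_const (kap \<mu>)) (fsc (tau_const K * tau_pow (int \<mu>)) (ev 0))"
    using W_path[of \<mu>] by (simp add: EV_def)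
  also have "\<dots> = fsc (tau_const (kap \<mu> * K) * tau_pow (int \<mu>)) (ev 0)"
    by (simp only: fsc_simps tau_const_simps mult.assoc)
  finally show ?thesis by (simp add: kap_K)
qed

text \<open>Moving \<open>D\<close> past tau^mu adds mu to it, and mu / p_j = q_j offsets the
  increase of the j-th multiplicity.\<close>

lemma W_shift: "W (\<lambda>j. c j + q j) = fsc (tau_pow (int \<mu>)) (W c)"
proof (induction "\<Sum>j=0..n. c j" arbitrary: c)
  case 0
  then have c: "c j = 0" if "j \<le> n" for j using that by simp
  have "W (\<lambda>j. c j + q j) = W q" using c by (intro W_cong) simp
  moreover have "W c = ev 0" using c by (rule W_zero)
  ultimately show ?case by (simp add: W_q)
next
  case (Suc s)
  then have "\<exists>j\<le>n. c j \<noteq> 0" by (metis Zero_not_Suc atLeastAtMost_iff sum.neutral)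
  then obtain j where j: "j \<le> n" "c j \<noteq> 0" by blast
  define c' where "c' = c(j := c j - 1)"
  have c: "c = c'(j := Suc (c' j))" using j by (auto simp: c'_def)
  have "(\<Sum>i=0..n. c i) = Suc (\<Sum>i=0..n. c' i)"
  proof -
    have "(\<Sum>i=0..n. c i) = (\<Sum>i=0..n. c' i + (if i = j then 1 else 0))" by (intro sum.cong) (auto simp: c)
    then show ?thesis using j by (simp add: sum.distrib)
  qed
  then have IH: "W (\<lambda>j. c' j + q j) = fsc (tau_pow (int \<mu>)) (W c')" using Suc by simp
  have "of_nat (q j) = tau_const (1 / of_nat (p j)) * of_int (int \<mu>)"
  proof -
    have "tau_const (1 / of_nat (p j)) * of_int (int \<mu>) = tau_const (1 / of_nat (p j) * of_int (int \<mu>))"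
      by (simp only: tau_const_simps)
    also have "1 / of_nat (p j) * of_int (int \<mu>) = (of_nat (q j) :: complex)"
      using p_pos[OF j(1)] pq[OF j(1)] by (simp add: field_simps flip: of_nat_mult)
    finally show ?thesis by simp
  qed
  then have qj: "of_nat (c' j + q j) = of_nat (c' j) + tau_const (1 / of_nat (p j)) * of_int (int \<mu>)" by simp
  have "(\<lambda>i. c i + q i) = (\<lambda>i. c' i + q i)(j := Suc (c' j + q j))" by (auto simp: c)
  then have "W (\<lambda>i. c i + q i) = fsc (of_nat (c' j + q j)) (fsc (tau_pow (int \<mu>)) (W c')) -
      fsc (tau_const (1 / of_nat (p j))) (D (fsc (tau_pow (int \<mu>)) (W c')))"
    using W_step[OF j(1), of "\<lambda>i. c' i + q i"] IH by simp
  also have "\<dots> = fsc (tau_pow (int \<mu>)) (fsc (of_nat (c' j)) (W c') - fsc (tau_const (1 / of_nat (p j))) (D (W c')))"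
    unfolding qj D_tau_pow by (simp add: fsc_def fun_eq_iff algebra_simps)
  also have "\<dots> = fsc (tau_pow (int \<mu>)) (W c)" using W_step[OF j(1), of c'] unfolding c[symmetric] by simp
  finally show ?case .
qed

lemma W_shift_mult: "W (\<lambda>j. c j + r * q j) = fsc (tau_pow (int r * int \<mu>)) (W c)"
proof (induction r)
  case (Suc r)
  have eq: "(\<lambda>j. c j + Suc r * q j) = (\<lambda>j. (c j + r * q j) + q j)" by (simp add: algebra_simps)
  show ?case unfolding eq W_shift Suc fsc_simps tau_pow_mult by (simp add: algebra_simps)
qed simp

definition model :: "(nat \<Rightarrow> laurent_tau) set" where
  "model = {x. \<forall>k\<ge>\<mu>. x k = 0}"

lemma D_model: "x \<in> model \<Longrightarrow> D x \<in> model"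
  using mu_pos by (auto simp: model_def D_def shift_def)

lemma model_closed: "0 \<in> model" "x \<in> model \<Longrightarrow> y \<in> model \<Longrightarrow> x + y \<in> model" "x \<in> model \<Longrightarrow> fsc a x \<in> model"
  "x \<in> model \<Longrightarrow> - x \<in> model" "x \<in> model \<Longrightarrow> y \<in> model \<Longrightarrow> x - y \<in> model"
  by (auto simp: model_def fsc_def)

lemma W_model: "W c \<in> model"
proof -
  have "(D ^^ i) (ev 0) \<in> model" for i
    by (induction i) (use mu_pos in \<open>auto simp: D_model, simp add: model_def ev_def\<close>)
  then have "(\<Sum>i\<in>S. fsc (a i) ((D ^^ i) (ev 0))) \<in> model" for a S
    by (induction S rule: infinite_finite_induct) (simp_all add: model_closed)
  then show ?thesis unfolding W_def act_def .
qed

end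

section \<open>Coordinates on the Gauss-Manin system\<close>

lemma lookup_embed_tau: "lk (embed_tau f) m = Poly_Mapping.single 0 (lk f m)"
  by (simp add: embed_tau_def Poly_Mapping.map.rep_eq when_def)

lemma lookup_map_deriv_tau: "lk (Poly_Mapping.map deriv_tau g) m = deriv_tau (lk g m)"
  by (simp add: Poly_Mapping.map.rep_eq when_def)

text \<open>The lattice geometry enters through these facts: \<open>ker\<close> determines the
  multiplicities of an exponent up to multiples of \<open>q\<close>, \<open>gen\<close> makes every
  monomial reachable, and \<open>pair\<close> supplies the linear forms for the spanning
  argument.\<close>

locale weighted_simplex = weights n q \<mu> for n q \<mu> +
  fixes v :: "nat \<Rightarrow> int^'n::finite"
  assumes n: "n = CARD('n)"
    and rel: "\<And>j. (\<Sum>i=0..n. int (q i) * v i $ j) = 0"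
    and ker: "\<And>c. (\<And>j. (\<Sum>i=0..n. c i * v i $ j) = 0) \<Longrightarrow> \<exists>r. \<forall>i\<in>{0..n}. c i = r * int (q i)"
    and gen: "\<And>m. \<exists>c. \<forall>j. m $ j = (\<Sum>i=0..n. c i * v i $ j)"
    and pair: "\<And>j k. j \<le> n \<Longrightarrow> k \<le> n \<Longrightarrow> j \<noteq> k \<Longrightarrow> \<exists>y :: 'n \<Rightarrow> real. \<forall>l\<in>{0..n}.
      (\<Sum>a\<in>UNIV. y a * real_of_int (v l $ a)) = (if l = j then real (q k) else if l = k then - real (q j) else 0)"
begin

definition emb :: "(nat \<Rightarrow> nat) \<Rightarrow> int^'n" where
  "emb c = (\<chi> j. \<Sum>i=0..n. int (c i) * v i $ j)"

abbreviation fD :: "'n laurent" where "fD \<equiv> f_Delta v"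

lemma emb_upd:
  assumes "j \<le> n" shows "emb (c(j := Suc (c j))) = v j + emb c"
proof -
  have "(\<Sum>i=0..n. int ((c(j := Suc (c j))) i) * v i $ a) = v j $ a + (\<Sum>i=0..n. int (c i) * v i $ a)" for a
  proof -
    have "(\<Sum>i=0..n. int ((c(j := Suc (c j))) i) * v i $ a) =
      (\<Sum>i=0..n. int (c i) * v i $ a + (if i = j then v j $ a else 0))"
      by (intro sum.cong) (auto simp: algebra_simps)
    then show ?thesis using assms by (simp add: sum.distrib)
  qed
  then show ?thesis by (simp add: emb_def vec_eq_iff)
qed

lemma emb_add: "emb (\<lambda>i. c i + c' i) = emb c + emb c'"
  by (simp add: emb_def vec_eq_iff sum.distrib distrib_right)

lemma emb_q: "(\<And>i. i \<le> n \<Longrightarrow> c i = q i) \<Longrightarrow> emb c = 0"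
  using rel by (simp add: emb_def vec_eq_iff)

text \<open>An integral combination becomes nonnegative after adding a multiple of the relation with
  coefficients \<open>q\<close>. The sum of the absolute values suffices as multiplier because every
  weight is at least 1.\<close>

lemma ex_lift: "\<exists>c. emb c = m"
proof -
  obtain c where c: "\<forall>j. m $ j = (\<Sum>i=0..n. c i * v i $ j)" using gen[of m] by blast
  define t where "t = (\<Sum>i=0..n. \<bar>c i\<bar>)"
  have pos: "0 \<le> c i + t * int (q i)" if "i \<le> n" for i
  proof -
    have "\<bar>c i\<bar> \<le> t" unfolding t_def using that by (intro member_le_sum) auto
    moreover have "t * 1 \<le> t * int (q i)" using q_pos[OF that] calculation by (intro mult_left_mono) auto
    ultimately show ?thesis by linarith
  qed
  have "(\<Sum>i=0..n. int (nat (c i + t * int (q i))) * v i $ j) = m $ j" for j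
  proof -
    have "(\<Sum>i=0..n. int (nat (c i + t * int (q i))) * v i $ j) = (\<Sum>i=0..n. c i * v i $ j + t * (int (q i) * v i $ j))"
      using pos by (intro sum.cong) (auto simp: algebra_simps)
    also have "\<dots> = m $ j + t * (\<Sum>i=0..n. int (q i) * v i $ j)" using c by (simp add: sum.distrib sum_distrib_left)
    finally show ?thesis using rel by simp
  qed
  then show ?thesis by (intro exI[of _ "\<lambda>i. nat (c i + t * int (q i))"]) (simp add: emb_def vec_eq_iff)
qed

definition csize :: "(nat \<Rightarrow> nat) \<Rightarrow> nat" where "csize c = (\<Sum>i=0..n. c i)"

definition U :: "(nat \<Rightarrow> nat) \<Rightarrow> nat \<Rightarrow> laurent_tau" where
  "U c = fsc (tau_pow (- int (csize c))) (W c)"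

text \<open>Two lifts of one exponent differ by r times \<open>q\<close>. \<open>W\<close> then
  gains tau^(r mu) while \<open>csize\<close> grows by r mu, and the two powers cancel.\<close>

lemma U_well_defined:
  assumes eq: "emb c = emb c'" shows "U c = U c'"
proof -
  have step: "U c = U c'" if s: "\<And>i. i \<le> n \<Longrightarrow> c' i = c i + s * q i" for s c c'
  proof -
    have "W c' = W (\<lambda>i. c i + s * q i)" using s by (rule W_cong)
    moreover have "csize c' = csize c + s * \<mu>" using s by (simp add: csize_def mu sum.distrib sum_distrib_left)
    ultimately show ?thesis by (simp add: U_def W_shift_mult tau_pow_mult)
  qed
  have "(\<Sum>i=0..n. (int (c' i) - int (c i)) * v i $ j) = 0" for j
  proof -
    have "emb c' $ j = emb c $ j" using eq by simp
    then show ?thesis by (simp add: emb_def left_diff_distrib sum_subtractf)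
  qed
  from ker[OF this] obtain r where r: "\<forall>i\<in>{0..n}. int (c' i) - int (c i) = r * int (q i)" by blast
  show ?thesis
  proof (cases "r \<ge> 0")
    case True
    have "c' i = c i + nat r * q i" if "i \<le> n" for i
    proof -
      have "int (c' i) = int (c i + nat r * q i)" using bspec[OF r, of i] that True by simp
      then show ?thesis by (simp only: of_nat_eq_iff)
    qed
    then show ?thesis by (rule step)
  next
    case False
    have "c i = c' i + nat (- r) * q i" if "i \<le> n" for i
    proof -
      have "int (c i) = int (c' i + nat (- r) * q i)" using bspec[OF r, of i] that False by (simp add: algebra_simps)
      then show ?thesis by (simp only: of_nat_eq_iff)
    qed
    then show ?thesis by (rule step[symmetric])
  qed
qed

definition psi :: "int^'n \<Rightarrow> nat \<Rightarrow> laurent_tau" where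
  "psi m = U (SOME c. emb c = m)"

lemma psi_emb: "psi (emb c) = U c"
proof -
  have "emb (SOME c'. emb c' = emb c) = emb c" by (rule someI[of _ c]) simp
  then show ?thesis unfolding psi_def by (rule U_well_defined)
qed

text \<open>\<open>W_step\<close> with the normalising powers of tau removed: the term with
  \<open>csize c\<close> arises from moving \<open>D\<close> past tau^(-|c|), and tau^(-1) accounts
  for the additional vertex.\<close>

lemma psi_step:
  assumes j: "j \<le> n"
  shows "psi (v j + emb c) = fsc (tau_pow (- 1)) (fsc (of_nat (c j)) (psi (emb c)) -
    fsc (tau_const (1 / of_nat (p j))) (D (psi (emb c)) + fsc (of_nat (csize c)) (psi (emb c))))"
proof -
  have sz: "csize (c(j := Suc (c j))) = Suc (csize c)"
  proof -
    have "csize (c(j := Suc (c j))) = (\<Sum>i=0..n. c i + (if i = j then 1 else 0))"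
      unfolding csize_def by (intro sum.cong) auto
    then show ?thesis using j by (simp add: csize_def sum.distrib)
  qed
  have DU: "D (U c) = fsc (tau_pow (- int (csize c))) (D (W c) - fsc (of_nat (csize c)) (W c))"
    unfolding U_def D_tau_pow by simp
  have "psi (v j + emb c) = fsc (tau_pow (- int (csize c) - 1)) (W (c(j := Suc (c j))))"
  proof -
    have e: "- int (Suc (csize c)) = - int (csize c) - 1" by simp
    show ?thesis unfolding emb_upd[OF j, symmetric] psi_emb U_def sz e ..
  qed
  also have "\<dots> = fsc (tau_pow (- 1)) (fsc (tau_pow (- int (csize c))) (W (c(j := Suc (c j)))))"
  proof -
    have "- 1 + - int (csize c) = - int (csize c) - 1" by simp
    then show ?thesis by (simp only: fsc_simps tau_pow_mult)
  qed
  also have "\<dots> = fsc (tau_pow (- 1)) (fsc (of_nat (c j)) (U c) -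
    fsc (tau_const (1 / of_nat (p j))) (D (U c) + fsc (of_nat (csize c)) (U c)))"
    unfolding W_step[OF j] DU by (simp add: U_def fsc_def fun_eq_iff algebra_simps)
  finally show ?thesis unfolding psi_emb .
qed

lemma psi_model: "psi m \<in> model"
  by (simp add: psi_def U_def W_model model_closed)

definition Psi :: "'n laurent_utau \<Rightarrow> nat \<Rightarrow> laurent_tau" where
  "Psi g = (\<Sum>m\<in>Poly_Mapping.keys g. fsc (lk g m) (psi m))"

lemma Psi_upto:
  assumes "finite S" "Poly_Mapping.keys g \<subseteq> S"
  shows "Psi g = (\<Sum>m\<in>S. fsc (lk g m) (psi m))"
  unfolding Psi_def using assms by (intro sum.mono_neutral_left) (auto simp: in_keys_iff)

lemma Psi_add: "Psi (g + h) = Psi g + Psi h"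
proof -
  let ?S = "Poly_Mapping.keys g \<union> Poly_Mapping.keys h"
  have "Poly_Mapping.keys (g + h) \<subseteq> ?S" by (rule Poly_Mapping.keys_add)
  then show ?thesis
    by (simp add: Psi_upto[of ?S] lookup_add sum.distrib)
qed

lemma Psi_single: "Psi (Poly_Mapping.single m a) = fsc a (psi m)"
  by (simp add: Psi_def)

lemma Psi_0: "Psi 0 = 0"
  by (simp add: Psi_def)

lemma Psi_diff: "Psi (g - h) = Psi g - Psi h"
  using Psi_add[of "g - h" h] by (simp add: eq_diff_eq)

lemma Psi_sum: "Psi (\<Sum>i\<in>S. g i) = (\<Sum>i\<in>S. Psi (g i))"
  by (induction S rule: infinite_finite_induct) (simp_all only: sum.infinite sum.empty sum.insert Psi_add Psi_0 not_False_eq_True)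

lemma Psi_scale: "Psi (Poly_Mapping.single 0 a * g) = fsc a (Psi g)"
proof (induction g rule: poly_mapping_sum_induct)
  case (single m b) then show ?case by (simp add: mult_single Psi_single)
next
  case (add g h) then show ?case by (simp only: distrib_left Psi_add fsc_simps)
qed

lemma Psi_model: "Psi g \<in> model"
proof -
  have "(\<Sum>m\<in>S. fsc (a m) (psi m)) \<in> model" for a S
    by (induction S rule: infinite_finite_induct) (simp_all only: sum.infinite sum.empty sum.insert model_closed psi_model not_False_eq_True)
  then show ?thesis unfolding Psi_def .
qed

lemma embed_fD: "embed_tau fD = (\<Sum>i=0..n. Poly_Mapping.single (v i) 1)"
proof (rule poly_mapping_eqI)
  fix m
  have "lk (embed_tau fD) m = (\<Sum>i=0..n. Poly_Mapping.single 0 (lk (Poly_Mapping.single (v i) 1) m))"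
    unfolding lookup_embed_tau f_Delta_def lookup_sum n
    by (induction rule: infinite_finite_induct) (simp_all add: single_add)
  also have "\<dots> = (\<Sum>i=0..n. lk (Poly_Mapping.single (v i) 1) m)"
    by (intro sum.cong) (auto simp: lookup_single when_def)
  finally show "lk (embed_tau fD) m = lk (\<Sum>i=0..n. Poly_Mapping.single (v i) 1) m" by (simp add: lookup_sum)
qed

lemma theta_fD: "theta a (embed_tau fD) = (\<Sum>i=0..n. Poly_Mapping.single (v i) (of_int (v i $ a)))"
  by (rule poly_mapping_eqI)
     (simp add: embed_fD lookup_sum sum_distrib_left lookup_single when_def if_distrib cong: if_cong)

lemma sum_v_p: "(\<Sum>i=0..n. of_int (v i $ a) * tau_const (1 / of_nat (p i))) = 0"
proof -
  have "of_int (v i $ a) * tau_const (1 / of_nat (p i)) = tau_const (of_int (int (q i) * v i $ a) / of_nat \<mu>)"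
    if "i \<in> {0..n}" for i
  proof -
    have i: "i \<le> n" using that by simp
    have "of_nat \<mu> = (of_nat (p i) * of_nat (q i) :: complex)" using pq[OF i] by (simp flip: of_nat_mult)
    then have "of_int (v i $ a) * (1 / of_nat (p i)) = (of_int (int (q i) * v i $ a) / of_nat \<mu> :: complex)"
      using q_pos[OF i] by simp
    then show ?thesis by (metis tau_const_simps(4,9))
  qed
  then have "(\<Sum>i=0..n. of_int (v i $ a) * tau_const (1 / of_nat (p i))) =
    (\<Sum>i=0..n. tau_const (of_int (int (q i) * v i $ a) / of_nat \<mu>))" by (rule sum.cong[OF refl])
  also have "\<dots> = tau_const (\<Sum>i=0..n. of_int (int (q i) * v i $ a) / of_nat \<mu>)"
    by (induction rule: infinite_finite_induct) simp_all
  also have "(\<Sum>i=0..n. of_int (int (q i) * v i $ a) / of_nat \<mu>) = (of_int (\<Sum>i=0..n. int (q i) * v i $ a) / of_nat \<mu> :: complex)"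
    by (simp add: sum_divide_distrib)
  finally show ?thesis unfolding rel by simp
qed

lemma sum_tau_p: "(\<Sum>i=0..n. tau_const (1 / of_nat (p i))) = 1"
proof -
  have "(\<Sum>i=0..n. tau_const (1 / of_nat (p i))) = tau_const (\<Sum>i=0..n. 1 / of_nat (p i))"
    by (induction rule: infinite_finite_induct) simp_all
  then show ?thesis by (simp add: sum_inverse_p)
qed

text \<open>Sum \<open>psi_step\<close> over the vertices with the coordinates of v_i as
  coefficients. The c_i terms add up to the exponent \<open>m\<close>, while the terms with 1 / p_i
  = q_i / mu drop out by the relation among the vertices.\<close>

lemma Psi_twisted: "Psi (twisted fD a g) = 0"
proof (induction g rule: poly_mapping_sum_induct)
  case (single m b)
  obtain c where m: "m = emb c" using ex_lift[of m] by blast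
  have th: "theta a (Poly_Mapping.single m b) = Poly_Mapping.single m (of_int (m $ a) * b)"
    by (rule poly_mapping_eqI) (simp add: lookup_single when_def)
  have tf: "theta a (embed_tau fD) * Poly_Mapping.single m b =
      (\<Sum>i=0..n. Poly_Mapping.single (v i + m) (of_int (v i $ a) * b))"
    by (simp add: theta_fD sum_distrib_right mult_single)
  define x y where "x = psi m" and "y = D (psi m) + fsc (of_nat (csize c)) (psi m)"
  have ps: "psi (v i + m) k = tau_pow (- 1) * (of_nat (c i) * x k - tau_const (1 / of_nat (p i)) * y k)"
    if "i \<in> {0..n}" for i k
    using psi_step[of i c] that unfolding m[symmetric] x_def y_def by (simp add: fsc_def)
  have m1: "(\<Sum>i=0..n. of_int (v i $ a) * of_nat (c i)) = (of_int (m $ a) :: laurent_tau)"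
    unfolding m emb_def by (simp add: mult.commute)
  show ?case
  proof
    fix k
    have "Psi (twisted fD a (Poly_Mapping.single m b)) k = of_int (m $ a) * b * x k -
        tau_pow 1 * (\<Sum>i=0..n. of_int (v i $ a) * b * psi (v i + m) k)"
      unfolding twisted_def th tf by (simp add: Psi_diff Psi_scale Psi_sum Psi_single x_def fsc_def sum_fun_apply)
    also have "(\<Sum>i=0..n. of_int (v i $ a) * b * psi (v i + m) k) =
      (\<Sum>i=0..n. tau_pow (- 1) * b * x k * (of_int (v i $ a) * of_nat (c i)) -
        tau_pow (- 1) * b * y k * (of_int (v i $ a) * tau_const (1 / of_nat (p i))))"
      by (intro sum.cong refl) (simp only: ps, simp add: algebra_simps)
    also have "\<dots> = tau_pow (- 1) * b * x k * of_int (m $ a)"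
      by (simp only: sum_subtractf sum_distrib_left[symmetric] m1 sum_v_p) simp
    also have "tau_pow 1 * (tau_pow (- 1) * b * x k * of_int (m $ a)) = b * x k * of_int (m $ a)"
      by (simp only: mult.assoc tau_pow_inv)
    finally show "Psi (twisted fD a (Poly_Mapping.single m b)) k = 0 k" by (simp add: mult_ac)
  qed
next
  case (add g h) then show ?case by (simp only: twisted_linear Psi_add add_0_right)
qed

text \<open>Sum \<open>psi_step\<close> over the vertices with coefficients 1. The c_i add up to
  \<open>csize c\<close> and the 1 / p_i to 1, so that multiplication by the Laurent polynomial
  becomes - tau^(-1) D.\<close>

lemma Psi_deriv: "Psi (Poly_Mapping.map deriv_tau g - embed_tau fD * g) = fsc (tau_pow (- 1)) (D (Psi g))"
proof (induction g rule: poly_mapping_sum_induct)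
  case (single m b)
  obtain c where m: "m = emb c" using ex_lift[of m] by blast
  have md: "Poly_Mapping.map deriv_tau (Poly_Mapping.single m b) = Poly_Mapping.single m (deriv_tau b)"
    by (rule poly_mapping_eqI) (simp add: lookup_map_deriv_tau lookup_single when_def)
  have ef: "embed_tau fD * Poly_Mapping.single m b = (\<Sum>i=0..n. Poly_Mapping.single (v i + m) b)"
    by (simp add: embed_fD sum_distrib_right mult_single)
  define x y where "x = psi m" and "y = D (psi m) + fsc (of_nat (csize c)) (psi m)"
  have ps: "psi (v i + m) k = tau_pow (- 1) * (of_nat (c i) * x k - tau_const (1 / of_nat (p i)) * y k)"
    if "i \<in> {0..n}" for i k
    using psi_step[of i c] that unfolding m[symmetric] x_def y_def by (simp add: fsc_def)
  have c1: "(\<Sum>i=0..n. of_nat (c i)) = (of_nat (csize c) :: laurent_tau)" by (simp add: csize_def)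
  have yx: "y k = D x k + of_nat (csize c) * x k" for k by (simp add: y_def x_def fsc_def)
  show ?case
  proof
    fix k
    have "Psi (Poly_Mapping.map deriv_tau (Poly_Mapping.single m b) - embed_tau fD * Poly_Mapping.single m b) k
        = deriv_tau b * x k - (\<Sum>i=0..n. b * psi (v i + m) k)"
      unfolding md ef by (simp add: Psi_diff Psi_sum Psi_single x_def fsc_def sum_fun_apply)
    also have "(\<Sum>i=0..n. b * psi (v i + m) k) =
      (\<Sum>i=0..n. tau_pow (- 1) * b * x k * of_nat (c i) -
        tau_pow (- 1) * b * y k * tau_const (1 / of_nat (p i)))"
      by (intro sum.cong refl) (simp only: ps, simp add: algebra_simps)
    also have "\<dots> = - (tau_pow (- 1) * b * D x k)"
      by (simp only: sum_subtractf sum_distrib_left[symmetric] c1 sum_tau_p yx) (simp add: algebra_simps)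
    finally have L: "Psi (Poly_Mapping.map deriv_tau (Poly_Mapping.single m b) - embed_tau fD * Poly_Mapping.single m b) k
        = deriv_tau b * x k + tau_pow (- 1) * b * D x k" by simp
    have "fsc (tau_pow (- 1)) (D (Psi (Poly_Mapping.single m b))) k =
      tau_pow (- 1) * (b * D x k + tau_pow 1 * deriv_tau b * x k)"
      unfolding Psi_single D_fsc by (simp add: x_def fsc_def tau_del_def)
    also have "\<dots> = deriv_tau b * x k + tau_pow (- 1) * b * D x k"
      using tau_pow_mult[of "-1" 1] by (simp add: distrib_left flip: mult.assoc)
    finally show "Psi (Poly_Mapping.map deriv_tau (Poly_Mapping.single m b) - embed_tau fD * Poly_Mapping.single m b) k
        = fsc (tau_pow (- 1)) (D (Psi (Poly_Mapping.single m b))) k" using L by simp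
  qed
next
  case (add g h)
  have "Poly_Mapping.map deriv_tau (g + h) - embed_tau fD * (g + h) =
    (Poly_Mapping.map deriv_tau g - embed_tau fD * g) + (Poly_Mapping.map deriv_tau h - embed_tau fD * h)"
    by (rule poly_mapping_eqI) (simp add: lookup_map_deriv_tau lookup_add lookup_minus distrib_left)
  then show ?case by (simp only: Psi_add add D_add fsc_simps)
qed

lemma psi_path:
  assumes "k < \<mu>"
  shows "psi (emb (path k)) = fsc (tau_const (kap k) * tau_pow (int (lev k) - int k)) (ev k)"
proof -
  have "psi (emb (path k)) = fsc (tau_pow (- int k)) (fsc (tau_const (kap k)) (fsc (tau_pow (int (lev k))) (ev k)))"
    using W_path[of k] assms by (simp add: psi_emb U_def csize_def sum_path EV_def)
  moreover have "tau_pow (- int k) * (tau_const (kap k) * tau_pow (int (lev k))) =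
    tau_const (kap k) * (tau_pow (- int k) * tau_pow (int (lev k)))" by (simp only: mult_ac)
  moreover have "- int k + int (lev k) = int (lev k) - int k" by simp
  ultimately show ?thesis by (simp only: fsc_simps tau_pow_mult)
qed

section \<open>Spanning by the monomials on the path\<close>

definition sec :: "nat \<Rightarrow> laurent_tau" where
  "sec k = tau_const (1 / kap k) * tau_pow (int k - int (lev k))"

text \<open>A right inverse of \<open>Psi\<close> on the model, with values in combinations of path
  monomials; \<open>sec k\<close> inverts the coefficient in \<open>psi_path\<close>.\<close>

definition Sec :: "(nat \<Rightarrow> laurent_tau) \<Rightarrow> 'n laurent_utau" where
  "Sec x = (\<Sum>k<\<mu>. Poly_Mapping.single (emb (path k)) (x k * sec k))"

lemma Psi_Sec:
  assumes "x \<in> model" shows "Psi (Sec x) = x"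
proof
  fix i
  have sk: "sec k * (tau_const (kap k) * tau_pow (int (lev k) - int k)) = 1" for k
  proof -
    have "sec k * (tau_const (kap k) * tau_pow (int (lev k) - int k)) =
      tau_const (1 / kap k * kap k) * (tau_pow (int k - int (lev k)) * tau_pow (int (lev k) - int k))"
      unfolding sec_def tau_const_simps by (simp only: mult_ac)
    then show ?thesis using kap_nz[of k] by (simp add: tau_pow_mult)
  qed
  have "Psi (Sec x) i = (\<Sum>k<\<mu>. x k * (sec k * (tau_const (kap k) * tau_pow (int (lev k) - int k))) * ev k i)"
    unfolding Sec_def Psi_sum sum_fun_apply
    by (intro sum.cong refl) (simp add: Psi_single psi_path fsc_def mult.assoc)
  also have "\<dots> = (\<Sum>k<\<mu>. if i = k then x k else 0)" unfolding sk by (intro sum.cong) (auto simp: ev_def)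
  also have "\<dots> = x i" using assms by (simp add: model_def)
  finally show "Psi (Sec x) i = x i" .
qed

lemma Sec_add: "Sec (x + y) = Sec x + Sec y"
  by (simp add: Sec_def single_add distrib_right sum.distrib)

lemma Sec_scale: "Sec (fsc a x) = Poly_Mapping.single 0 a * Sec x"
  by (simp add: Sec_def sum_distrib_left mult_single fsc_def mult.assoc)

lemma twisted_image_closed:
  "0 \<in> twisted_image fD" "x \<in> twisted_image fD \<Longrightarrow> y \<in> twisted_image fD \<Longrightarrow> x + y \<in> twisted_image fD"
  "x \<in> twisted_image fD \<Longrightarrow> Poly_Mapping.single 0 a * x \<in> twisted_image fD"
proof -
  have "0 = (\<Sum>i\<in>UNIV. twisted fD i 0)" by (simp add: twisted_linear)
  then show "0 \<in> twisted_image fD" unfolding twisted_image_def by (intro CollectI exI[of _ "\<lambda>_. 0"] conjI TrueI)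
  have sc: "Poly_Mapping.single 0 a * twisted fD i g = twisted fD i (Poly_Mapping.single 0 a * g)" for i g
  proof -
    have "theta i (Poly_Mapping.single 0 a * g) = Poly_Mapping.single 0 a * theta i g"
      by (rule poly_mapping_eqI) (simp add: lookup_single_mult mult.left_commute)
    then show ?thesis by (simp add: twisted_def right_diff_distrib mult.left_commute)
  qed
  { assume "x \<in> twisted_image fD" "y \<in> twisted_image fD"
    then obtain g h where "x = (\<Sum>i\<in>UNIV. twisted fD i (g i))" "y = (\<Sum>i\<in>UNIV. twisted fD i (h i))"
      unfolding twisted_image_def by blast
    then have "x + y = (\<Sum>i\<in>UNIV. twisted fD i (g i + h i))" by (simp add: twisted_linear sum.distrib)
    then show "x + y \<in> twisted_image fD" unfolding twisted_image_def by (intro CollectI exI[of _ "\<lambda>i. g i + h i"] conjI TrueI) }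
  { assume "x \<in> twisted_image fD"
    then obtain g where "x = (\<Sum>i\<in>UNIV. twisted fD i (g i))" unfolding twisted_image_def by blast
    then have "Poly_Mapping.single 0 a * x = (\<Sum>i\<in>UNIV. twisted fD i (Poly_Mapping.single 0 a * g i))"
      by (simp add: sc sum_distrib_left)
    then show "Poly_Mapping.single 0 a * x \<in> twisted_image fD"
      unfolding twisted_image_def by (intro CollectI exI[of _ "\<lambda>i. Poly_Mapping.single 0 a * g i"] conjI TrueI) }
qed

lemma Psi_twisted_image: "x \<in> twisted_image fD \<Longrightarrow> Psi x = 0"
proof -
  assume "x \<in> twisted_image fD"
  then obtain g where x: "x = (\<Sum>i\<in>UNIV. twisted fD i (g i))" unfolding twisted_image_def by blast
  show "Psi x = 0" unfolding x Psi_sum Psi_twisted by (rule sum.neutral_const)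
qed

text \<open>All elements turn out to be good, so that the kernel of \<open>Psi\<close> is not larger than \<open>twisted_image fD\<close>.\<close>

definition good :: "'n laurent_utau \<Rightarrow> bool" where
  "good g \<longleftrightarrow> g - Sec (Psi g) \<in> twisted_image fD"

lemma Sec_0: "Sec 0 = 0"
  by (simp add: Sec_def)

lemma good_closed: "good g \<Longrightarrow> good h \<Longrightarrow> good (g + h)" "good g \<Longrightarrow> good (Poly_Mapping.single 0 a * g)"
  "g \<in> twisted_image fD \<Longrightarrow> good g"
proof -
  show "good (g + h)" if "good g" "good h"
  proof -
    have eq: "(g + h) - Sec (Psi (g + h)) = (g - Sec (Psi g)) + (h - Sec (Psi h))" by (simp only: Psi_add Sec_add) simp
    show ?thesis unfolding good_def eq using that unfolding good_def by (rule twisted_image_closed(2))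
  qed
  show "good (Poly_Mapping.single 0 a * g)" if "good g"
  proof -
    have eq: "Poly_Mapping.single 0 a * g - Sec (Psi (Poly_Mapping.single 0 a * g)) = Poly_Mapping.single 0 a * (g - Sec (Psi g))"
      by (simp only: Psi_scale Sec_scale right_diff_distrib)
    show ?thesis unfolding good_def eq using that unfolding good_def by (rule twisted_image_closed(3))
  qed
  show "good g" if "g \<in> twisted_image fD"
    unfolding good_def Psi_twisted_image[OF that] Sec_0 using that by simp
qed

text \<open>\<open>Sec\<close> undoes \<open>Psi\<close> on the path monomials. The end point at
  \<open>\<mu>\<close> is the monomial 1 again, since the path closes up.\<close>

lemma good_mono_path:
  assumes "k \<le> \<mu>" shows "good (Poly_Mapping.single (emb (path k)) 1)"
proof -
  have *: "good (Poly_Mapping.single (emb (path k)) 1)" if k: "k < \<mu>" for k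
  proof -
    have "Sec (Psi (Poly_Mapping.single (emb (path k)) 1)) = Poly_Mapping.single (emb (path k)) 1"
    proof -
      have "Sec (ev k) = (\<Sum>i<\<mu>. if i = k then Poly_Mapping.single (emb (path k)) (sec k) else 0)"
        unfolding Sec_def by (intro sum.cong) (auto simp: ev_def)
      then have S: "Sec (ev k) = Poly_Mapping.single (emb (path k)) (sec k)" using k by simp
      have "tau_const (kap k) * tau_pow (int (lev k) - int k) * sec k =
        tau_const (kap k * (1 / kap k)) * (tau_pow (int (lev k) - int k) * tau_pow (int k - int (lev k)))"
        unfolding sec_def tau_const_simps by (simp only: mult_ac)
      then have "tau_const (kap k) * tau_pow (int (lev k) - int k) * sec k = 1"
        using kap_nz[of k] by (simp add: tau_pow_mult)
      then show ?thesis unfolding Psi_single psi_path[OF k] fsc_simps Sec_scale S by (simp add: mult_single)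
    qed
    then show ?thesis unfolding good_def by (simp add: twisted_image_closed)
  qed
  show ?thesis
  proof (cases "k = \<mu>")
    case True
    have "emb (path \<mu>) = 0" using path_mu by (rule emb_q)
    moreover have "emb (path 0) = 0" by (simp add: emb_def vec_eq_iff)
    ultimately show ?thesis using *[of 0] True mu_pos by simp
  qed (use * assms in simp)
qed

text \<open>Apply \<open>\<Sum> y\<^sub>a twisted\<^sub>a\<close> to \<open>u\<^bsup>m\<^esup>\<close>, where \<open>y\<close> is the linear form with values \<open>q\<^sub>k\<close> on \<open>v\<^sub>j\<close>, \<open>- q\<^sub>j\<close> on \<open>v\<^sub>k\<close>
  and \<open>0\<close> on the other vertices.\<close>

lemma pair_relation:
  assumes jk: "j \<le> n" "k \<le> n" "j \<noteq> k"
  shows "Poly_Mapping.single (emb c) (of_nat (q k * c j) - of_nat (q j * c k)) -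
    Poly_Mapping.single (v j + emb c) (tau_pow 1 * of_nat (q k)) +
    Poly_Mapping.single (v k + emb c) (tau_pow 1 * of_nat (q j)) \<in> twisted_image fD"
proof -
  obtain y :: "'n \<Rightarrow> real" where y: "\<forall>l\<in>{0..n}.
      (\<Sum>a\<in>UNIV. y a * real_of_int (v l $ a)) = (if l = j then real (q k) else if l = k then - real (q j) else 0)"
    using pair[OF jk] by blast
  define z where "z = (\<lambda>a. tau_const (of_real (y a)))"
  have zv: "(\<Sum>a\<in>UNIV. z a * of_int (v l $ a)) = (if l = j then of_nat (q k) else if l = k then - of_nat (q j) else 0)"
    if "l \<in> {0..n}" for l
  proof -
    have "(\<Sum>a\<in>UNIV. z a * of_int (v l $ a)) = (\<Sum>a\<in>UNIV. tau_const (of_real (y a * real_of_int (v l $ a))))"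
      by (simp add: z_def)
    also have "\<dots> = tau_const (of_real (\<Sum>a\<in>UNIV. y a * real_of_int (v l $ a)))"
      by (induction rule: infinite_finite_induct) simp_all
    also have "(\<Sum>a\<in>UNIV. y a * real_of_int (v l $ a)) = (if l = j then real (q k) else if l = k then - real (q j) else 0)"
      using y that by blast
    finally show ?thesis by simp
  qed
  let ?m = "emb c"
  have tw: "twisted fD a (Poly_Mapping.single ?m (z a)) = Poly_Mapping.single ?m (z a * of_int (?m $ a)) -
    (\<Sum>i=0..n. Poly_Mapping.single (v i + ?m) (tau_pow 1 * (z a * of_int (v i $ a))))" for a
  proof -
    have "theta a (Poly_Mapping.single ?m (z a)) = Poly_Mapping.single ?m (z a * of_int (?m $ a))"
      by (rule poly_mapping_eqI) (simp add: lookup_single when_def)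
    then show ?thesis
      by (simp add: twisted_def theta_fD sum_distrib_left sum_distrib_right mult_single mult_ac add.commute[of _ "emb c"])
  qed
  have ssum: "(\<Sum>a\<in>A. Poly_Mapping.single m (g a)) = Poly_Mapping.single m (\<Sum>a\<in>A. g a)" for A m and g :: "'n \<Rightarrow> laurent_tau"
    by (induction A rule: infinite_finite_induct) (simp_all add: single_add)
  have "(\<Sum>a\<in>UNIV. twisted fD a (Poly_Mapping.single ?m (z a))) =
    Poly_Mapping.single ?m (\<Sum>a\<in>UNIV. z a * of_int (?m $ a)) -
    (\<Sum>i=0..n. Poly_Mapping.single (v i + ?m) (tau_pow 1 * (\<Sum>a\<in>UNIV. z a * of_int (v i $ a))))"
    unfolding tw sum_subtractf ssum sum.swap[of _ "{0..n}"] by (simp only: sum_distrib_left ssum)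
  also have "(\<Sum>a\<in>UNIV. z a * of_int (?m $ a)) = of_nat (q k * c j) - of_nat (q j * c k)"
  proof -
    have "(\<Sum>a\<in>UNIV. z a * of_int (?m $ a)) = (\<Sum>a\<in>UNIV. \<Sum>i=0..n. of_nat (c i) * (z a * of_int (v i $ a)))"
      by (simp add: emb_def sum_distrib_left mult_ac)
    also have "\<dots> = (\<Sum>i=0..n. \<Sum>a\<in>UNIV. of_nat (c i) * (z a * of_int (v i $ a)))" by (rule sum.swap)
    also have "\<dots> = (\<Sum>i=0..n. of_nat (c i) * (if i = j then of_nat (q k) else if i = k then - of_nat (q j) else 0))"
      unfolding sum_distrib_left[symmetric] by (intro sum.cong refl) (simp only: zv)
    also have "\<dots> = (\<Sum>i=0..n. (if i = j then of_nat (q k * c j) else 0) + (if i = k then - of_nat (q j * c k) else 0))"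
      using jk(3) by (intro sum.cong) auto
    finally show ?thesis using jk by (simp add: sum.distrib)
  qed
  also have "(\<Sum>i=0..n. Poly_Mapping.single (v i + ?m) (tau_pow 1 * (\<Sum>a\<in>UNIV. z a * of_int (v i $ a)))) =
    (\<Sum>i=0..n. (if i = j then Poly_Mapping.single (v j + ?m) (tau_pow 1 * of_nat (q k)) else 0) +
      (if i = k then Poly_Mapping.single (v k + ?m) (tau_pow 1 * - of_nat (q j)) else 0))"
    using jk(3) by (intro sum.cong refl) (simp only: zv, auto)
  also have "\<dots> = Poly_Mapping.single (v j + ?m) (tau_pow 1 * of_nat (q k)) - Poly_Mapping.single (v k + ?m) (tau_pow 1 * of_nat (q j))"
    using jk by (simp add: sum.distrib single_uminus)
  finally have "(\<Sum>a\<in>UNIV. twisted fD a (Poly_Mapping.single ?m (z a))) =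
    Poly_Mapping.single ?m (of_nat (q k * c j) - of_nat (q j * c k)) -
    Poly_Mapping.single (v j + ?m) (tau_pow 1 * of_nat (q k)) +
    Poly_Mapping.single (v k + ?m) (tau_pow 1 * of_nat (q j))" by simp
  then have "\<dots> = (\<Sum>a\<in>UNIV. twisted fD a (Poly_Mapping.single ?m (z a)))" by (rule sym)
  then show ?thesis unfolding twisted_image_def by (intro CollectI exI[of _ "\<lambda>a. Poly_Mapping.single ?m (z a)"] conjI TrueI)
qed

text \<open>\<open>pair_relation\<close> can be solved for the monomial at
  \<open>v j + emb c\<close>, because its coefficient tau q_k is a unit.\<close>

lemma good_neighbour:
  assumes jk: "j \<le> n" "k \<le> n" and m: "good (Poly_Mapping.single (emb c) 1)"
    and vk: "good (Poly_Mapping.single (v k + emb c) 1)"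
  shows "good (Poly_Mapping.single (v j + emb c) 1)"
proof (cases "j = k")
  case False
  let ?m = "emb c" and ?a = "of_nat (q k * c j) - of_nat (q j * c k) :: laurent_tau"
  let ?r = "Poly_Mapping.single ?m ?a - Poly_Mapping.single (v j + ?m) (tau_pow 1 * of_nat (q k)) +
    Poly_Mapping.single (v k + ?m) (tau_pow 1 * of_nat (q j))"
  define u where "u = tau_const (1 / of_nat (q k)) * tau_pow (- 1)"
  have u: "u * (tau_pow 1 * of_nat (q k)) = 1"
  proof -
    have "u * (tau_pow 1 * of_nat (q k)) = tau_const (1 / of_nat (q k)) * tau_const (of_nat (q k)) * (tau_pow (- 1) * tau_pow 1)"
      unfolding u_def by (simp add: mult_ac)
    also have "tau_const (1 / of_nat (q k)) * tau_const (of_nat (q k)) = tau_const (1 / of_nat (q k) * of_nat (q k))"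
      by (simp only: tau_const_simps)
    finally show ?thesis using q_pos[OF jk(2)] by (simp add: tau_pow_mult)
  qed
  have sm: "Poly_Mapping.single x b = Poly_Mapping.single 0 b * Poly_Mapping.single x (1::laurent_tau)" for x :: "int^'n" and b
    by (simp add: mult_single)
  have eq: "Poly_Mapping.single (v j + ?m) 1 =
    Poly_Mapping.single 0 u * (Poly_Mapping.single 0 ?a * Poly_Mapping.single ?m 1 +
      Poly_Mapping.single 0 (tau_pow 1 * of_nat (q j)) * Poly_Mapping.single (v k + ?m) 1 + Poly_Mapping.single 0 (- 1) * ?r)"
  proof -
    have "Poly_Mapping.single 0 ?a * Poly_Mapping.single ?m 1 +
      Poly_Mapping.single 0 (tau_pow 1 * of_nat (q j)) * Poly_Mapping.single (v k + ?m) 1 + Poly_Mapping.single 0 (- 1) * ?r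
      = Poly_Mapping.single (v j + ?m) (tau_pow 1 * of_nat (q k))"
    proof -
      have "Poly_Mapping.single 0 (- 1) * ?r = - ?r" by (simp add: single_uminus)
      then show ?thesis unfolding sm[symmetric] by simp
    qed
    then show ?thesis by (simp add: mult_single u)
  qed
  have r: "good ?r" by (rule good_closed(3)[OF pair_relation[OF jk False]])
  show ?thesis unfolding eq
    by (rule good_closed(2), rule good_closed(1), rule good_closed(1))
       (rule good_closed(2)[OF m] good_closed(2)[OF vk] good_closed(2)[OF r])+
qed (use vk in simp)

text \<open>The induction works for translates of the whole path. Remove one use of \<open>j\<close>
  from \<open>c\<close> to get c', and let b be the k-th path point translated by c'. Both u^b and
  its neighbour in the direction \<open>dir k\<close> lie on the path translated by c', so
  \<open>good_neighbour\<close> yields the neighbour in the direction \<open>j\<close>.\<close>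

lemma good_path_shift: "k \<le> \<mu> \<Longrightarrow> good (Poly_Mapping.single (emb (path k) + emb c) 1)"
proof (induction "csize c" arbitrary: c k)
  case 0
  then have "emb c = 0" by (simp add: emb_def csize_def vec_eq_iff)
  then show ?case using good_mono_path[OF 0(2)] by simp
next
  case (Suc s)
  have "\<exists>j\<le>n. c j \<noteq> 0" using Suc(2) unfolding csize_def by (metis Zero_not_Suc atLeastAtMost_iff sum.neutral)
  then obtain j where j: "j \<le> n" "c j \<noteq> 0" by blast
  define c' where "c' = c(j := c j - 1)"
  have c: "c = c'(j := Suc (c' j))" using j by (auto simp: c'_def)
  have "csize c = (\<Sum>i=0..n. c' i + (if i = j then 1 else 0))" unfolding csize_def by (intro sum.cong) (auto simp: c)
  then have sz: "s = csize c'" using Suc(2) j by (simp add: csize_def sum.distrib)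
  note IH = Suc(1)[OF sz]
  have ec: "emb c = v j + emb c'" using emb_upd[OF j(1), of c'] unfolding c[symmetric] .
  have *: "good (Poly_Mapping.single (emb (path k) + emb c) 1)" if k: "k < \<mu>" for k
  proof -
    define b where "b = (\<lambda>i. path k i + c' i)"
    have eb: "emb b = emb (path k) + emb c'" unfolding b_def by (rule emb_add)
    have "emb (path (Suc k)) = v (dir k) + emb (path k)" unfolding path_Suc by (rule emb_upd[OF dir(1)])
    then have eb': "emb (path (Suc k)) + emb c' = v (dir k) + emb b" using eb by (simp add: add.assoc)
    have "good (Poly_Mapping.single (emb b) 1)" using IH[of k] k eb by simp
    moreover have "good (Poly_Mapping.single (v (dir k) + emb b) 1)" using IH[of "Suc k"] k eb' by simp
    ultimately have "good (Poly_Mapping.single (v j + emb b) 1)" by (rule good_neighbour[OF j(1) dir(1)])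
    moreover have "v j + emb b = emb (path k) + emb c" unfolding eb ec by (simp add: add_ac)
    ultimately show ?thesis by simp
  qed
  show ?case
  proof (cases "k = \<mu>")
    case True
    have "emb (path \<mu>) = 0" using path_mu by (rule emb_q)
    moreover have "emb (path 0) = 0" by (simp add: emb_def vec_eq_iff)
    ultimately show ?thesis using *[of 0] True mu_pos by simp
  qed (use * Suc(3) in simp)
qed

lemma good_all: "good g"
proof (induction g rule: poly_mapping_sum_induct)
  case (single m a)
  obtain c where m: "emb c = m" using ex_lift by blast
  have "emb (path 0) = 0" by (simp add: emb_def vec_eq_iff)
  then have "good (Poly_Mapping.single m 1)" using good_path_shift[of 0 c] m by simp
  from good_closed(2)[OF this, of a] show ?case by (simp add: mult_single)
next
  case (add g h) then show ?case by (rule good_closed(1))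
qed

lemma twisted_image_iff: "g \<in> twisted_image fD \<longleftrightarrow> Psi g = 0"
proof
  assume 0: "Psi g = 0"
  show "g \<in> twisted_image fD" using good_all[of g] unfolding good_def 0 Sec_0 by simp
qed (rule Psi_twisted_image)

definition hG :: "'n form set \<Rightarrow> nat \<Rightarrow> laurent_tau" where
  "hG = quot_coord Psi (\<lambda>\<omega>. \<omega> enum_list)"

lemma tb_kernel: "twisted_boundaries fD = {\<omega> \<in> carrier top_forms. Psi (\<omega> enum_list) = 0}"
  unfolding twisted_boundaries_eq twisted_image_iff ..

lemmas GM_quotient = chart_quotient[where \<pi> = Psi and sc' = fsc, OF top_forms_chart(1) Psi_add Psi_scale tb_kernel,
  folded GM_def hG_def]

lemma hG_image: "hG ` carrier (GM fD) = model"
proof (intro equalityI subsetI)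
  fix x assume "x \<in> hG ` carrier (GM fD)"
  then obtain X where X: "X \<in> carrier (GM fD)" "x = hG X" by blast
  obtain \<omega> where "\<omega> \<in> carrier top_forms" "X = twisted_boundaries fD +>\<^bsub>top_forms\<^esub> \<omega>" using GM_quotient(4)[OF X(1)] by blast
  then show "x \<in> model" using X(2) GM_quotient(3) Psi_model by simp
next
  fix x assume x: "x \<in> model"
  have "Sec x \<in> (\<lambda>\<omega>. \<omega> enum_list) ` carrier top_forms" unfolding top_forms_chart(2) by simp
  then obtain \<omega> :: "'n form" where \<omega>: "\<omega> \<in> carrier top_forms" "\<omega> enum_list = Sec x" by (elim imageE) simp
  have "hG (twisted_boundaries fD +>\<^bsub>top_forms\<^esub> \<omega>) = x" using GM_quotient(3)[OF \<omega>(1)] \<omega>(2) Psi_Sec[OF x] by simp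
  then show "x \<in> hG ` carrier (GM fD)" using GM_quotient(2)[OF \<omega>(1)] by (metis image_eqI)
qed

lemma GM_euler_coord:
  assumes X: "X \<in> carrier (GM fD)"
  shows "GM_euler fD X \<in> carrier (GM fD)" "hG (GM_euler fD X) = D (hG X)"
proof -
  let ?B = "twisted_boundaries fD" and ?\<phi> = "\<lambda>\<omega> l. Poly_Mapping.map deriv_tau (\<omega> l) - embed_tau fD * \<omega> l"
  obtain \<omega> where \<omega>: "\<omega> \<in> carrier top_forms" "X = ?B +>\<^bsub>top_forms\<^esub> \<omega>" using GM_quotient(4)[OF X] by blast
  have co: "X = {\<eta> \<in> carrier top_forms. Psi (\<eta> enum_list) = Psi (\<omega> enum_list)}"
    unfolding \<omega>(2) by (rule chart_coset[where \<pi> = Psi, OF top_forms_chart(1) Psi_add tb_kernel \<omega>(1)])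
  have \<phi>: "?\<phi> \<eta> \<in> carrier top_forms" if "\<eta> \<in> carrier top_forms" for \<eta> :: "'n form"
  proof -
    have "\<eta> \<in> forms CARD('n)" using that by (simp add: top_forms_def)
    moreover have "Poly_Mapping.map deriv_tau (- g) - embed_tau fD * - g = - (Poly_Mapping.map deriv_tau g - embed_tau fD * g)"
      for g :: "'n laurent_utau"
      by (rule poly_mapping_eqI) (simp add: lookup_map_deriv_tau lookup_minus lookup_add)
    moreover have "Poly_Mapping.map deriv_tau 0 - embed_tau fD * 0 = (0 :: 'n laurent_utau)"
      by (rule poly_mapping_eqI) (simp add: lookup_map_deriv_tau lookup_minus)
    ultimately show ?thesis by (simp add: top_forms_def forms_def)
  qed
  have der: "GM_deriv fD X = ?B +>\<^bsub>top_forms\<^esub> ?\<phi> \<omega>"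
    unfolding GM_deriv_def
  proof (rule induced_map_coset[where \<pi> = Psi, OF top_forms_chart(1) Psi_add tb_kernel])
    show "\<omega> \<in> X" using \<omega>(1) by (simp add: co)
    show "?\<phi> \<eta> \<in> carrier top_forms \<and> Psi (?\<phi> \<eta> enum_list) = Psi (?\<phi> \<omega> enum_list)" if "\<eta> \<in> X" for \<eta>
      using that \<phi> by (simp add: co Psi_deriv)
  qed
  have 1: "GM_deriv fD X \<in> carrier (GM fD)" unfolding der by (rule GM_quotient(2)[OF \<phi>[OF \<omega>(1)]])
  have 2: "hG (GM_deriv fD X) = fsc (tau_pow (- 1)) (D (hG X))"
    unfolding der GM_quotient(3)[OF \<phi>[OF \<omega>(1)]] Psi_deriv unfolding \<omega>(2) GM_quotient(3)[OF \<omega>(1)] ..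
  note c = chartD[OF GM_quotient(1)]
  show "GM_euler fD X \<in> carrier (GM fD)" unfolding GM_euler_def by (rule c(5)[OF UNIV_I 1])
  show "hG (GM_euler fD X) = D (hG X)" unfolding GM_euler_def c(6)[OF UNIV_I 1] 2 by (simp add: tau_pow_mult)
qed

sublocale GM: GM_chart fD hG D
  by unfold_locales (rule GM_quotient(1) GM_euler_coord D_add D_const | assumption)+

end

section \<open>The mixed Hodge structure\<close>

definition lb :: "int \<Rightarrow> laurent_tau \<Rightarrow> bool" where
  "lb d a \<longleftrightarrow> (\<forall>i. lk a i \<noteq> 0 \<longrightarrow> d \<le> i)"

definition ub :: "int \<Rightarrow> laurent_tau \<Rightarrow> bool" where
  "ub d a \<longleftrightarrow> (\<forall>i. lk a i \<noteq> 0 \<longrightarrow> i \<le> d)"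

lemma lb_simps: "lb d 0" "lb d a \<Longrightarrow> lb d b \<Longrightarrow> lb d (a + b)" "lb d (- a) \<longleftrightarrow> lb d a"
  "lb d (tau_pow s * a) \<longleftrightarrow> lb (d - s) a" "lb d a \<Longrightarrow> lb d (tau_const c * a)" "lb d a \<Longrightarrow> lb d (tau_del a)"
  "lb d a \<Longrightarrow> lb d b \<Longrightarrow> lb d (a - b)"
proof -
  have sum: "x \<noteq> 0 \<or> y \<noteq> 0" if "x + y \<noteq> 0 \<or> x - y \<noteq> 0" for x y :: complex using that by auto
  show "lb d a \<Longrightarrow> lb d b \<Longrightarrow> lb d (a + b)" "lb d a \<Longrightarrow> lb d b \<Longrightarrow> lb d (a - b)"
    unfolding lb_def lookup_add lookup_minus using sum by blast+
  show "lb d (tau_pow s * a) \<longleftrightarrow> lb (d - s) a"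
  proof
    assume L: "lb d (tau_pow s * a)"
    show "lb (d - s) a"
      unfolding lb_def
    proof (intro allI impI)
      fix i assume "lk a i \<noteq> 0"
      then show "d - s \<le> i" using L[unfolded lb_def, rule_format, of "i + s"] by simp
    qed
  next
    assume R: "lb (d - s) a"
    show "lb d (tau_pow s * a)"
      unfolding lb_def
    proof (intro allI impI)
      fix i assume "lk (tau_pow s * a) i \<noteq> 0"
      then show "d \<le> i" using R[unfolded lb_def, rule_format, of "i - s"] by simp
    qed
  qed
qed (auto simp: lb_def)

lemma ub_simps: "ub d 0" "ub d a \<Longrightarrow> ub d b \<Longrightarrow> ub d (a + b)" "ub d (- a) \<longleftrightarrow> ub d a"
  "ub d (tau_pow s * a) \<longleftrightarrow> ub (d - s) a" "ub d a \<Longrightarrow> ub d (tau_const c * a)" "ub d a \<Longrightarrow> ub d (tau_del a)"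
  "ub d a \<Longrightarrow> ub d b \<Longrightarrow> ub d (a - b)"
proof -
  have sum: "x \<noteq> 0 \<or> y \<noteq> 0" if "x + y \<noteq> 0 \<or> x - y \<noteq> 0" for x y :: complex using that by auto
  show "ub d a \<Longrightarrow> ub d b \<Longrightarrow> ub d (a + b)" "ub d a \<Longrightarrow> ub d b \<Longrightarrow> ub d (a - b)"
    unfolding ub_def lookup_add lookup_minus using sum by blast+
  show "ub d (tau_pow s * a) \<longleftrightarrow> ub (d - s) a"
  proof
    assume L: "ub d (tau_pow s * a)"
    show "ub (d - s) a"
      unfolding ub_def
    proof (intro allI impI)
      fix i assume "lk a i \<noteq> 0"
      then show "i \<le> d - s" using L[unfolded ub_def, rule_format, of "i + s"] by simp
    qed
  next
    assume R: "ub (d - s) a"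
    show "ub d (tau_pow s * a)"
      unfolding ub_def
    proof (intro allI impI)
      fix i assume "lk (tau_pow s * a) i \<noteq> 0"
      then show "i \<le> d" using R[unfolded ub_def, rule_format, of "i - s"] by simp
    qed
  qed
qed (auto simp: ub_def)

lemma lb_mult:
  assumes "lb d a" "lb e b" shows "lb (d + e) (a * b)"
  unfolding lb_def
proof (intro allI impI)
  fix i assume "lk (a * b) i \<noteq> 0"
  then have "i \<in> Poly_Mapping.keys (a * b)" by (simp add: in_keys_iff)
  then obtain x y where xy: "i = x + y" "x \<in> Poly_Mapping.keys a" "y \<in> Poly_Mapping.keys b"
    using keys_mult[of a b] by auto
  then show "d + e \<le> i" using assms[unfolded lb_def] by (simp add: in_keys_iff add_mono)
qed

lemma ub_mult:
  assumes "ub d a" "ub e b" shows "ub (d + e) (a * b)"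
  unfolding ub_def
proof (intro allI impI)
  fix i assume "lk (a * b) i \<noteq> 0"
  then have "i \<in> Poly_Mapping.keys (a * b)" by (simp add: in_keys_iff)
  then obtain x y where xy: "i = x + y" "x \<in> Poly_Mapping.keys a" "y \<in> Poly_Mapping.keys b"
    using keys_mult[of a b] by auto
  then show "i \<le> d + e" using assms[unfolded ub_def] by (simp add: in_keys_iff add_mono)
qed

lemma ring_tau_lb: "a \<in> carrier ring_tau \<longleftrightarrow> lb 0 a"
  by (auto simp: tau_ring_def lb_def in_keys_iff)

definition cp :: "(nat \<Rightarrow> laurent_tau) \<Rightarrow> nat \<Rightarrow> laurent_tau" where
  "cp x = (\<lambda>k. tau_const (lk (x k) 0))"

lemma cp_simps: "cp (x + y) = cp x + cp y" "cp (- x) = - cp x" "cp 0 = 0"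
  "a \<in> carrier field_const \<Longrightarrow> cp (fsc a x) = fsc a (cp x)"
proof -
  assume "a \<in> carrier field_const"
  then have a: "a = tau_const (lk a 0)" by (simp add: tau_const_carrier)
  have "tau_const (lk (a * b) 0) = a * tau_const (lk b 0)" for b
    by (subst (1 2) a) (simp only: lookup_tau_mult tau_const_simps)
  then show "cp (fsc a x) = fsc a (cp x)" by (simp add: cp_def fsc_def)
qed (auto simp: cp_def fun_eq_iff lookup_add)

lemma a_r_coset_carrier_update: "N +>\<^bsub>M\<lparr>carrier := V\<rparr>\<^esub> x = N +>\<^bsub>M\<^esub> x"
  by (simp add: a_r_coset_def')

lemma induced_map_carrier_update: "induced_map (M\<lparr>carrier := V\<rparr>) N \<phi> = induced_map M N \<phi>"
  by (simp add: induced_map_def a_r_coset_carrier_update fun_eq_iff)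

context weighted_simplex
begin

section \<open>The filtration by order in tau and its constant terms\<close>

abbreviation lev' :: "nat \<Rightarrow> int" where "lev' \<equiv> \<lambda>k. int (lev k)"

text \<open>The index bounds the pole order in tau, so the steps increase with it and multiplication
  by tau lowers it by one.\<close>

definition Vc :: "int \<Rightarrow> (nat \<Rightarrow> laurent_tau) set" where
  "Vc a = {x \<in> model. \<forall>k. lb (- a) (x k)}"

lemma Vc_closed: "0 \<in> Vc a" "x \<in> Vc a \<Longrightarrow> y \<in> Vc a \<Longrightarrow> x + y \<in> Vc a" "x \<in> Vc a \<Longrightarrow> - x \<in> Vc a"
  "x \<in> Vc a \<Longrightarrow> y \<in> Vc a \<Longrightarrow> x - y \<in> Vc a" "b \<in> carrier ring_tau \<Longrightarrow> x \<in> Vc a \<Longrightarrow> fsc b x \<in> Vc a"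
proof -
  show "fsc b x \<in> Vc a" if "b \<in> carrier ring_tau" "x \<in> Vc a"
  proof -
    have "lb (0 + - a) (b * x k)" for k using that by (intro lb_mult) (auto simp: ring_tau_lb Vc_def)
    then show ?thesis using that model_closed(3)[of x b] by (simp add: Vc_def fsc_def)
  qed
qed (auto simp: Vc_def model_closed lb_simps)

lemma Vc_mono: "a \<le> b \<Longrightarrow> Vc a \<subseteq> Vc b"
  by (fastforce simp: Vc_def lb_def)

lemma const_ring_tau: "tau_const c \<in> carrier ring_tau"
  by (auto simp: tau_ring_def tau_const_def)

lemma Vc_tau_pow: "fsc (tau_pow s) x \<in> Vc a \<longleftrightarrow> x \<in> Vc (a + s)"
proof -
  have "fsc (tau_pow s) x \<in> model \<longleftrightarrow> x \<in> model"
    using model_closed(3)[of x "tau_pow s"] model_closed(3)[of "fsc (tau_pow s) x" "tau_pow (- s)"]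
    by (auto simp: tau_pow_mult)
  then show ?thesis by (simp add: Vc_def fsc_def[of "tau_pow s" x] lb_simps algebra_simps)
qed

text \<open>No negative power of tau occurs in \<open>shift\<close>, by \<open>lev_mono\<close> and
  \<open>lev_less\<close>; the rescaling of the basis by the levels was made for this.\<close>

lemma D_Vc:
  assumes x: "x \<in> Vc a" shows "D x \<in> Vc a"
proof -
  have lbx: "lb (- a) (x k)" for k using x by (simp add: Vc_def)
  have lbs: "lb (- a) (tau_pow s * x k)" if "0 \<le> s" for s k
    using lbx[of k] that by (fastforce simp: lb_simps lb_def)
  have "lb (- a) (shift x k)" for k
    using lbs[of "int \<mu> - int (lev (\<mu> - 1))" "\<mu> - 1"] lbs[of "int (lev k) - int (lev (k - 1))" "k - 1"]
      lev_less[of "\<mu> - 1"] mu_pos lev_mono[of "k - 1" k]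
    by (auto simp: shift_def mult.assoc lb_simps)
  then have "lb (- a) (D x k)" for k using lbx[of k] by (simp add: D_def lb_simps)
  moreover have "D x \<in> model" using x by (simp add: Vc_def D_model)
  ultimately show ?thesis by (simp add: Vc_def)
qed

lemma cp_jspace: "x \<in> model \<Longrightarrow> cp x \<in> jspace \<mu>"
  by (auto simp: cp_def model_def jspace_def)

lemma jspace_cp:
  assumes "z \<in> jspace \<mu>" shows "cp z = z" "z \<in> Vc 0"
proof -
  have z: "z k = tau_const (lk (z k) 0)" for k using assms by (simp add: jspace_def tau_const_carrier)
  then show "cp z = z" by (auto simp: cp_def fun_eq_iff)
  have "lb 0 (z k)" for k by (subst z) (simp add: lb_def tau_const_def lookup_single when_def)
  then show "z \<in> Vc 0" using assms by (auto simp: Vc_def model_def jspace_def)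
qed

text \<open>Constant terms survive the shift only across a gap of width 0, that is, between
  neighbours of equal level. The wrap-around entry has a positive power of tau and
  disappears.\<close>

lemma cp_D:
  assumes x: "x \<in> Vc 0" shows "cp (D x) = - jop \<mu> lev' (cp x)"
proof
  fix k
  have z: "lk (x k) i = 0" if "i < 0" for k i using x that by (fastforce simp: Vc_def lb_def)
  have "lk (shift x k) 0 = (if 1 \<le> k \<and> k < \<mu> \<and> lev' (k - 1) = lev' k then lk (x (k - 1)) 0 else 0)"
    using z[of "int (lev (\<mu> - 1)) - int \<mu>" "\<mu> - 1"] z[of "int (lev (k - 1)) - int (lev k)" "k - 1"]
      lev_less[of "\<mu> - 1"] mu_pos lev_mono[of "k - 1" k]
    by (auto simp: shift_def mult.assoc)
  then show "cp (D x) k = (- jop \<mu> lev' (cp x)) k"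
    by (auto simp: cp_def D_def jop_def lookup_minus)
qed

lemma lev'_mono: "i \<le> j \<Longrightarrow> j < \<mu> \<Longrightarrow> lev' i \<le> lev' j"
  using lev_mono by simp

lemma D_nilpotent:
  assumes x: "x \<in> Vc 0" shows "(D ^^ \<mu>) x \<in> Vc (- 1)"
proof -
  have pow: "(D ^^ m) x \<in> Vc 0" for m by (induction m) (auto simp: x D_Vc)
  have xj: "cp x \<in> jspace \<mu>" using x cp_jspace by (simp add: Vc_def)
  have "cp ((D ^^ m) x) = fsc ((- 1) ^ m) ((jop \<mu> lev' ^^ m) (cp x))" for m
  proof (induction m)
    case (Suc m)
    have "cp ((D ^^ Suc m) x) = - jop \<mu> lev' (cp ((D ^^ m) x))" using cp_D[OF pow[of m]] by (simp only: funpow.simps o_apply)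
    also have "\<dots> = fsc ((- 1) ^ Suc m) (jop \<mu> lev' ((jop \<mu> lev' ^^ m) (cp x)))"
      unfolding Suc jop_linear(2) by (simp add: fsc_def fun_eq_iff)
    finally show ?case by (simp only: funpow.simps o_apply)
  qed simp
  moreover have "(jop \<mu> lev' ^^ \<mu>) (cp x) k = 0" for k
    by (subst jop_pow[OF lev'_mono xj]) auto
  ultimately have "cp ((D ^^ \<mu>) x) k = 0" for k by (simp add: fsc_def)
  then have "lk ((D ^^ \<mu>) x k) 0 = 0" for k by (metis cp_def lookup_zero tau_const_simps(7))
  moreover have "lb 0 ((D ^^ \<mu>) x k)" for k using pow[of \<mu>] by (simp add: Vc_def)
  ultimately have "lb 1 ((D ^^ \<mu>) x k)" for k unfolding lb_def by (metis int_one_le_iff_zero_less order_le_less)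
  then show ?thesis using pow[of \<mu>] by (simp add: Vc_def)
qed

text \<open>The floor records that all jumps are at integers, which reflects the integrality of
  \<open>lev\<close> and hence reflexivity.\<close>

definition V0 :: "rat \<Rightarrow> 'n form set set" where
  "V0 \<alpha> = {X \<in> carrier (GM fD). hG X \<in> Vc \<lfloor>\<alpha>\<rfloor>}"

lemma V0_sub: "V0 \<alpha> \<subseteq> carrier (GM fD)"
  by (auto simp: V0_def)

lemma hG_V0: "hG ` V0 \<alpha> = Vc \<lfloor>\<alpha>\<rfloor>"
proof -
  have "Vc \<lfloor>\<alpha>\<rfloor> \<subseteq> hG ` carrier (GM fD)" unfolding hG_image Vc_def by blast
  then show ?thesis unfolding V0_def by blast
qed

lemma V0_mono: "\<alpha> \<le> \<beta> \<Longrightarrow> V0 \<alpha> \<subseteq> V0 \<beta>"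
  using Vc_mono[OF floor_mono[of \<alpha> \<beta>]] by (auto simp: V0_def)

lemma V0_mem: "X \<in> carrier (GM fD) \<Longrightarrow> X \<in> V0 \<alpha> \<longleftrightarrow> hG X \<in> Vc \<lfloor>\<alpha>\<rfloor>"
  by (simp add: V0_def)

lemma chart_V0: "S \<subseteq> carrier ring_tau \<Longrightarrow> chart S ((GM fD)\<lparr>carrier := V0 \<alpha>\<rparr>) fsc hG"
  by (rule chart_restrict[OF GM_quotient(1) V0_def]) (auto simp: Vc_closed)

lemma V0_KM: "is_KM_filtration fD V0"
  unfolding is_KM_filtration_def
proof (intro conjI allI impI)
  note c = chartD[OF GM_quotient(1)]
  show "V0 \<alpha> \<subseteq> V0 \<beta>" if "\<alpha> \<le> \<beta>" for \<alpha> \<beta> by (rule V0_mono[OF that])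
  show "\<exists>r::nat. 0 < r \<and> (\<forall>\<alpha>. V0 \<alpha> = V0 (of_int \<lfloor>of_nat r * \<alpha>\<rfloor> / of_nat r))"
    by (intro exI[of _ 1]) (simp add: V0_def)
  show "submodule ring_tau (V0 \<alpha>) (GM fD)" for \<alpha>
  proof (rule LinearCombinations.submodule.intro)
    show "Module.module ring_tau (GM fD)" by (rule chart_module[OF GM.chart_S]) auto
    show "V0 \<alpha> \<subseteq> carrier (GM fD)" by (rule V0_sub)
    show "\<zero>\<^bsub>GM fD\<^esub> \<in> V0 \<alpha>" using c(1,2) Vc_closed(1) by (simp add: V0_def)
    show "X \<oplus>\<^bsub>GM fD\<^esub> Y \<in> V0 \<alpha>" if "X \<in> V0 \<alpha>" "Y \<in> V0 \<alpha>" for X Y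
      using that c(3,4) Vc_closed(2) by (simp add: V0_def)
    show "a \<odot>\<^bsub>GM fD\<^esub> X \<in> V0 \<alpha>" if "a \<in> carrier ring_tau" "X \<in> V0 \<alpha>" for a X
      using that c(5,6) Vc_closed(5) by (simp add: V0_def)
  qed
  show "free_finite_rank ring_tau ((GM fD)\<lparr>carrier := V0 \<alpha>\<rparr>)" for \<alpha>
  proof -
    have im: "hG ` carrier ((GM fD)\<lparr>carrier := V0 \<alpha>\<rparr>) = {x. (\<forall>k. k \<notin> {..<\<mu>} \<longrightarrow> x k = 0) \<and>
        (\<forall>k\<in>{..<\<mu>}. \<exists>a\<in>carrier ring_tau. x k = a * tau_pow (- \<lfloor>\<alpha>\<rfloor>))}"
    proof -
      have iff: "(\<exists>a\<in>carrier ring_tau. b = a * tau_pow s) \<longleftrightarrow> lb s b" for b s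
      proof
        assume "lb s b"
        then have "lb 0 (tau_pow (- s) * b)" by (simp add: lb_simps)
        moreover have "b = tau_pow (- s) * b * tau_pow s" using tau_pow_inv(1)[of s b] by (simp only: mult_ac)
        ultimately show "\<exists>a\<in>carrier ring_tau. b = a * tau_pow s" unfolding ring_tau_lb[symmetric] by blast
      next
        assume "\<exists>a\<in>carrier ring_tau. b = a * tau_pow s"
        then obtain a where "lb 0 a" "b = tau_pow s * a" by (auto simp: ring_tau_lb mult.commute)
        then show "lb s b" by (simp add: lb_simps)
      qed
      have "Vc \<lfloor>\<alpha>\<rfloor> = {x. (\<forall>k. k \<notin> {..<\<mu>} \<longrightarrow> x k = 0) \<and> (\<forall>k\<in>{..<\<mu>}. lb (- \<lfloor>\<alpha>\<rfloor>) (x k))}"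
      proof (intro equalityI subsetI CollectI conjI allI impI ballI)
        fix x assume "x \<in> {x. (\<forall>k. k \<notin> {..<\<mu>} \<longrightarrow> x k = 0) \<and> (\<forall>k\<in>{..<\<mu>}. lb (- \<lfloor>\<alpha>\<rfloor>) (x k))}"
        then have x: "\<And>k. \<not> k < \<mu> \<Longrightarrow> x k = 0" and y: "\<And>k. k < \<mu> \<Longrightarrow> lb (- \<lfloor>\<alpha>\<rfloor>) (x k)" by auto
        have "lb (- \<lfloor>\<alpha>\<rfloor>) (x k)" for k using x[of k] y[of k] lb_simps(1) by (cases "k < \<mu>") auto
        then show "x \<in> Vc \<lfloor>\<alpha>\<rfloor>" using x by (simp add: Vc_def model_def)
      qed (auto simp: Vc_def model_def)
      then show ?thesis by (simp add: hG_V0 iff)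
    qed
    have E: "(0::int) \<in> {0..}" "\<And>a b. a \<in> {0..} \<Longrightarrow> b \<in> {0..} \<Longrightarrow> a + b \<in> {0::int..}" by auto
    obtain B where "finite B" "B \<subseteq> carrier ((GM fD)\<lparr>carrier := V0 \<alpha>\<rparr>)" "card B = card {..<\<mu>}"
      "\<not> module.lin_dep ring_tau ((GM fD)\<lparr>carrier := V0 \<alpha>\<rparr>) B"
      "module.span ring_tau ((GM fD)\<lparr>carrier := V0 \<alpha>\<rparr>) B = carrier ((GM fD)\<lparr>carrier := V0 \<alpha>\<rparr>)"
      by (rule chart_basis[OF chart_V0[OF subset_refl] E finite_lessThan im])
    then show ?thesis unfolding free_finite_rank_def by blast
  qed
  show "module.span ring_tau_inv (GM fD) (V0 \<alpha>) = carrier (GM fD)" for \<alpha>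
  proof -
    interpret m: Module.module ring_tau_inv "GM fD" by (rule chart_module[OF GM.chart_S]) auto
    have U: "a \<in> carrier ring_tau_inv" for a by (simp add: tau_ring_def)
    show ?thesis
    proof (intro equalityI subsetI)
      fix X assume "X \<in> m.span (V0 \<alpha>)"
      then show "X \<in> carrier (GM fD)" using m.span_is_subset2[OF V0_sub] by blast
    next
      fix X assume X: "X \<in> carrier (GM fD)"
      obtain s where s: "hG X \<in> Vc s"
      proof -
        have hX: "hG X \<in> model" using X hG_image by blast
        define s where "s = (\<Sum>k<\<mu>. \<Sum>i\<in>Poly_Mapping.keys (hG X k). \<bar>i\<bar>)"
        have "- s \<le> i" if "lk (hG X k) i \<noteq> 0" for k i
        proof -
          have "k < \<mu>" using hX that by (auto simp: model_def not_le[symmetric])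
          then have "(\<Sum>i\<in>Poly_Mapping.keys (hG X k). \<bar>i\<bar>) \<le> s"
            unfolding s_def by (intro member_le_sum) (auto intro: sum_nonneg)
          moreover have "\<bar>i\<bar> \<le> (\<Sum>i\<in>Poly_Mapping.keys (hG X k). \<bar>i\<bar>)"
            using that by (intro member_le_sum) (auto simp: in_keys_iff)
          ultimately show ?thesis by linarith
        qed
        then have "hG X \<in> Vc s" using hX by (auto simp: Vc_def lb_def)
        then show ?thesis by (rule that)
      qed
      \<comment> \<open>tau^t X lies in \<open>V0 \<alpha>\<close>, and X is recovered from it with
        the coefficient tau^(-t).\<close>
      define t where "t = s - \<lfloor>\<alpha>\<rfloor>"
      define Y where "Y = tau_pow t \<odot>\<^bsub>GM fD\<^esub> X"
      have Y: "Y \<in> carrier (GM fD)" "hG Y = fsc (tau_pow t) (hG X)" unfolding Y_def using c(5,6) X by auto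
      then have YV: "Y \<in> V0 \<alpha>" using s by (simp add: V0_def Vc_tau_pow t_def)
      have "hG (m.lincomb (\<lambda>_. tau_pow (- t)) {Y}) = (\<Sum>v\<in>{Y}. fsc (tau_pow (- t)) (hG v))"
        by (rule chart_lincomb[where E = UNIV, OF GM.chart_S]) (use Y U in auto)
      also have "\<dots> = hG X" by (simp add: Y(2) tau_pow_mult)
      finally have "X = m.lincomb (\<lambda>_. tau_pow (- t)) {Y}"
        using X Y U by (intro c(7)[symmetric] m.lincomb_closed) auto
      then show "X \<in> m.span (V0 \<alpha>)" unfolding m.span_def using YV U
        by (intro CollectI exI[of _ "\<lambda>_. tau_pow (- t)"] exI[of _ "{Y}"]) auto
    qed
  qed
  show "GM_euler fD ` V0 \<alpha> \<subseteq> V0 \<alpha>" for \<alpha>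
    using GM_euler_coord D_Vc by (auto simp: V0_def)
  show "(\<lambda>X. tau_pow 1 \<odot>\<^bsub>GM fD\<^esub> X) ` V0 \<alpha> = V0 (\<alpha> - 1)" for \<alpha>
  proof (intro equalityI subsetI)
    fix Y assume "Y \<in> (\<lambda>X. tau_pow 1 \<odot>\<^bsub>GM fD\<^esub> X) ` V0 \<alpha>"
    then show "Y \<in> V0 (\<alpha> - 1)" using c(5,6) by (auto simp: V0_def Vc_tau_pow)
  next
    fix Y assume Y: "Y \<in> V0 (\<alpha> - 1)"
    define X where "X = tau_pow (- 1) \<odot>\<^bsub>GM fD\<^esub> Y"
    have YM: "Y \<in> carrier (GM fD)" using Y by (simp add: V0_def)
    have X: "X \<in> carrier (GM fD)" "hG X = fsc (tau_pow (- 1)) (hG Y)" unfolding X_def using c(5,6) YM by auto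
    have "X \<in> V0 \<alpha>" using Y X by (simp add: V0_def Vc_tau_pow)
    moreover have "Y = tau_pow 1 \<odot>\<^bsub>GM fD\<^esub> X"
      using c(5)[OF UNIV_I X(1), of "tau_pow 1"] c(6)[OF UNIV_I X(1), of "tau_pow 1"] YM X(2)
      by (intro c(7)) (auto simp: tau_pow_mult)
    ultimately show "Y \<in> (\<lambda>X. tau_pow 1 \<odot>\<^bsub>GM fD\<^esub> X) ` V0 \<alpha>" by blast
  qed
  show "nilpotent_on (gr_of fD V0 \<alpha>) (N_of fD V0 \<alpha>)" for \<alpha>
  proof (subst GM.nilpotent_coord)
    show "V0 \<beta> \<subseteq> carrier (GM fD)" for \<beta> by (rule V0_sub)
    show "V0 \<beta> \<subseteq> V0 \<gamma>" if "\<beta> \<le> \<gamma>" for \<beta> \<gamma> by (rule V0_mono[OF that])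
    show "subgrp (hG ` V0 \<beta>)" for \<beta> by (simp add: hG_V0 subgrp_def Vc_closed)
    show "fsc (tau_const z) x \<in> hG ` V0 \<beta>" if "x \<in> hG ` V0 \<beta>" for \<beta> z x
      using that by (simp add: hG_V0 Vc_closed const_ring_tau)
    show "D x \<in> hG ` V0 \<beta>" if "x \<in> hG ` V0 \<beta>" for \<beta> x using that by (simp add: hG_V0 D_Vc)
    show "\<exists>m. \<forall>x\<in>hG ` V0 \<alpha>. (shift_op D \<alpha> ^^ m) x \<in> below (\<lambda>\<alpha>. hG ` V0 \<alpha>) \<alpha>"
    proof (cases "\<alpha> = of_int \<lfloor>\<alpha>\<rfloor>")
      case False
      then have lt: "of_int \<lfloor>\<alpha>\<rfloor> < \<alpha>" using of_int_floor_le[of \<alpha>] by linarith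
      have "x \<in> below (\<lambda>\<alpha>. hG ` V0 \<alpha>) \<alpha>" if "x \<in> hG ` V0 \<alpha>" for x
        using that lt unfolding below_def hG_V0 by (intro UN_I[of "of_int \<lfloor>\<alpha>\<rfloor>"]) auto
      then show ?thesis by (intro exI[of _ 0]) simp
    next
      case True
      define a where "a = \<lfloor>\<alpha>\<rfloor>"
      have \<alpha>: "\<alpha> = of_int a" using True by (simp add: a_def)
      \<comment> \<open>Conjugation by tau^(-a) turns tau d/dtau + a into tau d/dtau, which reduces
        nilpotency at the integer \<open>a\<close> to index 0.\<close>
      have sh: "shift_op D \<alpha> (fsc (tau_pow (- a)) y) = fsc (tau_pow (- a)) (D y)" for y
        unfolding shift_op_def D_tau_pow \<alpha> by (simp add: fsc_def fun_eq_iff algebra_simps)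
      have pow: "(shift_op D \<alpha> ^^ m) (fsc (tau_pow (- a)) y) = fsc (tau_pow (- a)) ((D ^^ m) y)" for m y
        by (induction m) (simp_all only: funpow.simps o_apply id_apply sh)
      have "(shift_op D \<alpha> ^^ \<mu>) x \<in> below (\<lambda>\<alpha>. hG ` V0 \<alpha>) \<alpha>" if "x \<in> hG ` V0 \<alpha>" for x
      proof -
        define y where "y = fsc (tau_pow a) x"
        have x: "x = fsc (tau_pow (- a)) y" by (simp add: y_def tau_pow_mult)
        have "y \<in> Vc 0" using that unfolding y_def Vc_tau_pow hG_V0 a_def by simp
        then have "(D ^^ \<mu>) y \<in> Vc (- 1)" by (rule D_nilpotent)
        then have "(shift_op D \<alpha> ^^ \<mu>) x \<in> Vc (a - 1)" unfolding x pow Vc_tau_pow by simp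
        then have "(shift_op D \<alpha> ^^ \<mu>) x \<in> hG ` V0 (of_int (a - 1))" unfolding hG_V0 by (simp only: floor_of_int)
        then show ?thesis unfolding below_def \<alpha> by (intro UN_I[of "of_int (a - 1)"]) auto
      qed
      then show ?thesis by blast
    qed
  qed
qed

lemma KM_eq: "KM_filtration fD = V0"
  by (rule GM.KM_filtration_eqI[OF V0_KM])

subsection \<open>The graded pieces\<close>

text \<open>Only \<open>gr\<^sub>0\<close> is nonzero, and its coordinates are the constant terms of the coordinates on \<open>V\<^sub>0\<close>.\<close>

definition gpr :: "rat \<Rightarrow> (nat \<Rightarrow> laurent_tau) \<Rightarrow> nat \<Rightarrow> laurent_tau" where
  "gpr \<alpha> x = (if \<alpha> = 0 then cp x else 0)"

definition gdim :: "rat \<Rightarrow> nat" where "gdim \<alpha> = (if \<alpha> = 0 then \<mu> else 0)"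

definition gh :: "rat \<Rightarrow> 'n form set set \<Rightarrow> nat \<Rightarrow> laurent_tau" where
  "gh \<alpha> = quot_coord (gpr \<alpha>) hG"

text \<open>At index 0 the previous step is \<open>V0 (- 1)\<close>, cut out by the vanishing of
  constant terms. Strictly between 0 and 1 it is \<open>V0 \<alpha>\<close> itself, in accordance
  with \<open>gpr\<close> being zero there.\<close>

lemma below_V0:
  assumes "\<alpha> \<in> {0..<1}"
  shows "below V0 \<alpha> = {X \<in> carrier ((GM fD)\<lparr>carrier := V0 \<alpha>\<rparr>). gpr \<alpha> (hG X) = 0}"
proof (cases "\<alpha> = 0")
  case True
  have fm: "\<lfloor>- 1 :: rat\<rfloor> = - 1" by (rule floor_unique) simp_all
  have "below V0 0 = V0 (- 1)"
  proof
    show "below V0 0 \<subseteq> V0 (- 1)"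
    proof
      fix X assume "X \<in> below V0 0"
      then obtain \<beta> where b: "\<beta> < 0" "X \<in> V0 \<beta>" unfolding below_def by auto
      then have "\<lfloor>\<beta>\<rfloor> \<le> - 1" by linarith
      then show "X \<in> V0 (- 1)" using b(2) Vc_mono[of "\<lfloor>\<beta>\<rfloor>" "- 1"] by (auto simp: V0_def fm)
    qed
    show "V0 (- 1) \<subseteq> below V0 0" unfolding below_def by (intro UN_upper) simp
  qed
  also have "V0 (- 1) = {X \<in> V0 0. cp (hG X) = 0}"
  proof -
    have "x \<in> Vc (- 1) \<longleftrightarrow> x \<in> Vc 0 \<and> cp x = 0" for x
    proof
      assume x: "x \<in> Vc (- 1)"
      then have "lk (x k) 0 = 0" for k by (fastforce simp: Vc_def lb_def)
      then show "x \<in> Vc 0 \<and> cp x = 0" using x Vc_mono[of "- 1" 0] by (auto simp: cp_def fun_eq_iff)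
    next
      assume x: "x \<in> Vc 0 \<and> cp x = 0"
      have "lk (x k) 0 = 0" for k
      proof -
        have "tau_const (lk (x k) 0) = 0" using x by (auto simp: cp_def fun_eq_iff)
        then show ?thesis by (metis lookup_zero tau_const_simps(7))
      qed
      then have "lb 1 (x k)" for k using x unfolding Vc_def lb_def by (metis (mono_tags, lifting) int_one_le_iff_zero_less mem_Collect_eq minus_zero order_le_less)
      then show "x \<in> Vc (- 1)" using x by (simp add: Vc_def)
    qed
    then show ?thesis by (auto simp: V0_def fm)
  qed
  finally show ?thesis using True by (simp add: gpr_def)
next
  case False
  then have a: "0 < \<alpha>" "\<lfloor>\<alpha>\<rfloor> = 0" using assms by (auto simp: floor_eq_iff)
  have "below V0 \<alpha> = V0 \<alpha>"
  proof
    show "below V0 \<alpha> \<subseteq> V0 \<alpha>" unfolding below_def by (intro UN_least V0_mono) simp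
    have "V0 \<alpha> = V0 0" using a(2) by (simp add: V0_def)
    then show "V0 \<alpha> \<subseteq> below V0 \<alpha>" unfolding below_def using a(1) by (metis UN_upper lessThan_iff)
  qed
  then show ?thesis using False by (simp add: gpr_def)
qed

lemma gpr_add: "gpr \<alpha> (x + y) = gpr \<alpha> x + gpr \<alpha> y"
  by (simp add: gpr_def cp_simps)

lemma field_const_sub: "carrier field_const \<subseteq> carrier ring_tau"
  by (auto simp: tau_ring_def)

lemma gpr_fsc: "a \<in> carrier field_const \<Longrightarrow> gpr \<alpha> (fsc a x) = fsc a (gpr \<alpha> x)"
  by (simp add: gpr_def cp_simps)

lemma gr_V_eq: "gr_V fD \<alpha> = quotient_module ((GM fD)\<lparr>carrier := V0 \<alpha>\<rparr>) (below V0 \<alpha>)"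
  by (simp add: gr_V_def gr_of_def KM_eq)

context
  fixes \<alpha> :: rat assumes \<alpha>: "\<alpha> \<in> {0..<1}"
begin

lemma gr_quot:
  "chart (carrier field_const) (gr_V fD \<alpha>) fsc (gh \<alpha>)"
  "X \<in> V0 \<alpha> \<Longrightarrow> below V0 \<alpha> +>\<^bsub>GM fD\<^esub> X \<in> carrier (gr_V fD \<alpha>)"
  "X \<in> V0 \<alpha> \<Longrightarrow> gh \<alpha> (below V0 \<alpha> +>\<^bsub>GM fD\<^esub> X) = gpr \<alpha> (hG X)"
  "Y \<in> carrier (gr_V fD \<alpha>) \<Longrightarrow> \<exists>X\<in>V0 \<alpha>. Y = below V0 \<alpha> +>\<^bsub>GM fD\<^esub> X"
proof -
  note Q = chart_quotient[where \<pi> = "gpr \<alpha>" and sc' = fsc,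
    OF chart_V0[OF field_const_sub] gpr_add _ below_V0[OF \<alpha>], folded gr_V_eq gh_def, unfolded a_r_coset_carrier_update]
  show "chart (carrier field_const) (gr_V fD \<alpha>) fsc (gh \<alpha>)" by (rule Q(1)) (rule gpr_fsc)
  show "below V0 \<alpha> +>\<^bsub>GM fD\<^esub> X \<in> carrier (gr_V fD \<alpha>)" if "X \<in> V0 \<alpha>"
    by (rule Q(2)) (use that in \<open>simp_all add: gpr_fsc\<close>)
  show "gh \<alpha> (below V0 \<alpha> +>\<^bsub>GM fD\<^esub> X) = gpr \<alpha> (hG X)" if "X \<in> V0 \<alpha>"
    by (rule Q(3)) (use that in \<open>simp_all add: gpr_fsc\<close>)
  have "\<exists>X\<in>carrier ((GM fD)\<lparr>carrier := V0 \<alpha>\<rparr>). Y = below V0 \<alpha> +>\<^bsub>GM fD\<^esub> X" if "Y \<in> carrier (gr_V fD \<alpha>)"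
    by (rule Q(4)) (rule gpr_fsc that | assumption)+
  then show "\<exists>X\<in>V0 \<alpha>. Y = below V0 \<alpha> +>\<^bsub>GM fD\<^esub> X" if "Y \<in> carrier (gr_V fD \<alpha>)" using that by simp
qed

lemma floor_0: "\<lfloor>\<alpha>\<rfloor> = 0"
  using \<alpha> by (simp add: floor_eq_iff)

lemma gh_image: "gh \<alpha> ` carrier (gr_V fD \<alpha>) = jspace (gdim \<alpha>)"
proof -
  have "gh \<alpha> ` carrier (gr_V fD \<alpha>) = gpr \<alpha> ` hG ` V0 \<alpha>"
  proof (intro equalityI subsetI)
    fix x assume "x \<in> gh \<alpha> ` carrier (gr_V fD \<alpha>)"
    then obtain Y where Y: "Y \<in> carrier (gr_V fD \<alpha>)" "x = gh \<alpha> Y" by blast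
    obtain X where X: "X \<in> V0 \<alpha>" "Y = below V0 \<alpha> +>\<^bsub>GM fD\<^esub> X" using gr_quot(4)[OF Y(1)] by auto
    then show "x \<in> gpr \<alpha> ` hG ` V0 \<alpha>" using Y(2) gr_quot(3)[of X] by simp
  next
    fix x assume "x \<in> gpr \<alpha> ` hG ` V0 \<alpha>"
    then obtain X where X: "X \<in> V0 \<alpha>" "x = gpr \<alpha> (hG X)" by blast
    then show "x \<in> gh \<alpha> ` carrier (gr_V fD \<alpha>)"
      using gr_quot(2)[of X] gr_quot(3)[of X] by (intro image_eqI[of _ _ "below V0 \<alpha> +>\<^bsub>GM fD\<^esub> X"]) auto
  qed
  also have "\<dots> = gpr \<alpha> ` Vc 0" by (simp add: hG_V0 floor_0)
  also have "\<dots> = jspace (gdim \<alpha>)"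
  proof (cases "\<alpha> = 0")
    case True
    have "cp ` Vc 0 = jspace \<mu>"
    proof (intro equalityI subsetI)
      fix z assume "z \<in> cp ` Vc 0" then show "z \<in> jspace \<mu>" using cp_jspace by (auto simp: Vc_def)
    next
      fix z assume z: "z \<in> jspace \<mu>"
      then show "z \<in> cp ` Vc 0" using jspace_cp[OF z] by (metis image_eqI)
    qed
    then show ?thesis using True by (simp add: gpr_def gdim_def)
  next
    case False
    have "jspace 0 = {0}" using jspace_closed(1)[of 0] by (auto simp: jspace_def fun_eq_iff)
    moreover have "gpr \<alpha> ` Vc 0 = {0}" using False Vc_closed(1)[of 0] by (auto simp: gpr_def)
    ultimately show ?thesis using False by (simp add: gdim_def)
  qed
  finally show ?thesis .
qed

text \<open>The minus sign in \<open>N_of\<close> cancels the one in \<open>cp_D\<close> and leaves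
  the Jordan operator itself.\<close>

lemma N_V_coord:
  assumes Y: "Y \<in> carrier (gr_V fD \<alpha>)"
  shows "N_V fD \<alpha> Y \<in> carrier (gr_V fD \<alpha>)" "gh \<alpha> (N_V fD \<alpha> Y) = jop (gdim \<alpha>) lev' (gh \<alpha> Y)"
proof -
  let ?U = "below V0 \<alpha>"
  let ?\<phi> = "\<lambda>x. \<ominus>\<^bsub>GM fD\<^esub> (GM_euler fD x \<oplus>\<^bsub>GM fD\<^esub> tau_const (of_rat \<alpha>) \<odot>\<^bsub>GM fD\<^esub> x)"
  note c = chartD[OF GM_quotient(1)]
  obtain X where X: "X \<in> V0 \<alpha>" "Y = ?U +>\<^bsub>GM fD\<^esub> X" using gr_quot(4)[OF Y] by auto
  have \<phi>: "?\<phi> x \<in> V0 \<alpha>" "gpr \<alpha> (hG (?\<phi> x)) = jop (gdim \<alpha>) lev' (gpr \<alpha> (hG x))" if x: "x \<in> V0 \<alpha>" for x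
  proof -
    have xM: "x \<in> carrier (GM fD)" "hG x \<in> Vc 0" using x by (auto simp: V0_def floor_0)
    have 1: "GM_euler fD x \<oplus>\<^bsub>GM fD\<^esub> tau_const (of_rat \<alpha>) \<odot>\<^bsub>GM fD\<^esub> x \<in> carrier (GM fD)"
      "hG (GM_euler fD x \<oplus>\<^bsub>GM fD\<^esub> tau_const (of_rat \<alpha>) \<odot>\<^bsub>GM fD\<^esub> x) = D (hG x) + fsc (tau_const (of_rat \<alpha>)) (hG x)"
      using xM c(3,4,5,6) GM_euler_coord by auto
    have 2: "?\<phi> x \<in> carrier (GM fD)" "hG (?\<phi> x) = - (D (hG x) + fsc (tau_const (of_rat \<alpha>)) (hG x))"
      using chart_minus[OF GM_quotient(1) 1(1)] 1(2) by auto
    show "?\<phi> x \<in> V0 \<alpha>" unfolding V0_mem[OF 2(1)] 2(2) floor_0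
      by (intro Vc_closed(2,3,5) D_Vc xM const_ring_tau)
    show "gpr \<alpha> (hG (?\<phi> x)) = jop (gdim \<alpha>) lev' (gpr \<alpha> (hG x))"
    proof (cases "\<alpha> = 0")
      case True
      then have "hG (?\<phi> x) = - D (hG x)" unfolding 2(2) by simp
      then show ?thesis using True cp_D[OF xM(2)] unfolding gpr_def gdim_def by (simp only: simp_thms if_True cp_simps minus_minus)
    next
      case False then show ?thesis by (simp only: gpr_def gdim_def if_False jop_linear)
    qed
  qed
  have co: "Y = {Z \<in> V0 \<alpha>. gpr \<alpha> (hG Z) = gpr \<alpha> (hG X)}"
    using chart_coset[where \<pi> = "gpr \<alpha>", OF chart_V0[OF field_const_sub] gpr_add below_V0[OF \<alpha>], of X] X
    by (simp add: a_r_coset_carrier_update)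
  have "induced_map ((GM fD)\<lparr>carrier := V0 \<alpha>\<rparr>) ?U ?\<phi> Y = ?U +>\<^bsub>(GM fD)\<lparr>carrier := V0 \<alpha>\<rparr>\<^esub> ?\<phi> X"
    by (rule induced_map_coset[where \<pi> = "gpr \<alpha>", OF chart_V0[OF field_const_sub] gpr_add below_V0[OF \<alpha>]])
       (use X \<phi> in \<open>auto simp: co\<close>)
  then have N: "N_V fD \<alpha> Y = ?U +>\<^bsub>GM fD\<^esub> ?\<phi> X"
    by (simp add: N_V_def N_of_def KM_eq induced_map_carrier_update a_r_coset_carrier_update)
  show "N_V fD \<alpha> Y \<in> carrier (gr_V fD \<alpha>)" unfolding N using gr_quot(2) \<phi>(1)[OF X(1)] by simp
  show "gh \<alpha> (N_V fD \<alpha> Y) = jop (gdim \<alpha>) lev' (gh \<alpha> Y)"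
    unfolding N unfolding X(2) gr_quot(3)[OF X(1)] gr_quot(3)[OF \<phi>(1)[OF X(1)]] by (rule \<phi>(2)[OF X(1)])
qed

lemma weight_gr_eq:
  "weight_gr fD \<alpha> k = {Y \<in> carrier (gr_V fD \<alpha>). gh \<alpha> Y \<in> jfil (gdim \<alpha>) lev' (mhs_center TYPE('n) \<alpha>) k}"
  unfolding weight_gr_def
  by (rule weight_filtration_jordan[OF gr_quot(1) N_V_coord gh_image])
     (auto simp: gdim_def lev_mono split: if_splits)

end

end

text \<open>The Hodge and the weight filtration both turn out to consist of coordinate subspaces for
  one basis, which reduces their dimensions to counting indices.\<close>

definition cspace :: "nat \<Rightarrow> nat set \<Rightarrow> (nat \<Rightarrow> laurent_tau) set" where
  "cspace N S = {z \<in> jspace N. \<forall>k. z k \<noteq> 0 \<longrightarrow> k \<in> S}"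

lemma jfil_cspace: "jfil N a c m = cspace N {k. jweight N a c k \<le> m}"
  by (simp add: jfil_def cspace_def)

lemma cspace_closed: "0 \<in> cspace N S" "x \<in> cspace N S \<Longrightarrow> y \<in> cspace N S \<Longrightarrow> x + y \<in> cspace N S"
  "x \<in> cspace N S \<Longrightarrow> - x \<in> cspace N S" "a \<in> carrier field_const \<Longrightarrow> x \<in> cspace N S \<Longrightarrow> fsc a x \<in> cspace N S"
proof -
  show "x + y \<in> cspace N S" if "x \<in> cspace N S" "y \<in> cspace N S"
  proof -
    have "x k \<noteq> 0 \<or> y k \<noteq> 0" if "x k + y k \<noteq> 0" for k using that by auto
    then show ?thesis using that jspace_closed(2) by (fastforce simp: cspace_def)
  qed
  show "fsc a x \<in> cspace N S" if "a \<in> carrier field_const" "x \<in> cspace N S"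
    using that jspace_closed(5)[of a x] by (auto simp: cspace_def fsc_def)
qed (auto simp: cspace_def jspace_closed)

text \<open>Forgetting the coordinates in \<open>SA\<close> is an additive map whose kernel on
  \<open>B\<close> is \<open>A\<close>, so the quotient has the remaining coordinates of
  \<open>SB\<close>.\<close>

lemma dim_cspace_quotient:
  assumes ch: "chart (carrier field_const) M fsc h" and im: "h ` carrier M = jspace N" and sub: "SA \<subseteq> SB"
    and A: "A = {x \<in> carrier M. h x \<in> cspace N SA}" and B: "B = {x \<in> carrier M. h x \<in> cspace N SB}"
  shows "vectorspace.dim field_const (quotient_module (M\<lparr>carrier := B\<rparr>) A) = card {k. k < N \<and> k \<in> SB \<and> k \<notin> SA}"
proof -
  define \<pi> where "\<pi> = (\<lambda>z::nat \<Rightarrow> laurent_tau. \<lambda>k. if k \<in> SA then 0 else z k)"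
  have chB: "chart (carrier field_const) (M\<lparr>carrier := B\<rparr>) fsc h"
    by (rule chart_restrict[OF ch B]) (auto simp: cspace_closed)
  have \<pi>: "\<pi> (x + y) = \<pi> x + \<pi> y" "\<pi> (fsc a x) = fsc a (\<pi> x)" for x y a by (auto simp: \<pi>_def fun_eq_iff fsc_def)
  have N: "A = {x \<in> carrier (M\<lparr>carrier := B\<rparr>). \<pi> (h x) = 0}"
    unfolding A B using sub by (auto simp: \<pi>_def cspace_def fun_eq_iff)
  note Q = chart_quotient[where \<pi> = \<pi> and sc' = fsc, OF chB \<pi> N]
  have hB: "h ` B = cspace N SB"
  proof -
    have "cspace N SB \<subseteq> h ` carrier M" unfolding im by (auto simp: cspace_def)
    then show ?thesis unfolding B by blast
  qed
  show ?thesis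
  proof (rule chart_dim[OF Q(1)])
    show "finite {k. k < N \<and> k \<in> SB \<and> k \<notin> SA}" by simp
    have "quot_coord \<pi> h ` carrier (quotient_module (M\<lparr>carrier := B\<rparr>) A) = \<pi> ` h ` B"
    proof (intro equalityI subsetI)
      fix x assume "x \<in> quot_coord \<pi> h ` carrier (quotient_module (M\<lparr>carrier := B\<rparr>) A)"
      then obtain Y where Y: "Y \<in> carrier (quotient_module (M\<lparr>carrier := B\<rparr>) A)" "x = quot_coord \<pi> h Y" by blast
      obtain X where "X \<in> carrier (M\<lparr>carrier := B\<rparr>)" "Y = A +>\<^bsub>M\<lparr>carrier := B\<rparr>\<^esub> X" using Q(4)[OF Y(1)] by blast
      then show "x \<in> \<pi> ` h ` B" using Y(2) Q(3)[of X] by simp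
    next
      fix x assume "x \<in> \<pi> ` h ` B"
      then obtain X where X: "X \<in> carrier (M\<lparr>carrier := B\<rparr>)" "x = \<pi> (h X)" by auto
      show "x \<in> quot_coord \<pi> h ` carrier (quotient_module (M\<lparr>carrier := B\<rparr>) A)"
        unfolding X(2) Q(3)[OF X(1), symmetric] by (rule imageI[OF Q(2)[OF X(1)]])
    qed
    also have "\<dots> = {x. (\<forall>k. k \<notin> {k. k < N \<and> k \<in> SB \<and> k \<notin> SA} \<longrightarrow> x k = 0) \<and> (\<forall>k. x k \<in> carrier field_const)}"
    proof (intro equalityI subsetI)
      fix x assume "x \<in> \<pi> ` h ` B"
      then obtain z where "z \<in> cspace N SB" "x = \<pi> z" unfolding hB by blast
      then show "x \<in> {x. (\<forall>k. k \<notin> {k. k < N \<and> k \<in> SB \<and> k \<notin> SA} \<longrightarrow> x k = 0) \<and> (\<forall>k. x k \<in> carrier field_const)}"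
        using jspace_closed(1)[of N] by (auto simp: \<pi>_def cspace_def jspace_def)
    next
      fix x assume x: "x \<in> {x. (\<forall>k. k \<notin> {k. k < N \<and> k \<in> SB \<and> k \<notin> SA} \<longrightarrow> x k = 0) \<and> (\<forall>k. x k \<in> carrier field_const)}"
      then have "x \<in> cspace N SB" "x = \<pi> x" by (auto simp: cspace_def jspace_def \<pi>_def fun_eq_iff)
      then show "x \<in> \<pi> ` h ` B" unfolding hB by (metis image_eqI)
    qed
    finally show "quot_coord \<pi> h ` carrier (quotient_module (M\<lparr>carrier := B\<rparr>) A) =
      {x. (\<forall>k. k \<notin> {k. k < N \<and> k \<in> SB \<and> k \<notin> SA} \<longrightarrow> x k = 0) \<and> (\<forall>k. x k \<in> carrier field_const)}" .
  qed
qed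

lemma ub_sum: "(\<And>i. i \<in> S \<Longrightarrow> ub d (f i)) \<Longrightarrow> ub d (sum f S)"
  by (induction S rule: infinite_finite_induct) (auto simp: ub_simps)

lemma lookup_of_int_mult: "lk (of_int z * g :: 'n::finite laurent_utau) m = of_int z * lk g m"
proof -
  have "lk (Poly_Mapping.single 0 (of_int z) * g) m = of_int z * lk g (m - 0)" by (rule lookup_single_mult)
  then show ?thesis by simp
qed

section \<open>The Brieskorn lattice and the Hodge filtration in coordinates\<close>

context weighted_simplex
begin

text \<open>The k-th basis vector is tau^(k - lev k) u^(m_k) up to a constant. A coefficient of
  u^(m_k) in tau^s times the polynomials in tau^(-1) therefore means that the k-th coordinate has
  degree at most s + lev k - k.\<close>

definition Lam :: "int \<Rightarrow> (nat \<Rightarrow> laurent_tau) set" where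
  "Lam s = {x \<in> model. \<forall>k. ub (s + lev' k - int k) (x k)}"

lemma Lam_closed: "0 \<in> Lam s" "x \<in> Lam s \<Longrightarrow> y \<in> Lam s \<Longrightarrow> x + y \<in> Lam s" "x \<in> Lam s \<Longrightarrow> y \<in> Lam s \<Longrightarrow> x - y \<in> Lam s"
  "ub 0 b \<Longrightarrow> x \<in> Lam s \<Longrightarrow> fsc b x \<in> Lam s"
proof -
  show "fsc b x \<in> Lam s" if "ub 0 b" "x \<in> Lam s"
  proof -
    have "ub (0 + (s + lev' k - int k)) (b * x k)" for k using that by (intro ub_mult) (auto simp: Lam_def)
    then show ?thesis using that model_closed(3)[of x b] by (simp add: Lam_def fsc_def)
  qed
qed (auto simp: Lam_def model_closed ub_simps)

lemma Lam_tau_pow: "fsc (tau_pow t) x \<in> Lam s \<longleftrightarrow> x \<in> Lam (s - t)"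
proof -
  have "fsc (tau_pow t) x \<in> model \<longleftrightarrow> x \<in> model"
    using model_closed(3)[of x "tau_pow t"] model_closed(3)[of "fsc (tau_pow t) x" "tau_pow (- t)"]
    by (auto simp: tau_pow_mult)
  then show ?thesis by (simp add: Lam_def fsc_def[of "tau_pow t" x] ub_simps algebra_simps)
qed

lemma ub_const: "ub 0 (tau_const c)" "ub 0 (of_nat i)"
proof -
  show "ub 0 (tau_const c)" for c by (simp add: ub_def tau_const_def lookup_single when_def)
  from this[of "of_nat i"] show "ub 0 (of_nat i)" by simp
qed

text \<open>Measured against u^(m_k), every entry of \<open>shift\<close> raises the degree in tau
  by exactly one, the wrap-around entry included. This mirrors the action of tau d/dtau on a
  monomial as - tau times multiplication by the Laurent polynomial.\<close>

lemma Lam_D: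
  assumes x: "x \<in> Lam 0" shows "D x \<in> Lam 1"
proof -
  have ux: "ub (lev' k - int k) (x k)" for k using x by (simp add: Lam_def)
  have "ub (1 + lev' k - int k) (shift x k)" for k
  proof -
    have 1: "ub (1 + lev' 0 - int 0) (tau_const K * (tau_pow (int \<mu> - int (lev (\<mu> - 1))) * x (\<mu> - 1)))"
    proof (intro ub_simps(5), subst ub_simps(4))
      have "1 + lev' 0 - int 0 - (int \<mu> - int (lev (\<mu> - 1))) = lev' (\<mu> - 1) - int (\<mu> - 1)"
        using mu_pos by (simp add: lev_0 of_nat_diff)
      then show "ub (1 + lev' 0 - int 0 - (int \<mu> - int (lev (\<mu> - 1)))) (x (\<mu> - 1))" using ux by (simp only:)
    qed
    have 2: "ub (1 + lev' k - int k) (tau_pow (int (lev k) - int (lev (k - 1))) * x (k - 1))" if "k \<noteq> 0"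
    proof (subst ub_simps(4))
      have "1 + lev' k - int k - (int (lev k) - int (lev (k - 1))) = lev' (k - 1) - int (k - 1)"
        using that by (simp add: of_nat_diff)
      then show "ub (1 + lev' k - int k - (int (lev k) - int (lev (k - 1)))) (x (k - 1))" using ux by (simp only:)
    qed
    show ?thesis
    proof (cases "k = 0")
      case True
      have "shift x k = tau_const K * (tau_pow (int \<mu> - int (lev (\<mu> - 1))) * x (\<mu> - 1))"
        unfolding shift_def True by (simp add: mult.assoc)
      then show ?thesis using 1 True by simp
    next
      case False
      then have "shift x k = (if k < \<mu> then tau_pow (int (lev k) - int (lev (k - 1))) * x (k - 1) else 0)"
        by (simp add: shift_def)
      then show ?thesis using 2[OF False] by (simp add: ub_simps)
    qed
  qed
  moreover have "ub (1 + lev' k - int k) (tau_del (x k))" for k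
  proof -
    have "ub (lev' k - int k) (tau_del (x k))" by (rule ub_simps(6)[OF ux])
    then show ?thesis by (fastforce simp: ub_def)
  qed
  ultimately have "ub (1 + lev' k - int k) (D x k)" for k by (simp add: D_def ub_simps(7))
  moreover have "D x \<in> model" using x by (simp add: Lam_def D_model)
  ultimately show ?thesis by (simp add: Lam_def)
qed

lemma Lam_mono: "s \<le> t \<Longrightarrow> x \<in> Lam s \<Longrightarrow> x \<in> Lam t"
  by (fastforce simp: Lam_def ub_def)

text \<open>The factor tau^(-1) in \<open>psi_step\<close> compensates the degree one of
  \<open>D\<close>. So every monomial, on the path or not, is a combination of path monomials
  without positive powers of tau, and the Brieskorn lattice is spanned by the path.\<close>

lemma psi_Lam: "psi (emb c) \<in> Lam 0"
proof (induction "csize c" arbitrary: c)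
  case 0
  then have "c j = 0" if "j \<le> n" for j using that by (simp add: csize_def)
  then have "psi (emb c) = ev 0" using 0 by (simp add: psi_emb U_def W_zero)
  moreover have "ub 0 (1 :: laurent_tau)" using ub_const(1)[of 1] by simp
  ultimately show ?case using mu_pos by (auto simp: Lam_def model_def ev_def ub_simps lev_0)
next
  case (Suc s)
  have "\<exists>j\<le>n. c j \<noteq> 0" using Suc(2) unfolding csize_def by (metis Zero_not_Suc atLeastAtMost_iff sum.neutral)
  then obtain j where j: "j \<le> n" "c j \<noteq> 0" by blast
  define c' where "c' = c(j := c j - 1)"
  have c: "c = c'(j := Suc (c' j))" using j by (auto simp: c'_def)
  have "csize c = (\<Sum>i=0..n. c' i + (if i = j then 1 else 0))" unfolding csize_def by (intro sum.cong) (auto simp: c)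
  then have sz: "s = csize c'" using Suc(2) j by (simp add: csize_def sum.distrib)
  note IH = Suc(1)[OF sz]
  have ec: "emb c = v j + emb c'" using emb_upd[OF j(1), of c'] unfolding c[symmetric] .
  have IH1: "psi (emb c') \<in> Lam 1" by (rule Lam_mono[OF _ IH]) simp
  have "fsc (of_nat (c' j)) (psi (emb c')) -
    fsc (tau_const (1 / of_nat (p j))) (D (psi (emb c')) + fsc (of_nat (csize c')) (psi (emb c'))) \<in> Lam 1"
    by (intro Lam_closed(3) Lam_closed(4) Lam_closed(2) ub_const IH1 Lam_D IH)
  then show ?case unfolding ec psi_step[OF j(1)] Lam_tau_pow by simp
qed

lemma Psi_Lam:
  assumes "\<And>m. ub 0 (lk g m)" shows "Psi g \<in> Lam 0"
proof -
  have "psi m \<in> Lam 0" for m using ex_lift[of m] psi_Lam by blast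
  then have "(\<Sum>m\<in>S. fsc (lk g m) (psi m)) \<in> Lam 0" for S
    by (induction S rule: infinite_finite_induct)
      (simp_all only: sum.infinite sum.empty sum.insert Lam_closed assms not_False_eq_True)
  then show ?thesis unfolding Psi_def .
qed

lemma keys_ub: "Poly_Mapping.keys a \<subseteq> {..0} \<longleftrightarrow> ub 0 a"
  by (auto simp: ub_def in_keys_iff)

text \<open>\<open>Psi_Lam\<close> gives one direction. For the other, \<open>Sec\<close> of
  coordinates in \<open>Lam 0\<close> has coefficients without positive powers of tau, and
  \<open>vol\<close> times it is a representing form.\<close>

lemma brieskorn_coord: "X \<in> brieskorn fD \<longleftrightarrow> X \<in> carrier (GM fD) \<and> hG X \<in> Lam 0"
proof
  assume "X \<in> brieskorn fD"
  then obtain \<omega> where \<omega>: "X = twisted_boundaries fD +>\<^bsub>top_forms\<^esub> \<omega>" "\<omega> \<in> forms CARD('n)"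
    "\<forall>l m. Poly_Mapping.keys (lk (\<omega> l) m) \<subseteq> {..0}" unfolding brieskorn_def by blast
  have "\<omega> \<in> carrier top_forms" using \<omega>(2) by (simp add: top_forms_def)
  then show "X \<in> carrier (GM fD) \<and> hG X \<in> Lam 0"
    unfolding \<omega>(1) using GM_quotient(2,3) Psi_Lam[of "\<omega> enum_list"] \<omega>(3) keys_ub by simp
next
  assume X: "X \<in> carrier (GM fD) \<and> hG X \<in> Lam 0"
  define x where "x = hG X"
  have xM: "x \<in> model" using X by (simp add: x_def Lam_def)
  define \<omega> :: "'n form" where "\<omega> = (\<lambda>l. of_int (vol l) * Sec x)"
  have \<omega>f: "\<omega> \<in> forms CARD('n)"
    unfolding \<omega>_def by (rule formsI) (auto simp: vol_swap, simp add: vol_def)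
  then have \<omega>c: "\<omega> \<in> carrier top_forms" by (simp add: top_forms_def)
  have "ub 0 (x k * sec k)" for k
  proof -
    have eq: "x k * sec k = tau_const (1 / kap k) * (tau_pow (int k - lev' k) * x k)" by (simp add: sec_def mult_ac)
    have u: "ub (0 - (int k - lev' k)) (x k)" using X by (simp add: x_def Lam_def)
    show ?thesis unfolding eq by (rule ub_simps(5)) (simp only: ub_simps(4) u)
  qed
  then have "ub 0 (lk (Sec x) m)" for m
    unfolding Sec_def lookup_sum by (intro ub_sum) (auto simp: lookup_single when_def ub_simps)
  then have "ub 0 (tau_const (of_int (vol l)) * lk (Sec x) m)" for l :: "'n list" and m by (rule ub_simps(5))
  then have "ub 0 (lk (\<omega> l) m)" for l m by (simp add: \<omega>_def lookup_of_int_mult)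
  then have keys: "\<forall>l m. Poly_Mapping.keys (lk (\<omega> l) m) \<subseteq> {..0}" using keys_ub by blast
  have "hG (twisted_boundaries fD +>\<^bsub>top_forms\<^esub> \<omega>) = hG X"
    unfolding GM_quotient(3)[OF \<omega>c] using Psi_Sec[OF xM] by (simp add: \<omega>_def vol_enum x_def)
  then have "X = twisted_boundaries fD +>\<^bsub>top_forms\<^esub> \<omega>"
    using chartD(7)[OF GM_quotient(1) conjunct1[OF X] GM_quotient(2)[OF \<omega>c]] by simp
  then show "X \<in> brieskorn fD" unfolding brieskorn_def using \<omega>f keys by blast
qed

lemma tau_brieskorn_coord: "X \<in> tau_brieskorn fD s \<longleftrightarrow> X \<in> carrier (GM fD) \<and> hG X \<in> Lam s"
proof
  note c = chartD[OF GM_quotient(1)]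
  { assume "X \<in> tau_brieskorn fD s"
    then obtain Y where "Y \<in> brieskorn fD" "X = tau_pow s \<odot>\<^bsub>GM fD\<^esub> Y" unfolding tau_brieskorn_def by blast
    then show "X \<in> carrier (GM fD) \<and> hG X \<in> Lam s"
      using c(5,6) by (simp add: brieskorn_coord Lam_tau_pow) }
  assume X: "X \<in> carrier (GM fD) \<and> hG X \<in> Lam s"
  define Y where "Y = tau_pow (- s) \<odot>\<^bsub>GM fD\<^esub> X"
  have Y: "Y \<in> carrier (GM fD)" "hG Y = fsc (tau_pow (- s)) (hG X)" unfolding Y_def using c(5,6) X by auto
  have "Y \<in> brieskorn fD" using X Y by (simp add: brieskorn_coord Lam_tau_pow)
  moreover have "X = tau_pow s \<odot>\<^bsub>GM fD\<^esub> Y"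
    using c(5)[OF UNIV_I Y(1), of "tau_pow s"] c(6)[OF UNIV_I Y(1), of "tau_pow s"] X Y(2)
    by (intro c(7)) (auto simp: tau_pow_mult)
  ultimately show "X \<in> tau_brieskorn fD s" unfolding tau_brieskorn_def by blast
qed

lemma hodge_gr_eq:
  "hodge_gr fD \<alpha> r = (\<lambda>x. below V0 \<alpha> +>\<^bsub>GM fD\<^esub> x) ` (tau_brieskorn fD (mhs_center TYPE('n) \<alpha> - r) \<inter> V0 \<alpha>)"
  by (simp add: hodge_gr_def KM_eq)

lemma zero_gr:
  assumes \<alpha>: "\<alpha> \<in> {0..<1}"
  shows "\<zero>\<^bsub>gr_V fD \<alpha>\<^esub> \<in> carrier (gr_V fD \<alpha>)" "gh \<alpha> \<zero>\<^bsub>gr_V fD \<alpha>\<^esub> = 0"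
    "\<zero>\<^bsub>gr_V fD \<alpha>\<^esub> \<in> hodge_gr fD \<alpha> r" "\<zero>\<^bsub>gr_V fD \<alpha>\<^esub> \<in> weight_gr fD \<alpha> m"
proof -
  note g = chartD[OF gr_quot(1)[OF \<alpha>]] and c = chartD[OF GM_quotient(1)]
  show z: "\<zero>\<^bsub>gr_V fD \<alpha>\<^esub> \<in> carrier (gr_V fD \<alpha>)" "gh \<alpha> \<zero>\<^bsub>gr_V fD \<alpha>\<^esub> = 0" by (rule g(1), rule g(2))
  have z0: "\<zero>\<^bsub>GM fD\<^esub> \<in> V0 \<alpha>" using c(1,2) by (simp add: V0_def Vc_closed)
  have "\<zero>\<^bsub>gr_V fD \<alpha>\<^esub> = below V0 \<alpha> +>\<^bsub>GM fD\<^esub> \<zero>\<^bsub>GM fD\<^esub>"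
    using gr_quot(2)[OF \<alpha> z0] gr_quot(3)[OF \<alpha> z0] z c(2) by (intro g(7)) (auto simp: gpr_def cp_simps)
  moreover have "\<zero>\<^bsub>GM fD\<^esub> \<in> tau_brieskorn fD s" for s using c(1,2) by (simp add: tau_brieskorn_coord Lam_closed)
  ultimately show "\<zero>\<^bsub>gr_V fD \<alpha>\<^esub> \<in> hodge_gr fD \<alpha> r" unfolding hodge_gr_eq using z0 by blast
  show "\<zero>\<^bsub>gr_V fD \<alpha>\<^esub> \<in> weight_gr fD \<alpha> m"
    unfolding weight_gr_eq[OF \<alpha>] using z by (simp add: jfil_cspace cspace_closed)
qed

lemma gr_trivial:
  assumes \<alpha>: "\<alpha> \<in> {0..<1}" "\<alpha> \<noteq> 0" and Y: "Y \<in> carrier (gr_V fD \<alpha>)"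
  shows "Y = \<zero>\<^bsub>gr_V fD \<alpha>\<^esub>"
proof -
  have "gh \<alpha> Y \<in> jspace 0" using gh_image[OF \<alpha>(1)] Y \<alpha>(2) by (auto simp: gdim_def)
  then have "gh \<alpha> Y = 0" by (auto simp: jspace_def fun_eq_iff)
  then show ?thesis using zero_gr(1,2)[OF \<alpha>(1)] Y by (intro chartD(7)[OF gr_quot(1)[OF \<alpha>(1)]]) auto
qed

lemma unit0: "(0::rat) \<in> {0..<1}"
  by simp

text \<open>The basis is adapted to both lattices: \<open>Vc 0\<close> bounds each coordinate from
  below and \<open>Lam\<close> bounds each from above. A constant vector thus lies in
  \<open>Lam (int n - r)\<close> as soon as each of its nonzero entries k admits the exponent 0,
  that is, r is at most n - k + lev k.\<close>

lemma hodge_gr0: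
  assumes Y: "Y \<in> carrier (gr_V fD 0)"
  shows "Y \<in> hodge_gr fD 0 r \<longleftrightarrow> gh 0 Y \<in> cspace \<mu> {k. r \<le> int n - int k + lev' k}"
proof
  have center: "mhs_center TYPE('n) 0 = int n" by (simp add: mhs_center_def n)
  { assume "Y \<in> hodge_gr fD 0 r"
    then obtain X where X: "X \<in> tau_brieskorn fD (int n - r)" "X \<in> V0 0" "Y = below V0 0 +>\<^bsub>GM fD\<^esub> X"
      unfolding hodge_gr_eq center by blast
    have gY: "gh 0 Y = cp (hG X)" unfolding X(3) gr_quot(3)[OF unit0 X(2)] by (simp add: gpr_def)
    have "r \<le> int n - int k + lev' k" if "cp (hG X) k \<noteq> 0" for k
    proof -
      have "lk (hG X k) 0 \<noteq> 0" using that by (auto simp: cp_def)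
      moreover have "ub (int n - r + lev' k - int k) (hG X k)" using X(1) by (simp add: tau_brieskorn_coord Lam_def)
      ultimately have "0 \<le> int n - r + lev' k - int k" unfolding ub_def by blast
      then show ?thesis by simp
    qed
    moreover have "cp (hG X) \<in> jspace \<mu>" using X(1) by (intro cp_jspace) (simp add: tau_brieskorn_coord Lam_def)
    ultimately show "gh 0 Y \<in> cspace \<mu> {k. r \<le> int n - int k + lev' k}" unfolding gY cspace_def by blast }
  assume z: "gh 0 Y \<in> cspace \<mu> {k. r \<le> int n - int k + lev' k}"
  define z where "z = gh 0 Y"
  have zj: "z \<in> jspace \<mu>" using z by (simp add: z_def cspace_def)
  have zV: "z \<in> Vc 0" "cp z = z" using jspace_cp[OF zj] by auto
  then have "z \<in> hG ` carrier (GM fD)" unfolding hG_image Vc_def by blast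
  then obtain X where X: "X \<in> carrier (GM fD)" "hG X = z" by (elim imageE) simp
  have XV: "X \<in> V0 0" using X zV by (simp add: V0_def)
  have "ub (int n - r + lev' k - int k) (z k)" for k
  proof (cases "z k = 0")
    case False
    then have "0 \<le> int n - r + lev' k - int k" using z by (auto simp: z_def cspace_def)
    moreover have zk: "z k = tau_const (lk (z k) 0)" using zj by (simp add: jspace_def tau_const_carrier)
    have "ub 0 (z k)" by (subst zk) (rule ub_const(1))
    ultimately show ?thesis unfolding ub_def by (auto intro: order.trans)
  qed (simp add: ub_simps)
  then have "X \<in> tau_brieskorn fD (int n - r)" using X zV by (simp add: tau_brieskorn_coord Lam_def Vc_def)
  moreover have "Y = below V0 0 +>\<^bsub>GM fD\<^esub> X"
    using gr_quot(2)[OF unit0 XV] gr_quot(3)[OF unit0 XV] Y X(2) zV(2)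
    by (intro chartD(7)[OF gr_quot(1)[OF unit0]]) (auto simp: gpr_def z_def)
  ultimately show "Y \<in> hodge_gr fD 0 r" unfolding hodge_gr_eq center using XV by blast
qed

section \<open>The direct sum, reduced to its component at index 0\<close>

definition hH :: "(rat \<Rightarrow> 'n form set set) \<Rightarrow> nat \<Rightarrow> laurent_tau" where
  "hH h = gh 0 (h 0)"

lemma carrier_H: "h \<in> carrier (mhs_H fD) \<longleftrightarrow> h \<in> (\<Pi>\<^sub>E i\<in>{0..<1}. carrier (gr_V fD i))"
proof -
  have "finite {i \<in> {0..<1}. h i \<noteq> \<zero>\<^bsub>gr_V fD i\<^esub>}" if "h \<in> (\<Pi>\<^sub>E i\<in>{0..<1}. carrier (gr_V fD i))"
  proof (rule finite_subset[of _ "{0}"])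
    show "{i \<in> {0..<1}. h i \<noteq> \<zero>\<^bsub>gr_V fD i\<^esub>} \<subseteq> {0}"
    proof
      fix i assume i: "i \<in> {i \<in> {0..<1}. h i \<noteq> \<zero>\<^bsub>gr_V fD i\<^esub>}"
      then have "i \<in> {0..<1}" "h i \<in> carrier (gr_V fD i)" using PiE_mem[OF that, of i] by auto
      then show "i \<in> {0}" using gr_trivial[of i "h i"] i by blast
    qed
  qed simp
  then show ?thesis by (auto simp: mhs_H_def direct_sum_module_def)
qed

lemma H_eqI:
  assumes g: "g \<in> carrier (mhs_H fD)" and h: "h \<in> carrier (mhs_H fD)" and eq: "g 0 = h 0"
  shows "g = h"
proof (rule PiE_ext)
  show "g \<in> (\<Pi>\<^sub>E i\<in>{0..<1}. carrier (gr_V fD i))" "h \<in> (\<Pi>\<^sub>E i\<in>{0..<1}. carrier (gr_V fD i))"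
    using g h by (simp_all only: carrier_H)
  fix i :: rat assume i: "i \<in> {0..<1}"
  have gi: "g i \<in> carrier (gr_V fD i)" using g unfolding carrier_H by (rule PiE_mem[OF _ i])
  have hi: "h i \<in> carrier (gr_V fD i)" using h unfolding carrier_H by (rule PiE_mem[OF _ i])
  show "g i = h i"
  proof (cases "i = 0")
    case False
    show ?thesis unfolding gr_trivial[OF i False gi] gr_trivial[OF i False hi] ..
  qed (use eq in simp)
qed

lemma H_chart: "chart (carrier field_const) (mhs_H fD) fsc hH"
  and hH_image: "hH ` carrier (mhs_H fD) = jspace \<mu>"
proof -
  let ?H = "mhs_H fD"
  have g: "chart (carrier field_const) (gr_V fD i) fsc (gh i)" if "i \<in> {0..<1}" for i using that by (rule gr_quot(1))
  note c = chartD[OF g]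
  have mem: "h i \<in> carrier (gr_V fD i)" if "h \<in> carrier ?H" "i \<in> {0..<1}" for h i
    using that unfolding carrier_H by (rule PiE_mem)
  have zero: "\<zero>\<^bsub>?H\<^esub> = (\<lambda>i\<in>{0..<1}. \<zero>\<^bsub>gr_V fD i\<^esub>)"
    and add: "\<And>g h. g \<oplus>\<^bsub>?H\<^esub> h = (\<lambda>i\<in>{0..<1}. g i \<oplus>\<^bsub>gr_V fD i\<^esub> h i)"
    and sm: "\<And>a h. a \<odot>\<^bsub>?H\<^esub> h = (\<lambda>i\<in>{0..<1}. a \<odot>\<^bsub>gr_V fD i\<^esub> h i)"
    by (simp_all add: mhs_H_def direct_sum_module_def)
  have lift: "\<exists>h\<in>carrier ?H. h 0 = Y" if "Y \<in> carrier (gr_V fD 0)" for Y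
  proof (rule bexI[of _ "\<lambda>i\<in>{0..<1}. if i = 0 then Y else \<zero>\<^bsub>gr_V fD i\<^esub>"])
    show "(\<lambda>i\<in>{0..<1}. if i = 0 then Y else \<zero>\<^bsub>gr_V fD i\<^esub>) 0 = Y" by simp
    show "(\<lambda>i\<in>{0..<1}. if i = 0 then Y else \<zero>\<^bsub>gr_V fD i\<^esub>) \<in> carrier ?H"
      unfolding carrier_H using that zero_gr(1) by auto
  qed
  show "chart (carrier field_const) ?H fsc hH"
    unfolding chart_def
  proof (intro conjI ballI)
    show "inj_on hH (carrier ?H)"
    proof (rule inj_onI)
      fix g h assume gh: "g \<in> carrier ?H" "h \<in> carrier ?H" "hH g = hH h"
      then have "g 0 = h 0" using mem[OF _ unit0] by (intro c(7)[OF unit0]) (auto simp: hH_def)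
      then show "g = h" by (rule H_eqI[OF gh(1,2)])
    qed
    show "\<zero>\<^bsub>?H\<^esub> \<in> carrier ?H" unfolding zero carrier_H using zero_gr(1) by auto
    show "hH \<zero>\<^bsub>?H\<^esub> = 0" unfolding zero hH_def using zero_gr(2)[OF unit0] by simp
  next
    fix g h assume gh: "g \<in> carrier ?H" "h \<in> carrier ?H"
    show "g \<oplus>\<^bsub>?H\<^esub> h \<in> carrier ?H"
      unfolding add carrier_H using mem[OF gh(1)] mem[OF gh(2)] c(3) by auto
    show "hH (g \<oplus>\<^bsub>?H\<^esub> h) = hH g + hH h"
      unfolding add hH_def using c(4)[OF unit0 mem[OF gh(1) unit0] mem[OF gh(2) unit0]] by simp
  next
    fix h assume h: "h \<in> carrier ?H"
    obtain Y where Y: "Y \<in> carrier (gr_V fD 0)" "gh 0 Y = - gh 0 (h 0)" using c(8)[OF unit0 mem[OF h unit0]] by blast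
    obtain g where "g \<in> carrier ?H" "g 0 = Y" using lift[OF Y(1)] by blast
    then show "\<exists>g\<in>carrier ?H. hH g = - hH h" using Y(2) by (intro bexI[of _ g]) (simp_all add: hH_def)
  next
    fix a h assume a: "a \<in> carrier field_const" and h: "h \<in> carrier ?H"
    show "a \<odot>\<^bsub>?H\<^esub> h \<in> carrier ?H" unfolding sm carrier_H using mem[OF h] c(5)[OF _ a] by auto
    show "hH (a \<odot>\<^bsub>?H\<^esub> h) = fsc a (hH h)"
      unfolding sm hH_def using c(6)[OF unit0 a mem[OF h unit0]] by simp
  qed
  show "hH ` carrier ?H = jspace \<mu>"
  proof (intro equalityI subsetI)
    fix x assume "x \<in> hH ` carrier ?H"
    then obtain h where "h \<in> carrier ?H" "x = gh 0 (h 0)" by (auto simp: hH_def)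
    then have "x \<in> gh 0 ` carrier (gr_V fD 0)" using mem[OF _ unit0] by blast
    then show "x \<in> jspace \<mu>" unfolding gh_image[OF unit0] by (simp add: gdim_def)
  next
    fix x assume "x \<in> jspace \<mu>"
    then have "x \<in> gh 0 ` carrier (gr_V fD 0)" unfolding gh_image[OF unit0] by (simp add: gdim_def)
    then obtain Y where Y: "Y \<in> carrier (gr_V fD 0)" "x = gh 0 Y" by blast
    obtain h where "h \<in> carrier ?H" "h 0 = Y" using lift[OF Y(1)] by blast
    then show "x \<in> hH ` carrier ?H" using Y(2) by (intro image_eqI[of _ _ h]) (simp_all add: hH_def)
  qed
qed

lemma mhs_F_eq: "mhs_F fD r = {h \<in> carrier (mhs_H fD). hH h \<in> cspace \<mu> {k. r \<le> int n - int k + lev' k}}"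
proof -
  have "(\<forall>\<alpha>\<in>{0..<1}. h \<alpha> \<in> hodge_gr fD \<alpha> r) \<longleftrightarrow> hH h \<in> cspace \<mu> {k. r \<le> int n - int k + lev' k}"
    if h: "h \<in> carrier (mhs_H fD)" for h
  proof -
    have mem: "h i \<in> carrier (gr_V fD i)" if "i \<in> {0..<1}" for i using h that unfolding carrier_H by (rule PiE_mem)
    have "h \<alpha> \<in> hodge_gr fD \<alpha> r" if "\<alpha> \<in> {0..<1}" "\<alpha> \<noteq> 0" for \<alpha>
      unfolding gr_trivial[OF that mem[OF that(1)]] by (rule zero_gr(3)[OF that(1)])
    then have "(\<forall>\<alpha>\<in>{0..<1}. h \<alpha> \<in> hodge_gr fD \<alpha> r) \<longleftrightarrow> h 0 \<in> hodge_gr fD 0 r" using unit0 by metis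
    then show ?thesis unfolding hodge_gr0[OF mem[OF unit0]] hH_def .
  qed
  then show ?thesis unfolding mhs_F_def by blast
qed

lemma mhs_W_eq: "mhs_W fD m = {h \<in> carrier (mhs_H fD). hH h \<in> cspace \<mu> {k. jweight \<mu> lev' (int n) k \<le> m}}"
proof -
  have "(\<forall>\<alpha>\<in>{0..<1}. h \<alpha> \<in> weight_gr fD \<alpha> m) \<longleftrightarrow> hH h \<in> cspace \<mu> {k. jweight \<mu> lev' (int n) k \<le> m}"
    if h: "h \<in> carrier (mhs_H fD)" for h
  proof -
    have mem: "h i \<in> carrier (gr_V fD i)" if "i \<in> {0..<1}" for i using h that unfolding carrier_H by (rule PiE_mem)
    have "h \<alpha> \<in> weight_gr fD \<alpha> m" if "\<alpha> \<in> {0..<1}" "\<alpha> \<noteq> 0" for \<alpha>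
      unfolding gr_trivial[OF that mem[OF that(1)]] by (rule zero_gr(4)[OF that(1)])
    then have "(\<forall>\<alpha>\<in>{0..<1}. h \<alpha> \<in> weight_gr fD \<alpha> m) \<longleftrightarrow> h 0 \<in> weight_gr fD 0 m" using unit0 by metis
    moreover have "mhs_center TYPE('n) 0 = int n" by (simp add: mhs_center_def n)
    ultimately show ?thesis using mem[OF unit0] unfolding weight_gr_eq[OF unit0] by (simp add: jfil_cspace hH_def gdim_def)
  qed
  then show ?thesis unfolding mhs_W_def by blast
qed

lemma dim_gr_F_eq: "dim_gr_F fD r = card {k. k < \<mu> \<and> int n - int k + lev' k = r}"
proof -
  have "dim_gr_F fD r = card {k. k < \<mu> \<and> k \<in> {k. r \<le> int n - int k + lev' k} \<and> k \<notin> {k. r + 1 \<le> int n - int k + lev' k}}"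
    unfolding dim_gr_F_def by (rule dim_cspace_quotient[OF H_chart hH_image _ mhs_F_eq mhs_F_eq]) auto
  also have "\<dots> = card {k. k < \<mu> \<and> int n - int k + lev' k = r}" by (rule arg_cong[where f = card]) auto
  finally show ?thesis .
qed

lemma dim_gr_W_eq: "dim_gr_W fD m = card {k. k < \<mu> \<and> jweight \<mu> lev' (int n) k = m}"
proof -
  have "dim_gr_W fD m = card {k. k < \<mu> \<and> k \<in> {k. jweight \<mu> lev' (int n) k \<le> m} \<and> k \<notin> {k. jweight \<mu> lev' (int n) k \<le> m - 1}}"
    unfolding dim_gr_W_def by (rule dim_cspace_quotient[OF H_chart hH_image _ mhs_W_eq mhs_W_eq]) auto
  also have "\<dots> = card {k. k < \<mu> \<and> jweight \<mu> lev' (int n) k = m}" by (rule arg_cong[where f = card]) auto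
  finally show ?thesis .
qed

end

section \<open>Comparison of the two filtrations\<close>

text \<open>On a Jordan chain both \<open>w\<close> and \<open>2 h\<close> run through an arithmetic progression with step \<open>-2\<close>.
  A progression of given length minimises the second moment about \<open>c\<close> exactly when it is centered
  at \<open>c\<close>, as those of \<open>w\<close> are. Hence equal distributions force \<open>2 h = w\<close> chain by chain.\<close>

lemma weights_eq_iff:
  fixes a :: "nat \<Rightarrow> int" and c :: int
  assumes mono: "\<And>i j. i \<le> j \<Longrightarrow> j < N \<Longrightarrow> a i \<le> a j"
  defines "h \<equiv> \<lambda>k. c - int k + a k" and "w \<equiv> jweight N a c"
  shows "(\<forall>r. card {k. k < N \<and> h k = r} = card {k. k < N \<and> w k = 2 * r}) \<longleftrightarrow> (\<forall>k<N. w k = 2 * h k)"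
proof
  assume eq: "\<forall>k<N. w k = 2 * h k"
  have "{k. k < N \<and> h k = r} = {k. k < N \<and> w k = 2 * r}" for r using eq by auto
  then show "\<forall>r. card {k. k < N \<and> h k = r} = card {k. k < N \<and> w k = 2 * r}" by simp
next
  assume cards: "\<forall>r. card {k. k < N \<and> h k = r} = card {k. k < N \<and> w k = 2 * r}"
  define R where "R = h ` {..<N} \<union> (\<lambda>k. w k div 2) ` {..<N}"
  \<comment> \<open>Grouping by the common value \<open>r\<close> turns the equality of all counts
    into equality of sums of any function. Only indices of even weight occur on the right.\<close>
  have sums: "(\<Sum>k<N. G (h k)) = (\<Sum>k\<in>{k. k < N \<and> even (w k)}. G (w k div 2))" for G :: "int \<Rightarrow> int"
  proof -
    have "(\<Sum>k<N. G (h k)) = (\<Sum>r\<in>R. \<Sum>k\<in>{k \<in> {..<N}. h k = r}. G (h k))"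
      by (rule sum.group[symmetric]) (auto simp: R_def)
    also have "\<dots> = (\<Sum>r\<in>R. int (card {k. k < N \<and> h k = r}) * G r)" by (intro sum.cong) auto
    also have "\<dots> = (\<Sum>r\<in>R. int (card {k. k < N \<and> w k = 2 * r}) * G r)" using cards by simp
    also have "\<dots> = (\<Sum>r\<in>R. \<Sum>k\<in>{k \<in> {k. k < N \<and> even (w k)}. w k div 2 = r}. G (w k div 2))"
    proof (intro sum.cong refl)
      fix r
      have "{k \<in> {k. k < N \<and> even (w k)}. w k div 2 = r} = {k. k < N \<and> w k = 2 * r}" by auto
      then show "int (card {k. k < N \<and> w k = 2 * r}) * G r =
        (\<Sum>k\<in>{k \<in> {k. k < N \<and> even (w k)}. w k div 2 = r}. G (w k div 2))" by simp
    qed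
    also have "\<dots> = (\<Sum>k\<in>{k. k < N \<and> even (w k)}. G (w k div 2))"
      by (rule sum.group) (auto simp: R_def)
    finally show ?thesis .
  qed
  \<comment> \<open>The constant function 1 shows that the indices of even weight already number
    \<open>N\<close>, so no weight is odd.\<close>
  have "card {k. k < N \<and> even (w k)} = card {..<N}" using sums[of "\<lambda>_. 1"] by simp
  then have "{k. k < N \<and> even (w k)} = {..<N}" by (intro card_subset_eq) auto
  then have even: "even (w k)" if "k < N" for k using that by auto
  then have "{k. k < N \<and> even (w k)} = {..<N}" by auto
  then have "(\<Sum>k<N. (2 * h k - c)\<^sup>2) = (\<Sum>k<N. (2 * (w k div 2) - c)\<^sup>2)"
    using sums[of "\<lambda>r. (2 * r - c)\<^sup>2"] by simp
  also have "\<dots> = (\<Sum>k<N. (w k - c)\<^sup>2)" using even by (intro sum.cong) auto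
  finally have sq: "(\<Sum>k<N. (2 * h k - c)\<^sup>2) = (\<Sum>k<N. (w k - c)\<^sup>2)" .
  define \<delta> where "\<delta> = (\<lambda>k. 2 * h k - w k)"
  \<comment> \<open>Reversal of each block. It preserves \<open>\<delta>\<close>, since
    \<open>w\<close> and \<open>2 h\<close> drop by the same amount along a block, and it negates
    \<open>w - c\<close>.\<close>
  define \<rho> where "\<rho> = (\<lambda>k. jlast N a k + jfirst N a k - 1 - k)"
  have chain: "\<rho> k < N \<and> a (\<rho> k) = a k \<and> \<rho> (\<rho> k) = k \<and>
      w (\<rho> k) - c = - (w k - c) \<and> \<delta> (\<rho> k) = \<delta> k" if k: "k < N" for k
  proof -
    note self = jchain_self[where n = N and \<alpha> = a, OF mono k]
    have 1: "\<rho> k < N \<and> a (\<rho> k) = a k"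
      by (rule iffD2[OF jchain_iff[where n = N and \<alpha> = a, OF mono k]]) (use self in \<open>auto simp: \<rho>_def\<close>)
    have fl: "jfirst N a (\<rho> k) = jfirst N a k" "jlast N a (\<rho> k) = jlast N a k"
      using 1 by (simp_all add: jfirst_def jlast_def)
    have "int (\<rho> k) = int (jlast N a k) + int (jfirst N a k) - 1 - int k" using self by (simp add: \<rho>_def)
    then show ?thesis using 1 fl self
      by (auto simp: w_def jweight_def \<delta>_def h_def) (simp add: \<rho>_def fl)
  qed
  have bij: "bij_betw \<rho> {..<N} {..<N}"
    by (rule bij_betw_byWitness[where f' = \<rho>]) (use chain in auto)
  \<comment> \<open>As 2 h - c = (w - c) + \<delta>, this is the mixed term of the square. The
    reversal shows that it equals its own negative, so equality of second moments leaves only the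
    sum of the squares of \<open>\<delta>\<close>.\<close>
  have "(\<Sum>k<N. (w k - c) * \<delta> k) = (\<Sum>k<N. (w (\<rho> k) - c) * \<delta> (\<rho> k))"
    by (rule sum.reindex_bij_betw[OF bij, symmetric])
  also have "\<dots> = (\<Sum>k<N. - ((w k - c) * \<delta> k))"
  proof (rule sum.cong[OF refl])
    fix k assume "k \<in> {..<N}"
    then have "w (\<rho> k) - c = - (w k - c)" "\<delta> (\<rho> k) = \<delta> k" using chain[of k] by simp_all
    then show "(w (\<rho> k) - c) * \<delta> (\<rho> k) = - ((w k - c) * \<delta> k)" by (simp only: mult_minus_left)
  qed
  also have "\<dots> = - (\<Sum>k<N. (w k - c) * \<delta> k)" by (rule sum_negf)
  finally have cross: "(\<Sum>k<N. (w k - c) * \<delta> k) = 0" by simp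
  have "(\<Sum>k<N. (2 * h k - c)\<^sup>2) = (\<Sum>k<N. (w k - c)\<^sup>2 + 2 * ((w k - c) * \<delta> k) + (\<delta> k)\<^sup>2)"
    by (intro sum.cong refl) (simp add: \<delta>_def power2_eq_square algebra_simps)
  also have "\<dots> = (\<Sum>k<N. (w k - c)\<^sup>2) + 2 * (\<Sum>k<N. (w k - c) * \<delta> k) + (\<Sum>k<N. (\<delta> k)\<^sup>2)"
    by (simp only: sum.distrib sum_distrib_left)
  finally have "(\<Sum>k<N. (\<delta> k)\<^sup>2) = 0" using sq cross by simp
  then have "\<forall>k\<in>{..<N}. (\<delta> k)\<^sup>2 = 0" by (subst (asm) sum_nonneg_eq_0_iff) auto
  then show "\<forall>k<N. w k = 2 * h k" by (simp add: \<delta>_def)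
qed

lemma (in weighted_simplex) satisfies_KKP_iff:
  "satisfies_KKP fD \<longleftrightarrow> (\<forall>k<\<mu>. jweight \<mu> lev' (int n) k = 2 * (int n - int k + lev' k))"
  unfolding satisfies_KKP_def dim_gr_F_eq dim_gr_W_eq
  using weights_eq_iff[of \<mu> lev' "int n"] lev'_mono by blast

theorem proposition4p7:
  fixes v :: "nat \<Rightarrow> int^'n" and q d :: "nat \<Rightarrow> nat" and n \<mu> k :: nat
    and \<phi> :: "nat \<Rightarrow> rat" and F :: "rat set"
  assumes "n = CARD('n)"
    and "lattice_simplex v"
    and "\<forall>i\<le>n. q i = simplex_weight v i"
    and "\<forall>i j. i \<le> j \<and> j \<le> n \<longrightarrow> q i \<le> q j"
    and "Gcd (q ` {0..n}) = 1"
    and "reflexive_polytope (simplex_hull v)"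
    and "q n \<ge> 2"
    and "\<mu> = (\<Sum>i=0..n. q i)"
    and "F = {of_nat l / of_nat (q i) | l i. 0 \<le> l \<and> l \<le> q i - 1 \<and> 0 \<le> i \<and> i \<le> n}"
    and "k = card F"
    and "\<phi> ` {1..k} = F" and "strict_mono_on {1..k} \<phi>"
    and "\<forall>i\<in>{1..k}. d i = card {j \<in> {0..n}. of_nat (q j) * \<phi> i \<in> \<int>}"
  shows "satisfies_KKP (f_Delta v) \<longleftrightarrow>
    (\<forall>i\<in>{2..k}. (\<Sum>l=1..i-1. of_nat (d l)) - of_nat \<mu> * \<phi> i
                  = (of_nat (d 1) - of_nat (d i)) / (2 :: rat))"
proof -
  have qw: "q i = simplex_weight v i" if "i \<in> {0..CARD('n)}" for i using assms(1,3) that by simp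
  have gcd: "Gcd (q ` {0..CARD('n)}) = 1" using assms(1,5) by simp
  have qpos: "0 < q i" if "i \<le> n" for i
    using simplex_weight_pos[OF assms(2), of i] qw[of i] assms(1) that by simp
  interpret weighted_simplex n q \<mu> v
  proof
    show "0 < q i" if "i \<le> n" for i by (rule qpos[OF that])
    show "\<mu> = (\<Sum>i=0..n. q i)" by (rule assms(8))
    show "q i dvd \<mu>" if "i \<le> n" for i
      using reflexive_dvd[OF assms(2) qw assms(6), of i] that unfolding assms(8) assms(1) by simp
    show "n = CARD('n)" by (rule assms(1))
    show "(\<Sum>i=0..n. int (q i) * v i $ j) = 0" for j
      unfolding assms(1) by (rule weight_relation[OF assms(2) qw])
    show "\<exists>r. \<forall>i\<in>{0..n}. c i = r * int (q i)" if "\<And>j. (\<Sum>i=0..n. c i * v i $ j) = 0" for c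
      using weight_kernel[OF assms(2) qw gcd, of c] that unfolding assms(1) by blast
    show "\<exists>c. \<forall>j. m $ j = (\<Sum>i=0..n. c i * v i $ j)" for m
      unfolding assms(1) by (rule simplex_generates[OF assms(2) qw gcd])
    show "\<exists>y :: 'n \<Rightarrow> real. \<forall>l\<in>{0..n}. (\<Sum>a\<in>UNIV. y a * real_of_int (v l $ a)) =
        (if l = j then real (q k) else if l = k then - real (q j) else 0)" if "j \<le> n" "k \<le> n" "j \<noteq> k" for j k
    proof -
      note ne = that(3)
      have jk: "j \<in> {0..CARD('n)}" "k \<in> {0..CARD('n)}" using that assms(1) by auto
      show ?thesis
      proof (rule pair_functional[OF assms(2) qw jk ne])
        fix y :: "'n \<Rightarrow> real"
        assume "\<And>l. l \<in> {0..CARD('n)} \<Longrightarrow> (\<Sum>a\<in>UNIV. y a * real_of_int (v l $ a)) =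
          (if l = j then real (q k) else if l = k then - real (q j) else 0)"
        then show ?thesis unfolding assms(1) by blast
      qed
    qed
  qed

  \<comment> \<open>Levels of the path and the elements of \<open>F\<close>\<close>
  have mu0: "(of_nat \<mu> :: rat) \<noteq> 0" using mu_pos by simp
  have pos1: "i \<in> {1..k} \<Longrightarrow> \<phi> i \<in> F" for i using assms(11) by blast
  have F_iff: "x \<in> F \<longleftrightarrow> (\<exists>j l. j \<le> n \<and> l < q j \<and> x = of_nat l / of_nat (q j))" for x
  proof -
    have "l \<le> q j - 1 \<longleftrightarrow> l < q j" if "j \<le> n" for j l using qpos[OF that] by auto
    then show ?thesis unfolding assms(9) by auto
  qed
  have frac: "of_nat \<mu> * (of_nat l / of_nat (q j)) = (of_nat (l * p j) :: rat)" if "j \<le> n" for j l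
  proof -
    have "(of_nat \<mu> :: rat) = of_nat (p j) * of_nat (q j)" using pq[OF that] by (simp flip: of_nat_mult)
    then show ?thesis using qpos[OF that] by simp
  qed
  have lev_ex: "\<exists>m<\<mu>. of_nat (lev m) = of_nat \<mu> * \<phi> i" if i: "i \<in> {1..k}" for i
  proof -
    obtain j l where jl: "j \<le> n" "l < q j" "\<phi> i = of_nat l / of_nat (q j)" using pos1[OF i] F_iff by blast
    have "(j, l) \<in> (\<lambda>k. (dir k, path k (dir k))) ` {..<\<mu>}" using bij_path jl by (auto simp: bij_betw_def)
    then obtain m where m: "m < \<mu>" "dir m = j" "path m (dir m) = l" by auto
    then have "of_nat (lev m) = of_nat \<mu> * \<phi> i" unfolding jl(3) frac[OF jl(1)] by (simp add: lev_def)
    then show ?thesis using m(1) by blast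
  qed
  have phi_ex: "\<exists>i\<in>{1..k}. of_nat (lev m) = of_nat \<mu> * \<phi> i" if m: "m < \<mu>" for m
  proof -
    have "of_nat (path m (dir m)) / of_nat (q (dir m)) \<in> F"
      unfolding F_iff using dir(1)[of m] path_dir_less[OF m] by blast
    then obtain i where i: "i \<in> {1..k}" "\<phi> i = of_nat (path m (dir m)) / of_nat (q (dir m))" using assms(11) by (metis imageE)
    then have "of_nat (lev m) = of_nat \<mu> * \<phi> i" unfolding i(2) frac[OF dir(1)] by (simp add: lev_def)
    then show ?thesis using i(1) by blast
  qed
  have phi_less: "\<phi> i < \<phi> j \<longleftrightarrow> i < j" if "i \<in> {1..k}" "j \<in> {1..k}" for i j
    using assms(12) that by (metis linorder_less_linear order_less_asym strict_mono_onD order_less_irrefl)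
  have card_d: "card {m. m < \<mu> \<and> of_nat (lev m) = of_nat \<mu> * \<phi> i} = d i" if i: "i \<in> {1..k}" for i
  proof -
    obtain m0 where m0: "m0 < \<mu>" "of_nat (lev m0) = of_nat \<mu> * \<phi> i" using lev_ex[OF i] by blast
    define L where "L = lev m0"
    have L: "L < \<mu>" "\<phi> i = of_nat L / of_nat \<mu>" using lev_less[OF m0(1)] m0(2) mu0 by (auto simp: L_def)
    have "card {m. m < \<mu> \<and> of_nat (lev m) = of_nat \<mu> * \<phi> i} = card {m. m < \<mu> \<and> lev m = L}"
      unfolding m0(2)[symmetric] L_def by simp
    also have "\<dots> = (\<Sum>j=0..n. card {l. l < q j \<and> l * p j = L})" by (rule card_lev)
    also have "\<dots> = (\<Sum>j=0..n. if of_nat (q j) * \<phi> i \<in> \<int> then 1 else 0)"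
    proof (intro sum.cong refl)
      fix j assume "j \<in> {0..n}"
      then have j: "j \<le> n" by simp
      have muj: "(of_nat \<mu> :: rat) = of_nat (p j) * of_nat (q j)" using pq[OF j] by (simp flip: of_nat_mult)
      \<comment> \<open>In this form integrality means that p_j divides \<open>L\<close>, and the
        quotient is then the one \<open>l\<close> that is counted; it is below q_j because
        \<open>L\<close> is below mu.\<close>
      have qL: "of_nat (q j) * \<phi> i = of_nat L / of_nat (p j)" unfolding L(2) muj using qpos[OF j] by simp
      show "card {l. l < q j \<and> l * p j = L} = (if of_nat (q j) * \<phi> i \<in> \<int> then 1 else 0)"
      proof (cases "of_nat (q j) * \<phi> i \<in> \<int>")
        case True
        then obtain z where "of_nat L / of_nat (p j) = (of_int z :: rat)" unfolding qL by (elim Ints_cases)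
        then have "(of_int (int L) :: rat) = of_int (z * int (p j))" using p_pos[OF j] by (simp add: field_simps)
        then have "int L = z * int (p j)" by (simp only: of_int_eq_iff)
        then have "int (p j) dvd int L" by simp
        then have "p j dvd L" by (simp only: int_dvd_int_iff)
        then obtain l where l: "L = l * p j" by (metis dvd_div_mult_self)
        then have "l * p j < q j * p j" using L(1) pq[OF j] by (simp add: mult.commute)
        then have "{l. l < q j \<and> l * p j = L} = {l}" using l p_pos[OF j] by auto
        then show ?thesis using True by simp
      next
        case False
        have "\<not> (l < q j \<and> l * p j = L)" for l
        proof
          assume "l < q j \<and> l * p j = L"
          then have "of_nat L / of_nat (p j) = (of_nat l :: rat)" using p_pos[OF j] by auto
          then show False using False unfolding qL by simp
        qed
        then show ?thesis using False by simp
      qed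
    qed
    also have "\<dots> = card {j \<in> {0..n}. of_nat (q j) * \<phi> i \<in> \<int>}" by (simp add: sum.If_cases Int_def)
    also have "\<dots> = d i" using assms(13) i by simp
    finally show ?thesis .
  qed
  \<comment> \<open>The block of f_i starts after the blocks of all smaller elements of
    \<open>F\<close>, whose lengths are the numbers d_l by \<open>card_d\<close>.\<close>
  have first: "jfirst \<mu> lev' m = (\<Sum>l=1..i-1. d l)"
    if i: "i \<in> {1..k}" and m: "of_nat (lev m) = of_nat \<mu> * \<phi> i" for i m
  proof -
    have "{m'. m' < \<mu> \<and> lev' m' < lev' m} = (\<Union>l\<in>{1..i-1}. {m'. m' < \<mu> \<and> of_nat (lev m') = of_nat \<mu> * \<phi> l})"
    proof (intro equalityI subsetI)
      fix m' assume "m' \<in> {m'. m' < \<mu> \<and> lev' m' < lev' m}"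
      then have m': "m' < \<mu>" "(of_nat (lev m') :: rat) < of_nat (lev m)" by auto
      obtain l where l: "l \<in> {1..k}" "of_nat (lev m') = of_nat \<mu> * \<phi> l" using phi_ex[OF m'(1)] by blast
      then have "\<phi> l < \<phi> i" using m'(2) mu_pos unfolding m l(2) by simp
      then have "l \<in> {1..i-1}" using phi_less[OF l(1) i] l(1) by auto
      then show "m' \<in> (\<Union>l\<in>{1..i-1}. {m'. m' < \<mu> \<and> of_nat (lev m') = of_nat \<mu> * \<phi> l})" using m'(1) l(2) by blast
    next
      fix m' assume "m' \<in> (\<Union>l\<in>{1..i-1}. {m'. m' < \<mu> \<and> of_nat (lev m') = of_nat \<mu> * \<phi> l})"
      then obtain l where l: "l \<in> {1..i-1}" "m' < \<mu>" "of_nat (lev m') = of_nat \<mu> * \<phi> l" by blast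
      then have "\<phi> l < \<phi> i" using phi_less[of l i] i by auto
      then have "(of_nat (lev m') :: rat) < of_nat (lev m)" unfolding m l(3) using mu_pos by simp
      then show "m' \<in> {m'. m' < \<mu> \<and> lev' m' < lev' m}" using l(2) by simp
    qed
    then have "jfirst \<mu> lev' m = card (\<Union>l\<in>{1..i-1}. {m'. m' < \<mu> \<and> of_nat (lev m') = of_nat \<mu> * \<phi> l})"
      unfolding jfirst_def by simp
    also have "\<dots> = (\<Sum>l=1..i-1. card {m'. m' < \<mu> \<and> of_nat (lev m') = of_nat \<mu> * \<phi> l})"
    proof (rule card_UN_disjoint)
      show "\<forall>l\<in>{1..i-1}. \<forall>l'\<in>{1..i-1}. l \<noteq> l' \<longrightarrow> {m'. m' < \<mu> \<and> of_nat (lev m') = of_nat \<mu> * \<phi> l} \<inter>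
        {m'. m' < \<mu> \<and> of_nat (lev m') = of_nat \<mu> * \<phi> l'} = {}"
      proof (intro ballI impI)
        fix l l' assume l: "l \<in> {1..i-1}" "l' \<in> {1..i-1}" "l \<noteq> l'"
        then have "l \<in> {1..k}" "l' \<in> {1..k}" using i by auto
        then have "\<phi> l \<noteq> \<phi> l'" using phi_less[of l l'] phi_less[of l' l] l(3) by linarith
        then show "{m'. m' < \<mu> \<and> of_nat (lev m') = of_nat \<mu> * \<phi> l} \<inter>
          {m'. m' < \<mu> \<and> of_nat (lev m') = of_nat \<mu> * \<phi> l'} = {}" using mu0 by auto
      qed
    qed auto
    also have "\<dots> = (\<Sum>l=1..i-1. d l)" using i by (intro sum.cong refl card_d) auto
    finally show ?thesis .
  qed
  have last: "jlast \<mu> lev' m = jfirst \<mu> lev' m + d i"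
    if i: "i \<in> {1..k}" and m: "of_nat (lev m) = of_nat \<mu> * \<phi> i" for i m
  proof -
    have "{m'. m' < \<mu> \<and> lev' m' \<le> lev' m} = {m'. m' < \<mu> \<and> lev' m' < lev' m} \<union>
        {m'. m' < \<mu> \<and> of_nat (lev m') = of_nat \<mu> * \<phi> i}" unfolding m[symmetric] by auto
    moreover have "card ({m'. m' < \<mu> \<and> lev' m' < lev' m} \<union> {m'. m' < \<mu> \<and> of_nat (lev m') = of_nat \<mu> * \<phi> i}) =
        card {m'. m' < \<mu> \<and> lev' m' < lev' m} + card {m'. m' < \<mu> \<and> of_nat (lev m') = of_nat \<mu> * \<phi> i}"
      by (rule card_Un_disjoint) (auto simp: m[symmetric])
    ultimately show ?thesis unfolding jlast_def jfirst_def card_d[OF i] by simp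
  qed
  obtain i0 where i0: "i0 \<in> {1..k}" "\<phi> i0 = 0"
  proof -
    have "0 \<in> F" unfolding F_iff using qpos[of 0] by (intro exI[of _ 0]) simp
    then show ?thesis using that assms(11) by (metis imageE)
  qed
  have one: "1 \<in> {1..k}" using i0(1) by simp
  have phi1: "\<phi> 1 = 0"
  proof -
    have "0 \<le> \<phi> 1" using pos1[OF one] unfolding F_iff by auto
    moreover have "\<phi> 1 \<le> 0" using phi_less[OF i0(1) one] i0 by (simp add: not_less[symmetric])
    ultimately show ?thesis by simp
  qed
  \<comment> \<open>As f_1 = 0, every index satisfies the integrality condition. This is how the
    center n of the weights enters the displayed equation as d_1 - 1.\<close>
  have d1: "d 1 = n + 1" using assms(13) one phi1 by simp
  \<comment> \<open>Inside a block the term - 2 m occurs on both sides and cancels, so all indices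
    of the block give one condition. With s the start of the block and s + d_i its end, it reads 2 s
    - 2 lev m = d_1 - d_i.\<close>
  have cond: "jweight \<mu> lev' (int n) m = 2 * (int n - int m + lev' m) \<longleftrightarrow>
    (\<Sum>l=1..i-1. of_nat (d l)) - of_nat \<mu> * \<phi> i = (of_nat (d 1) - of_nat (d i)) / (2 :: rat)"
    if i: "i \<in> {1..k}" and m: "of_nat (lev m) = of_nat \<mu> * \<phi> i" for i m
  proof -
    define s where "s = (\<Sum>l=1..i-1. d l)"
    have "jweight \<mu> lev' (int n) m = 2 * (int n - int m + lev' m) \<longleftrightarrow>
      2 * int s - 2 * int (lev m) = int (d 1) - int (d i)"
      unfolding jweight_def last[OF i m] first[OF i m] s_def[symmetric] d1 by auto
    also have "\<dots> \<longleftrightarrow> (of_int (2 * int s - 2 * int (lev m)) :: rat) = of_int (int (d 1) - int (d i))"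
      by (simp only: of_int_eq_iff)
    also have "\<dots> \<longleftrightarrow> of_nat s - of_nat (lev m) = (of_nat (d 1) - of_nat (d i)) / (2 :: rat)"
      by (simp add: field_simps)
    finally show ?thesis unfolding m s_def by simp
  qed
  \<comment> \<open>The first block is centered automatically, which is why the range of the
    equation starts at 2.\<close>
  have triv: "(\<Sum>l=1..1-1. of_nat (d l)) - of_nat \<mu> * \<phi> 1 = (of_nat (d 1) - of_nat (d 1)) / (2 :: rat)"
    by (simp only: phi1) simp
  have "satisfies_KKP (f_Delta v) \<longleftrightarrow>
    (\<forall>i\<in>{1..k}. (\<Sum>l=1..i-1. of_nat (d l)) - of_nat \<mu> * \<phi> i = (of_nat (d 1) - of_nat (d i)) / (2 :: rat))"
    (is "_ \<longleftrightarrow> (\<forall>i\<in>{1..k}. ?C i)")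
  proof
    assume "satisfies_KKP (f_Delta v)"
    then have *: "jweight \<mu> lev' (int n) m = 2 * (int n - int m + lev' m)" if "m < \<mu>" for m
      using that unfolding satisfies_KKP_iff by blast
    show "\<forall>i\<in>{1..k}. ?C i"
    proof
      fix i assume i: "i \<in> {1..k}"
      obtain m where m: "m < \<mu>" "of_nat (lev m) = of_nat \<mu> * \<phi> i" using lev_ex[OF i] by blast
      show "?C i" using *[OF m(1)] unfolding cond[OF i m(2)] .
    qed
  next
    assume C: "\<forall>i\<in>{1..k}. ?C i"
    show "satisfies_KKP (f_Delta v)"
      unfolding satisfies_KKP_iff
    proof (intro allI impI)
      fix m assume "m < \<mu>"
      then obtain i where i: "i \<in> {1..k}" "of_nat (lev m) = of_nat \<mu> * \<phi> i" using phi_ex by blast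
      show "jweight \<mu> lev' (int n) m = 2 * (int n - int m + lev' m)"
        unfolding cond[OF i] using C i(1) by blast
    qed
  qed
  also have "\<dots> \<longleftrightarrow> (\<forall>i\<in>{2..k}. ?C i)"
  proof -
    have "{1..k} = insert 1 {2..k}" using one by auto
    then show ?thesis using triv by simp
  qed
  finally show ?thesis .
qed

end
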